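(* Let $(M,\langle\,,\rangle)$ be a smooth, connected, non-compact, complete Riemannian manifold of dimension $m\ge 2$, fix $o\in M$, and let $r(x)=\mathrm{dist}(x,o)$ and $B_t=\{x\in M: r(x)<t\}$. Let $\varphi\in C^1((0,+\infty))\cap C^0([0,+\infty))$ be real valued with $\varphi(0)=0$, $\varphi(t)>0$ for all $t>0$, and $\varphi(t)\le A t^{\delta}$ for all $t\ge 0$, for some positive constants $A$ and $\delta$. Let $a,b\in C^0(M)$, where $a(x)=a_+(x)-a_-(x)$ with $a_\pm\ge 0$. Assume that $\|a_-\|_\infty<+\infty$ and that $$b(x)\ge\frac{1}{Q(r(x))}\quad\text{on } M,$$ where $Q(t)$ is positive, non-decreasing and satisfies $Q(t)=o(t^{1+\delta})$ as $t\to+\infty$. Assume further that, for some $H>0$, $$\frac{a_-(x)}{b(x)}\le H\quad\text{on } M.$$ Let $u\in C^1(M)$ be a non-negative solution of $$\mathrm{div}\big(|\nabla u|^{-1}\varphi(|\nabla u|)\nabla u\big)\ge b(x)u^\sigma+a(x)u\quad\text{on } M,$$ with $\sigma>\max\{1,\delta\}$. If $$\liminf_{r\to+\infty}\frac{Q(r)\log\mathrm{vol}\,B_r}{r^{1+\delta}}<+\infty,$$ then $$u(x)\le H^{1/(\sigma-1)}\quad\text{on } M.$$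
   Context: The vector field $|\nabla u|^{-1}\varphi(|\nabla u|)\nabla u$ is understood to be $0$ where $\nabla u=0$. If this vector field is not $C^1$, the divergence, and hence the differential inequality, is interpreted in the sense of distributions. $a_+$ and $a_-$ are the positive and negative parts of $a$. $\mathrm{vol}\,B_r$ is the Riemannian volume of the geodesic ball $B_r$ centered at $o$. *)

theory Defs
  imports "HOL-Analysis.Analysis" "HOL-Library.Landau_Symbols"
begin

section \<open>Smooth functions\<close>

text \<open>Only meant for open \<open>S\<close>. Differentiability plus \<open>C\<^sup>k\<close> partial derivatives is \<open>C\<^sup>k\<^sup>+\<^sup>1\<close>.\<close>

primrec Ck_on :: "nat \<Rightarrow> 'e::euclidean_space set \<Rightarrow> ('e \<Rightarrow> 'f::real_normed_vector) \<Rightarrow> bool" where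
  "Ck_on 0 S f \<longleftrightarrow> continuous_on S f"
| "Ck_on (Suc k) S f \<longleftrightarrow> (\<forall>x\<in>S. f differentiable (at x)) \<and>
     (\<forall>i\<in>Basis. Ck_on k S (\<lambda>x. frechet_derivative f (at x) i))"

definition smooth_on :: "'e::euclidean_space set \<Rightarrow> ('e \<Rightarrow> 'f::real_normed_vector) \<Rightarrow> bool" where
  "smooth_on S f \<longleftrightarrow> (\<forall>k. Ck_on k S f)"


section \<open>Smooth manifolds\<close>

text \<open>
  The manifold is a whole (Hausdorff, second countable) type \<open>'a\<close>. A chart is a pair of an open
  domain and a coordinate map; the coordinate map is irrelevant outside the domain.
\<close>

type_synonym ('a, 'm) chart = "'a set \<times> ('a \<Rightarrow> real ^ 'm)"

definition coord_inv :: "('a, 'm) chart \<Rightarrow> real ^ 'm \<Rightarrow> 'a" where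
  "coord_inv c = inv_into (fst c) (snd c)"

definition smooth_atlas ::
    "('a::{t2_space,second_countable_topology}, 'm::finite) chart set \<Rightarrow> bool" where
  "smooth_atlas A \<longleftrightarrow>
     (\<Union>c\<in>A. fst c) = UNIV \<and>
     (\<forall>c\<in>A. open (fst c) \<and> open (snd c ` fst c) \<and>
        homeomorphism (fst c) (snd c ` fst c) (snd c) (coord_inv c)) \<and>
     (\<forall>c\<in>A. \<forall>d\<in>A. smooth_on (snd c ` (fst c \<inter> fst d)) (snd d \<circ> coord_inv c))"

definition Ck_fun :: "('a, 'm::finite) chart set \<Rightarrow> nat \<Rightarrow> ('a \<Rightarrow> real) \<Rightarrow> bool" where
  "Ck_fun A k f \<longleftrightarrow> (\<forall>c\<in>A. Ck_on k (snd c ` fst c) (f \<circ> coord_inv c))"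

definition smooth_fun :: "('a, 'm::finite) chart set \<Rightarrow> ('a \<Rightarrow> real) \<Rightarrow> bool" where
  "smooth_fun A f \<longleftrightarrow> (\<forall>k. Ck_fun A k f)"

text \<open>Used for coordinate-independent expressions, where any chart around \<open>p\<close> gives the same value.\<close>

definition chart_at :: "('a, 'm) chart set \<Rightarrow> 'a \<Rightarrow> ('a, 'm) chart" where
  "chart_at A p = (SOME c. c \<in> A \<and> p \<in> fst c)"


section \<open>Riemannian metrics\<close>

text \<open>
  A metric is given by its components: \<open>g c p\<close> is the Gram matrix at \<open>p\<close> of the coordinate frame of
  the chart \<open>c\<close>. Likewise, a vector field is given by its components \<open>X c p\<close> in that frame.
\<close>

type_synonym ('a, 'm) metric_tensor = "('a, 'm) chart \<Rightarrow> 'a \<Rightarrow> real ^ 'm ^ 'm"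
type_synonym ('a, 'm) vector_field = "('a, 'm) chart \<Rightarrow> 'a \<Rightarrow> real ^ 'm"

definition riemannian_metric ::
    "('a, 'm::finite) chart set \<Rightarrow> ('a, 'm) metric_tensor \<Rightarrow> bool" where
  "riemannian_metric A g \<longleftrightarrow>
     (\<forall>c\<in>A. smooth_on (snd c ` fst c) (g c \<circ> coord_inv c)) \<and>
     (\<forall>c\<in>A. \<forall>p\<in>fst c. transpose (g c p) = g c p \<and> (\<forall>v. v \<noteq> 0 \<longrightarrow> 0 < v \<bullet> (g c p *v v))) \<and>
     (\<forall>c\<in>A. \<forall>d\<in>A. \<forall>p\<in>fst c \<inter> fst d.
        (let J = jacobian (snd d \<circ> coord_inv c) (at (snd c p))
         in g c p = transpose J ** g d p ** J))"

definition rinner ::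
    "('a, 'm::finite) chart set \<Rightarrow> ('a, 'm) metric_tensor \<Rightarrow>
     ('a, 'm) vector_field \<Rightarrow> ('a, 'm) vector_field \<Rightarrow> 'a \<Rightarrow> real" where
  "rinner A g X Y p = (let c = chart_at A p in X c p \<bullet> (g c p *v Y c p))"

definition rnorm ::
    "('a, 'm::finite) chart set \<Rightarrow> ('a, 'm) metric_tensor \<Rightarrow> ('a, 'm) vector_field \<Rightarrow> 'a \<Rightarrow> real" where
  "rnorm A g X p = sqrt (rinner A g X X p)"

definition coord_partials :: "('a \<Rightarrow> real) \<Rightarrow> ('a, 'm::finite) chart \<Rightarrow> 'a \<Rightarrow> real ^ 'm" where
  "coord_partials f c p = (\<chi> i. frechet_derivative (f \<circ> coord_inv c) (at (snd c p)) (axis i 1))"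

definition grad :: "('a, 'm::finite) metric_tensor \<Rightarrow> ('a \<Rightarrow> real) \<Rightarrow> ('a, 'm) vector_field" where
  "grad g f c p = matrix_inv (g c p) *v coord_partials f c p"


section \<open>Riemannian distance\<close>

definition C1_curve_on ::
    "('a, 'm::finite) chart set \<Rightarrow> real \<Rightarrow> real \<Rightarrow> (real \<Rightarrow> 'a) \<Rightarrow> bool" where
  "C1_curve_on A a b \<gamma> \<longleftrightarrow>
     (\<forall>c\<in>A. \<exists>D. (\<forall>t\<in>{a..b}. \<gamma> t \<in> fst c \<longrightarrow>
                   ((snd c \<circ> \<gamma>) has_vector_derivative D t) (at t within {a..b})) \<and>
                continuous_on {t\<in>{a..b}. \<gamma> t \<in> fst c} D)"

definition piecewise_C1_curve ::
    "('a::topological_space, 'm::finite) chart set \<Rightarrow> (real \<Rightarrow> 'a) \<Rightarrow> bool" where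
  "piecewise_C1_curve A \<gamma> \<longleftrightarrow> path \<gamma> \<and>
     (\<exists>S. finite S \<and> {0, 1} \<subseteq> S \<and> S \<subseteq> {0..1} \<and>
        (\<forall>a\<in>S. \<forall>b\<in>S. a < b \<and> {a<..<b} \<inter> S = {} \<longrightarrow> C1_curve_on A a b \<gamma>))"

text \<open>The speed is arbitrary at the finitely many break points, which does not affect the length.\<close>

definition curve_speed ::
    "('a, 'm::finite) chart set \<Rightarrow> ('a, 'm) metric_tensor \<Rightarrow> (real \<Rightarrow> 'a) \<Rightarrow> real \<Rightarrow> real" where
  "curve_speed A g \<gamma> t =
     (let c = chart_at A (\<gamma> t); v = vector_derivative (snd c \<circ> \<gamma>) (at t within {0..1})
      in sqrt (v \<bullet> (g c (\<gamma> t) *v v)))"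

definition curve_length ::
    "('a, 'm::finite) chart set \<Rightarrow> ('a, 'm) metric_tensor \<Rightarrow> (real \<Rightarrow> 'a) \<Rightarrow> real" where
  "curve_length A g \<gamma> = integral {0..1} (curve_speed A g \<gamma>)"

definition rdist ::
    "('a::topological_space, 'm::finite) chart set \<Rightarrow> ('a, 'm) metric_tensor \<Rightarrow> 'a \<Rightarrow> 'a \<Rightarrow> real" where
  "rdist A g p q =
     Inf {curve_length A g \<gamma> | \<gamma>. piecewise_C1_curve A \<gamma> \<and> pathstart \<gamma> = p \<and> pathfinish \<gamma> = q}"

definition riemannian_complete ::
    "('a::topological_space, 'm::finite) chart set \<Rightarrow> ('a, 'm) metric_tensor \<Rightarrow> bool" where
  "riemannian_complete A g \<longleftrightarrow> Metric_space.mcomplete UNIV (rdist A g)"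

definition rball ::
    "('a::topological_space, 'm::finite) chart set \<Rightarrow> ('a, 'm) metric_tensor \<Rightarrow> 'a \<Rightarrow> real \<Rightarrow> 'a set" where
  "rball A g p t = {x. rdist A g x p < t}"


section \<open>Riemannian volume and the weak divergence inequality\<close>

text \<open>The unique Borel measure which in every chart has density \<open>sqrt (det g)\<close>.\<close>

definition rvol ::
    "('a::topological_space, 'm::finite) chart set \<Rightarrow> ('a, 'm) metric_tensor \<Rightarrow> 'a measure" where
  "rvol A g = (THE \<mu>. sets \<mu> = sets borel \<and>
     (\<forall>c\<in>A. \<forall>E\<in>sets borel. E \<subseteq> fst c \<longrightarrow>
        emeasure \<mu> E = (\<integral>\<^sup>+y\<in>snd c ` E. ennreal (sqrt (det (g c (coord_inv c y)))) \<partial>lborel)))"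

text \<open>\<open>div X \<ge> f\<close> in the sense of distributions, for continuous \<open>X\<close> and \<open>f\<close>.\<close>

definition div_ge ::
    "('a::topological_space, 'm::finite) chart set \<Rightarrow> ('a, 'm) metric_tensor \<Rightarrow>
     ('a, 'm) vector_field \<Rightarrow> ('a \<Rightarrow> real) \<Rightarrow> bool" where
  "div_ge A g X f \<longleftrightarrow>
     (\<forall>\<psi>. smooth_fun A \<psi> \<and> compact (closure {x. \<psi> x \<noteq> 0}) \<and> (\<forall>x. 0 \<le> \<psi> x) \<longrightarrow>
        - (LINT x|rvol A g. rinner A g X (grad g \<psi>) x) \<ge> (LINT x|rvol A g. f x * \<psi> x))"

text \<open>The vector field \<open>|\<nabla>u|\<^sup>-\<^sup>1 \<phi>(|\<nabla>u|) \<nabla>u\<close>, set to \<open>0\<close> where \<open>\<nabla>u = 0\<close>.\<close>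

definition phi_field ::
    "('a, 'm::finite) chart set \<Rightarrow> ('a, 'm) metric_tensor \<Rightarrow> (real \<Rightarrow> real) \<Rightarrow> ('a \<Rightarrow> real) \<Rightarrow>
     ('a, 'm) vector_field" where
  "phi_field A g \<phi> u c p =
     (let s = rnorm A g (grad g u) p
      in if s = 0 then 0 else (\<phi> s / s) *\<^sub>R grad g u c p)"

definition neg_part :: "('a \<Rightarrow> real) \<Rightarrow> 'a \<Rightarrow> real" where
  "neg_part f x = max (- f x) 0"

end

theory Submission
  imports Defs
begin

text \<open>
  The function \<open>w = - u\<^sup>-\<^sup>s\<close> is bounded above. If \<open>u\<close> exceeds \<open>H\<^sup>1\<^sup>/\<^sup>(\<^sup>\<sigma>\<^sup>-\<^sup>1\<^sup>)\<close> somewhere, then on a superlevel set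
  \<open>{u > \<gamma>}\<close> the right-hand side of the inequality is at least \<open>c u\<^sup>\<sigma> / Q(r)\<close>. Test the inequality with
  \<open>\<psi>\<^sup>p T\<^sup>\<alpha>\<close>, where \<open>T\<close> is the positive part of \<open>w - (sup w - \<eta>)\<close> and \<open>\<psi>\<close> is a cutoff function of \<open>B\<^sub>r\<close>. With
  \<open>\<alpha> = r\<^sup>1\<^sup>+\<^sup>\<delta> / Q(r)\<close> and \<open>p\<close> proportional to \<open>\<alpha>\<close>, all error terms are absorbed up to a multiple of
  \<open>(C \<eta>\<^sup>1\<^sup>+\<^sup>\<delta>)\<^sup>\<alpha> vol B\<^sub>r\<close>, while the remaining term is at least a multiple of \<open>(\<eta> / 2)\<^sup>\<alpha>\<close>. By the volume
  assumption, \<open>vol B\<^sub>r \<le> e\<^sup>L\<^sup>\<alpha>\<close> for arbitrarily large \<open>r\<close>, and since \<open>\<alpha> \<rightarrow> \<infinity>\<close> this is impossible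
  when \<open>\<eta>\<close> is small.
\<close>

section \<open>Calculus of smooth functions\<close>

text \<open>Two gaps in regularity shape the development. \<open>div_ge\<close> admits only smooth
  test functions, whereas the one required is merely C^1, so the inequality is first extended to C^1
  test functions by mollification in charts. The distance is merely Lipschitz, so the cutoffs arise
  by mollification too, and their gradient bound must be a universal multiple of 1/r, free of the
  distortion of the charts. Completeness makes balls compact, hence the cutoffs admissible. As
  \<open>rvol\<close> is a definite description, the volume measure must be shown to exist uniquely
  before it can be used. The function u need not be bounded, but -u^(-s) is bounded above by 0
  wherever u is positive; this is why a negative power is truncated. The truncation ranges over
  (\<eta>/2, \<eta>] on the set where the main term is kept, which costs a factor 2^\<alpha>, and
  the volume costs e^(L \<alpha>). The error constant K enters with the power \<alpha> as well and
  is of order \<eta>^\<delta> uniformly in r, so a small \<eta> defeats both. The value of \<alpha>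
  is the one for which K does not depend on r.\<close>

lemma Ck_on_SucI:
  fixes f :: "'a::euclidean_space \<Rightarrow> 'b::real_normed_vector"
  assumes "open S" "\<And>x. x \<in> S \<Longrightarrow> (f has_derivative f' x) (at x)"
    and "\<And>i. i \<in> Basis \<Longrightarrow> Ck_on k S (\<lambda>x. f' x i)"
    and cong: "\<And>f g :: 'a \<Rightarrow> 'b. \<forall>x\<in>S. f x = g x \<Longrightarrow> Ck_on k S f \<Longrightarrow> Ck_on k S g"
  shows "Ck_on (Suc k) S f"
proof -
  have "frechet_derivative f (at x) = f' x" if "x \<in> S" for x
    using frechet_derivative_at[OF assms(2)[OF that]] by simp
  then have e: "\<forall>x\<in>S. f' x i = frechet_derivative f (at x) i" for i
    by simp
  \<comment> \<open>The components of \<open>f'\<close> are known to agree with the Frechet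
    derivative only on \<open>S\<close>, so the order is transferred by congruence. Congruence is a
    hypothesis because its own induction step applies this rule.\<close>
  have "Ck_on k S (\<lambda>x. frechet_derivative f (at x) i)" if "i \<in> Basis" for i
    using cong[OF e assms(3)[OF that]] .
  then show ?thesis
    using assms(2) by (auto simp: differentiable_def)
qed

lemma Ck_on_SucD:
  assumes "Ck_on (Suc k) S f"
  shows "x \<in> S \<Longrightarrow> (f has_derivative frechet_derivative f (at x)) (at x)"
    and "i \<in> Basis \<Longrightarrow> Ck_on k S (\<lambda>x. frechet_derivative f (at x) i)"
  using assms by (auto simp: frechet_derivative_works)

lemma Ck_on_cong:
  assumes "open S" "\<And>x. x \<in> S \<Longrightarrow> f x = g x" "Ck_on k S f"
  shows "Ck_on k S g"
  using assms(2,3)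
proof (induction k arbitrary: f g)
  case 0
  then show ?case by (metis Ck_on.simps(1) continuous_on_cong)
next
  case (Suc k)
  have d: "(g has_derivative frechet_derivative f (at x)) (at x)" if "x \<in> S" for x
    using has_derivative_transform_within_open[OF Ck_on_SucD(1)[OF Suc.prems(2) that] \<open>open S\<close> that Suc.prems(1)] .
  show ?case
    by (rule Ck_on_SucI[OF \<open>open S\<close> d Ck_on_SucD(2)[OF Suc.prems(2)] Suc.IH]) simp_all
qed

lemma Ck_on_SucI':
  assumes "open S" "\<And>x. x \<in> S \<Longrightarrow> (f has_derivative f' x) (at x)"
    and "\<And>i. i \<in> Basis \<Longrightarrow> Ck_on k S (\<lambda>x. f' x i)"
  shows "Ck_on (Suc k) S f"
  by (rule Ck_on_SucI[OF assms Ck_on_cong[OF assms(1)]]) simp_all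

lemma Ck_on_subset: "Ck_on k S f \<Longrightarrow> T \<subseteq> S \<Longrightarrow> Ck_on k T f"
proof (induction k arbitrary: f)
  case 0
  then show ?case by (auto intro: continuous_on_subset)
qed auto

lemma Ck_on_local:
  assumes "\<And>x. x \<in> S \<Longrightarrow> \<exists>T. open T \<and> x \<in> T \<and> Ck_on k T f"
  shows "Ck_on k S f"
  using assms
proof (induction k arbitrary: f)
  case 0
  have "isCont f x" if "x \<in> S" for x
    using 0[OF that] continuous_on_eq_continuous_at by auto
  then show ?case by (simp add: continuous_at_imp_continuous_on)
next
  case (Suc k)
  have "f differentiable at x" if "x \<in> S" for x
    using Suc.prems[OF that] by auto
  moreover have "Ck_on k S (\<lambda>x. frechet_derivative f (at x) i)" if "i \<in> Basis" for i
  proof (rule Suc.IH)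
    fix x assume "x \<in> S"
    from Suc.prems[OF this] obtain T where "open T" "x \<in> T" "Ck_on (Suc k) T f" by blast
    then show "\<exists>T. open T \<and> x \<in> T \<and> Ck_on k T (\<lambda>x. frechet_derivative f (at x) i)"
      using Ck_on_SucD(2)[OF _ that] by blast
  qed
  ultimately show ?case by simp
qed

lemma Ck_on_Suc_imp: "Ck_on (Suc k) S f \<Longrightarrow> Ck_on k S f"
proof (induction k arbitrary: f)
  case 0
  then have "isCont f x" if "x \<in> S" for x
    using that has_derivative_continuous[OF Ck_on_SucD(1)[OF 0 that]] by blast
  then show ?case by (simp add: continuous_at_imp_continuous_on)
next
  case (Suc k)
  have "Ck_on k S (\<lambda>x. frechet_derivative f (at x) i)" if "i \<in> Basis" for i
    using Suc.IH[OF Ck_on_SucD(2)[OF Suc.prems that]] .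
  then show ?case using Suc.prems by simp
qed

lemma Ck_on_const [simp]: "Ck_on k S (\<lambda>x. c)"
proof (induction k arbitrary: c)
  case (Suc k)
  then show ?case by (simp add: frechet_derivative_const)
qed simp

lemma Ck_on_add:
  assumes "open S" "Ck_on k S f" "Ck_on k S g"
  shows "Ck_on k S (\<lambda>x. f x + g x)"
  using assms(2,3)
proof (induction k arbitrary: f g)
  case 0
  then show ?case by (auto intro: continuous_intros)
next
  case (Suc k)
  show ?case
    by (rule Ck_on_SucI'[OF \<open>open S\<close> has_derivative_add[OF Suc.prems[THEN Ck_on_SucD(1)]]])
      (use Suc.IH Suc.prems[THEN Ck_on_SucD(2)] in auto)
qed

lemma Ck_on_sum:
  assumes "open S" "\<And>i. i \<in> I \<Longrightarrow> Ck_on k S (f i)"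
  shows "Ck_on k S (\<lambda>x. \<Sum>i\<in>I. f i x)"
  using assms(2)
proof (induction I rule: infinite_finite_induct)
  case (insert i I)
  then have "Ck_on k S (\<lambda>x. f i x + (\<Sum>i\<in>I. f i x))"
    by (intro Ck_on_add[OF assms(1)]) auto
  then show ?case using insert by simp
qed simp_all

lemma Ck_on_mult:
  fixes f g :: "'a::euclidean_space \<Rightarrow> real"
  assumes "open S" "Ck_on k S f" "Ck_on k S g"
  shows "Ck_on k S (\<lambda>x. f x * g x)"
  using assms(2,3)
proof (induction k arbitrary: f g)
  case 0
  then show ?case by (auto intro: continuous_intros)
next
  case (Suc k)
  show ?case
  proof (rule Ck_on_SucI'[OF \<open>open S\<close> has_derivative_mult[OF Suc.prems[THEN Ck_on_SucD(1)]]])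
    fix i :: 'a assume i: "i \<in> Basis"
    show "Ck_on k S (\<lambda>x. f x * frechet_derivative g (at x) i + frechet_derivative f (at x) i * g x)"
      using Suc.prems[THEN Ck_on_SucD(2), OF i] Suc.prems[THEN Ck_on_Suc_imp]
      by (intro Ck_on_add[OF assms(1)] Suc.IH)
  qed auto
qed

lemma Ck_on_inner:
  fixes f :: "'a::euclidean_space \<Rightarrow> 'b::real_inner"
  assumes "open S" "Ck_on k S f"
  shows "Ck_on k S (\<lambda>x. f x \<bullet> j)"
  using assms(2)
proof (induction k arbitrary: f)
  case 0
  then show ?case by (auto intro: continuous_intros)
next
  case (Suc k)
  show ?case
    by (rule Ck_on_SucI'[OF \<open>open S\<close> has_derivative_inner_left[OF Suc.prems[THEN Ck_on_SucD(1)]]])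
      (use Suc.IH Suc.prems[THEN Ck_on_SucD(2)] in auto)
qed

lemma Ck_on_compose:
  fixes f :: "'b::euclidean_space \<Rightarrow> real" and h :: "'a::euclidean_space \<Rightarrow> 'b"
  assumes "open S" "Ck_on k S h" "Ck_on k T f" "h ` S \<subseteq> T"
  shows "Ck_on k S (f \<circ> h)"
  using assms(2,3)
proof (induction k arbitrary: f)
  case 0
  then show ?case
    using continuous_on_compose[of S h f] continuous_on_subset[OF _ assms(4), of f] by simp
next
  case (Suc k)
  let ?Df = "\<lambda>x. frechet_derivative f (at x)" and ?Dh = "\<lambda>x. frechet_derivative h (at x)"
  show ?case
  proof (rule Ck_on_SucI'[OF \<open>open S\<close>])
    fix x assume x: "x \<in> S"
    show "(f \<circ> h has_derivative (\<lambda>v. ?Df (h x) (?Dh x v))) (at x)"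
      using diff_chain_at[OF Ck_on_SucD(1)[OF Suc.prems(1) x] Ck_on_SucD(1)[OF Suc.prems(2)]] assms(4) x
      by (auto simp: o_def)
  next
    fix i :: 'a assume i: "i \<in> Basis"
    \<comment> \<open>Expanding the chain rule in the basis leaves sums of products. Each factor
      \<open>?Df (h x) j\<close> is again a composite with \<open>h\<close>, so the induction
      hypothesis for an arbitrary outer function covers it.\<close>
    have "?Df (h x) (?Dh x i) = (\<Sum>j\<in>Basis. (?Dh x i \<bullet> j) * (?Df (h x) j))" if x: "x \<in> S" for x
    proof -
      have "linear (?Df (h x))"
        using Ck_on_SucD(1)[OF Suc.prems(2), of "h x"] assms(4) x
        by (auto intro: has_derivative_linear)
      then show ?thesis
        by (subst euclidean_representation[of "?Dh x i", symmetric], subst linear_sum)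
          (auto simp: linear_cmul)
    qed
    moreover have "Ck_on k S (\<lambda>x. \<Sum>j\<in>Basis. (?Dh x i \<bullet> j) * (?Df (h x) j))"
    proof (intro Ck_on_sum Ck_on_mult Ck_on_inner \<open>open S\<close>)
      show "Ck_on k S (\<lambda>x. ?Dh x i)" using Ck_on_SucD(2)[OF Suc.prems(1) i] .
      fix j :: 'b assume "j \<in> Basis"
      then show "Ck_on k S (\<lambda>x. ?Df (h x) j)"
        using Suc.IH[OF Ck_on_Suc_imp[OF Suc.prems(1)] Ck_on_SucD(2)[OF Suc.prems(2)]] by (auto simp: o_def)
    qed
    ultimately show "Ck_on k S (\<lambda>x. ?Df (h x) (?Dh x i))"
      using Ck_on_cong[OF \<open>open S\<close>, of "\<lambda>x. \<Sum>j\<in>Basis. (?Dh x i \<bullet> j) * (?Df (h x) j)"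
        "\<lambda>x. ?Df (h x) (?Dh x i)" k] by simp
  qed
qed

lemma Ck_on_id: "Ck_on k S (\<lambda>x. x)"
proof (cases k)
  case (Suc n)
  have "Ck_on n S (\<lambda>x. frechet_derivative (\<lambda>x::'a. x) (at x) i)" for i
    by (simp add: frechet_derivative_id)
  then show ?thesis using Suc by simp
qed simp

section \<open>Mollification\<close>

text \<open>The powers of t in the denominator make the family closed under differentiation up to
  linear combinations, so that smoothness of all its members follows by one induction over the
  order.\<close>

definition flat_exp :: "nat \<Rightarrow> real \<Rightarrow> real" where
  "flat_exp j t = (if t > 0 then exp (- 1 / t) / t ^ j else 0)"

lemma flat_exp_tendsto_0: "(flat_exp j \<longlongrightarrow> 0) (at 0)"
proof -
  have r: "((\<lambda>t::real. exp (- 1 / t) / t ^ j) \<longlongrightarrow> 0) (at_right 0)"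
  proof -
    have "((\<lambda>x::real. x ^ j / exp x) \<longlongrightarrow> 0) at_top" by (rule tendsto_power_div_exp_0)
    then have "((\<lambda>t. (inverse t) ^ j / exp (inverse t)) \<longlongrightarrow> 0) (at_right (0::real))"
      by (rule filterlim_compose[OF _ filterlim_inverse_at_top_right])
    then show ?thesis
      by (rule Lim_transform_eventually)
        (auto simp: eventually_at_filter exp_minus field_simps)
  qed
  have "(flat_exp j \<longlongrightarrow> 0) (at_right 0)"
    by (rule Lim_transform_eventually[OF r]) (auto simp: eventually_at_filter flat_exp_def)
  moreover have "(flat_exp j \<longlongrightarrow> 0) (at_left 0)"
    by (rule Lim_transform_eventually[OF tendsto_const])
      (auto simp: eventually_at_filter flat_exp_def)
  ultimately show ?thesis by (simp add: filterlim_at_split)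
qed

lemma flat_exp_deriv:
  "(flat_exp j has_real_derivative flat_exp (Suc (Suc j)) t - real j * flat_exp (Suc j) t) (at t)"
proof -
  consider "t > 0" | "t < 0" | "t = 0" by linarith
  then show ?thesis
  proof cases
    case 1
    have "((\<lambda>t. exp (- 1 / t) / t ^ j) has_real_derivative
       flat_exp (Suc (Suc j)) t - real j * flat_exp (Suc j) t) (at t)"
    proof (cases j)
      case 0
      then show ?thesis using 1 
        by (auto intro!: derivative_eq_intros simp: flat_exp_def field_simps power2_eq_square)
    next
      case (Suc n)
      have "((\<lambda>t. exp (- 1 / t) / t ^ Suc n) has_real_derivative
         (exp (- 1 / t) * (1 / t\<^sup>2) * t ^ Suc n - exp (- 1 / t) * (real (Suc n) * t ^ n)) / (t ^ Suc n * t ^ Suc n)) (at t)"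
        using 1 by (auto intro!: derivative_eq_intros simp: power2_eq_square simp del: power_Suc)
      also have "(exp (- 1 / t) * (1 / t\<^sup>2) * t ^ Suc n - exp (- 1 / t) * (real (Suc n) * t ^ n)) / (t ^ Suc n * t ^ Suc n)
         = flat_exp (Suc (Suc j)) t - real j * flat_exp (Suc j) t"
        using 1 Suc by (simp add: flat_exp_def field_simps power2_eq_square)
      finally show ?thesis by (simp add: Suc)
    qed
    then show ?thesis
      by (rule has_field_derivative_transform_within_open[of _ _ _ "{0<..}"])
        (use 1 in \<open>auto simp: flat_exp_def\<close>)
  next
    case 2
    have "((\<lambda>t. 0) has_real_derivative flat_exp (Suc (Suc j)) t - real j * flat_exp (Suc j) t) (at t)"
      using 2 by (auto simp: flat_exp_def)
    then show ?thesis
      by (rule has_field_derivative_transform_within_open[of _ _ _ "{..<0}"])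
        (use 2 in \<open>auto simp: flat_exp_def\<close>)
  next
    case 3
    \<comment> \<open>The difference quotient at 0 is the next member
      \<open>flat_exp (Suc j)\<close> of the family, which tends to 0.\<close>
    have "((\<lambda>h. (flat_exp j h - flat_exp j 0) / (h - 0)) \<longlongrightarrow> 0) (at 0)"
      by (rule Lim_transform_eventually[OF flat_exp_tendsto_0[of "Suc j"]])
        (auto simp: eventually_at_filter flat_exp_def)
    then have "(flat_exp j has_real_derivative 0) (at 0)"
      by (simp add: has_field_derivative_iff)
    then show ?thesis using 3 by (simp add: flat_exp_def)
  qed
qed

lemma Ck_on_flat_exp: "Ck_on k UNIV (flat_exp j)"
proof (induction k arbitrary: j)
  case 0
  have "isCont (flat_exp j) t" for t using DERIV_isCont[OF flat_exp_deriv] .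
  then show ?case by (simp add: continuous_at_imp_continuous_on)
next
  case (Suc k)
  show ?case
  proof (rule Ck_on_SucI')
    show "(flat_exp j has_derivative (*) (flat_exp (Suc (Suc j)) t - real j * flat_exp (Suc j) t)) (at t)" for t
      using flat_exp_deriv[of j t] by (simp add: has_field_derivative_def)
    have "Ck_on k UNIV (\<lambda>t. flat_exp (Suc (Suc j)) t + (- real j) * flat_exp (Suc j) t)"
      by (intro Ck_on_add Ck_on_mult Suc) auto
    then show "Ck_on k UNIV (\<lambda>t. (flat_exp (Suc (Suc j)) t - real j * flat_exp (Suc j) t) * i)" 
      if "i \<in> Basis" for i
      using that by simp
  qed auto
qed

text \<open>The squared norm is a polynomial, so there is no loss of smoothness at the origin. The
  function is positive exactly on the open ball of radius e.\<close>

definition bump :: "real \<Rightarrow> 'a::euclidean_space \<Rightarrow> real" where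
  "bump e x = flat_exp 0 (e\<^sup>2 - x \<bullet> x)"

lemma Ck_on_bump: "Ck_on k UNIV (bump e)"
proof -
  have "Ck_on k UNIV (\<lambda>x::'a. e\<^sup>2 + (-1) * (\<Sum>i\<in>Basis. (x \<bullet> i) * (x \<bullet> i)))"
    by (intro Ck_on_add Ck_on_mult Ck_on_sum Ck_on_inner Ck_on_id Ck_on_const open_UNIV)
  then have "Ck_on k UNIV (\<lambda>x::'a. e\<^sup>2 - x \<bullet> x)"
    by (simp add: euclidean_inner[symmetric])
  from Ck_on_compose[OF open_UNIV this Ck_on_flat_exp] show ?thesis
    by (simp add: bump_def[abs_def] o_def)
qed

lemma bump_props:
  shows "bump e x \<ge> 0" "e > 0 \<Longrightarrow> bump e x > 0 \<longleftrightarrow> norm x < e" "e > 0 \<Longrightarrow> norm x \<ge> e \<Longrightarrow> bump e x = 0"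
    "continuous_on S (bump e)"
proof -
  show "continuous_on S (bump e)"
    using Ck_on_bump[of 0 e] by (auto intro: continuous_on_subset)
  show "bump e x \<ge> 0" by (simp add: bump_def flat_exp_def)
  assume e: "e > 0"
  have "e\<^sup>2 - x \<bullet> x > 0 \<longleftrightarrow> norm x < e"
    using e power_strict_mono[of "norm x" e 2] power_mono[of e "norm x" 2] norm_ge_zero[of x]
    unfolding dot_square_norm by linarith
  then show "bump e x > 0 \<longleftrightarrow> norm x < e" "norm x \<ge> e \<Longrightarrow> bump e x = 0"
    by (auto simp: bump_def flat_exp_def)
qed

text \<open>Differentiation under the integral falls on the kernel alone, which is why
  \<open>f\<close> need only be continuous and why the induction runs over all kernels.\<close>

lemma Ck_on_convolution:
  fixes \<rho> f :: "'a::euclidean_space \<Rightarrow> real"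
  assumes "Ck_on k UNIV \<rho>" "continuous_on UNIV f"
  shows "Ck_on k UNIV (\<lambda>y. integral (cbox a b) (\<lambda>z. \<rho> (y - z) * f z))"
  using assms(1)
proof (induction k arbitrary: \<rho>)
  case 0
  then have "continuous_on UNIV \<rho>" by simp
  have "continuous_on (UNIV \<times> cbox a b) (\<lambda>(y, z). \<rho> (y - z) * f z)"
    unfolding split_beta
    by (intro continuous_intros continuous_on_compose2[OF \<open>continuous_on UNIV \<rho>\<close>]
        continuous_on_compose2[OF assms(2)]) auto
  then show ?case
    using integral_continuous_on_param by auto
next
  case (Suc k)
  let ?D = "\<lambda>x. frechet_derivative \<rho> (at x)"
  have D: "(\<rho> has_derivative ?D x) (at x)" for x using Ck_on_SucD(1)[OF Suc.prems] by simp
  have c\<rho>: "continuous_on UNIV \<rho>"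
    using D by (meson continuous_at_imp_continuous_on has_derivative_continuous)
  have cD: "continuous_on UNIV (\<lambda>x. ?D x i)" if "i \<in> Basis" for i
  proof -
    have "Ck_on n S f \<Longrightarrow> continuous_on S f" for n S and f :: "'a \<Rightarrow> real"
      by (induction n) (use Ck_on_Suc_imp in auto)
    then show ?thesis using Ck_on_SucD(2)[OF Suc.prems that] by blast
  qed
  \<comment> \<open>The Leibniz rule wants the derivative of the integrand as a continuous family of
    bounded linear maps; continuity is then checked on basis vectors.\<close>
  define G where "G y z = Blinfun (\<lambda>v. ?D (y - z) v * f z)" for y z
  have bl: "bounded_linear (\<lambda>v. ?D (y - z) v * f z)" for y z
    using bounded_linear_mult_const[OF has_derivative_bounded_linear[OF D]] .
  have G: "blinfun_apply (G y z) = (\<lambda>v. ?D (y - z) v * f z)" for y z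
    unfolding G_def by (rule bounded_linear_Blinfun_apply[OF bl])
  have cG: "continuous_on (UNIV \<times> cbox a b) (\<lambda>(y, z). G y z)"
    unfolding split_beta
  proof (rule continuous_on_blinfun_componentwise)
    fix i :: 'a assume "i \<in> Basis"
    show "continuous_on (UNIV \<times> cbox a b) (\<lambda>x. blinfun_apply (G (fst x) (snd x)) i)"
      unfolding G
      by (intro continuous_intros continuous_on_compose2[OF cD[OF \<open>i \<in> Basis\<close>]]
          continuous_on_compose2[OF assms(2)]) auto
  qed
  have int: "(\<lambda>z. \<rho> (y - z) * f z) integrable_on cbox a b" for y
    by (intro integrable_continuous continuous_intros continuous_on_compose2[OF c\<rho>]
          continuous_on_compose2[OF assms(2)]) auto
  have "((\<lambda>y. integral (cbox a b) (\<lambda>z. \<rho> (y - z) * f z)) has_derivative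
          integral (cbox a b) (G y)) (at y within UNIV)" for y
  proof (rule leibniz_rule[OF _ int cG])
    fix y z :: 'a
    have "((\<lambda>y. y - z) has_derivative (\<lambda>v. v)) (at y)"
      using has_derivative_diff[OF has_derivative_ident has_derivative_const] by simp
    from has_derivative_mult_left[OF has_derivative_compose[OF this D[of "y - z"]]]
    show "((\<lambda>y. \<rho> (y - z) * f z) has_derivative blinfun_apply (G y z)) (at y within UNIV)"
      unfolding G .
  qed auto
  moreover have "blinfun_apply (integral (cbox a b) (G y)) i = integral (cbox a b) (\<lambda>z. ?D (y - z) i * f z)" for y i
  proof -
    have "G y integrable_on cbox a b"
      by (rule integrable_continuous, rule continuous_on_compose2[OF cG, of _ "\<lambda>z. (y, z)", simplified])
        (auto intro: continuous_intros)
    then show ?thesis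
      using integral_linear[OF \<open>G y integrable_on cbox a b\<close> blinfun.bounded_linear_left[of i]]
      by (simp add: o_def G)
  qed
  ultimately have d: "((\<lambda>y. integral (cbox a b) (\<lambda>z. \<rho> (y - z) * f z)) has_derivative
          blinfun_apply (integral (cbox a b) (G y))) (at y)" and
       e: "blinfun_apply (integral (cbox a b) (G y)) i = integral (cbox a b) (\<lambda>z. ?D (y - z) i * f z)" for y i
    by auto
  show ?case
  proof (rule Ck_on_SucI'[OF open_UNIV d])
    fix i :: 'a assume "i \<in> Basis"
    from Suc.IH[OF Ck_on_SucD(2)[OF Suc.prems this]]
    show "Ck_on k UNIV (\<lambda>y. blinfun_apply (integral (cbox a b) (G y)) i)"
      by (simp add: e)
  qed
qed

definition mollify :: "real \<Rightarrow> ('a::euclidean_space \<Rightarrow> real) \<Rightarrow> 'a \<Rightarrow> real" where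
  "mollify e f y = (LINT w|lborel. bump e w * f (y - w)) / (LINT w|lborel. bump e (w::'a))"

lemma integrable_bump:
  fixes f :: "'a::euclidean_space \<Rightarrow> real"
  assumes "e > 0" "continuous_on UNIV f"
  shows "integrable lborel (\<lambda>w. bump e w * f w)"
proof -
  have "integrable lborel (\<lambda>w. indicator (cball 0 e) w *\<^sub>R (bump e w * f w))"
    by (rule borel_integrable_compact)
      (auto intro!: continuous_intros bump_props continuous_on_subset[OF assms(2)])
  also have "(\<lambda>w. indicator (cball 0 e) w *\<^sub>R (bump e w * f w)) = (\<lambda>w. bump e w * f w)"
  proof
    fix w
    show "indicator (cball 0 e) w *\<^sub>R (bump e w * f w) = bump e w * f w"
      using bump_props(3)[OF \<open>e > 0\<close>, of w] by (cases "norm w \<le> e") (auto simp: indicator_def)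
  qed
  finally show ?thesis .
qed

lemma bump_integral_pos:
  assumes "e > 0"
  shows "(LINT w|lborel. bump e (w::'a::euclidean_space)) > 0"
proof -
  have i: "integrable lborel (bump e :: 'a \<Rightarrow> real)"
    using integrable_bump[OF assms, of "\<lambda>_. 1"] by simp
  have "(LINT w|lborel. bump e (w::'a)) \<noteq> 0"
  proof
    assume "(LINT w|lborel. bump e (w::'a)) = 0"
    then have "AE w in lborel. bump e (w::'a) = 0"
      using integral_nonneg_eq_0_iff_AE[OF i] bump_props(1) by auto
    then have "AE w in lborel. (w::'a) \<notin> ball 0 e"
      by (rule AE_mp) (use bump_props(2)[OF assms] in \<open>force intro!: AE_I2\<close>)
    then have "ball 0 e \<in> null_sets (lborel :: 'a measure)"
      by (simp add: AE_iff_null_sets)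
    then have "negligible (ball (0::'a) e)"
      by (simp add: negligible_iff_null_sets null_sets_completionI)
    then show False using open_not_negligible[of "ball (0::'a) e"] assms by auto
  qed
  moreover have "(LINT w|lborel. bump e (w::'a)) \<ge> 0"
    by (intro integral_nonneg_AE AE_I2 bump_props)
  ultimately show ?thesis by linarith
qed

lemma bump_average_le:
  fixes f :: "'a::euclidean_space \<Rightarrow> real"
  assumes "e > 0" "continuous_on UNIV f" "\<And>w. norm w < e \<Longrightarrow> \<bar>f w\<bar> \<le> \<kappa>"
  shows "\<bar>LINT w|lborel. bump e w * f w\<bar> \<le> \<kappa> * (LINT w|lborel. bump e (w::'a))"
proof -
  have i: "integrable lborel (\<lambda>w::'a. \<kappa> * bump e w)"
    using integrable_bump[OF assms(1), of "\<lambda>_. \<kappa>"] by (simp add: mult.commute)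
  have "\<bar>LINT w|lborel. bump e w * f w\<bar> \<le> (LINT w|lborel. \<bar>bump e w * f w\<bar>)"
    by (rule integral_abs_bound)
  also have "\<dots> \<le> (LINT w|lborel. \<kappa> * bump e (w::'a))"
  proof (rule integral_mono[OF _ i])
    show "integrable lborel (\<lambda>w. \<bar>bump e w * f w\<bar>)"
      using integrable_abs[OF integrable_bump[OF assms(1,2)]] by simp
    fix w :: 'a
    show "\<bar>bump e w * f w\<bar> \<le> \<kappa> * bump e w"
    proof (cases "norm w < e")
      case True
      then show ?thesis using assms(3)[OF True] bump_props(1)[of e w]
        by (simp add: abs_mult mult.commute[of \<kappa>] mult_left_mono)
    qed (use bump_props(3)[OF assms(1), of w] in simp)
  qed
  also have "\<dots> = \<kappa> * (LINT w|lborel. bump e (w::'a))" by simp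
  finally show ?thesis .
qed

text \<open>The mollification is a weighted mean of the values of f on the e-ball around y, so any
  bound valid on that ball survives. With m = 0 and \<kappa> = 0 this also yields the support of the
  mollification.\<close>

lemma mollify_close:
  fixes f :: "'a::euclidean_space \<Rightarrow> real"
  assumes "e > 0" "continuous_on UNIV f" "\<And>w. norm w < e \<Longrightarrow> \<bar>f (y - w) - m\<bar> \<le> \<kappa>"
  shows "\<bar>mollify e f y - m\<bar> \<le> \<kappa>"
proof -
  let ?Z = "LINT w|lborel. bump e (w::'a)"
  have c: "continuous_on UNIV (\<lambda>w. f (y - w))"
    by (intro continuous_on_compose2[OF assms(2)] continuous_intros) auto
  have Z: "?Z > 0" by (rule bump_integral_pos[OF assms(1)])
  have "(LINT w|lborel. bump e w * (f (y - w) - m)) = (LINT w|lborel. bump e w * f (y - w)) - m * ?Z"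
    unfolding right_diff_distrib
    by (subst Bochner_Integration.integral_diff[OF integrable_bump[OF assms(1) c] integrable_bump[OF assms(1), of "\<lambda>_. m"]])
      (simp_all add: mult.commute)
  then have "mollify e f y - m = (LINT w|lborel. bump e w * (f (y - w) - m)) / ?Z"
    using Z by (simp add: mollify_def field_simps)
  moreover have "\<bar>LINT w|lborel. bump e w * (f (y - w) - m)\<bar> \<le> \<kappa> * ?Z"
    by (rule bump_average_le[OF assms(1)]) (auto intro!: continuous_intros c assms(3))
  ultimately show ?thesis using Z by (simp add: abs_divide pos_divide_le_eq)
qed

lemma mollify_diff:
  fixes f :: "'a::euclidean_space \<Rightarrow> real"
  assumes "e > 0" "continuous_on UNIV f"
    "\<And>w. norm w < e \<Longrightarrow> \<bar>f (y' - w) - f (y - w) - m\<bar> \<le> \<kappa>"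
  shows "\<bar>mollify e f y' - mollify e f y - m\<bar> \<le> \<kappa>"
proof -
  let ?Z = "LINT w|lborel. bump e (w::'a)"
  have c: "continuous_on UNIV (\<lambda>w. f (y - w))" for y
    by (intro continuous_on_compose2[OF assms(2)] continuous_intros) auto
  have Z: "?Z > 0" by (rule bump_integral_pos[OF assms(1)])
  note [simp] = integrable_bump[OF assms(1) c] integrable_bump[OF assms(1), of "\<lambda>_. m", simplified]
  have "(LINT w|lborel. bump e w * (f (y' - w) - f (y - w) - m))
      = (LINT w|lborel. bump e w * f (y' - w) - bump e w * f (y - w) - bump e w * m)"
    by (simp add: right_diff_distrib)
  also have "\<dots> = (LINT w|lborel. bump e w * f (y' - w)) - (LINT w|lborel. bump e w * f (y - w)) - m * ?Z"
    using integrable_bump[OF assms(1), of "\<lambda>_. m"]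
    by (subst Bochner_Integration.integral_diff, simp, simp)+ simp
  finally have "mollify e f y' - mollify e f y - m
      = (LINT w|lborel. bump e w * (f (y' - w) - f (y - w) - m)) / ?Z"
    using Z by (simp add: mollify_def field_simps)
  moreover have "\<bar>LINT w|lborel. bump e w * (f (y' - w) - f (y - w) - m)\<bar> \<le> \<kappa> * ?Z"
    by (rule bump_average_le[OF assms(1)]) (auto intro!: continuous_intros c assms(3))
  ultimately show ?thesis using Z by (simp add: abs_divide pos_divide_le_eq)
qed

text \<open>Substituting z = y - w moves the dependence on y from f to the smooth kernel, and the
  box containing the support of f makes the domain of integration compact.\<close>

lemma Ck_on_mollify:
  fixes f :: "'a::euclidean_space \<Rightarrow> real"
  assumes "e > 0" "continuous_on UNIV f" "\<And>z. z \<notin> cbox a b \<Longrightarrow> f z = 0"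
  shows "Ck_on k UNIV (mollify e f)"
proof -
  let ?Z = "LINT w|lborel. bump e (w::'a)"
  have "(LINT w|lborel. bump e w * f (y - w)) = integral (cbox a b) (\<lambda>z. bump e (y - z) * f z)" for y
  proof -
    have c: "continuous_on UNIV (\<lambda>z. bump e (y - z) * f z)"
      by (intro continuous_intros continuous_on_compose2[OF bump_props(4)[of UNIV]] assms(2)) auto
    have cm: "continuous_on UNIV (\<lambda>w. bump e w * f (y - w))"
      by (intro continuous_intros continuous_on_compose2[OF assms(2)] bump_props(4)) auto
    have "integrable lborel (\<lambda>z. indicator (cbox a b) z *\<^sub>R (bump e (y - z) * f z))"
      by (rule borel_integrable_compact) (auto intro: continuous_on_subset[OF c])
    also have "(\<lambda>z. indicator (cbox a b) z *\<^sub>R (bump e (y - z) * f z)) = (\<lambda>z. bump e (y - z) * f z)"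
      using assms(3) by (auto simp: indicator_def fun_eq_iff)
    finally have i: "integrable lborel (\<lambda>z. bump e (y - z) * f z)" .
    have "(lborel :: 'a measure) = distr lborel borel (\<lambda>x. y - x)"
      using lborel_affine[of "-1" y] by (simp add: density_1)
    then have "(LINT w|lborel. bump e w * f (y - w)) = (LINT w|distr lborel borel (\<lambda>x. y - x). bump e w * f (y - w))"
      by simp
    also have "\<dots> = (LINT z|lborel. bump e (y - z) * f z)"
      using borel_measurable_continuous_onI[OF cm] by (subst integral_distr) auto
    also have "\<dots> = integral UNIV (\<lambda>z. bump e (y - z) * f z)"
      by (rule integral_lborel[OF i, symmetric])
    also have "\<dots> = integral UNIV (\<lambda>z. if z \<in> cbox a b then bump e (y - z) * f z else 0)"
      by (rule arg_cong[of _ _ "integral UNIV"]) (use assms(3) in auto)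
    also have "\<dots> = integral (cbox a b) (\<lambda>z. bump e (y - z) * f z)"
      by (rule integral_restrict_UNIV)
    finally show ?thesis .
  qed
  then have "mollify e f = (\<lambda>y. inverse ?Z * integral (cbox a b) (\<lambda>z. bump e (y - z) * f z))"
    by (simp add: mollify_def fun_eq_iff divide_inverse)
  then show ?thesis
    using Ck_on_mult[OF open_UNIV Ck_on_const Ck_on_convolution[OF Ck_on_bump assms(2)]] by metis
qed

text \<open>Only difference quotients of f enter, so the same lemma serves two purposes: with m a
  partial derivative and \<kappa> small it gives C^1 approximation, and with m = 0 it carries a
  Lipschitz bound over to the derivative.\<close>

lemma mollify_derivative:
  fixes f :: "'a::euclidean_space \<Rightarrow> real"
  assumes "e > 0" "continuous_on UNIV f" "\<And>z. z \<notin> cbox a b \<Longrightarrow> f z = 0"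
    and "h0 > 0" "\<And>w h. norm w < e \<Longrightarrow> 0 < h \<Longrightarrow> h < h0 \<Longrightarrow> \<bar>f (y - w + h *\<^sub>R v) - f (y - w) - h * m\<bar> \<le> h * \<kappa>"
  shows "\<bar>frechet_derivative (mollify e f) (at y) v - m\<bar> \<le> \<kappa>"
proof -
  let ?F = "mollify e f" and ?D = "frechet_derivative (mollify e f) (at y)"
  have D: "(?F has_derivative ?D) (at y)"
    using Ck_on_SucD(1)[OF Ck_on_mollify[OF assms(1-3), of a b "Suc 0"]] by simp
  have "((\<lambda>h::real. y + h *\<^sub>R v) has_derivative (\<lambda>h. h *\<^sub>R v)) (at 0)"
    by (auto intro!: derivative_eq_intros)
  from has_derivative_compose[OF this, of ?F ?D] D
  have "((\<lambda>h. ?F (y + h *\<^sub>R v)) has_derivative (\<lambda>h. ?D (h *\<^sub>R v))) (at 0)" by simp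
  moreover have "(\<lambda>h. ?D (h *\<^sub>R v)) = (\<lambda>h. h * ?D v)"
    using linear_cmul[OF has_derivative_linear[OF D]] by auto
  ultimately have "((\<lambda>h. ?F (y + h *\<^sub>R v)) has_real_derivative ?D v) (at 0)"
    by (simp add: has_field_derivative_def mult.commute[of "?D v"] mult_commute_abs)
  then have "((\<lambda>h. (?F (y + h *\<^sub>R v) - ?F y) / h) \<longlongrightarrow> ?D v) (at 0)"
    by (simp add: has_field_derivative_iff)
  then have "((\<lambda>h. (?F (y + h *\<^sub>R v) - ?F y) / h) \<longlongrightarrow> ?D v) (at_right 0)"
    by (simp add: filterlim_at_split)
  then have "((\<lambda>h. \<bar>(?F (y + h *\<^sub>R v) - ?F y) / h - m\<bar>) \<longlongrightarrow> \<bar>?D v - m\<bar>) (at_right 0)"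
    by (intro tendsto_intros)
  moreover have "\<forall>\<^sub>F h in at_right 0. \<bar>(?F (y + h *\<^sub>R v) - ?F y) / h - m\<bar> \<le> \<kappa>"
    using eventually_at_right_less[of 0] eventually_at_right_real[OF assms(4)]
  proof eventually_elim
    case (elim h)
    have "\<bar>?F (y + h *\<^sub>R v) - ?F y - h * m\<bar> \<le> h * \<kappa>"
      by (rule mollify_diff[OF assms(1,2)]) (use assms(5)[of _ h] elim in \<open>simp add: diff_add_eq\<close>)
    moreover have "(?F (y + h *\<^sub>R v) - ?F y) / h - m = (?F (y + h *\<^sub>R v) - ?F y - h * m) / h"
      using elim by (simp add: field_simps)
    ultimately show ?case using elim by (simp add: abs_divide pos_divide_le_eq mult.commute)
  qed
  ultimately show ?thesis
    by (rule tendsto_upperbound) simp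
qed

section \<open>Positive definite matrices\<close>

definition pos_def :: "real ^ 'm ^ 'm \<Rightarrow> bool" where
  "pos_def G \<longleftrightarrow> transpose G = G \<and> (\<forall>v. v \<noteq> 0 \<longrightarrow> 0 < v \<bullet> (G *v v))"

lemma pos_def_sym: "pos_def G \<Longrightarrow> v \<bullet> (G *v w) = w \<bullet> (G *v v)"
  by (metis dot_lmul_matrix inner_commute pos_def_def transpose_matrix_vector)

lemma pos_def_nonneg: "pos_def G \<Longrightarrow> 0 \<le> v \<bullet> (G *v v)"
  by (cases "v = 0") (auto simp: pos_def_def intro: less_imp_le)

lemma pos_def_invertible:
  fixes G :: "real ^ 'm ^ 'm"
  assumes "pos_def G" shows "invertible G"
proof -
  have "G *v x = 0 \<Longrightarrow> x = 0" for x
    using assms by (metis inner_zero_right less_irrefl pos_def_def)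
  then obtain B where "B ** G = mat 1"
    using matrix_left_invertible_ker[of G] by auto
  then show ?thesis by (auto simp: invertible_def matrix_left_right_inverse)
qed

lemma pos_def_inverse:
  fixes G :: "real ^ 'm ^ 'm"
  assumes "pos_def G"
  shows "G *v (matrix_inv G *v w) = w" "matrix_inv G *v (G *v w) = w"
proof -
  have "G ** matrix_inv G = mat 1 \<and> matrix_inv G ** G = mat 1"
    using pos_def_invertible[OF assms] unfolding invertible_def matrix_inv_def by (rule someI_ex)
  then show "G *v (matrix_inv G *v w) = w" "matrix_inv G *v (G *v w) = w"
    by (simp_all add: matrix_vector_mul_assoc)
qed

lemma pos_def_Cauchy_Schwarz:
  assumes "pos_def G"
  shows "(v \<bullet> (G *v w))\<^sup>2 \<le> (v \<bullet> (G *v v)) * (w \<bullet> (G *v w))"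
proof (cases "w = 0")
  case False
  then have c: "w \<bullet> (G *v w) > 0" using assms by (auto simp: pos_def_def)
  define t where "t = (v \<bullet> (G *v w)) / (w \<bullet> (G *v w))"
  have "0 \<le> (v - t *\<^sub>R w) \<bullet> (G *v (v - t *\<^sub>R w))" by (rule pos_def_nonneg[OF assms])
  also have "\<dots> = v \<bullet> (G *v v) - 2 * t * (v \<bullet> (G *v w)) + t\<^sup>2 * (w \<bullet> (G *v w))"
    using pos_def_sym[OF assms, of w v]
    by (simp add: matrix_vector_mult_diff_distrib scaleR_matrix_vector_assoc[symmetric] inner_diff_left
        inner_diff_right power2_eq_square algebra_simps matrix_vector_mult_scaleR)
  also have "\<dots> = v \<bullet> (G *v v) - (v \<bullet> (G *v w))\<^sup>2 / (w \<bullet> (G *v w))"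
    using c by (simp add: t_def field_simps power2_eq_square)
  finally show ?thesis using c by (simp add: field_simps)
qed simp

lemma continuous_on_det:
  fixes G :: "'b::topological_space \<Rightarrow> real ^ 'm ^ 'm"
  assumes "continuous_on S G"
  shows "continuous_on S (\<lambda>x. det (G x))"
  unfolding det_def by (intro continuous_intros continuous_on_component assms)

text \<open>The segment from the identity to G consists of positive definite, hence invertible,
  matrices. The determinant is 1 at its start and cannot cross 0.\<close>

lemma pos_def_det_pos:
  fixes G :: "real ^ 'm ^ 'm"
  assumes "pos_def G" shows "det G > 0"
proof (rule ccontr)
  assume n: "\<not> det G > 0"
  define F where "F t = (1 - t) *\<^sub>R (mat 1 :: real ^ 'm ^ 'm) + t *\<^sub>R G" for t :: real
  have "continuous_on {0..1} (\<lambda>t. det (F t))"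
    unfolding F_def by (intro continuous_on_det continuous_intros)
  moreover have "det (F 1) \<le> 0" "0 \<le> det (F 0)" using n by (auto simp: F_def)
  ultimately obtain t where t: "0 \<le> t" "t \<le> 1" "det (F t) = 0"
    using IVT2'[of "\<lambda>t. det (F t)" 1 0 0] by auto
  have "pos_def (F t)"
    unfolding pos_def_def
  proof (intro conjI allI impI)
    show "transpose (F t) = F t"
      using assms by (simp add: F_def pos_def_def transpose_def vec_eq_iff mat_def)
    fix v :: "real ^ 'm" assume v: "v \<noteq> 0"
    have "v \<bullet> (F t *v v) = (1 - t) * (v \<bullet> v) + t * (v \<bullet> (G *v v))"
      by (simp add: F_def matrix_vector_mult_add_rdistrib scaleR_matrix_vector_assoc[symmetric] inner_add_right)
    moreover have "v \<bullet> v > 0" "v \<bullet> (G *v v) > 0" using v assms by (auto simp: pos_def_def)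
    ultimately show "0 < v \<bullet> (F t *v v)"
      using t(1,2) by (cases "t = 0") (auto intro!: add_nonneg_pos mult_nonneg_nonneg)
  qed
  then have "det (F t) \<noteq> 0" using pos_def_invertible invertible_det_nz by blast
  then show False using t by simp
qed

text \<open>Cramer's rule turns the continuity of the inverse matrix into that of determinants.\<close>

lemma continuous_on_matrix_inv_mult:
  fixes G :: "'b::topological_space \<Rightarrow> real ^ 'm ^ 'm"
  assumes "continuous_on S G" "continuous_on S \<xi>" "\<And>x. x \<in> S \<Longrightarrow> pos_def (G x)"
  shows "continuous_on S (\<lambda>x. matrix_inv (G x) *v \<xi> x)"
proof -
  have "matrix_inv (G x) *v \<xi> x = (\<chi> k. det (\<chi> i j. if j = k then \<xi> x $ i else G x $ i $ j) / det (G x))"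
    if "x \<in> S" for x
    using cramer[of "G x" "matrix_inv (G x) *v \<xi> x" "\<xi> x"] pos_def_inverse[OF assms(3)[OF that]]
      pos_def_det_pos[OF assms(3)[OF that]] by auto
  moreover have "continuous_on S (\<lambda>x. \<chi> k. det (\<chi> i j. if j = k then \<xi> x $ i else G x $ i $ j) / det (G x))"
  proof (intro continuous_on_vec_lambda continuous_on_divide continuous_on_det assms(1) ballI)
    show "det (G x) \<noteq> 0" if "x \<in> S" for x using pos_def_det_pos[OF assms(3)[OF that]] by simp
    show "continuous_on S (\<lambda>x. if j = k then \<xi> x $ i else G x $ i $ j)" for i j k
      using assms(1,2) by (cases "j = k") (auto intro!: continuous_on_component)
  qed
  ultimately show ?thesis by (simp cong: continuous_on_cong)
qed

section \<open>Differentials in charts\<close>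

text \<open>The covector \<omega> represents the differential of f in the chart. A relation is
  easier to compute with than \<open>coord_partials\<close>, because it comes with the usual
  derivative rules and determines \<omega> uniquely.\<close>

definition has_dif :: "('a \<Rightarrow> real) \<Rightarrow> ('a, 'm::finite) chart \<Rightarrow> 'a \<Rightarrow> real ^ 'm \<Rightarrow> bool" where
  "has_dif f c p \<omega> \<longleftrightarrow> (f \<circ> coord_inv c has_derivative (\<lambda>v. \<omega> \<bullet> v)) (at (snd c p))"

lemma has_dif_coord_partials:
  assumes "has_dif f c p \<omega>" shows "coord_partials f c p = \<omega>"
proof -
  have "frechet_derivative (f \<circ> coord_inv c) (at (snd c p)) = (\<lambda>v. \<omega> \<bullet> v)"
    using frechet_derivative_at assms unfolding has_dif_def by metis
  then show ?thesis by (simp add: coord_partials_def vec_eq_iff inner_axis)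
qed

lemma linear_inner_rep:
  fixes D :: "real ^ 'm \<Rightarrow> real"
  assumes "linear D"
  shows "D v = (\<chi> i. D (axis i 1)) \<bullet> v"
proof -
  have "D v = D (\<Sum>i\<in>UNIV. (v $ i) *\<^sub>R axis i 1)"
    using basis_expansion[of v] by (simp add: scalar_mult_eq_scaleR)
  also have "\<dots> = (\<chi> i. D (axis i 1)) \<bullet> v"
    by (simp add: linear_sum[OF assms] linear_cmul[OF assms] inner_vec_def mult.commute)
  finally show ?thesis .
qed

lemma differentiable_has_dif:
  assumes "(f \<circ> coord_inv c) differentiable (at (snd c p))"
  shows "has_dif f c p (coord_partials f c p)"
proof -
  let ?D = "frechet_derivative (f \<circ> coord_inv c) (at (snd c p))"
  have D: "(f \<circ> coord_inv c has_derivative ?D) (at (snd c p))"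
    using assms by (simp add: frechet_derivative_works)
  have "?D = (\<lambda>v. coord_partials f c p \<bullet> v)"
    unfolding coord_partials_def using linear_inner_rep[OF has_derivative_linear[OF D]] by blast
  then show ?thesis using D unfolding has_dif_def by simp
qed

lemma has_dif_add:
  assumes "has_dif f c p \<omega>" "has_dif h c p \<xi>"
  shows "has_dif (\<lambda>x. f x + h x) c p (\<omega> + \<xi>)"
proof -
  have "(\<lambda>v. (\<omega> + \<xi>) \<bullet> v) = (\<lambda>v. \<omega> \<bullet> v + \<xi> \<bullet> v)" by (simp add: fun_eq_iff inner_add_left)
  then show ?thesis
    using has_derivative_add[OF assms[unfolded has_dif_def]] by (simp add: has_dif_def o_def)
qed

lemma has_dif_const: "has_dif (\<lambda>x. k) c p 0"
proof -
  have "(\<lambda>v. (0 :: real ^ 'b) \<bullet> v) = (\<lambda>v. 0)" by (simp add: fun_eq_iff)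
  then show ?thesis by (simp add: has_dif_def o_def)
qed

section \<open>Charts, transition maps and the metric in coordinates\<close>

locale riem =
  fixes A :: "('a::{t2_space,second_countable_topology}, 'm::finite) chart set"
    and g :: "('a, 'm) metric_tensor"
  assumes atlas: "smooth_atlas A" and metric: "riemannian_metric A g"
begin

lemma ex_chart: "\<exists>c\<in>A. p \<in> fst c"
  using atlas by (auto simp: smooth_atlas_def)

lemma chart_at: "chart_at A p \<in> A" "p \<in> fst (chart_at A p)"
proof -
  have "chart_at A p \<in> A \<and> p \<in> fst (chart_at A p)"
    unfolding chart_at_def by (rule someI_ex) (use ex_chart in blast)
  then show "chart_at A p \<in> A" "p \<in> fst (chart_at A p)" by auto
qed

context
  fixes c assumes c: "c \<in> A"
begin

lemma chart_homeo:
  "open (fst c)" "open (snd c ` fst c)" "continuous_on (fst c) (snd c)"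
  "continuous_on (snd c ` fst c) (coord_inv c)"
  "p \<in> fst c \<Longrightarrow> coord_inv c (snd c p) = p"
  "y \<in> snd c ` fst c \<Longrightarrow> snd c (coord_inv c y) = y"
  "y \<in> snd c ` fst c \<Longrightarrow> coord_inv c y \<in> fst c"
  using atlas c by (auto simp: smooth_atlas_def homeomorphism_def)

lemma chart_image_eq:
  assumes "W \<subseteq> fst c" shows "snd c ` W = snd c ` fst c \<inter> coord_inv c -` W"
proof (intro equalityI subsetI)
  show "y \<in> snd c ` fst c \<inter> coord_inv c -` W" if "y \<in> snd c ` W" for y
    using that assms chart_homeo(5) by auto
  show "y \<in> snd c ` W" if y: "y \<in> snd c ` fst c \<inter> coord_inv c -` W" for y
    using chart_homeo(6)[of y] y by (intro image_eqI[of _ _ "coord_inv c y"]) auto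
qed

lemma chart_image_open: "open W \<Longrightarrow> W \<subseteq> fst c \<Longrightarrow> open (snd c ` W)"
  by (subst chart_image_eq) (auto intro: continuous_open_preimage[OF chart_homeo(4,2)])

lemma chart_preimage_open: "open Y \<Longrightarrow> open (fst c \<inter> snd c -` Y)"
  using continuous_open_preimage[OF chart_homeo(3,1)] .

lemma chart_inv_image:
  assumes "Y \<subseteq> snd c ` fst c" shows "coord_inv c ` Y = fst c \<inter> snd c -` Y"
proof (intro equalityI subsetI)
  show "p \<in> fst c \<inter> snd c -` Y" if "p \<in> coord_inv c ` Y" for p
    using that assms chart_homeo(6,7) by (auto simp: subset_iff)
  show "p \<in> coord_inv c ` Y" if p: "p \<in> fst c \<inter> snd c -` Y" for p
    using chart_homeo(5)[of p] p by (intro image_eqI[of _ _ "snd c p"]) auto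
qed

lemma has_dif_continuous: "has_dif f c p \<omega> \<Longrightarrow> p \<in> fst c \<Longrightarrow> isCont f p"
proof -
  assume d: "has_dif f c p \<omega>" and p: "p \<in> fst c"
  have "isCont (f \<circ> coord_inv c) (snd c p)"
    using d by (auto simp: has_dif_def intro: has_derivative_continuous)
  moreover have "isCont (snd c) p"
    using p chart_homeo(1,3) continuous_on_eq_continuous_at by blast
  ultimately have "isCont ((f \<circ> coord_inv c) \<circ> snd c) p"
    using continuous_at_compose[of p "snd c" "f \<circ> coord_inv c"] by blast
  moreover have "\<forall>\<^sub>F x in nhds p. ((f \<circ> coord_inv c) \<circ> snd c) x = f x"
    by (rule eventually_mono[OF eventually_nhds_in_open[OF chart_homeo(1) p]]) (simp add: chart_homeo(5))
  ultimately show "isCont f p" using isCont_cong by blast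
qed

lemma has_dif_mult:
  assumes "p \<in> fst c" "has_dif f c p \<omega>" "has_dif h c p \<xi>"
  shows "has_dif (\<lambda>x. f x * h x) c p (f p *\<^sub>R \<xi> + h p *\<^sub>R \<omega>)"
proof -
  have "(\<lambda>v. (f p *\<^sub>R \<xi> + h p *\<^sub>R \<omega>) \<bullet> v) = (\<lambda>v. f p * (\<xi> \<bullet> v) + \<omega> \<bullet> v * h p)"
    by (simp add: fun_eq_iff inner_add_left mult.commute)
  then show ?thesis
    using has_derivative_mult[OF assms(2,3)[unfolded has_dif_def]] chart_homeo(5)[OF assms(1)]
    by (simp add: has_dif_def o_def)
qed

lemma has_dif_compose:
  assumes "p \<in> fst c" "has_dif f c p \<omega>" "(\<theta> has_real_derivative k) (at (f p))"
  shows "has_dif (\<lambda>x. \<theta> (f x)) c p (k *\<^sub>R \<omega>)"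
proof -
  have "(\<lambda>v. (k *\<^sub>R \<omega>) \<bullet> v) = (\<lambda>v. k * (\<omega> \<bullet> v))" by (simp add: fun_eq_iff)
  then show ?thesis
    using has_derivative_compose[OF assms(2)[unfolded has_dif_def], of \<theta> "(*) k"] assms(3) chart_homeo(5)[OF assms(1)]
    by (simp add: has_dif_def o_def has_field_derivative_def)
qed

lemma has_dif_cong:
  assumes "p \<in> W" "open W" "\<And>x. x \<in> W \<Longrightarrow> f x = h x" "has_dif f c p \<omega>" "p \<in> fst c"
  shows "has_dif h c p \<omega>"
  unfolding has_dif_def
proof (rule has_derivative_transform_within_open[OF assms(4)[unfolded has_dif_def]])
  show "open (snd c ` (W \<inter> fst c))"
    using chart_image_open assms(2) chart_homeo(1) by auto
  show "snd c p \<in> snd c ` (W \<inter> fst c)" using assms by auto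
  show "\<And>y. y \<in> snd c ` (W \<inter> fst c) \<Longrightarrow> (f \<circ> coord_inv c) y = (h \<circ> coord_inv c) y"
    using assms(3) chart_homeo(5) by auto
qed

lemma metric_pos_def: "p \<in> fst c \<Longrightarrow> pos_def (g c p)"
  using metric c by (auto simp: riemannian_metric_def pos_def_def)

lemma metric_continuous: "continuous_on (fst c) (g c)"
proof -
  have "smooth_on (snd c ` fst c) (g c \<circ> coord_inv c)" using metric c by (auto simp: riemannian_metric_def)
  then have "continuous_on (snd c ` fst c) (g c \<circ> coord_inv c)"
    unfolding smooth_on_def by (metis Ck_on.simps(1))
  from continuous_on_compose[OF chart_homeo(3) this]
  show ?thesis using chart_homeo(5) by (simp add: o_def cong: continuous_on_cong)
qed

end

definition trans_mat :: "('a, 'm) chart \<Rightarrow> ('a, 'm) chart \<Rightarrow> 'a \<Rightarrow> real ^ 'm ^ 'm" where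
  "trans_mat c d p = jacobian (snd d \<circ> coord_inv c) (at (snd c p))"

context
  fixes c d assumes c: "c \<in> A" and d: "d \<in> A"
begin

lemma trans_smooth: "Ck_on k (snd c ` (fst c \<inter> fst d)) (snd d \<circ> coord_inv c)"
  using atlas c d by (auto simp: smooth_atlas_def smooth_on_def)

lemma trans_derivative:
  assumes "p \<in> fst c" "p \<in> fst d"
  shows "(snd d \<circ> coord_inv c has_derivative (\<lambda>v. trans_mat c d p *v v)) (at (snd c p))"
proof -
  have "(snd d \<circ> coord_inv c) differentiable (at (snd c p))"
    using trans_smooth[of "Suc 0"] assms by auto
  then show ?thesis using jacobian_works unfolding trans_mat_def by blast
qed

lemma trans_mat_continuous: "continuous_on (fst c \<inter> fst d) (trans_mat c d)"
proof -
  let ?D = "\<lambda>y. frechet_derivative (snd d \<circ> coord_inv c) (at y)"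
  have "continuous_on (snd c ` (fst c \<inter> fst d)) (\<lambda>y. ?D y (axis j 1))" for j
    using Ck_on_SucD(2)[OF trans_smooth[of "Suc 0"], of "axis j 1"] by (auto simp: Basis_vec_def)
  then have "continuous_on (fst c \<inter> fst d) (\<lambda>p. ?D (snd c p) (axis j 1))" for j
    by (rule continuous_on_compose2) (auto intro: continuous_on_subset[OF chart_homeo(3)[OF c]])
  then show ?thesis
    unfolding trans_mat_def[abs_def] jacobian_def matrix_def
    by (intro continuous_on_vec_lambda continuous_on_component)
qed

lemma metric_change:
  assumes "p \<in> fst c" "p \<in> fst d"
  shows "g c p = transpose (trans_mat c d p) ** g d p ** trans_mat c d p"
  using metric c d assms unfolding riemannian_metric_def trans_mat_def Let_def by blast

lemma trans_has_derivative_chain: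
  assumes "p \<in> fst c" "p \<in> fst d" "(F \<circ> coord_inv d has_derivative F') (at (snd d p))"
  shows "(F \<circ> coord_inv c has_derivative (\<lambda>v. F' (trans_mat c d p *v v))) (at (snd c p))"
proof -
  have "(F \<circ> coord_inv d has_derivative F') (at ((snd d \<circ> coord_inv c) (snd c p)))"
    using assms(3) by (simp add: chart_homeo(5)[OF c assms(1)])
  from has_derivative_compose[OF trans_derivative[OF assms(1,2)] this]
  have h: "((\<lambda>y. (F \<circ> coord_inv d) ((snd d \<circ> coord_inv c) y)) has_derivative (\<lambda>v. F' (trans_mat c d p *v v))) (at (snd c p))" .
  show ?thesis
  proof (rule has_derivative_transform_within_open[OF h])
    show "open (snd c ` (fst c \<inter> fst d))"
      by (rule chart_image_open[OF c]) (use chart_homeo(1)[OF c] chart_homeo(1)[OF d] in auto)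
    show "snd c p \<in> snd c ` (fst c \<inter> fst d)" using assms by auto
    show "\<And>y. y \<in> snd c ` (fst c \<inter> fst d) \<Longrightarrow> (F \<circ> coord_inv d) ((snd d \<circ> coord_inv c) y) = (F \<circ> coord_inv c) y"
      using chart_homeo(5)[OF c] chart_homeo(5)[OF d] by auto
  qed
qed

lemma has_dif_change:
  assumes "p \<in> fst c" "p \<in> fst d" "has_dif f d p \<omega>"
  shows "has_dif f c p (\<omega> v* trans_mat c d p)"
  using trans_has_derivative_chain[OF assms(1,2) assms(3)[unfolded has_dif_def]]
  by (simp add: has_dif_def dot_lmul_matrix)

end

lemma trans_mat_inverse:
  assumes "c \<in> A" "d \<in> A" "p \<in> fst c" "p \<in> fst d"
  shows "trans_mat c d p *v (trans_mat d c p *v v) = v"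
proof -
  have "(snd d \<circ> coord_inv d has_derivative (\<lambda>v. trans_mat c d p *v (trans_mat d c p *v v))) (at (snd d p))"
    by (rule trans_has_derivative_chain[OF assms(2,1,4,3) trans_derivative[OF assms]])
  moreover have "(snd d \<circ> coord_inv d has_derivative (\<lambda>v. v)) (at (snd d p))"
  proof (rule has_derivative_transform_within_open[OF has_derivative_ident])
    show "open (snd d ` fst d)" using chart_homeo[OF assms(2)] by auto
    show "snd d p \<in> snd d ` fst d" using assms by auto
    show "\<And>y. y \<in> snd d ` fst d \<Longrightarrow> y = (snd d \<circ> coord_inv d) y" using chart_homeo(6)[OF assms(2)] by auto
  qed
  ultimately show ?thesis using has_derivative_unique by metis
qed

lemma metric_norm_change:
  assumes "c \<in> A" "d \<in> A" "p \<in> fst c" "p \<in> fst d"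
  shows "v \<bullet> (g c p *v v) = (trans_mat c d p *v v) \<bullet> (g d p *v (trans_mat c d p *v v))"
proof -
  let ?J = "trans_mat c d p"
  have "g c p *v v = (g d p *v (?J *v v)) v* ?J"
    by (simp add: metric_change[OF assms] matrix_vector_mul_assoc[symmetric])
  then have "v \<bullet> (g c p *v v) = ((g d p *v (?J *v v)) v* ?J) \<bullet> v" by (simp add: inner_commute)
  then show ?thesis unfolding dot_lmul_matrix by (simp add: inner_commute)
qed

subsection \<open>Continuously differentiable functions\<close>

text \<open>The notion is pointwise so that functions which are C^1 only in some region, such as
  functions read in one chart, can be handled before they are cut off. One chart suffices;
  \<open>C1atE\<close> passes to any other.\<close>

definition C1at :: "('a \<Rightarrow> real) \<Rightarrow> 'a \<Rightarrow> bool" where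
  "C1at f p \<longleftrightarrow> (\<exists>c\<in>A. \<exists>W \<omega>. open W \<and> p \<in> W \<and> W \<subseteq> fst c \<and> continuous_on W \<omega> \<and> (\<forall>q\<in>W. has_dif f c q (\<omega> q)))"

lemma C1atI:
  "c \<in> A \<Longrightarrow> open W \<Longrightarrow> p \<in> W \<Longrightarrow> W \<subseteq> fst c \<Longrightarrow> continuous_on W \<omega> \<Longrightarrow> (\<And>q. q \<in> W \<Longrightarrow> has_dif f c q (\<omega> q)) \<Longrightarrow> C1at f p"
  unfolding C1at_def by blast

lemma C1atE:
  assumes "C1at f p" "c \<in> A" "p \<in> fst c"
  obtains W \<omega> where "open W" "p \<in> W" "W \<subseteq> fst c" "continuous_on W \<omega>" "\<forall>q\<in>W. has_dif f c q (\<omega> q)"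
proof -
  obtain d W \<omega> where d: "d \<in> A" "open W" "p \<in> W" "W \<subseteq> fst d" "continuous_on W \<omega>" "\<forall>q\<in>W. has_dif f d q (\<omega> q)"
    using assms(1) unfolding C1at_def by blast
  show ?thesis
  proof (rule that[of "W \<inter> fst c" "\<lambda>q. \<omega> q v* trans_mat c d q"])
    show "open (W \<inter> fst c)" using d chart_homeo(1)[OF assms(2)] by auto
    have "continuous_on (W \<inter> fst c) (trans_mat c d)" "continuous_on (W \<inter> fst c) \<omega>"
      using trans_mat_continuous[OF assms(2) d(1)] d(4,5) by (auto intro: continuous_on_subset)
    then show "continuous_on (W \<inter> fst c) (\<lambda>q. \<omega> q v* trans_mat c d q)"
      unfolding vector_matrix_mult_def
      by (intro continuous_on_vec_lambda continuous_on_sum continuous_on_mult continuous_on_component)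
    show "\<forall>q\<in>W \<inter> fst c. has_dif f c q (\<omega> q v* trans_mat c d q)"
      using d has_dif_change[OF assms(2) d(1)] by auto
  qed (use d assms in auto)
qed

lemma C1at_has_dif:
  assumes "C1at f p" "c \<in> A" "p \<in> fst c"
  shows "has_dif f c p (coord_partials f c p)"
  using C1atE[OF assms] has_dif_coord_partials by metis

lemma C1at_isCont: "C1at f p \<Longrightarrow> isCont f p"
  using has_dif_continuous[OF chart_at(1) C1at_has_dif chart_at(2)] chart_at by blast

lemma C1at_partials_continuous:
  assumes "c \<in> A" "open W" "W \<subseteq> fst c" "\<And>q. q \<in> W \<Longrightarrow> C1at f q"
  shows "continuous_on W (coord_partials f c)"
proof -
  have "isCont (coord_partials f c) q" if q: "q \<in> W" for q
  proof -
    have "q \<in> fst c" using q assms(3) by blast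
    from C1atE[OF assms(4)[OF q] assms(1) this]
    obtain V \<omega> where V: "open V" "q \<in> V" "V \<subseteq> fst c" "continuous_on V \<omega>" "\<forall>q\<in>V. has_dif f c q (\<omega> q)" .
    have "continuous_on V (coord_partials f c)"
      using V(4) has_dif_coord_partials[OF V(5)[rule_format]] by (simp cong: continuous_on_cong)
    then show ?thesis using V(1,2) continuous_on_eq_continuous_at by blast
  qed
  then show ?thesis by (simp add: continuous_at_imp_continuous_on)
qed

lemma Ck_fun_1_iff: "Ck_fun A 1 f \<longleftrightarrow> (\<forall>p. C1at f p)"
proof
  assume f: "Ck_fun A 1 f"
  show "\<forall>p. C1at f p"
  proof
    fix p
    obtain c where c: "c \<in> A" "p \<in> fst c" using ex_chart by blast
    have k: "Ck_on (Suc 0) (snd c ` fst c) (f \<circ> coord_inv c)" using f c unfolding Ck_fun_def by simp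
    show "C1at f p"
    proof (rule C1atI[OF c(1) chart_homeo(1)[OF c(1)] c(2)])
      have "continuous_on (fst c) (\<lambda>p. frechet_derivative (f \<circ> coord_inv c) (at (snd c p)) (axis i 1))" for i
      proof (rule continuous_on_compose2[OF _ chart_homeo(3)[OF c(1)] order_refl])
        show "continuous_on (snd c ` fst c) (\<lambda>y. frechet_derivative (f \<circ> coord_inv c) (at y) (axis i 1))"
          using Ck_on_SucD(2)[OF k, of "axis i 1"] by (auto simp: Basis_vec_def)
      qed
      then show "continuous_on (fst c) (coord_partials f c)"
        unfolding coord_partials_def[abs_def] by (intro continuous_on_vec_lambda)
      show "has_dif f c q (coord_partials f c q)" if "q \<in> fst c" for q
        by (rule differentiable_has_dif) (use k that in auto)
    qed auto
  qed
next
  assume f: "\<forall>p. C1at f p"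
  show "Ck_fun A 1 f"
    unfolding Ck_fun_def
  proof
    fix c assume c: "c \<in> A"
    have d: "(f \<circ> coord_inv c has_derivative (\<lambda>v. coord_partials f c (coord_inv c y) \<bullet> v)) (at y)" if "y \<in> snd c ` fst c" for y
      using C1at_has_dif[OF f[rule_format] c, of "coord_inv c y"] chart_homeo(6,7)[OF c that]
      by (simp add: has_dif_def)
    have cp: "continuous_on (fst c) (coord_partials f c)"
      by (rule C1at_partials_continuous[OF c chart_homeo(1)[OF c]]) (use f in auto)
    have "Ck_on (Suc 0) (snd c ` fst c) (f \<circ> coord_inv c)"
    proof (rule Ck_on_SucI'[OF chart_homeo(2)[OF c] d])
      show "Ck_on 0 (snd c ` fst c) (\<lambda>y. coord_partials f c (coord_inv c y) \<bullet> i)" for i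
        using chart_homeo(7)[OF c]
        by (auto intro!: continuous_intros continuous_on_compose2[OF cp] chart_homeo(4)[OF c])
    qed
    then show "Ck_on 1 (snd c ` fst c) (f \<circ> coord_inv c)" by simp
  qed
qed

lemma C1at_const: "C1at (\<lambda>x. k) p"
  by (rule C1atI[OF chart_at(1) chart_homeo(1)[OF chart_at(1)] chart_at(2) order_refl continuous_on_const has_dif_const])

lemma C1at_add:
  assumes "C1at f p" "C1at h p" shows "C1at (\<lambda>x. f x + h x) p"
proof -
  obtain c where c: "c \<in> A" "p \<in> fst c" using ex_chart by blast
  from C1atE[OF assms(1) c] obtain W \<omega> where W: "open W" "p \<in> W" "W \<subseteq> fst c" "continuous_on W \<omega>" "\<forall>q\<in>W. has_dif f c q (\<omega> q)" .
  from C1atE[OF assms(2) c] obtain V \<xi> where V: "open V" "p \<in> V" "V \<subseteq> fst c" "continuous_on V \<xi>" "\<forall>q\<in>V. has_dif h c q (\<xi> q)" .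
  show ?thesis
    by (rule C1atI[OF c(1), of "W \<inter> V" _ "\<lambda>q. \<omega> q + \<xi> q"])
      (use W V in \<open>auto intro!: continuous_intros has_dif_add intro: continuous_on_subset\<close>)
qed

lemma C1at_mult:
  assumes "C1at f p" "C1at h p" shows "C1at (\<lambda>x. f x * h x) p"
proof -
  obtain c where c: "c \<in> A" "p \<in> fst c" using ex_chart by blast
  from C1atE[OF assms(1) c] obtain W \<omega> where W: "open W" "p \<in> W" "W \<subseteq> fst c" "continuous_on W \<omega>" "\<forall>q\<in>W. has_dif f c q (\<omega> q)" .
  from C1atE[OF assms(2) c] obtain V \<xi> where V: "open V" "p \<in> V" "V \<subseteq> fst c" "continuous_on V \<xi>" "\<forall>q\<in>V. has_dif h c q (\<xi> q)" .
  have "continuous_on W f" "continuous_on V h"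
    using has_dif_continuous[OF c(1)] W V by (meson continuous_at_imp_continuous_on subsetD)+
  then have "continuous_on (W \<inter> V) (\<lambda>q. f q *\<^sub>R \<xi> q + h q *\<^sub>R \<omega> q)"
    using W(4) V(4) by (auto intro!: continuous_intros intro: continuous_on_subset)
  then show ?thesis
    by (rule C1atI[OF c(1), of "W \<inter> V", rotated 3]) (use W V in \<open>auto intro!: has_dif_mult[OF c(1)]\<close>)
qed

lemma C1at_compose:
  assumes "C1at f p" "open T" "f p \<in> T" "\<And>t. t \<in> T \<Longrightarrow> (\<theta> has_real_derivative \<theta>' t) (at t)" "continuous_on T \<theta>'"
  shows "C1at (\<lambda>x. \<theta> (f x)) p"
proof -
  obtain c where c: "c \<in> A" "p \<in> fst c" using ex_chart by blast
  from C1atE[OF assms(1) c] obtain W \<omega> where W: "open W" "p \<in> W" "W \<subseteq> fst c" "continuous_on W \<omega>" "\<forall>q\<in>W. has_dif f c q (\<omega> q)" .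
  have cf: "continuous_on W f"
    using has_dif_continuous[OF c(1)] W by (meson continuous_at_imp_continuous_on subsetD)
  define V where "V = W \<inter> f -` T"
  have V: "open V" unfolding V_def by (rule continuous_open_preimage[OF cf W(1) assms(2)])
  have "continuous_on V (\<lambda>q. \<theta>' (f q))"
    by (rule continuous_on_compose2[OF assms(5)]) (auto intro: continuous_on_subset[OF cf] simp: V_def)
  then have "continuous_on V (\<lambda>q. \<theta>' (f q) *\<^sub>R \<omega> q)"
    by (intro continuous_intros) (auto intro: continuous_on_subset[OF W(4)] simp: V_def)
  then show ?thesis
    by (rule C1atI[OF c(1) V, rotated 2])
      (use W assms(3,4) in \<open>auto intro!: has_dif_compose[OF c(1), where f = f and \<theta> = \<theta>] simp: V_def\<close>)
qed

lemma C1at_cong: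
  assumes "C1at f p" "open V" "p \<in> V" "\<And>x. x \<in> V \<Longrightarrow> f x = h x"
  shows "C1at h p"
proof -
  obtain c where c: "c \<in> A" "p \<in> fst c" using ex_chart by blast
  from C1atE[OF assms(1) c] obtain W \<omega> where W: "open W" "p \<in> W" "W \<subseteq> fst c" "continuous_on W \<omega>" "\<forall>q\<in>W. has_dif f c q (\<omega> q)" .
  show ?thesis
    by (rule C1atI[OF c(1), of "W \<inter> V" _ \<omega>])
      (use W assms in \<open>auto intro: continuous_on_subset has_dif_cong[OF c(1), of _ V f]\<close>)
qed

lemma C1at_sum: "(\<And>i. i \<in> I \<Longrightarrow> C1at (f i) p) \<Longrightarrow> C1at (\<lambda>x. \<Sum>i\<in>I. f i x) p"
  by (induction I rule: infinite_finite_induct) (auto intro: C1at_const C1at_add)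

lemma C1at_chart:
  assumes "c \<in> A" "p \<in> fst c" "open T" "snd c p \<in> T" "T \<subseteq> snd c ` fst c"
    "\<And>y. y \<in> T \<Longrightarrow> (F has_derivative F' y) (at y)" "\<And>i. continuous_on T (\<lambda>y. F' y (axis i 1))"
    "\<And>q. q \<in> fst c \<Longrightarrow> snd c q \<in> T \<Longrightarrow> f q = F (snd c q)"
  shows "C1at f p"
proof (rule C1atI[OF assms(1), of "fst c \<inter> snd c -` T" _ "\<lambda>q. \<chi> i. F' (snd c q) (axis i 1)"])
  show "open (fst c \<inter> snd c -` T)" by (rule chart_preimage_open[OF assms(1,3)])
  show "continuous_on (fst c \<inter> snd c -` T) (\<lambda>q. \<chi> i. F' (snd c q) (axis i 1))"
    by (intro continuous_on_vec_lambda continuous_on_compose2[OF assms(7)]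
        continuous_on_subset[OF chart_homeo(3)[OF assms(1)]]) auto
  fix q assume q: "q \<in> fst c \<inter> snd c -` T"
  have "F' (snd c q) = (\<lambda>v. (\<chi> i. F' (snd c q) (axis i 1)) \<bullet> v)"
    using linear_inner_rep[OF has_derivative_linear[OF assms(6)]] q by blast
  then have "(F has_derivative (\<lambda>v. (\<chi> i. F' (snd c q) (axis i 1)) \<bullet> v)) (at (snd c q))"
    using assms(6)[of "snd c q"] q by simp
  then show "has_dif f c q (\<chi> i. F' (snd c q) (axis i 1))"
    unfolding has_dif_def
    by (rule has_derivative_transform_within_open[OF _ assms(3)])
      (use q assms(5,8) chart_homeo(6,7)[OF assms(1)] in auto)
qed (use assms in auto)

subsection \<open>The cometric\<close>

definition cip :: "('a \<Rightarrow> real) \<Rightarrow> ('a \<Rightarrow> real) \<Rightarrow> 'a \<Rightarrow> real" where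
  "cip f h p = coord_partials f (chart_at A p) p \<bullet>
     (matrix_inv (g (chart_at A p) p) *v coord_partials h (chart_at A p) p)"

text \<open>Covectors transform by the transposed Jacobian and the inverse Gram matrix by the
  inverse one, so the factors cancel. Hence the arbitrary choice made by \<open>chart_at\<close>
  does not matter.\<close>

lemma cip_chart:
  assumes "c \<in> A" "p \<in> fst c" "has_dif f c p \<omega>" "has_dif h c p \<xi>"
  shows "cip f h p = \<omega> \<bullet> (matrix_inv (g c p) *v \<xi>)"
proof -
  define d where "d = chart_at A p"
  have d: "d \<in> A" "p \<in> fst d" using chart_at d_def by auto
  let ?J = "trans_mat d c p" and ?K = "trans_mat c d p"
  have f: "coord_partials f d p = \<omega> v* ?J"
    by (rule has_dif_coord_partials[OF has_dif_change[OF d(1) assms(1) d(2) assms(2,3)]])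
  have h: "coord_partials h d p = \<xi> v* ?J"
    by (rule has_dif_coord_partials[OF has_dif_change[OF d(1) assms(1) d(2) assms(2,4)]])
  have JK: "?J *v (?K *v v) = v" for v by (rule trans_mat_inverse[OF d(1) assms(1) d(2) assms(2)])
  have "g d p *v (?K *v (matrix_inv (g c p) *v \<xi>)) = \<xi> v* ?J"
    unfolding metric_change[OF d(1) assms(1) d(2) assms(2)]
    by (simp add: matrix_vector_mul_assoc[symmetric] JK pos_def_inverse[OF metric_pos_def[OF assms(1,2)]])
  then have "matrix_inv (g d p) *v (\<xi> v* ?J) = ?K *v (matrix_inv (g c p) *v \<xi>)"
    using pos_def_inverse(2)[OF metric_pos_def[OF d]] by metis
  then show ?thesis
    unfolding cip_def d_def[symmetric] f h by (simp add: dot_lmul_matrix JK)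
qed

lemma cip_isCont:
  assumes "\<And>q. C1at f q" "\<And>q. C1at h q" shows "continuous_on UNIV (cip f h)"
proof -
  have "isCont (cip f h) p" for p
  proof -
    obtain c where c: "c \<in> A" "p \<in> fst c" using ex_chart by blast
    \<comment> \<open>The chart in the definition of \<open>cip\<close> may jump from point to
      point, so continuity has to be read off in one fixed chart around p.\<close>
    have "continuous_on (fst c) (\<lambda>q. coord_partials f c q \<bullet> (matrix_inv (g c q) *v coord_partials h c q))"
      using c(1) assms by (intro continuous_intros continuous_on_matrix_inv_mult C1at_partials_continuous
          metric_continuous metric_pos_def chart_homeo(1)) auto
    moreover have "cip f h q = coord_partials f c q \<bullet> (matrix_inv (g c q) *v coord_partials h c q)" if "q \<in> fst c" for q
      using cip_chart[OF c(1) that] C1at_has_dif[OF _ c(1) that] assms by blast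
    ultimately have "continuous_on (fst c) (cip f h)" by (simp cong: continuous_on_cong)
    then show ?thesis using chart_homeo(1)[OF c(1)] c(2) continuous_on_eq_continuous_at by blast
  qed
  then show ?thesis by (simp add: continuous_at_imp_continuous_on)
qed

definition gnorm :: "('a \<Rightarrow> real) \<Rightarrow> 'a \<Rightarrow> real" where
  "gnorm f p = sqrt (cip f f p)"

text \<open>The vectors v and w are the gradients of f and h in the chart. Through them, positivity
  and the Cauchy-Schwarz inequality pass from the metric to \<open>cip\<close>.\<close>

lemma cip_dual:
  assumes "c \<in> A" "p \<in> fst c" "has_dif f c p \<omega>" "has_dif h c p \<xi>"
  shows "\<exists>v w. cip f h p = v \<bullet> (g c p *v w) \<and> cip f f p = v \<bullet> (g c p *v v) \<and> cip h h p = w \<bullet> (g c p *v w)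
    \<and> cip f h p = \<omega> \<bullet> w \<and> cip f f p = \<omega> \<bullet> v"
proof -
  note G = metric_pos_def[OF assms(1,2)]
  let ?v = "matrix_inv (g c p) *v \<omega>" and ?w = "matrix_inv (g c p) *v \<xi>"
  have "?v \<bullet> (g c p *v ?w) = ?w \<bullet> (g c p *v ?v)" by (rule pos_def_sym[OF G])
  then show ?thesis
    using assms by (intro exI[of _ ?v] exI[of _ ?w])
      (auto simp: cip_chart pos_def_inverse[OF G] inner_commute)
qed

lemma cip_nonneg: "C1at f p \<Longrightarrow> cip f f p \<ge> 0"
  using cip_dual[OF chart_at C1at_has_dif C1at_has_dif] pos_def_nonneg[OF metric_pos_def[OF chart_at]]
    chart_at by metis

lemma gnorm_nonneg: "C1at f p \<Longrightarrow> gnorm f p \<ge> 0"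
  unfolding gnorm_def using cip_nonneg by simp

lemma gnorm_sq: "C1at f p \<Longrightarrow> gnorm f p * gnorm f p = cip f f p"
  unfolding gnorm_def using cip_nonneg by simp

lemma cip_Cauchy_Schwarz:
  assumes "C1at f p" "C1at h p"
  shows "\<bar>cip f h p\<bar> \<le> gnorm f p * gnorm h p"
proof -
  have "(cip f h p)\<^sup>2 \<le> cip f f p * cip h h p"
    using cip_dual[OF chart_at C1at_has_dif[OF assms(1) chart_at] C1at_has_dif[OF assms(2) chart_at]]
      pos_def_Cauchy_Schwarz[OF metric_pos_def[OF chart_at]] by metis
  then have "sqrt ((cip f h p)\<^sup>2) \<le> sqrt (cip f f p * cip h h p)" by (rule real_sqrt_le_mono)
  then show ?thesis by (simp add: gnorm_def real_sqrt_mult)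
qed

text \<open>The norm of the gradient is the dual norm of the differential. Testing the bound with v
  equal to the gradient turns both sides into powers of \<open>gnorm f p\<close>. The opposite
  inequality is \<open>gnorm_dual\<close>.\<close>

lemma gnorm_le:
  assumes "c \<in> A" "p \<in> fst c" "has_dif f c p \<omega>" "\<And>v. \<omega> \<bullet> v \<le> L * sqrt (v \<bullet> (g c p *v v))" "L \<ge> 0"
  shows "gnorm f p \<le> L"
proof -
  obtain v where v: "cip f f p = v \<bullet> (g c p *v v)" "cip f f p = \<omega> \<bullet> v"
    using cip_dual[OF assms(1-3,3)] by blast
  have n: "cip f f p \<ge> 0" using v(1) pos_def_nonneg[OF metric_pos_def[OF assms(1,2)]] by simp
  have "sqrt (cip f f p) * sqrt (cip f f p) = cip f f p" using n by simp
  also have "\<dots> \<le> L * sqrt (cip f f p)" using assms(4)[of v] v by simp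
  finally have le: "sqrt (cip f f p) * sqrt (cip f f p) \<le> L * sqrt (cip f f p)" .
  show ?thesis
  proof (cases "cip f f p = 0")
    case False
    then have "sqrt (cip f f p) > 0" using n by simp
    with le show ?thesis unfolding gnorm_def by (rule mult_right_le_imp_le)
  qed (use assms(5) in \<open>simp add: gnorm_def\<close>)
qed

lemma rinner_grad: "rinner A g X (grad g h) p = X (chart_at A p) p \<bullet> coord_partials h (chart_at A p) p"
  unfolding rinner_def grad_def Let_def by (simp add: pos_def_inverse[OF metric_pos_def[OF chart_at]])

lemma rnorm_grad: "rnorm A g (grad g f) p = gnorm f p"
  unfolding rnorm_def gnorm_def rinner_grad unfolding grad_def cip_def by (simp add: inner_commute)

text \<open>No case distinction is left: where the gradient vanishes, the quotient is 0 because
  division by 0 yields 0, in accordance with the value 0 of the field there.\<close>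

lemma rinner_phi_field:
  "rinner A g (phi_field A g \<phi> u) (grad g h) p = \<phi> (gnorm u p) / gnorm u p * cip u h p"
proof -
  have "(matrix_inv (g (chart_at A p) p) *v coord_partials u (chart_at A p) p) \<bullet> coord_partials h (chart_at A p) p
    = coord_partials u (chart_at A p) p \<bullet> (matrix_inv (g (chart_at A p) p) *v coord_partials h (chart_at A p) p)"
    using pos_def_sym[OF metric_pos_def[OF chart_at]] pos_def_inverse[OF metric_pos_def[OF chart_at]]
    by (metis inner_commute)
  then show ?thesis
    unfolding rinner_grad phi_field_def rnorm_grad Let_def by (simp add: grad_def cip_def)
qed

lemma phi_pairing_bound:
  assumes "C1at u p" "C1at h p" "\<And>t. t \<ge> 0 \<Longrightarrow> \<phi> t \<ge> 0"
  shows "\<bar>rinner A g (phi_field A g \<phi> u) (grad g h) p\<bar> \<le> \<phi> (gnorm u p) * gnorm h p"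
proof (cases "gnorm u p = 0")
  case True
  then show ?thesis using assms gnorm_nonneg[of h p] by (simp add: rinner_phi_field)
next
  case False
  then have pos: "gnorm u p > 0" using gnorm_nonneg[OF assms(1)] by simp
  have "\<bar>\<phi> (gnorm u p) / gnorm u p * cip u h p\<bar> = \<phi> (gnorm u p) / gnorm u p * \<bar>cip u h p\<bar>"
    using pos assms(3)[of "gnorm u p"] by (simp add: abs_mult)
  also have "\<dots> \<le> \<phi> (gnorm u p) / gnorm u p * (gnorm u p * gnorm h p)"
    using pos assms(3)[of "gnorm u p"] cip_Cauchy_Schwarz[OF assms(1,2)] by (intro mult_left_mono) auto
  finally show ?thesis using pos by (simp add: rinner_phi_field)
qed

lemma gnorm_continuous: "(\<And>q. C1at f q) \<Longrightarrow> continuous_on UNIV (gnorm f)"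
  unfolding gnorm_def[abs_def] by (intro continuous_intros cip_isCont)

text \<open>At critical points of u the quotient \<phi>(t)/t may be unbounded. Continuity there
  comes from the bound \<open>phi_pairing_bound\<close>, whose right-hand side tends to 0 since
  \<phi> is continuous with \<phi>(0) = 0.\<close>

lemma phi_pairing_continuous:
  assumes u: "\<And>q. C1at u q" and h: "\<And>q. C1at h q"
    and \<phi>: "continuous_on {0..} \<phi>" "\<phi> 0 = 0" "\<And>t. t \<ge> 0 \<Longrightarrow> \<phi> t \<ge> 0"
  shows "continuous_on UNIV (rinner A g (phi_field A g \<phi> u) (grad g h))"
proof -
  let ?F = "rinner A g (phi_field A g \<phi> u) (grad g h)"
  have c\<phi>: "continuous_on UNIV (\<lambda>p. \<phi> (gnorm u p))"
    by (rule continuous_on_compose2[OF \<phi>(1) gnorm_continuous]) (use u gnorm_nonneg in auto)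
  have "isCont ?F p" for p
  proof (cases "gnorm u p = 0")
    case True
    have "(\<lambda>q. \<phi> (gnorm u q) * gnorm h q) \<midarrow>p\<rightarrow> \<phi> (gnorm u p) * gnorm h p"
      using c\<phi> gnorm_continuous[of h] h by (auto intro!: tendsto_intros simp: continuous_on_def)
    then have "(\<lambda>q. \<phi> (gnorm u q) * gnorm h q) \<midarrow>p\<rightarrow> 0" using True \<phi>(2) by simp
    moreover have "\<forall>\<^sub>F q in at p. norm (?F q) \<le> \<phi> (gnorm u q) * gnorm h q"
      by (intro always_eventually allI) (simp add: phi_pairing_bound[OF u h] \<phi>(3))
    ultimately have "?F \<midarrow>p\<rightarrow> 0" by (rule Lim_null_comparison[rotated])
    then show ?thesis using True by (simp add: isCont_def rinner_phi_field)
  next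
    case False
    have "isCont (\<lambda>p. \<phi> (gnorm u p) / gnorm u p * cip u h p) p"
      using False c\<phi> gnorm_continuous[OF u] cip_isCont[OF u h]
      by (intro continuous_intros) (auto simp: continuous_on_eq_continuous_at)
    then show ?thesis by (simp add: rinner_phi_field[abs_def])
  qed
  then show ?thesis by (simp add: continuous_at_imp_continuous_on)
qed

end

section \<open>Curves and the Riemannian distance\<close>

context riem
begin

text \<open>Unlike in \<open>curve_speed\<close>, the derivative is two-sided and refers to no
  parameter interval, so that subcurves and curves over arbitrary intervals share one speed. The two
  differ at most at the end points.\<close>

definition spd :: "(real \<Rightarrow> 'a) \<Rightarrow> real \<Rightarrow> real" where
  "spd \<gamma> t = (let c = chart_at A (\<gamma> t); v = vector_derivative (snd c \<circ> \<gamma>) (at t)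
     in sqrt (v \<bullet> (g c (\<gamma> t) *v v)))"

definition glen :: "real \<Rightarrow> real \<Rightarrow> (real \<Rightarrow> 'a) \<Rightarrow> real" where
  "glen a b \<gamma> = integral {a..b} (spd \<gamma>)"

definition pwc :: "real \<Rightarrow> real \<Rightarrow> (real \<Rightarrow> 'a) \<Rightarrow> bool" where
  "pwc a b \<gamma> \<longleftrightarrow> continuous_on {a..b} \<gamma> \<and>
     (\<exists>S. finite S \<and> {a, b} \<subseteq> S \<and> S \<subseteq> {a..b} \<and>
        (\<forall>s\<in>S. \<forall>s'\<in>S. s < s' \<and> {s<..<s'} \<inter> S = {} \<longrightarrow> C1_curve_on A s s' \<gamma>))"

lemma C1_curve_on_subset: "C1_curve_on A a b \<gamma> \<Longrightarrow> a \<le> a' \<Longrightarrow> b' \<le> b \<Longrightarrow> C1_curve_on A a' b' \<gamma>"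
  unfolding C1_curve_on_def
proof
  fix c assume H: "\<forall>c\<in>A. \<exists>D. (\<forall>t\<in>{a..b}. \<gamma> t \<in> fst c \<longrightarrow> ((snd c \<circ> \<gamma>) has_vector_derivative D t) (at t within {a..b})) \<and>
       continuous_on {t\<in>{a..b}. \<gamma> t \<in> fst c} D"
    and s: "a \<le> a'" "b' \<le> b" and "c \<in> A"
  then obtain D where D: "\<forall>t\<in>{a..b}. \<gamma> t \<in> fst c \<longrightarrow> ((snd c \<circ> \<gamma>) has_vector_derivative D t) (at t within {a..b})"
     "continuous_on {t\<in>{a..b}. \<gamma> t \<in> fst c} D" by blast
  have sub: "{a'..b'} \<subseteq> {a..b}" using s by auto
  show "\<exists>D. (\<forall>t\<in>{a'..b'}. \<gamma> t \<in> fst c \<longrightarrow> ((snd c \<circ> \<gamma>) has_vector_derivative D t) (at t within {a'..b'})) \<and>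
       continuous_on {t\<in>{a'..b'}. \<gamma> t \<in> fst c} D"
  proof (intro exI[of _ D] conjI ballI impI)
    fix t assume "t \<in> {a'..b'}" "\<gamma> t \<in> fst c"
    then have "((snd c \<circ> \<gamma>) has_vector_derivative D t) (at t within {a..b})" using D(1) sub by blast
    then show "((snd c \<circ> \<gamma>) has_vector_derivative D t) (at t within {a'..b'})"
      by (rule has_vector_derivative_within_subset[OF _ sub])
  next
    show "continuous_on {t\<in>{a'..b'}. \<gamma> t \<in> fst c} D"
      by (rule continuous_on_subset[OF D(2)]) (use sub in auto)
  qed
qed

text \<open>Properties of parameter intervals that can be concatenated need to be checked on C^1
  pieces only. The induction is on the number of break points strictly inside the interval.\<close>

lemma pwc_induct [consumes 2, case_names piece refl trans]:
  assumes "pwc a b \<gamma>" "a \<le> b"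
    and piece: "\<And>s s'. a \<le> s \<Longrightarrow> s < s' \<Longrightarrow> s' \<le> b \<Longrightarrow> C1_curve_on A s s' \<gamma> \<Longrightarrow> continuous_on {s..s'} \<gamma> \<Longrightarrow> P s s'"
    and refl: "\<And>s. P s s"
    and trans: "\<And>r s t. a \<le> r \<Longrightarrow> r \<le> s \<Longrightarrow> s \<le> t \<Longrightarrow> t \<le> b \<Longrightarrow> P r s \<Longrightarrow> P s t \<Longrightarrow> P r t"
  shows "P a b"
proof -
  from assms(1) obtain S where S: "finite S" "{a, b} \<subseteq> S" "S \<subseteq> {a..b}"
    "\<forall>s\<in>S. \<forall>s'\<in>S. s < s' \<and> {s<..<s'} \<inter> S = {} \<longrightarrow> C1_curve_on A s s' \<gamma>" and c: "continuous_on {a..b} \<gamma>"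
    unfolding pwc_def by blast
  have "P s s'" if "s \<in> S" "s' \<in> S" "s \<le> s'" for s s'
    using that
  proof (induction "card ({s<..<s'} \<inter> S)" arbitrary: s s' rule: less_induct)
    case less
    show ?case
    proof (cases "s = s'")
      case False
      then have l: "s < s'" using less by simp
      show ?thesis
      proof (cases "{s<..<s'} \<inter> S = {}")
        case True
        have sb: "a \<le> s" "s' \<le> b" using S(3) less by auto
        then have "continuous_on {s..s'} \<gamma>" by (intro continuous_on_subset[OF c]) auto
        then show ?thesis using S(4) less l True sb by (intro piece) auto
      next
        case False
        then obtain m where m: "m \<in> S" "s < m" "m < s'" by auto
        have "{s<..<m} \<inter> S \<subset> {s<..<s'} \<inter> S" "{m<..<s'} \<inter> S \<subset> {s<..<s'} \<inter> S" using m by auto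
        then have "card ({s<..<m} \<inter> S) < card ({s<..<s'} \<inter> S)" "card ({m<..<s'} \<inter> S) < card ({s<..<s'} \<inter> S)"
          using S(1) by (auto intro: psubset_card_mono)
        then have "P s m" "P m s'" using less m by auto
        then show ?thesis using m S less by (intro trans[of s m s']) auto
      qed
    qed (simp add: refl)
  qed
  then show ?thesis using S assms(2) by auto
qed

lemma pwc_piece: "a < b \<Longrightarrow> C1_curve_on A a b \<gamma> \<Longrightarrow> continuous_on {a..b} \<gamma> \<Longrightarrow> pwc a b \<gamma>"
  unfolding pwc_def by (intro conjI exI[of _ "{a, b}"]) auto

lemma pwc_refl: "pwc a a \<gamma>"
  unfolding pwc_def by (intro conjI exI[of _ "{a}"]) auto

lemma pwc_combine:
  assumes "pwc a b \<gamma>" "pwc b c \<gamma>" "a \<le> b" "b \<le> c"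
  shows "pwc a c \<gamma>"
proof -
  obtain S where S: "finite S" "{a, b} \<subseteq> S" "S \<subseteq> {a..b}"
    "\<forall>s\<in>S. \<forall>s'\<in>S. s < s' \<and> {s<..<s'} \<inter> S = {} \<longrightarrow> C1_curve_on A s s' \<gamma>" and c1: "continuous_on {a..b} \<gamma>"
    using assms(1) unfolding pwc_def by blast
  obtain T where T: "finite T" "{b, c} \<subseteq> T" "T \<subseteq> {b..c}"
    "\<forall>s\<in>T. \<forall>s'\<in>T. s < s' \<and> {s<..<s'} \<inter> T = {} \<longrightarrow> C1_curve_on A s s' \<gamma>" and c2: "continuous_on {b..c} \<gamma>"
    using assms(2) unfolding pwc_def by blast
  have "{a..b} \<union> {b..c} = {a..c}" using assms by auto
  then have "continuous_on {a..c} \<gamma>"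
    using continuous_on_closed_Un[OF _ _ c1 c2] by simp
  moreover have "C1_curve_on A s s' \<gamma>"
    if "s \<in> S \<union> T" "s' \<in> S \<union> T" "s < s'" "{s<..<s'} \<inter> (S \<union> T) = {}" for s s'
  proof -
    have "b \<in> S \<union> T" using S by auto
    then have "s' \<le> b \<or> b \<le> s" using that by force
    then show ?thesis
    proof
      assume "s' \<le> b"
      then have "s \<in> S" "s' \<in> S" using that S(2) T(3) by (force, force)
      then show ?thesis using S(4) that by blast
    next
      assume "b \<le> s"
      then have "s \<in> T" "s' \<in> T" using that S(3) T(2) by (force, force)
      then show ?thesis using T(4) that by blast
    qed
  qed
  moreover have "finite (S \<union> T)" "{a, c} \<subseteq> S \<union> T" "S \<union> T \<subseteq> {a..c}" using S T assms by auto
  ultimately show ?thesis unfolding pwc_def by blast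
qed

lemma pwc_sub:
  assumes "pwc a b \<gamma>" "a \<le> a'" "a' \<le> b'" "b' \<le> b"
  shows "pwc a' b' \<gamma>"
proof -
  \<comment> \<open>The claim for the interval clipped to [a', b'] is stable under concatenation;
    the second alternative covers intervals that miss [a', b'].\<close>
  have "pwc (max a' a) (min b' b) \<gamma> \<or> min b' b < max a' a"
    using assms(1) order_trans[OF order_trans[OF assms(2,3)] assms(4)]
  proof (induction rule: pwc_induct)
    case (piece s s')
    show ?case
    proof (cases "max a' s < min b' s'")
      case True
      have "C1_curve_on A (max a' s) (min b' s') \<gamma>"
        by (rule C1_curve_on_subset[OF piece(4)]) auto
      moreover have "continuous_on {max a' s..min b' s'} \<gamma>"
        by (rule continuous_on_subset[OF piece(5)]) auto
      ultimately show ?thesis using pwc_piece[OF True] by blast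
    next
      case False
      then show ?thesis using pwc_refl[of "max a' s" \<gamma>] by (cases "max a' s = min b' s'") auto
    qed
  next
    case (refl s)
    then show ?case using pwc_refl by (cases "max a' s = min b' s") auto
  next
    case (trans r s t)
    have "max a' r \<le> min b' t \<Longrightarrow> pwc (max a' r) (min b' t) \<gamma>"
    proof -
      assume l: "max a' r \<le> min b' t"
      consider "s < a'" | "s > b'" | "a' \<le> s" "s \<le> b'" by linarith
      then show ?thesis
      proof cases
        case 1
        then have "max a' r = max a' s" using trans by auto
        then show ?thesis using trans l by auto
      next
        case 2
        then have "min b' t = min b' s" using trans by auto
        then show ?thesis using trans l by auto
      next
        case 3
        then have e: "min b' s = s" "max a' s = s" by auto
        have le: "max a' r \<le> s" "s \<le> min b' t" using 3 trans(2,3) by auto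
        have "pwc (max a' r) s \<gamma>" "pwc s (min b' t) \<gamma>" using trans(5,6) le unfolding e by auto
        then show ?thesis using le by (rule pwc_combine)
      qed
    qed
    then show ?case by linarith
  qed
  moreover have "max a' a = a'" "min b' b = b'" using assms by auto
  ultimately show ?thesis using assms by simp
qed

subsection \<open>Smooth pieces\<close>

lemma within_open_vimage:
  assumes "continuous_on {a..b::real} \<gamma>" "open U" "t \<in> {a..b}" "\<gamma> t \<in> U"
  shows "at t within {t\<in>{a..b}. \<gamma> t \<in> U} = at t within {a..b}" "\<forall>\<^sub>F s in at t within {a..b}. \<gamma> s \<in> U"
proof -
  obtain V where V: "open V" "V \<inter> {a..b} = \<gamma> -` U \<inter> {a..b}"
    using assms(1,2) continuous_on_open_invariant by metis
  show "at t within {t\<in>{a..b}. \<gamma> t \<in> U} = at t within {a..b}"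
  proof (rule at_within_nhd[of t V])
    show "t \<in> V" using V(2) assms(3,4) by blast
    show "{t \<in> {a..b}. \<gamma> t \<in> U} \<inter> V - {t} = {a..b} \<inter> V - {t}" using V(2) by blast
  qed (rule V(1))
  show "\<forall>\<^sub>F s in at t within {a..b}. \<gamma> s \<in> U"
    unfolding eventually_at_topological using V assms by blast
qed

context
  fixes a b :: real and \<gamma> :: "real \<Rightarrow> 'a"
  assumes ab: "a < b" and C1: "C1_curve_on A a b \<gamma>" and cont: "continuous_on {a..b} \<gamma>"
begin

definition vel :: "('a, 'm) chart \<Rightarrow> real \<Rightarrow> real ^ 'm" where
  "vel c t = vector_derivative (snd c \<circ> \<gamma>) (at t within {a..b})"

lemma vel:
  assumes "c \<in> A"
  shows "t \<in> {a..b} \<Longrightarrow> \<gamma> t \<in> fst c \<Longrightarrow> ((snd c \<circ> \<gamma>) has_vector_derivative vel c t) (at t within {a..b})"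
    "continuous_on {t\<in>{a..b}. \<gamma> t \<in> fst c} (vel c)"
proof -
  obtain D where D: "\<forall>t\<in>{a..b}. \<gamma> t \<in> fst c \<longrightarrow> ((snd c \<circ> \<gamma>) has_vector_derivative D t) (at t within {a..b})"
     "continuous_on {t\<in>{a..b}. \<gamma> t \<in> fst c} D"
    using C1 assms unfolding C1_curve_on_def by blast
  have e: "vel c t = D t" if "t \<in> {a..b}" "\<gamma> t \<in> fst c" for t
    unfolding vel_def by (rule vector_derivative_within_closed_interval[OF ab that(1)]) (use D that in auto)
  show "t \<in> {a..b} \<Longrightarrow> \<gamma> t \<in> fst c \<Longrightarrow> ((snd c \<circ> \<gamma>) has_vector_derivative vel c t) (at t within {a..b})"
    using D e by simp
  show "continuous_on {t\<in>{a..b}. \<gamma> t \<in> fst c} (vel c)"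
    by (rule continuous_on_eq[OF D(2)]) (use e in auto)
qed

lemma vel_change:
  assumes "c \<in> A" "d \<in> A" "t \<in> {a..b}" "\<gamma> t \<in> fst c" "\<gamma> t \<in> fst d"
  shows "vel d t = trans_mat c d (\<gamma> t) *v vel c t"
proof -
  have h: "((\<lambda>s. (snd d \<circ> coord_inv c) ((snd c \<circ> \<gamma>) s)) has_derivative
     (\<lambda>h. trans_mat c d (\<gamma> t) *v (h *\<^sub>R vel c t))) (at t within {a..b})"
    by (rule has_derivative_compose[OF vel(1)[OF assms(1,3,4), unfolded has_vector_derivative_def]])
      (use trans_derivative[OF assms(1,2,4,5)] in \<open>simp add: o_def\<close>)
  have "((snd d \<circ> \<gamma>) has_derivative (\<lambda>h. trans_mat c d (\<gamma> t) *v (h *\<^sub>R vel c t))) (at t within {a..b})"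
  proof (rule has_derivative_transform_eventually[OF h])
    show "\<forall>\<^sub>F s in at t within {a..b}. (snd d \<circ> coord_inv c) ((snd c \<circ> \<gamma>) s) = (snd d \<circ> \<gamma>) s"
      by (rule eventually_mono[OF within_open_vimage(2)[OF cont chart_homeo(1)[OF assms(1)] assms(3,4)]])
        (simp add: chart_homeo(5)[OF assms(1)])
  qed (use assms chart_homeo(5)[OF assms(1)] in auto)
  then have "((snd d \<circ> \<gamma>) has_vector_derivative trans_mat c d (\<gamma> t) *v vel c t) (at t within {a..b})"
    by (simp add: has_vector_derivative_def matrix_vector_mult_scaleR)
  then show ?thesis
    unfolding vel_def[of d] using vector_derivative_within_closed_interval[OF ab assms(3)] by blast
qed

text \<open>The velocity is taken within the closed piece, so this speed is continuous up to the end
  points, where the two-sided derivative in \<open>spd\<close> may fail to exist. It serves to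
  integrate \<open>spd\<close>, with which it agrees inside.\<close>

definition pspd :: "real \<Rightarrow> real" where
  "pspd t = (let c = chart_at A (\<gamma> t) in sqrt (vel c t \<bullet> (g c (\<gamma> t) *v vel c t)))"

lemma pspd_chart:
  assumes "c \<in> A" "t \<in> {a..b}" "\<gamma> t \<in> fst c"
  shows "pspd t = sqrt (vel c t \<bullet> (g c (\<gamma> t) *v vel c t))"
  unfolding pspd_def Let_def
  using metric_norm_change[OF assms(1) chart_at(1) assms(3) chart_at(2)]
    vel_change[OF assms(1) chart_at(1) assms(2,3) chart_at(2)] by simp

lemma pspd_continuous: "continuous_on {a..b} pspd"
  unfolding continuous_on_eq_continuous_within
proof
  fix t assume t: "t \<in> {a..b}"
  define c where "c = chart_at A (\<gamma> t)"
  have c: "c \<in> A" "\<gamma> t \<in> fst c" using chart_at c_def by auto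
  define T where "T = {t\<in>{a..b}. \<gamma> t \<in> fst c}"
  have "continuous_on T (\<lambda>t. g c (\<gamma> t))"
    by (rule continuous_on_compose2[OF metric_continuous[OF c(1)] continuous_on_subset[OF cont]]) (auto simp: T_def)
  moreover have "continuous_on T (vel c)" using vel(2)[OF c(1)] by (simp add: T_def)
  ultimately have ct: "continuous_on T (\<lambda>t. sqrt (vel c t \<bullet> (g c (\<gamma> t) *v vel c t)))"
    unfolding matrix_vector_mult_def
    by (intro continuous_intros continuous_on_vec_lambda continuous_on_component)
  have "continuous_on T pspd"
    by (rule continuous_on_eq[OF ct]) (use pspd_chart[OF c(1)] in \<open>auto simp: T_def\<close>)
  moreover have "t \<in> T" using t c by (simp add: T_def)
  ultimately have "continuous (at t within T) pspd"
    using continuous_on_eq_continuous_within by blast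
  then show "continuous (at t within {a..b}) pspd"
    using within_open_vimage(1)[OF cont chart_homeo(1)[OF c(1)] t c(2)]
    by (simp add: T_def)
qed

lemma spd_eq_pspd: "t \<in> {a<..<b} \<Longrightarrow> spd \<gamma> t = pspd t"
  unfolding spd_def pspd_def vel_def Let_def by (simp add: at_within_Icc_at)

lemma piece_integral: "(spd \<gamma> has_integral integral {a..b} pspd) {a..b}"
  by (rule has_integral_spike_finite[of "{a, b}" _ _ pspd])
    (use spd_eq_pspd integrable_integral[OF integrable_continuous_real[OF pspd_continuous]] in auto)

lemma piece_bound:
  assumes "c \<in> A" "\<And>t. t \<in> {a..b} \<Longrightarrow> \<gamma> t \<in> fst c"
    "\<And>t v. t \<in> {a..b} \<Longrightarrow> norm v \<le> \<Lambda> * sqrt (v \<bullet> (g c (\<gamma> t) *v v))"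
  shows "norm (snd c (\<gamma> b) - snd c (\<gamma> a)) \<le> \<Lambda> * glen a b \<gamma>"
proof -
  have h: "(vel c has_integral (snd c \<circ> \<gamma>) b - (snd c \<circ> \<gamma>) a) {a..b}"
    by (rule fundamental_theorem_of_calculus) (use ab vel(1)[OF assms(1)] assms(2) in \<open>auto simp: o_def\<close>)
  have i: "pspd integrable_on {a..b}" by (rule integrable_continuous_real[OF pspd_continuous])
  have "norm (integral {a..b} (vel c)) \<le> integral {a..b} (\<lambda>t. \<Lambda> * pspd t)"
    by (rule integral_norm_bound_integral)
      (use h integrable_on_mult_right[OF i] pspd_chart[OF assms(1)] assms(2,3) in auto)
  also have "\<dots> = \<Lambda> * glen a b \<gamma>"
    using piece_integral by (simp add: glen_def integral_unique)
  finally show ?thesis using integral_unique[OF h] by simp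
qed

lemma piece_differentiable:
  assumes "c \<in> A" "t \<in> {a<..<b}" "\<gamma> t \<in> fst c"
  shows "(snd c \<circ> \<gamma>) differentiable (at t)"
  using vel(1)[OF assms(1) _ assms(3)] assms(2)
  by (auto simp: at_within_Icc_at has_vector_derivative_def differentiable_def)

end

lemma spd_nonneg: "spd \<gamma> t \<ge> 0"
  unfolding spd_def Let_def using pos_def_nonneg[OF metric_pos_def[OF chart_at]] by simp

lemma pwc_integrable: "pwc a b \<gamma> \<Longrightarrow> a \<le> b \<Longrightarrow> spd \<gamma> integrable_on {a..b}"
proof (induction rule: pwc_induct)
  case (piece s s')
  then show ?case using piece_integral by blast
next
  case (refl s)
  then show ?case using integrable_on_refl[of "spd \<gamma>" s] by simp
next
  case (trans r s t)
  then show ?case by (intro Henstock_Kurzweil_Integration.integrable_combine[of r s t]) auto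
qed

lemma glen_nonneg: "pwc a b \<gamma> \<Longrightarrow> a \<le> b \<Longrightarrow> glen a b \<gamma> \<ge> 0"
  unfolding glen_def by (rule integral_nonneg[OF pwc_integrable]) (auto simp: spd_nonneg)

lemma glen_combine:
  assumes "pwc a c \<gamma>" "a \<le> b" "b \<le> c"
  shows "glen a b \<gamma> + glen b c \<gamma> = glen a c \<gamma>"
  unfolding glen_def using assms by (intro Henstock_Kurzweil_Integration.integral_combine pwc_integrable) auto

lemma pwc_differentiable:
  assumes "pwc a b \<gamma>" "a \<le> b"
  shows "\<exists>S. finite S \<and> (\<forall>t\<in>{a..b} - S. \<forall>c\<in>A. \<gamma> t \<in> fst c \<longrightarrow> (snd c \<circ> \<gamma>) differentiable (at t))"
  using assms
proof (induction rule: pwc_induct)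
  case (piece s s')
  have "(snd c \<circ> \<gamma>) differentiable (at t)" if "t \<in> {s..s'} - {s, s'}" "c \<in> A" "\<gamma> t \<in> fst c" for t c
    by (rule piece_differentiable[OF piece(2,4,5)]) (use that in auto)
  then show ?case by (intro exI[of _ "{s, s'}"]) blast
next
  case (refl s)
  show ?case by (intro exI[of _ "{s}"]) auto
next
  case (trans r s t)
  then obtain S T where "finite S" "\<forall>t\<in>{r..s} - S. \<forall>c\<in>A. \<gamma> t \<in> fst c \<longrightarrow> (snd c \<circ> \<gamma>) differentiable (at t)"
    "finite T" "\<forall>t\<in>{s..t} - T. \<forall>c\<in>A. \<gamma> t \<in> fst c \<longrightarrow> (snd c \<circ> \<gamma>) differentiable (at t)" by blast
  moreover have "{r..t} - (S \<union> T) \<subseteq> ({r..s} - S) \<union> ({s..t} - T)" by auto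
  ultimately show ?case by (intro exI[of _ "S \<union> T"] conjI) blast+
qed

subsection \<open>Congruence and affine reparametrisation\<close>

lemma spd_cong:
  assumes "open T" "t \<in> T" "\<And>s. s \<in> T \<Longrightarrow> \<gamma> s = \<eta> s"
  shows "spd \<gamma> t = spd \<eta> t"
proof -
  have "((snd c \<circ> \<gamma>) has_vector_derivative v) (at t) \<longleftrightarrow> ((snd c \<circ> \<eta>) has_vector_derivative v) (at t)" for c :: "('a, 'm) chart" and v
    using has_vector_derivative_transform_within_open[of _ v t T] assms by (auto simp: o_def)
  then show ?thesis using assms unfolding spd_def vector_derivative_def by simp
qed

lemma pwc_cong:
  assumes "\<And>t. t \<in> {a..b} \<Longrightarrow> \<gamma> t = \<eta> t" "pwc a b \<gamma>"
  shows "pwc a b \<eta>" "glen a b \<gamma> = glen a b \<eta>"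
proof -
  have c: "C1_curve_on A s s' \<eta>" if C: "C1_curve_on A s s' \<gamma>" and "a \<le> s" "s' \<le> b" for s s'
    unfolding C1_curve_on_def
  proof
    fix c assume "c \<in> A"
    then obtain D where D: "\<forall>t\<in>{s..s'}. \<gamma> t \<in> fst c \<longrightarrow> ((snd c \<circ> \<gamma>) has_vector_derivative D t) (at t within {s..s'})"
       "continuous_on {t\<in>{s..s'}. \<gamma> t \<in> fst c} D"
      using C unfolding C1_curve_on_def by blast
    have e: "\<gamma> t = \<eta> t" if "t \<in> {s..s'}" for t using assms(1) that \<open>a \<le> s\<close> \<open>s' \<le> b\<close> by auto
    have "{t\<in>{s..s'}. \<gamma> t \<in> fst c} = {t\<in>{s..s'}. \<eta> t \<in> fst c}" using e by auto
    then have "continuous_on {t\<in>{s..s'}. \<eta> t \<in> fst c} D" using D(2) by (simp only:)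
    moreover have "((snd c \<circ> \<eta>) has_vector_derivative D t) (at t within {s..s'})" if "t \<in> {s..s'}" "\<eta> t \<in> fst c" for t
      by (rule has_vector_derivative_transform[OF that(1), of _ "snd c \<circ> \<gamma>"]) (use e that D(1) in auto)
    ultimately show "\<exists>D. (\<forall>t\<in>{s..s'}. \<eta> t \<in> fst c \<longrightarrow> ((snd c \<circ> \<eta>) has_vector_derivative D t) (at t within {s..s'})) \<and>
         continuous_on {t\<in>{s..s'}. \<eta> t \<in> fst c} D"
      by blast
  qed
  obtain S where S: "finite S" "{a, b} \<subseteq> S" "S \<subseteq> {a..b}"
    "\<forall>s\<in>S. \<forall>s'\<in>S. s < s' \<and> {s<..<s'} \<inter> S = {} \<longrightarrow> C1_curve_on A s s' \<gamma>" and co: "continuous_on {a..b} \<gamma>"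
    using assms(2) unfolding pwc_def by blast
  have "continuous_on {a..b} \<eta>" by (rule continuous_on_eq[OF co assms(1)])
  moreover have "\<forall>s\<in>S. \<forall>s'\<in>S. s < s' \<and> {s<..<s'} \<inter> S = {} \<longrightarrow> C1_curve_on A s s' \<eta>"
    using S(3,4) c by (meson atLeastAtMost_iff subsetD)
  ultimately show "pwc a b \<eta>" unfolding pwc_def using S(1-3) by blast
  show "glen a b \<gamma> = glen a b \<eta>"
    unfolding glen_def
  proof (rule integral_spike[of "{a, b}"])
    show "spd \<eta> x = spd \<gamma> x" if "x \<in> {a..b} - {a, b}" for x
      by (rule spd_cong[of "{a<..<b}"]) (use that assms(1) in auto)
  qed auto
qed

lemma C1_curve_on_affine:
  assumes "C1_curve_on A s s' \<gamma>" "\<And>t. t \<in> {r..r'} \<Longrightarrow> k * t + e \<in> {s..s'}"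
  shows "C1_curve_on A r r' (\<lambda>t. \<gamma> (k * t + e))"
  unfolding C1_curve_on_def
proof
  fix c assume "c \<in> A"
  then obtain D where D: "\<forall>t\<in>{s..s'}. \<gamma> t \<in> fst c \<longrightarrow> ((snd c \<circ> \<gamma>) has_vector_derivative D t) (at t within {s..s'})"
       "continuous_on {t\<in>{s..s'}. \<gamma> t \<in> fst c} D"
      using assms(1) unfolding C1_curve_on_def by blast
  have "((snd c \<circ> (\<lambda>t. \<gamma> (k * t + e))) has_vector_derivative k *\<^sub>R D (k * t + e)) (at t within {r..r'})"
    if t: "t \<in> {r..r'}" "\<gamma> (k * t + e) \<in> fst c" for t
  proof -
    have f: "((\<lambda>t. k * t + e) has_vector_derivative k) (at t within {r..r'})"
      by (auto intro!: derivative_eq_intros)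
    have "(\<lambda>t. k * t + e) ` {r..r'} \<subseteq> {s..s'}" using assms(2) by auto
    then have "((snd c \<circ> \<gamma>) has_vector_derivative D (k * t + e)) (at (k * t + e) within (\<lambda>t. k * t + e) ` {r..r'})"
      using D(1) t assms(2) by (auto intro: has_vector_derivative_within_subset)
    from vector_diff_chain_within[OF f this] show ?thesis by (simp add: o_def)
  qed
  moreover have "continuous_on {t\<in>{r..r'}. \<gamma> (k * t + e) \<in> fst c} (\<lambda>t. k *\<^sub>R D (k * t + e))"
    by (intro continuous_intros continuous_on_compose2[OF D(2)]) (use assms(2) in auto)
  ultimately show "\<exists>D. (\<forall>t\<in>{r..r'}. \<gamma> (k * t + e) \<in> fst c \<longrightarrow>
      ((snd c \<circ> (\<lambda>t. \<gamma> (k * t + e))) has_vector_derivative D t) (at t within {r..r'})) \<and>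
      continuous_on {t\<in>{r..r'}. \<gamma> (k * t + e) \<in> fst c} D"
    by (intro exI[of _ "\<lambda>t. k *\<^sub>R D (k * t + e)"]) auto
qed

lemma spd_affine:
  assumes "k \<noteq> 0" "\<And>c. c \<in> A \<Longrightarrow> \<gamma> (k * t + e) \<in> fst c \<Longrightarrow> (snd c \<circ> \<gamma>) differentiable (at (k * t + e))"
  shows "spd (\<lambda>t. \<gamma> (k * t + e)) t = \<bar>k\<bar> * spd \<gamma> (k * t + e)"
proof -
  define c where "c = chart_at A (\<gamma> (k * t + e))"
  define v where "v = vector_derivative (snd c \<circ> \<gamma>) (at (k * t + e))"
  have v: "((snd c \<circ> \<gamma>) has_vector_derivative v) (at (k * t + e))"
    unfolding v_def using assms(2) chart_at c_def vector_derivative_works by blast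
  have f: "((\<lambda>t. k * t + e) has_vector_derivative k) (at t)"
    by (auto intro!: derivative_eq_intros)
  have "((snd c \<circ> (\<lambda>t. \<gamma> (k * t + e))) has_vector_derivative k *\<^sub>R v) (at t)"
    using vector_diff_chain_at[OF f v] by (simp add: o_def)
  then have "vector_derivative (snd c \<circ> (\<lambda>t. \<gamma> (k * t + e))) (at t) = k *\<^sub>R v"
    by (rule vector_derivative_at)
  then show ?thesis
    unfolding spd_def c_def[symmetric] Let_def v_def[symmetric]
    by (simp add: matrix_vector_mult_scaleR real_sqrt_mult mult.assoc[symmetric])
qed

text \<open>Only the image interval is prescribed, so the factor k may have either sign: positive k
  rescales to the unit interval, negative k reverses the curve.\<close>

lemma pwc_affine:
  assumes "pwc a b \<gamma>" "a \<le> b" "k \<noteq> 0" and im: "(\<lambda>t. k * t + e) ` {a'..b'} = {a..b}" "a' \<le> b'"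
  shows "pwc a' b' (\<lambda>t. \<gamma> (k * t + e))" "glen a' b' (\<lambda>t. \<gamma> (k * t + e)) = glen a b \<gamma>"
proof -
  let ?\<sigma> = "\<lambda>t. k * t + e"
  obtain S where S: "finite S" "{a, b} \<subseteq> S" "S \<subseteq> {a..b}"
    "\<forall>s\<in>S. \<forall>s'\<in>S. s < s' \<and> {s<..<s'} \<inter> S = {} \<longrightarrow> C1_curve_on A s s' \<gamma>" and co: "continuous_on {a..b} \<gamma>"
    using assms(1) unfolding pwc_def by blast
  have inv: "?\<sigma> t = s \<longleftrightarrow> t = (s - e) / k" for t s using assms(3) by (auto simp: field_simps)
  have mem: "t \<in> {a'..b'} \<longleftrightarrow> ?\<sigma> t \<in> {a..b}" for t
  proof
    show "t \<in> {a'..b'} \<Longrightarrow> ?\<sigma> t \<in> {a..b}" using im(1) by blast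
    assume "?\<sigma> t \<in> {a..b}"
    then obtain t' where t': "t' \<in> {a'..b'}" "?\<sigma> t = ?\<sigma> t'" using im(1) by (metis (no_types, lifting) imageE)
    then have "t = t'" using assms(3) by simp
    then show "t \<in> {a'..b'}" using t'(1) by simp
  qed
  define S' where "S' = {t. ?\<sigma> t \<in> S}"
  have "S' = (\<lambda>s. (s - e) / k) ` S" unfolding S'_def using inv assms(3) by auto
  then have f1: "finite S'" using S(1) by simp
  have f2: "{a', b'} \<subseteq> S'"
  proof (cases "k > 0")
    case True
    have "?\<sigma> a' \<in> {a..b}" "?\<sigma> b' \<in> {a..b}" using mem im(2) by auto
    moreover obtain t1 t2 where "t1 \<in> {a'..b'}" "?\<sigma> t1 = a" "t2 \<in> {a'..b'}" "?\<sigma> t2 = b"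
      using im(1) assms(2) by (metis (no_types, lifting) atLeastAtMost_iff imageE order_refl)
    moreover have "k * a' \<le> k * t1" "k * t2 \<le> k * b'" using calculation True by auto
    ultimately have "?\<sigma> a' = a" "?\<sigma> b' = b" by auto
    then show ?thesis using S(2) by (simp add: S'_def)
  next
    case False
    have "?\<sigma> a' \<in> {a..b}" "?\<sigma> b' \<in> {a..b}" using mem im(2) by auto
    moreover obtain t1 t2 where "t1 \<in> {a'..b'}" "?\<sigma> t1 = a" "t2 \<in> {a'..b'}" "?\<sigma> t2 = b"
      using im(1) assms(2) by (metis (no_types, lifting) atLeastAtMost_iff imageE order_refl)
    moreover have "k * b' \<le> k * t1" "k * t2 \<le> k * a'" using calculation False by (auto intro: mult_left_mono_neg)
    ultimately have "?\<sigma> a' = b" "?\<sigma> b' = a" by auto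
    then show ?thesis using S(2) by (simp add: S'_def)
  qed
  have f3: "S' \<subseteq> {a'..b'}" using S(3) mem by (auto simp: S'_def)
  have f4: "C1_curve_on A r r' (\<lambda>t. \<gamma> (?\<sigma> t))" if "r \<in> S'" "r' \<in> S'" "r < r'" "{r<..<r'} \<inter> S' = {}" for r r'
  proof (cases "k > 0")
    case True
    have "{?\<sigma> r<..<?\<sigma> r'} \<inter> S = {}"
    proof -
      have "False" if s: "?\<sigma> r < s" "s < ?\<sigma> r'" "s \<in> S" for s
      proof -
        have e: "?\<sigma> ((s - e) / k) = s" using inv by blast
        have "r < (s - e) / k" "(s - e) / k < r'" using s True by (auto simp: field_simps)
        then have "(s - e) / k \<in> {r<..<r'} \<inter> S'" using s e by (auto simp: S'_def)
        then show False using \<open>{r<..<r'} \<inter> S' = {}\<close> by blast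
      qed
      then show ?thesis by auto
    qed
    then have "C1_curve_on A (?\<sigma> r) (?\<sigma> r') \<gamma>" using S(4) that True by (auto simp: S'_def)
    then show ?thesis by (rule C1_curve_on_affine) (use True in auto)
  next
    case False
    then have k: "k < 0" using assms(3) by simp
    have "{?\<sigma> r'<..<?\<sigma> r} \<inter> S = {}"
    proof -
      have "False" if s: "?\<sigma> r' < s" "s < ?\<sigma> r" "s \<in> S" for s
      proof -
        have e: "?\<sigma> ((s - e) / k) = s" using inv by blast
        have "r < (s - e) / k" "(s - e) / k < r'" using s k by (auto simp: field_simps)
        then have "(s - e) / k \<in> {r<..<r'} \<inter> S'" using s e by (auto simp: S'_def)
        then show False using \<open>{r<..<r'} \<inter> S' = {}\<close> by blast
      qed
      then show ?thesis by auto
    qed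
    moreover have "?\<sigma> r' < ?\<sigma> r" using k that by (simp add: mult_less_cancel_left)
    ultimately have "C1_curve_on A (?\<sigma> r') (?\<sigma> r) \<gamma>" using S(4) that by (auto simp: S'_def)
    then show ?thesis by (rule C1_curve_on_affine) (use k in \<open>auto intro: mult_left_mono_neg\<close>)
  qed
  have f5: "continuous_on {a'..b'} (\<lambda>t. \<gamma> (?\<sigma> t))"
    by (rule continuous_on_compose2[OF co]) (use mem in \<open>auto intro!: continuous_intros\<close>)
  show "pwc a' b' (\<lambda>t. \<gamma> (?\<sigma> t))"
    unfolding pwc_def
    by (intro conjI exI[of _ S'] f1 f2 f3 f5 ballI impI; elim conjE; rule f4)
  have "((\<lambda>x. spd \<gamma> (k *\<^sub>R x + e)) has_integral (1 / \<bar>k\<bar> ^ DIM(real)) *\<^sub>R glen a b \<gamma>)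
     ((\<lambda>x. (1 / k) *\<^sub>R x + - ((1 / k) *\<^sub>R e)) ` cbox a b)"
    unfolding glen_def
    by (rule has_integral_affinity) (use integrable_integral[OF pwc_integrable[OF assms(1,2)]] assms(3) in auto)
  moreover have "(\<lambda>x. (1 / k) *\<^sub>R x + - ((1 / k) *\<^sub>R e)) ` cbox a b = {a'..b'}"
  proof -
    have "(\<lambda>x. (x - e) / k) ` {a..b} = {a'..b'}"
    proof (intro equalityI subsetI)
      show "t \<in> {a'..b'}" if "t \<in> (\<lambda>x. (x - e) / k) ` {a..b}" for t
        using that mem[of t] assms(3) by auto
      show "t \<in> (\<lambda>x. (x - e) / k) ` {a..b}" if "t \<in> {a'..b'}" for t
        using that mem[of t] assms(3) by (intro image_eqI[of _ _ "?\<sigma> t"]) auto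
    qed
    then show ?thesis by (simp add: diff_divide_distrib)
  qed
  ultimately have i1: "((\<lambda>x. \<bar>k\<bar> * spd \<gamma> (?\<sigma> x)) has_integral \<bar>k\<bar> * ((1 / \<bar>k\<bar>) * glen a b \<gamma>)) {a'..b'}"
    by (intro has_integral_mult_right) simp
  obtain T where T: "finite T" "\<forall>t\<in>{a..b} - T. \<forall>c\<in>A. \<gamma> t \<in> fst c \<longrightarrow> (snd c \<circ> \<gamma>) differentiable (at t)"
    using pwc_differentiable[OF assms(1,2)] by blast
  have fT: "finite {t. ?\<sigma> t \<in> T}"
  proof -
    have "{t. ?\<sigma> t \<in> T} = (\<lambda>s. (s - e) / k) ` T" using inv assms(3) by auto
    then show ?thesis using T(1) by simp
  qed
  have "spd (\<lambda>t. \<gamma> (?\<sigma> t)) x = \<bar>k\<bar> * spd \<gamma> (?\<sigma> x)" if x: "x \<in> {a'..b'} - {t. ?\<sigma> t \<in> T}" for x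
    by (rule spd_affine[OF assms(3)]) (use T(2) mem[of x] x in blast)
  from has_integral_spike_finite[OF fT this i1]
  have "(spd (\<lambda>t. \<gamma> (?\<sigma> t)) has_integral \<bar>k\<bar> * ((1 / \<bar>k\<bar>) * glen a b \<gamma>)) {a'..b'}" .
  then show "glen a' b' (\<lambda>t. \<gamma> (?\<sigma> t)) = glen a b \<gamma>"
    unfolding glen_def[of a'] using assms(3) by (simp add: integral_unique)
qed

end

section \<open>The distance as an infimum of lengths, and its comparison with coordinates\<close>

context riem
begin

lemma curve_speed_interior: "t \<in> {0<..<1} \<Longrightarrow> curve_speed A g \<gamma> t = spd \<gamma> t"
  unfolding curve_speed_def spd_def Let_def by (simp add: at_within_Icc_at)

lemma curve_length_eq: "curve_length A g \<gamma> = glen 0 1 \<gamma>"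
  unfolding curve_length_def glen_def
  by (rule integral_spike[of "{0, 1}"]) (auto simp: curve_speed_interior)

lemma piecewise_C1_curve_eq: "piecewise_C1_curve A \<gamma> \<longleftrightarrow> pwc 0 1 \<gamma>"
  unfolding piecewise_C1_curve_def pwc_def path_def by auto

lemma rdist_eq: "rdist A g p q = Inf {glen 0 1 \<gamma> | \<gamma>. pwc 0 1 \<gamma> \<and> \<gamma> 0 = p \<and> \<gamma> 1 = q}"
  unfolding rdist_def curve_length_eq piecewise_C1_curve_eq pathstart_def pathfinish_def ..

lemma glen_refl: "glen a a \<gamma> = 0"
  by (simp add: glen_def)

lemma pwc_const: "a \<le> b \<Longrightarrow> pwc a b (\<lambda>t. p)"
proof (cases "a < b")
  case True
  have "C1_curve_on A a b (\<lambda>t. p)"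
    unfolding C1_curve_on_def by (auto intro!: exI[of _ "\<lambda>_. 0"] simp: o_def)
  then show ?thesis using True by (intro pwc_piece) auto
next
  case False
  assume "a \<le> b"
  then have "a = b" using False by simp
  then show ?thesis using pwc_refl by simp
qed

lemma rdist_le_01:
  assumes "pwc 0 1 \<gamma>" shows "rdist A g (\<gamma> 0) (\<gamma> 1) \<le> glen 0 1 \<gamma>"
  unfolding rdist_eq
proof (rule cInf_lower)
  show "glen 0 1 \<gamma> \<in> {glen 0 1 \<gamma>' |\<gamma>'. pwc 0 1 \<gamma>' \<and> \<gamma>' 0 = \<gamma> 0 \<and> \<gamma>' 1 = \<gamma> 1}" using assms by blast
  show "bdd_below {glen 0 1 \<gamma>' |\<gamma>'. pwc 0 1 \<gamma>' \<and> \<gamma>' 0 = \<gamma> 0 \<and> \<gamma>' 1 = \<gamma> 1}"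
    by (rule bdd_belowI[of _ 0]) (auto intro: glen_nonneg)
qed

lemma rdist_le:
  assumes "pwc a b \<gamma>" "a < b"
  shows "rdist A g (\<gamma> a) (\<gamma> b) \<le> glen a b \<gamma>" "rdist A g (\<gamma> b) (\<gamma> a) \<le> glen a b \<gamma>"
proof -
  have im: "(\<lambda>t. (b - a) * t + a) ` {0..1} = {a..b}"
    using assms(2) image_affinity_atLeastAtMost[of "b - a" a 0 1] by simp
  have "pwc 0 1 (\<lambda>t. \<gamma> ((b - a) * t + a))" "glen 0 1 (\<lambda>t. \<gamma> ((b - a) * t + a)) = glen a b \<gamma>"
    using pwc_affine[OF assms(1) _ _ im] assms(2) by auto
  then show "rdist A g (\<gamma> a) (\<gamma> b) \<le> glen a b \<gamma>" using rdist_le_01 by fastforce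
  have im: "(\<lambda>t. (a - b) * t + b) ` {0..1} = {a..b}"
    using assms(2) image_affinity_atLeastAtMost[of "a - b" b 0 1] by simp
  have "pwc 0 1 (\<lambda>t. \<gamma> ((a - b) * t + b))" "glen 0 1 (\<lambda>t. \<gamma> ((a - b) * t + b)) = glen a b \<gamma>"
    using pwc_affine[OF assms(1) _ _ im] assms(2) by auto
  then show "rdist A g (\<gamma> b) (\<gamma> a) \<le> glen a b \<gamma>" using rdist_le_01 by fastforce
qed

lemma pwc_join:
  assumes "pwc 0 1 \<gamma>" "pwc 0 1 \<eta>" "\<gamma> 1 = \<eta> 0"
  obtains \<zeta> where "pwc 0 2 \<zeta>" "\<zeta> 0 = \<gamma> 0" "\<zeta> 2 = \<eta> 1" "glen 0 2 \<zeta> = glen 0 1 \<gamma> + glen 0 1 \<eta>"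
proof -
  define \<zeta> where "\<zeta> t = (if t \<le> 1 then \<gamma> t else \<eta> (1 * t + (-1)))" for t :: real
  have im: "(\<lambda>t. 1 * t + (-1)) ` {1..2} = {0..1::real}"
    using image_affinity_atLeastAtMost[of 1 "-1" 1 2] by simp
  have 1: "pwc 0 1 \<zeta>" "glen 0 1 \<gamma> = glen 0 1 \<zeta>"
    using pwc_cong[OF _ assms(1), of \<zeta>] by (auto simp: \<zeta>_def)
  have "pwc 1 2 (\<lambda>t. \<eta> (1 * t + (-1)))" "glen 1 2 (\<lambda>t. \<eta> (1 * t + (-1))) = glen 0 1 \<eta>"
    using pwc_affine[OF assms(2) _ _ im] by auto
  moreover have "\<eta> (1 * t + (-1)) = \<zeta> t" if "t \<in> {1..2}" for t
    using that assms(3) by (cases "t = 1") (auto simp: \<zeta>_def)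
  ultimately have 2: "pwc 1 2 \<zeta>" "glen 1 2 \<zeta> = glen 0 1 \<eta>"
    using pwc_cong[of 1 2 "\<lambda>t. \<eta> (1 * t + (-1))" \<zeta>] by auto
  have "pwc 0 2 \<zeta>" by (rule pwc_combine[OF 1(1) 2(1)]) auto
  moreover from glen_combine[OF this, of 1] have "glen 0 2 \<zeta> = glen 0 1 \<gamma> + glen 0 1 \<eta>" using 1 2 by simp
  ultimately show ?thesis by (intro that[of \<zeta>]) (auto simp: \<zeta>_def)
qed

subsection \<open>Local comparison with the Euclidean distance\<close>

text \<open>The constant \<Lambda> compares the metric with the Euclidean norm and may be
  arbitrarily bad; it suffices for topological statements. The last clause says that the metric
  varies at most by the absolute factor 2 over the ball. It keeps \<Lambda> out of the gradient
  bound for cutoff functions.\<close>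

definition nice_ball :: "('a, 'm) chart \<Rightarrow> real ^ 'm \<Rightarrow> real \<Rightarrow> real \<Rightarrow> bool" where
  "nice_ball c y0 r \<Lambda> \<longleftrightarrow> c \<in> A \<and> r > 0 \<and> \<Lambda> > 0 \<and> cball y0 r \<subseteq> snd c ` fst c \<and>
     (\<forall>y\<in>cball y0 r. \<forall>v. norm v \<le> \<Lambda> * sqrt (v \<bullet> (g c (coord_inv c y) *v v)) \<and>
         sqrt (v \<bullet> (g c (coord_inv c y) *v v)) \<le> \<Lambda> * norm v) \<and>
     (\<forall>y\<in>cball y0 r. \<forall>z\<in>cball y0 r. \<forall>v. sqrt (v \<bullet> (g c (coord_inv c y) *v v)) \<le> 2 * sqrt (v \<bullet> (g c (coord_inv c z) *v v)))"

lemma nice_ball_mono: "nice_ball c y0 r \<Lambda> \<Longrightarrow> 0 < r' \<Longrightarrow> r' \<le> r \<Longrightarrow> nice_ball c y0 r' \<Lambda>"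
  unfolding nice_ball_def using subset_cball[of r' r y0] by (meson dual_order.trans subsetD)

lemma ex_nice_ball:
  assumes c: "c \<in> A" "p \<in> fst c"
  shows "\<exists>r \<Lambda>. nice_ball c (snd c p) r \<Lambda>"
proof -
  define F where "F y v = v \<bullet> (g c (coord_inv c y) *v v)" for y v
  obtain r0 where r0: "r0 > 0" "cball (snd c p) r0 \<subseteq> snd c ` fst c"
    using chart_homeo(2)[OF c(1)] c(2) open_contains_cball by blast
  have gc: "continuous_on (cball (snd c p) r0) (\<lambda>y. g c (coord_inv c y))"
    by (rule continuous_on_compose2[OF metric_continuous[OF c(1)] continuous_on_subset[OF chart_homeo(4)[OF c(1)] r0(2)]])
      (use r0 chart_homeo(7)[OF c(1)] in auto)
  define K where "K = cball (snd c p) r0 \<times> sphere (0 :: real ^ 'm) 1"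
  have "compact K" unfolding K_def by (intro compact_Times) auto
  have "continuous_on K (\<lambda>x. g c (coord_inv c (fst x)))"
    unfolding K_def by (rule continuous_on_compose2[OF gc continuous_on_fst[OF continuous_on_id]]) auto
  then have Fc: "continuous_on K (\<lambda>x. F (fst x) (snd x))"
    unfolding F_def matrix_vector_mult_def
    by (intro continuous_intros continuous_on_vec_lambda continuous_on_component)
  have hom: "F y v = (norm v)\<^sup>2 * F y (v /\<^sub>R norm v)" if "v \<noteq> 0" for y v
    using that by (simp add: F_def matrix_vector_mult_scaleR power2_eq_square field_simps)
  have pos: "F y v \<ge> 0" if "y \<in> cball (snd c p) r0" for y v
    unfolding F_def using pos_def_nonneg[OF metric_pos_def[OF c(1) chart_homeo(7)[OF c(1)]]] that r0 by blast
  have pos': "F y v > 0" if "y \<in> cball (snd c p) r0" "v \<noteq> 0" for y v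
    unfolding F_def using metric_pos_def[OF c(1) chart_homeo(7)[OF c(1)]] that r0 by (auto simp: pos_def_def)
  have "K \<noteq> {}" using r0(1) by (auto simp: K_def intro!: exI[of _ "snd c p"] exI[of _ "axis undefined 1"])
  from continuous_attains_inf[OF \<open>compact K\<close> this Fc] continuous_attains_sup[OF \<open>compact K\<close> this Fc]
  obtain x1 x2 where x1: "x1 \<in> K" "\<And>x. x \<in> K \<Longrightarrow> F (fst x1) (snd x1) \<le> F (fst x) (snd x)"
    and x2: "x2 \<in> K" "\<And>x. x \<in> K \<Longrightarrow> F (fst x) (snd x) \<le> F (fst x2) (snd x2)" by blast
  define m where "m = F (fst x1) (snd x1)"
  define M where "M = F (fst x2) (snd x2)"
  have m: "m > 0" unfolding m_def using x1(1) by (intro pos') (auto simp: K_def)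
  have Mm: "m \<le> M" using x1 x2 by (auto simp: m_def M_def)
  have bd: "m * (norm v)\<^sup>2 \<le> F y v" "F y v \<le> M * (norm v)\<^sup>2" if y: "y \<in> cball (snd c p) r0" for y v
  proof -
    have "m * (norm v)\<^sup>2 \<le> F y v \<and> F y v \<le> M * (norm v)\<^sup>2"
    proof (cases "v = 0")
      case False
      then have "(y, v /\<^sub>R norm v) \<in> K" using y by (simp add: K_def)
      then have "m \<le> F y (v /\<^sub>R norm v)" "F y (v /\<^sub>R norm v) \<le> M"
        using x1(2) x2(2) by (auto simp: m_def M_def)
      then show ?thesis using False unfolding hom[OF False]
        by (simp add: mult.commute[of _ "(norm v)\<^sup>2"] mult_left_mono)
    qed (simp add: F_def)
    then show "m * (norm v)\<^sup>2 \<le> F y v" "F y v \<le> M * (norm v)\<^sup>2" by auto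
  qed
  \<comment> \<open>The tolerance is the minimum m of the quadratic form on unit vectors: two values
    that differ by less than m have ratio at most 2. Two points of the final ball are at most 2r
    apart, hence the radius d / 3 below.\<close>
  from compact_uniformly_continuous[OF Fc \<open>compact K\<close>] m
  obtain d where d: "d > 0" "\<And>x x'. x \<in> K \<Longrightarrow> x' \<in> K \<Longrightarrow> dist x' x < d \<Longrightarrow> dist (F (fst x') (snd x')) (F (fst x) (snd x)) < m"
    unfolding uniformly_continuous_on_def by metis
  define r where "r = min r0 (d / 3)"
  have r: "r > 0" "r \<le> r0" using d r0 by (auto simp: r_def)
  have cmp: "F y v \<le> 2 * F z v" if "y \<in> cball (snd c p) r" "z \<in> cball (snd c p) r" for y z v
  proof (cases "v = 0")
    case False
    let ?w = "v /\<^sub>R norm v"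
    have yz: "y \<in> cball (snd c p) r0" "z \<in> cball (snd c p) r0" using that r by auto
    then have K: "(y, ?w) \<in> K" "(z, ?w) \<in> K" using False by (auto simp: K_def)
    have "dist y z \<le> 2 * r" using that dist_triangle2[of y z "snd c p"] by (simp add: dist_commute)
    also have "\<dots> < d" using d by (simp add: r_def)
    finally have "dist (y, ?w) (z, ?w) < d" by (simp add: dist_Pair_Pair)
    from d(2)[OF K(2,1) this] have "F y ?w < F z ?w + m" by (simp add: dist_real_def)
    also have "m \<le> F z ?w" using x1(2)[OF K(2)] by (simp add: m_def)
    finally have "F y ?w \<le> 2 * F z ?w" by simp
    then have "(norm v)\<^sup>2 * F y ?w \<le> (norm v)\<^sup>2 * (2 * F z ?w)" by (intro mult_left_mono) auto
    then show ?thesis unfolding hom[OF False, of y] hom[OF False, of z] by simp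
  qed (simp add: F_def)
  define \<Lambda> where "\<Lambda> = max (1 / sqrt m) (sqrt M)"
  have \<Lambda>: "\<Lambda> > 0" "\<Lambda> \<ge> 1 / sqrt m" "\<Lambda> \<ge> sqrt M" using m by (auto simp: \<Lambda>_def less_max_iff_disj)
  have "norm v \<le> \<Lambda> * sqrt (F y v)" "sqrt (F y v) \<le> \<Lambda> * norm v" if "y \<in> cball (snd c p) r" for y v
  proof -
    have y: "y \<in> cball (snd c p) r0" using that r by auto
    have "sqrt (m * (norm v)\<^sup>2) \<le> sqrt (F y v)" using bd(1)[OF y] by (rule real_sqrt_le_mono)
    then have "norm v \<le> 1 / sqrt m * sqrt (F y v)" using m by (simp add: real_sqrt_mult field_simps)
    also have "\<dots> \<le> \<Lambda> * sqrt (F y v)" by (intro mult_right_mono \<Lambda>) (use pos[OF y] in simp)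
    finally show "norm v \<le> \<Lambda> * sqrt (F y v)" .
    have "sqrt (F y v) \<le> sqrt (M * (norm v)\<^sup>2)" using bd(2)[OF y] by (rule real_sqrt_le_mono)
    also have "\<dots> = sqrt M * norm v" by (simp add: real_sqrt_mult)
    also have "\<dots> \<le> \<Lambda> * norm v" by (intro mult_right_mono \<Lambda>) simp
    finally show "sqrt (F y v) \<le> \<Lambda> * norm v" .
  qed
  moreover have "sqrt (F y v) \<le> 2 * sqrt (F z v)" if "y \<in> cball (snd c p) r" "z \<in> cball (snd c p) r" for y z v
  proof -
    have z: "z \<in> cball (snd c p) r0" using that r by auto
    have "sqrt (F y v) \<le> sqrt (2 * F z v)" using cmp[OF that] by (rule real_sqrt_le_mono)
    also have "\<dots> \<le> sqrt (4 * F z v)" using pos[OF z] by (intro real_sqrt_le_mono) simp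
    also have "\<dots> = 2 * sqrt (F z v)" by (simp add: real_sqrt_mult)
    finally show ?thesis .
  qed
  moreover have "cball (snd c p) r \<subseteq> snd c ` fst c" using r r0 subset_cball[of r r0] by blast
  ultimately have "nice_ball c (snd c p) r \<Lambda>"
    unfolding nice_ball_def F_def using c r \<Lambda>(1) by blast
  then show ?thesis by blast
qed

lemma segment_curve:
  assumes c: "c \<in> A" and im: "\<And>t. t \<in> {0..1} \<Longrightarrow> y + t *\<^sub>R v \<in> snd c ` fst c"
    and B: "\<And>t. t \<in> {0..1} \<Longrightarrow> sqrt (v \<bullet> (g c (coord_inv c (y + t *\<^sub>R v)) *v v)) \<le> B"
  shows "pwc 0 1 (\<lambda>t. coord_inv c (y + t *\<^sub>R v))" "glen 0 1 (\<lambda>t. coord_inv c (y + t *\<^sub>R v)) \<le> B"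
proof -
  let ?\<gamma> = "\<lambda>t. coord_inv c (y + t *\<^sub>R v)"
  have mem: "?\<gamma> t \<in> fst c" "snd c (?\<gamma> t) = y + t *\<^sub>R v" if "t \<in> {0..1}" for t
    using chart_homeo(6,7)[OF c im[OF that]] by auto
  have co: "continuous_on {0..1} ?\<gamma>"
    by (rule continuous_on_compose2[OF chart_homeo(4)[OF c]]) (use im in \<open>auto intro!: continuous_intros\<close>)
  have line: "((\<lambda>t. y + t *\<^sub>R v) has_vector_derivative v) (at t within {0..1})" for t
    by (auto intro!: derivative_eq_intros)
  have "((snd c \<circ> ?\<gamma>) has_vector_derivative v) (at t within {0..1})" if "t \<in> {0..1}" for t
    by (rule has_vector_derivative_transform[OF that _ line]) (simp add: mem)
  have C1: "C1_curve_on A 0 1 ?\<gamma>"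
    unfolding C1_curve_on_def
  proof
    fix d assume d: "d \<in> A"
    show "\<exists>D. (\<forall>t\<in>{0..1}. ?\<gamma> t \<in> fst d \<longrightarrow> ((snd d \<circ> ?\<gamma>) has_vector_derivative D t) (at t within {0..1})) \<and>
        continuous_on {t\<in>{0..1}. ?\<gamma> t \<in> fst d} D"
    proof (intro exI[of _ "\<lambda>t. trans_mat c d (?\<gamma> t) *v v"] conjI ballI impI)
      fix t :: real assume t: "t \<in> {0..1}" "?\<gamma> t \<in> fst d"
      have "((\<lambda>t. (snd d \<circ> coord_inv c) (y + t *\<^sub>R v)) has_derivative
         (\<lambda>h. trans_mat c d (?\<gamma> t) *v (h *\<^sub>R v))) (at t within {0..1})"
        by (rule has_derivative_compose[OF line[unfolded has_vector_derivative_def]])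
          (use trans_derivative[OF c d mem(1)[OF t(1)] t(2)] mem(2)[OF t(1)] in \<open>simp add: o_def\<close>)
      then show "((snd d \<circ> ?\<gamma>) has_vector_derivative trans_mat c d (?\<gamma> t) *v v) (at t within {0..1})"
        by (simp add: has_vector_derivative_def matrix_vector_mult_scaleR o_def)
    next
      have "continuous_on {t\<in>{0..1}. ?\<gamma> t \<in> fst d} (\<lambda>t. trans_mat c d (?\<gamma> t))"
      proof (rule continuous_on_compose2[OF trans_mat_continuous[OF c d]])
        show "continuous_on {t\<in>{0..1}. ?\<gamma> t \<in> fst d} ?\<gamma>" by (rule continuous_on_subset[OF co]) auto
      qed (use mem in auto)
      then show "continuous_on {t\<in>{0..1}. ?\<gamma> t \<in> fst d} (\<lambda>t. trans_mat c d (?\<gamma> t) *v v)"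
        unfolding matrix_vector_mult_def
        by (intro continuous_intros continuous_on_vec_lambda continuous_on_component)
    qed
  qed
  show "pwc 0 1 ?\<gamma>" by (rule pwc_piece[OF _ C1 co]) simp
  have z: "(0::real) < 1" by simp
  have pB: "pspd 0 1 ?\<gamma> t \<le> B" if t: "t \<in> {0..1}" for t
  proof -
    have "vel 0 1 ?\<gamma> c t = v"
      unfolding vel_def[OF z C1 co]
      by (rule vector_derivative_within_closed_interval[OF z t])
        (rule has_vector_derivative_transform[OF t _ line], simp add: mem)
    then show ?thesis
      using pspd_chart[OF z C1 co c t mem(1)[OF t]] B[OF t] by simp
  qed
  have "integral {0..1} (pspd 0 1 ?\<gamma>) \<le> integral {0..1} (\<lambda>_::real. B)"
  proof (rule Henstock_Kurzweil_Integration.integral_le)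
    show "pspd 0 1 ?\<gamma> integrable_on {0..1}"
      by (rule integrable_continuous_real[OF pspd_continuous[OF z C1 co]])
  qed (auto intro: pB)
  then show "glen 0 1 ?\<gamma> \<le> B"
    using integral_unique[OF piece_integral[OF z C1 co]] by (simp add: glen_def)
qed

lemma rdist_segment_le:
  assumes c: "c \<in> A" and im: "\<And>t. t \<in> {0..1} \<Longrightarrow> y + t *\<^sub>R v \<in> snd c ` fst c"
    and B: "\<And>t. t \<in> {0..1} \<Longrightarrow> sqrt (v \<bullet> (g c (coord_inv c (y + t *\<^sub>R v)) *v v)) \<le> B"
  shows "rdist A g (coord_inv c y) (coord_inv c (y + v)) \<le> B"
  using rdist_le_01[OF segment_curve(1)[OF assms]] segment_curve(2)[OF assms] by simp

text \<open>Lengths add up along a curve and increments of h obey the triangle inequality, so the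
  estimate spreads from short parameter intervals to long ones by bisection. Only the local
  behaviour of h along curves is needed.\<close>

lemma curve_lipschitz:
  assumes "pwc a b \<gamma>" "a \<le> b"
    and loc: "\<And>p. \<exists>N. open N \<and> p \<in> N \<and> (\<forall>s s'. s < s' \<and> C1_curve_on A s s' \<gamma> \<and> continuous_on {s..s'} \<gamma> \<and> \<gamma> ` {s..s'} \<subseteq> N
        \<longrightarrow> \<bar>h (\<gamma> s') - h (\<gamma> s)\<bar> \<le> \<Lambda> * glen s s' \<gamma>)"
  shows "\<bar>h (\<gamma> b) - h (\<gamma> a)\<bar> \<le> \<Lambda> * glen a b \<gamma>"
proof -
  have comb: "\<bar>h (\<gamma> t) - h (\<gamma> r)\<bar> \<le> \<Lambda> * glen r t \<gamma>"
    if "pwc r t \<gamma>" "r \<le> s" "s \<le> t" "\<bar>h (\<gamma> s) - h (\<gamma> r)\<bar> \<le> \<Lambda> * glen r s \<gamma>" "\<bar>h (\<gamma> t) - h (\<gamma> s)\<bar> \<le> \<Lambda> * glen s t \<gamma>" for r s t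
    using that glen_combine[OF that(1-3)] by (simp add: algebra_simps flip: glen_combine[OF that(1-3)])
  from assms(1,2) show ?thesis
  proof (induction rule: pwc_induct)
    case (piece s s')
    have pw: "pwc s s' \<gamma>" using pwc_piece piece by blast
    have "s \<le> s'" using piece by simp
    then have "s \<le> s \<and> s' \<le> s' \<longrightarrow> \<bar>h (\<gamma> s') - h (\<gamma> s)\<bar> \<le> \<Lambda> * glen s s' \<gamma>"
    proof (induction rule: Bolzano[where P = "\<lambda>x y. s \<le> x \<and> y \<le> s' \<longrightarrow> \<bar>h (\<gamma> y) - h (\<gamma> x)\<bar> \<le> \<Lambda> * glen x y \<gamma>"])
      case (trans x y z)
      show ?case
      proof
        assume l: "s \<le> x \<and> z \<le> s'"
        show "\<bar>h (\<gamma> z) - h (\<gamma> x)\<bar> \<le> \<Lambda> * glen x z \<gamma>"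
          by (rule comb[of x z y]) (use trans l pwc_sub[OF pw, of x z] in auto)
      qed
    next
      case (local x)
      from loc[of "\<gamma> x"] obtain N where N: "open N" "\<gamma> x \<in> N" "\<forall>s s'. s < s' \<and> C1_curve_on A s s' \<gamma> \<and> continuous_on {s..s'} \<gamma> \<and> \<gamma> ` {s..s'} \<subseteq> N
        \<longrightarrow> \<bar>h (\<gamma> s') - h (\<gamma> s)\<bar> \<le> \<Lambda> * glen s s' \<gamma>"
        by (elim exE conjE) (rule that; assumption)
      have "x \<in> {s..s'}" using local by simp
      then have "\<forall>\<^sub>F t in at x within {s..s'}. \<gamma> t \<in> N"
        by (rule within_open_vimage(2)[OF piece(5) N(1) _ N(2)])
      then obtain d where d: "d > 0" "\<And>t. t \<in> {s..s'} \<Longrightarrow> t \<noteq> x \<Longrightarrow> dist t x < d \<Longrightarrow> \<gamma> t \<in> N"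
        unfolding eventually_at by blast
      show ?case
      proof (intro exI[of _ d] conjI allI impI d(1))
        fix y z assume yz: "y \<le> x \<and> x \<le> z \<and> z - y < d" "s \<le> y \<and> z \<le> s'"
        show "\<bar>h (\<gamma> z) - h (\<gamma> y)\<bar> \<le> \<Lambda> * glen y z \<gamma>"
        proof (cases "y = z")
          case False
          have "\<gamma> ` {y..z} \<subseteq> N"
          proof
            fix q assume "q \<in> \<gamma> ` {y..z}"
            then obtain t where t: "t \<in> {y..z}" "q = \<gamma> t" by blast
            show "q \<in> N" using d(2)[of t] t yz N(2) by (cases "t = x") (auto simp: dist_real_def)
          qed
          moreover have "C1_curve_on A y z \<gamma>" by (rule C1_curve_on_subset[OF piece(4)]) (use yz in auto)
          moreover have "continuous_on {y..z} \<gamma>" by (rule continuous_on_subset[OF piece(5)]) (use yz in auto)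
          moreover have "y < z" using yz False by auto
          ultimately show ?thesis using N(3) by blast
        qed (simp add: glen_refl)
      qed
    qed
    then show ?case by simp
  next
    case (refl s)
    then show ?case by (simp add: glen_refl)
  next
    case (trans r s t)
    show ?case by (rule comb[of r t s]) (use trans pwc_sub[OF assms(1), of r t] in auto)
  qed
qed

end

context riem
begin

lemma nice_ball_curve:
  assumes nb: "nice_ball c y0 r \<Lambda>" and yz: "y \<in> cball y0 r" "z \<in> cball y0 r"
  shows "\<exists>\<gamma>. pwc 0 1 \<gamma> \<and> \<gamma> 0 = coord_inv c y \<and> \<gamma> 1 = coord_inv c z \<and> glen 0 1 \<gamma> \<le> \<Lambda> * norm (z - y)"
    and "w \<in> cball y0 r \<Longrightarrow> rdist A g (coord_inv c y) (coord_inv c z) \<le> 2 * sqrt ((z - y) \<bullet> (g c (coord_inv c w) *v (z - y)))"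
proof -
  have c: "c \<in> A" using nb by (simp add: nice_ball_def)
  have seg: "y + t *\<^sub>R (z - y) \<in> cball y0 r" if "t \<in> {0..1}" for t
  proof -
    have "y + t *\<^sub>R (z - y) = (1 - t) *\<^sub>R y + t *\<^sub>R z" by (simp add: algebra_simps)
    then show ?thesis using convexD[OF convex_cball yz, of "1 - t" t] that by simp
  qed
  have im: "y + t *\<^sub>R (z - y) \<in> snd c ` fst c" if "t \<in> {0..1}" for t
    using seg[OF that] nb unfolding nice_ball_def by blast
  have B: "sqrt ((z - y) \<bullet> (g c (coord_inv c (y + t *\<^sub>R (z - y))) *v (z - y))) \<le> \<Lambda> * norm (z - y)" if "t \<in> {0..1}" for t
    using seg[OF that] nb unfolding nice_ball_def by blast
  show "\<exists>\<gamma>. pwc 0 1 \<gamma> \<and> \<gamma> 0 = coord_inv c y \<and> \<gamma> 1 = coord_inv c z \<and> glen 0 1 \<gamma> \<le> \<Lambda> * norm (z - y)"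
    by (intro exI[of _ "\<lambda>t. coord_inv c (y + t *\<^sub>R (z - y))"] conjI segment_curve[OF c im B]) auto
  assume w: "w \<in> cball y0 r"
  have "sqrt ((z - y) \<bullet> (g c (coord_inv c (y + t *\<^sub>R (z - y))) *v (z - y))) \<le> 2 * sqrt ((z - y) \<bullet> (g c (coord_inv c w) *v (z - y)))"
    if "t \<in> {0..1}" for t
    using seg[OF that] w nb unfolding nice_ball_def by blast
  from rdist_segment_le[OF c im this]
  show "rdist A g (coord_inv c y) (coord_inv c z) \<le> 2 * sqrt ((z - y) \<bullet> (g c (coord_inv c w) *v (z - y)))"
    by simp
qed

text \<open>The Euclidean distance from the centre, truncated at r' and continued by r' to the whole
  manifold. Its growth along curves is controlled by length, so a curve leaving the coordinate ball
  cannot be short.\<close>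

definition cball_fun :: "('a, 'm) chart \<Rightarrow> real ^ 'm \<Rightarrow> real \<Rightarrow> real \<Rightarrow> 'a \<Rightarrow> real" where
  "cball_fun c y0 r r' q = (if q \<in> fst c \<and> snd c q \<in> ball y0 r then min r' (norm (snd c q - y0)) else r')"

lemma nice_ball_compact: "nice_ball c y0 r \<Lambda> \<Longrightarrow> r' \<le> r \<Longrightarrow> compact (coord_inv c ` cball y0 r')"
  by (rule compact_continuous_image[OF continuous_on_subset[OF chart_homeo(4)]])
    (auto simp: nice_ball_def)

lemma cball_fun_le:
  assumes nb: "nice_ball c y0 r \<Lambda>" and r': "0 < r'" "r' < r" and "p \<in> fst c" "snd c p = y0"
    and "pwc 0 1 \<gamma>" "\<gamma> 0 = p"
  shows "cball_fun c y0 r r' (\<gamma> 1) \<le> \<Lambda> * glen 0 1 \<gamma>"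
proof -
  have c: "c \<in> A" and sub: "cball y0 r \<subseteq> snd c ` fst c" and \<Lambda>: "\<Lambda> > 0" using nb by (auto simp: nice_ball_def)
  let ?h = "cball_fun c y0 r r'" and ?V = "fst c \<inter> snd c -` ball y0 r"
  have "\<bar>?h (\<gamma> 1) - ?h (\<gamma> 0)\<bar> \<le> \<Lambda> * glen 0 1 \<gamma>"
  proof (rule curve_lipschitz[OF assms(6)])
    fix q
    show "\<exists>N. open N \<and> q \<in> N \<and> (\<forall>s s'. s < s' \<and> C1_curve_on A s s' \<gamma> \<and> continuous_on {s..s'} \<gamma> \<and> \<gamma> ` {s..s'} \<subseteq> N
        \<longrightarrow> \<bar>?h (\<gamma> s') - ?h (\<gamma> s)\<bar> \<le> \<Lambda> * glen s s' \<gamma>)"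
    proof (cases "q \<in> ?V")
      case True
      show ?thesis
      proof (intro exI[of _ ?V] conjI True allI impI chart_preimage_open[OF c open_ball]; elim conjE)
        fix s s' assume s: "s < s'" "C1_curve_on A s s' \<gamma>" "continuous_on {s..s'} \<gamma>" "\<gamma> ` {s..s'} \<subseteq> ?V"
        have m: "\<gamma> t \<in> fst c" "snd c (\<gamma> t) \<in> ball y0 r" if "t \<in> {s..s'}" for t
        proof -
          have "\<gamma> t \<in> ?V" using s(4) that by blast
          then show "\<gamma> t \<in> fst c" "snd c (\<gamma> t) \<in> ball y0 r" by auto
        qed
        have "norm v \<le> \<Lambda> * sqrt (v \<bullet> (g c (\<gamma> t) *v v))" if "t \<in> {s..s'}" for t v
        proof -
          have "snd c (\<gamma> t) \<in> cball y0 r" using m(2)[OF that] by auto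
          then have "norm v \<le> \<Lambda> * sqrt (v \<bullet> (g c (coord_inv c (snd c (\<gamma> t))) *v v))"
            using nb unfolding nice_ball_def by blast
          then show ?thesis using chart_homeo(5)[OF c m(1)[OF that]] by simp
        qed
        from piece_bound[OF s(1-3) c m(1) this]
        have "norm (snd c (\<gamma> s') - snd c (\<gamma> s)) \<le> \<Lambda> * glen s s' \<gamma>" .
        moreover have "\<bar>?h (\<gamma> s') - ?h (\<gamma> s)\<bar> \<le> norm (snd c (\<gamma> s') - snd c (\<gamma> s))"
        proof -
          have "\<bar>norm (snd c (\<gamma> s') - y0) - norm (snd c (\<gamma> s) - y0)\<bar> \<le> norm (snd c (\<gamma> s') - snd c (\<gamma> s))"
            using norm_triangle_ineq3[of "snd c (\<gamma> s') - y0" "snd c (\<gamma> s) - y0"] by simp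
          then show ?thesis using m[of s] m[of s'] s(1) unfolding cball_fun_def by (auto simp: min_def)
        qed
        ultimately show "\<bar>?h (\<gamma> s') - ?h (\<gamma> s)\<bar> \<le> \<Lambda> * glen s s' \<gamma>" by linarith
      qed
    next
      case False
      \<comment> \<open>Off the open r-ball the function is locally constant: as r' < r, the point
        avoids the image of the closed r'-ball, which is compact and thus closed because the space
        is Hausdorff.\<close>
      let ?N = "- (coord_inv c ` cball y0 r')"
      have cs: "cball y0 r' \<subseteq> snd c ` fst c" using sub r' by auto
      have "compact (coord_inv c ` cball y0 r')" by (rule nice_ball_compact[OF nb]) (use r' in simp)
      then have "open ?N" using compact_imp_closed open_Compl by blast
      moreover have "q \<in> ?N" using False r' chart_inv_image[OF c cs] by auto
      moreover have "?h x = r'" if "x \<in> ?N" for x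
      proof -
        have "x \<notin> fst c \<inter> snd c -` cball y0 r'" using that unfolding chart_inv_image[OF c cs] by simp
        then show ?thesis by (auto simp: cball_fun_def dist_norm norm_minus_commute)
      qed
      moreover have "glen s s' \<gamma> \<ge> 0" if "s < s'" "C1_curve_on A s s' \<gamma>" "continuous_on {s..s'} \<gamma>" for s s'
        using glen_nonneg[OF pwc_piece[OF that]] that by simp
      ultimately show ?thesis using \<Lambda>
        by (intro exI[of _ ?N] conjI allI impI; (elim conjE)?)
          (auto simp: image_subset_iff)
    qed
  qed simp
  moreover have "?h (\<gamma> 0) = 0" using assms nb r' by (simp add: cball_fun_def nice_ball_def)
  ultimately show ?thesis by simp
qed

end

section \<open>The distance is a metric inducing the manifold topology\<close>

locale conn_riem = riem +
  assumes conn: "connected (UNIV :: 'a set)"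
begin

text \<open>Being joined by a curve is an equivalence relation with open classes, so connectedness
  leaves a single class. This is what makes the infimum in \<open>rdist\<close> one over a non-empty
  set.\<close>

lemma ex_curve: "\<exists>\<gamma>. pwc 0 1 \<gamma> \<and> \<gamma> 0 = p \<and> \<gamma> 1 = q"
proof -
  define R where "R x y \<longleftrightarrow> (\<exists>\<gamma>. pwc 0 1 \<gamma> \<and> \<gamma> 0 = x \<and> \<gamma> 1 = y)" for x y
  have trans: "R x z" if xy: "R x y" and yz: "R y z" for x y z
  proof -
    obtain \<gamma> \<eta> where "pwc 0 1 \<gamma>" "\<gamma> 0 = x" "\<gamma> 1 = y" "pwc 0 1 \<eta>" "\<eta> 0 = y" "\<eta> 1 = z" using xy yz unfolding R_def by blast
    then obtain \<zeta> where \<zeta>: "pwc 0 2 \<zeta>" "\<zeta> 0 = x" "\<zeta> 2 = z" using pwc_join[of \<gamma> \<eta>] by metis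
    have im: "(\<lambda>t. 2 * t + 0) ` {0..1} = {0..2::real}" using image_affinity_atLeastAtMost[of 2 0 0 1] by simp
    have "pwc 0 1 (\<lambda>t. \<zeta> (2 * t + 0))" by (rule pwc_affine(1)[OF \<zeta>(1) _ _ im]) auto
    then show ?thesis unfolding R_def using \<zeta> by (intro exI[of _ "\<lambda>t. \<zeta> (2 * t + 0)"]) auto
  qed
  have sym: "R y x" if xy: "R x y" for x y
  proof -
    obtain \<gamma> where \<gamma>: "pwc 0 1 \<gamma>" "\<gamma> 0 = x" "\<gamma> 1 = y" using xy unfolding R_def by blast
    have im: "(\<lambda>t. -1 * t + 1) ` {0..1} = {0..1::real}" using image_affinity_atLeastAtMost[of "-1" 1 0 1] by simp
    have "pwc 0 1 (\<lambda>t. \<gamma> (-1 * t + 1))" by (rule pwc_affine(1)[OF \<gamma>(1) _ _ im]) auto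
    then show ?thesis unfolding R_def using \<gamma> by (intro exI[of _ "\<lambda>t. \<gamma> (-1 * t + 1)"]) auto
  qed
  have loc: "\<exists>N. open N \<and> x \<in> N \<and> (\<forall>y\<in>N. R x y)" for x
  proof -
    obtain c where c: "c \<in> A" "x \<in> fst c" using ex_chart by blast
    obtain r \<Lambda> where nb: "nice_ball c (snd c x) r \<Lambda>" using ex_nice_ball[OF c] by blast
    have r: "r > 0" using nb by (simp add: nice_ball_def)
    show ?thesis
    proof (intro exI[of _ "fst c \<inter> snd c -` ball (snd c x) r"] conjI ballI)
      show "open (fst c \<inter> snd c -` ball (snd c x) r)" by (rule chart_preimage_open[OF c(1) open_ball])
      show "x \<in> fst c \<inter> snd c -` ball (snd c x) r" using c r by simp
      fix y assume "y \<in> fst c \<inter> snd c -` ball (snd c x) r"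
      then show "R x y"
        using nice_ball_curve(1)[OF nb, of "snd c x" "snd c y"] chart_homeo(5)[OF c(1)] c(2) r
        unfolding R_def by auto
    qed
  qed
  have "open {y. R p y}" 
    unfolding open_subopen[of "{y. R p y}"] using loc trans by (metis mem_Collect_eq subsetI)
  moreover have "open (- {y. R p y})"
    unfolding open_subopen[of "- {y. R p y}"] using loc trans sym by (metis ComplD ComplI mem_Collect_eq subsetI)
  moreover have "R p p" using loc by blast
  ultimately have "{y. R p y} = UNIV"
    using connectedD[OF conn, of "{y. R p y}" "- {y. R p y}"] by blast
  then show ?thesis unfolding R_def by auto
qed

abbreviation dd :: "'a \<Rightarrow> 'a \<Rightarrow> real" where "dd \<equiv> rdist A g"

lemma dd_witness: "dd p q < e \<Longrightarrow> \<exists>\<gamma>. pwc 0 1 \<gamma> \<and> \<gamma> 0 = p \<and> \<gamma> 1 = q \<and> glen 0 1 \<gamma> < e"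
proof -
  assume "dd p q < e"
  define S where "S = {glen 0 1 \<gamma> | \<gamma>. pwc 0 1 \<gamma> \<and> \<gamma> 0 = p \<and> \<gamma> 1 = q}"
  have "Inf S < e" using \<open>dd p q < e\<close> by (simp only: rdist_eq S_def)
  moreover have "S \<noteq> {}" using ex_curve unfolding S_def by blast
  ultimately obtain x where x: "x \<in> S" "x < e" using cInf_lessD[of S e] by blast
  from x(1) obtain \<gamma> where "x = glen 0 1 \<gamma>" "pwc 0 1 \<gamma>" "\<gamma> 0 = p" "\<gamma> 1 = q" unfolding S_def by blast
  then show ?thesis using x(2) by (intro exI[of _ \<gamma>]) simp
qed

lemma dd_geI: "(\<And>\<gamma>. pwc 0 1 \<gamma> \<Longrightarrow> \<gamma> 0 = p \<Longrightarrow> \<gamma> 1 = q \<Longrightarrow> k \<le> glen 0 1 \<gamma>) \<Longrightarrow> k \<le> dd p q"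
  using dd_witness[of p q k] by (metis not_le)

lemma dd_nonneg: "dd p q \<ge> 0"
  by (rule dd_geI) (auto intro: glen_nonneg)

lemma dd_refl: "dd p p = 0"
proof -
  have "dd p p \<le> glen 0 1 (\<lambda>t. p)" using rdist_le_01[OF pwc_const[of 0 1 p]] by simp
  also have "\<dots> \<le> 0"
  proof -
    have "spd (\<lambda>t. p) = (\<lambda>t. 0)" by (simp add: fun_eq_iff spd_def o_def Let_def)
    then show ?thesis by (simp add: glen_def)
  qed
  finally show ?thesis using dd_nonneg[of p p] by simp
qed

lemma dd_sym: "dd p q = dd q p"
proof -
  have "dd q p \<le> dd p q" for p q
    by (rule dd_geI) (use rdist_le(2)[of 0 1] in auto)
  then show ?thesis by (simp add: antisym)
qed

lemma dd_triangle: "dd p r \<le> dd p q + dd q r"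
proof (rule field_le_epsilon)
  fix e :: real assume "e > 0"
  obtain \<gamma> where \<gamma>: "pwc 0 1 \<gamma>" "\<gamma> 0 = p" "\<gamma> 1 = q" "glen 0 1 \<gamma> < dd p q + e / 2"
    using dd_witness[of p q "dd p q + e / 2"] \<open>e > 0\<close> by auto
  obtain \<eta> where \<eta>: "pwc 0 1 \<eta>" "\<eta> 0 = q" "\<eta> 1 = r" "glen 0 1 \<eta> < dd q r + e / 2"
    using dd_witness[of q r "dd q r + e / 2"] \<open>e > 0\<close> by auto
  obtain \<zeta> where "pwc 0 2 \<zeta>" "\<zeta> 0 = p" "\<zeta> 2 = r" "glen 0 2 \<zeta> = glen 0 1 \<gamma> + glen 0 1 \<eta>"
    using pwc_join[OF \<gamma>(1) \<eta>(1)] \<gamma> \<eta> by metis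
  then show "dd p r \<le> dd p q + dd q r + e" using rdist_le(1)[of 0 2 \<zeta>] \<gamma> \<eta> by simp
qed

lemma dd_lower:
  assumes nb: "nice_ball c y0 r \<Lambda>" and r': "0 < r'" "r' < r" and "p \<in> fst c" "snd c p = y0"
  shows "cball_fun c y0 r r' q \<le> \<Lambda> * dd p q"
proof -
  have \<Lambda>: "\<Lambda> > 0" using nb by (simp add: nice_ball_def)
  have "cball_fun c y0 r r' q / \<Lambda> \<le> dd p q"
    by (rule dd_geI) (use cball_fun_le[OF assms] \<Lambda> in \<open>auto simp: field_simps\<close>)
  then show ?thesis using \<Lambda> by (simp add: field_simps)
qed

lemma dd_ball_subset:
  assumes "open W" "p \<in> W" shows "\<exists>e>0. \<forall>q. dd p q < e \<longrightarrow> q \<in> W"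
proof -
  obtain c where c: "c \<in> A" "p \<in> fst c" using ex_chart by blast
  obtain r0 \<Lambda> where nb0: "nice_ball c (snd c p) r0 \<Lambda>" using ex_nice_ball[OF c] by blast
  have "open (snd c ` (W \<inter> fst c))" by (rule chart_image_open[OF c(1)]) (use assms chart_homeo(1)[OF c(1)] in auto)
  moreover have "snd c p \<in> snd c ` (W \<inter> fst c)" using assms c by auto
  ultimately obtain r1 where r1: "r1 > 0" "ball (snd c p) r1 \<subseteq> snd c ` (W \<inter> fst c)" using open_contains_ball by blast
  define r where "r = min r0 r1"
  have r: "r > 0" "r \<le> r0" "r \<le> r1" using r1 nb0 by (auto simp: r_def nice_ball_def)
  have nb: "nice_ball c (snd c p) r \<Lambda>" by (rule nice_ball_mono[OF nb0 r(1,2)])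
  have \<Lambda>: "\<Lambda> > 0" using nb by (simp add: nice_ball_def)
  show ?thesis
  proof (intro exI[of _ "r / 2 / \<Lambda>"] conjI allI impI)
    show "r / 2 / \<Lambda> > 0" using r \<Lambda> by simp
    fix q assume "dd p q < r / 2 / \<Lambda>"
    then have "\<Lambda> * dd p q < r / 2" using \<Lambda> by (simp add: field_simps)
    \<comment> \<open>Outside the coordinate ball the function takes the value r / 2, so this
      inequality forces q into the chart.\<close>
    then have "cball_fun c (snd c p) r (r / 2) q < r / 2"
      using dd_lower[OF nb, of "r / 2" p q] r c by simp
    then have q: "q \<in> fst c" "snd c q \<in> ball (snd c p) r" unfolding cball_fun_def by (auto split: if_splits)
    then have "snd c q \<in> snd c ` (W \<inter> fst c)" using r1 r by auto
    then obtain x where "x \<in> W" "x \<in> fst c" "snd c q = snd c x" by auto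
    then show "q \<in> W" using chart_homeo(5)[OF c(1)] q(1) by metis
  qed
qed

lemma dd_ball_nhd:
  assumes "e > 0" shows "\<exists>W. open W \<and> p \<in> W \<and> (\<forall>q\<in>W. dd p q < e)"
proof -
  obtain c where c: "c \<in> A" "p \<in> fst c" using ex_chart by blast
  obtain r \<Lambda> where nb: "nice_ball c (snd c p) r \<Lambda>" using ex_nice_ball[OF c] by blast
  have r: "r > 0" "\<Lambda> > 0" using nb by (auto simp: nice_ball_def)
  define s where "s = min r (e / \<Lambda>)"
  have s: "s > 0" "s \<le> r" "\<Lambda> * s \<le> e" using r assms by (auto simp: s_def min_def field_simps)
  show ?thesis
  proof (intro exI[of _ "fst c \<inter> snd c -` ball (snd c p) s"] conjI ballI)
    show "open (fst c \<inter> snd c -` ball (snd c p) s)" by (rule chart_preimage_open[OF c(1) open_ball])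
    show "p \<in> fst c \<inter> snd c -` ball (snd c p) s" using c s by simp
    fix q assume q: "q \<in> fst c \<inter> snd c -` ball (snd c p) s"
    then have "snd c q \<in> cball (snd c p) r" using s by auto
    moreover have "snd c p \<in> cball (snd c p) r" using r by simp
    ultimately obtain \<gamma> where "pwc 0 1 \<gamma>" "\<gamma> 0 = p" "\<gamma> 1 = q" "glen 0 1 \<gamma> \<le> \<Lambda> * norm (snd c q - snd c p)"
      using nice_ball_curve(1)[OF nb, of "snd c p" "snd c q"] chart_homeo(5)[OF c(1)] c(2) q by auto
    then have "dd p q \<le> \<Lambda> * norm (snd c q - snd c p)" using rdist_le_01[of \<gamma>] by simp
    also have "\<dots> < \<Lambda> * s" using q r by (simp add: dist_norm norm_minus_commute)
    finally show "dd p q < e" using s by simp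
  qed
qed

lemma dd_eq_0: "dd p q = 0 \<Longrightarrow> p = q"
proof (rule ccontr)
  assume "dd p q = 0" "p \<noteq> q"
  then show False using dd_ball_subset[of "- {q}" p] by force
qed

lemma dd_metric: "Metric_space UNIV dd"
  by unfold_locales (auto simp: dd_nonneg dd_sym dd_refl dd_triangle dest: dd_eq_0)

lemma dd_continuous: "continuous_on UNIV (\<lambda>x. dd x p)"
proof -
  have "isCont (\<lambda>x. dd x p) q" for q
    unfolding isCont_def tendsto_iff
  proof (intro allI impI)
    fix e :: real assume "e > 0"
    from dd_ball_nhd[OF this, of q] obtain W where W: "open W" "q \<in> W" "\<forall>x\<in>W. dd q x < e" by blast
    have "dist (dd x p) (dd q p) < e" if "x \<in> W" for x
    proof -
      have "\<bar>dd x p - dd q p\<bar> \<le> dd q x"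
        using dd_triangle[of x p q] dd_triangle[of q p x] dd_sym[of x q] by linarith
      then show ?thesis using W(3) that by (force simp: dist_real_def)
    qed
    then show "\<forall>\<^sub>F x in at q. dist (dd x p) (dd q p) < e"
      using W unfolding eventually_at_topological by blast
  qed
  then show ?thesis by (simp add: continuous_at_imp_continuous_on)
qed

text \<open>Completeness is stated for the abstract metric space, while compactness belongs to the
  topology of the type; this equality carries results from one to the other.\<close>

lemma dd_topology: "Metric_space.mtopology UNIV dd = euclidean"
proof -
  interpret Metric_space UNIV dd by (rule dd_metric)
  have "openin mtopology U \<longleftrightarrow> open U" for U
  proof
    assume "openin mtopology U"
    then have U: "\<exists>r>0. mball x r \<subseteq> U" if "x \<in> U" for x using that by (auto simp: openin_mtopology)
    show "open U"
      unfolding open_subopen[of U]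
    proof
      fix x assume "x \<in> U"
      then obtain r where r: "r > 0" "mball x r \<subseteq> U" using U by blast
      from dd_ball_nhd[OF r(1), of x] obtain W where "open W" "x \<in> W" "\<forall>q\<in>W. dd x q < r" by blast
      then show "\<exists>T. open T \<and> x \<in> T \<and> T \<subseteq> U" using r by (intro exI[of _ W]) auto
    qed
  next
    assume "open U"
    then show "openin mtopology U"
      unfolding openin_mtopology using dd_ball_subset[of U] by (auto simp: subset_iff)
  qed
  then show ?thesis by (simp add: topology_eq)
qed

text \<open>The length space property: a nearly shortest curve is cut where its initial part has
  length s. It lets a larger ball be reached from a smaller one with small error.\<close>

lemma dd_split:
  assumes "dd p q < s + e" "s \<ge> 0" "e > 0"
  shows "\<exists>z. dd p z \<le> s \<and> dd z q < e"
proof -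
  obtain \<gamma> where \<gamma>: "pwc 0 1 \<gamma>" "\<gamma> 0 = p" "\<gamma> 1 = q" "glen 0 1 \<gamma> < s + e" using dd_witness[OF assms(1)] by blast
  show ?thesis
  proof (cases "glen 0 1 \<gamma> \<le> s")
    case True
    then show ?thesis using rdist_le_01[OF \<gamma>(1)] \<gamma> assms dd_refl by (intro exI[of _ q]) auto
  next
    case False
    have "continuous_on {0..1} (\<lambda>t. glen 0 t \<gamma>)"
      unfolding glen_def by (rule indefinite_integral_continuous_1[OF pwc_integrable[OF \<gamma>(1)]]) simp
    then obtain t where t: "0 \<le> t" "t \<le> 1" "glen 0 t \<gamma> = s"
      using IVT'[of "\<lambda>t. glen 0 t \<gamma>" 0 s 1] False assms glen_refl by auto
    have "t < 1" using t False by (cases "t = 1") auto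
    have "dd p (\<gamma> t) \<le> s"
    proof (cases "t = 0")
      case False
      then show ?thesis using rdist_le(1)[OF pwc_sub[OF \<gamma>(1), of 0 t]] t \<gamma> by simp
    qed (use \<gamma> dd_refl assms in simp)
    moreover have "dd (\<gamma> t) q < e"
      using rdist_le(1)[OF pwc_sub[OF \<gamma>(1), of t 1]] t \<gamma> \<open>t < 1\<close> glen_combine[OF \<gamma>(1), of t] by simp
    ultimately show ?thesis by blast
  qed
qed

lemma locally_compact_dd: "\<exists>e>0. \<exists>K. compact K \<and> (\<forall>q. dd p q < e \<longrightarrow> q \<in> K)"
proof -
  obtain c where c: "c \<in> A" "p \<in> fst c" using ex_chart by blast
  obtain r \<Lambda> where nb: "nice_ball c (snd c p) r \<Lambda>" using ex_nice_ball[OF c] by blast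
  have sub: "cball (snd c p) r \<subseteq> snd c ` fst c" "r > 0" using nb by (auto simp: nice_ball_def)
  have "open (fst c \<inter> snd c -` ball (snd c p) r)" by (rule chart_preimage_open[OF c(1) open_ball])
  moreover have "p \<in> fst c \<inter> snd c -` ball (snd c p) r" using c sub by simp
  ultimately obtain e where e: "e > 0" "\<forall>q. dd p q < e \<longrightarrow> q \<in> fst c \<inter> snd c -` ball (snd c p) r"
    using dd_ball_subset by blast
  have "q \<in> coord_inv c ` cball (snd c p) r" if "dd p q < e" for q
    unfolding chart_inv_image[OF c(1) sub(1)] using e(2) that by (force simp: less_imp_le)
  then show ?thesis using e(1) nice_ball_compact[OF nb order_refl] by blast
qed

end

section \<open>Completeness and compactness of closed balls\<close>

locale complete_riem = conn_riem +
  assumes complete: "riemannian_complete A g"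
begin

lemma closed_dd_ball: "closed {x. dd x p \<le> \<rho>}"
  using continuous_closed_vimage[of "{..\<rho>}" "\<lambda>x. dd x p"] dd_continuous[of p]
  by (simp add: vimage_def continuous_on_eq_continuous_at)

text \<open>In a length space every point of the ball lies close to a slightly smaller concentric
  ball, so a net of the compact smaller ball is a coarser net of the larger one. Total boundedness
  and completeness then give compactness.\<close>

lemma compact_dd_ball_limit:
  assumes "\<rho> > 0" "\<And>s. 0 \<le> s \<Longrightarrow> s < \<rho> \<Longrightarrow> compact {x. dd x p \<le> s}"
  shows "compact {x. dd x p \<le> \<rho>}"
proof -
  interpret Metric_space UNIV dd by (rule dd_metric)
  have mc: "mcomplete" using complete by (simp add: riemannian_complete_def)
  have "mtotally_bounded {x. dd x p \<le> \<rho>}"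
    unfolding mtotally_bounded_def
  proof (intro allI impI)
    fix e :: real assume e: "e > 0"
    \<comment> \<open>With this radius a point of the ball is within 2e/3 of the smaller ball and
      from there within e/3 of the net.\<close>
    define s where "s = max 0 (\<rho> - e / 3)"
    have s: "0 \<le> s" "s < \<rho>" "\<rho> - e / 3 \<le> s" using assms(1) e by (auto simp: s_def)
    have "compactin mtopology {x. dd x p \<le> s}" using assms(2)[OF s(1,2)] by (simp add: dd_topology)
    then have "mtotally_bounded {x. dd x p \<le> s}" by (rule compactin_imp_mtotally_bounded)
    then obtain K where K: "finite K" "K \<subseteq> {x. dd x p \<le> s}" "{x. dd x p \<le> s} \<subseteq> (\<Union>x\<in>K. mball x (e / 3))"
      unfolding mtotally_bounded_def using e by (meson divide_pos_pos zero_less_numeral)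
    have "x \<in> (\<Union>y\<in>K. mball y e)" if x: "dd x p \<le> \<rho>" for x
    proof -
      have "dd p x < s + 2 * e / 3" using x s(3) e dd_sym[of p x] by simp
      then obtain z where z: "dd p z \<le> s" "dd z x < 2 * e / 3" using dd_split[of p x s "2 * e / 3"] s e by auto
      then have "z \<in> {x. dd x p \<le> s}" using dd_sym[of p z] by simp
      then obtain y where y: "y \<in> K" "dd y z < e / 3" using K(3) by auto
      then have "dd y x < e" using z dd_triangle[of y x z] by simp
      then show ?thesis using y by auto
    qed
    then show "\<exists>K. finite K \<and> K \<subseteq> {x. dd x p \<le> \<rho>} \<and> {x. dd x p \<le> \<rho>} \<subseteq> (\<Union>x\<in>K. mball x e)"
      using K s by (intro exI[of _ K]) auto
  qed
  then have "compactin mtopology (mtopology closure_of {x. dd x p \<le> \<rho>})"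
    using mtotally_bounded_eq_compact_closure_of[OF mc] by blast
  then show ?thesis using closed_dd_ball by (simp add: dd_topology)
qed

text \<open>Finitely many points with relatively compact neighbourhoods serve the whole ball, and
  \<open>d\<close> is a margin valid for all of them. Only half of it is used, since
  \<open>dd_split\<close> needs a strict inequality. The 1 in the minimum guards against an empty
  family.\<close>

lemma compact_dd_ball_extend:
  assumes "\<rho> \<ge> 0" "compact {x. dd x p \<le> \<rho>}"
  shows "\<exists>\<rho>'>\<rho>. compact {x. dd x p \<le> \<rho>'}"
proof -
  obtain e K where eK: "\<And>x. e x > 0" "\<And>x. compact (K x)" "\<And>x q. dd x q < e x \<Longrightarrow> q \<in> K x"
    using locally_compact_dd by metis
  have "\<forall>x. \<exists>W. open W \<and> x \<in> W \<and> (\<forall>q\<in>W. dd x q < e x / 2)"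
    by (intro allI dd_ball_nhd half_gt_zero eK(1))
  then obtain W where W: "\<And>x. open (W x)" "\<And>x. x \<in> W x" "\<And>x q. q \<in> W x \<Longrightarrow> dd x q < e x / 2"
    by metis
  obtain F where F: "F \<subseteq> {x. dd x p \<le> \<rho>}" "finite F" "{x. dd x p \<le> \<rho>} \<subseteq> (\<Union>x\<in>F. W x)"
    using compactE_image[OF assms(2), of "{x. dd x p \<le> \<rho>}" W] W(1,2) by blast
  define d where "d = Min (insert 1 ((\<lambda>x. e x / 2) ` F))"
  have "d > 0" using F(2) eK(1) by (auto simp: d_def)
  moreover have "d \<le> e x / 2" if "x \<in> F" for x
    unfolding d_def by (rule Min_le) (use F(2) that in auto)
  ultimately have d: "d > 0" "\<And>x. x \<in> F \<Longrightarrow> d \<le> e x / 2" by auto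
  have "{x. dd x p \<le> \<rho> + d / 2} \<subseteq> (\<Union>x\<in>F. K x)"
  proof
    fix y assume "y \<in> {x. dd x p \<le> \<rho> + d / 2}"
    then have "dd p y < \<rho> + d" using d dd_sym[of p y] by simp
    then obtain z where z: "dd p z \<le> \<rho>" "dd z y < d" using dd_split assms(1) d(1) by blast
    then obtain x where x: "x \<in> F" "z \<in> W x" using F(3) dd_sym[of p z] by auto
    have "dd x y < e x" using W(3)[OF x(2)] d(2)[OF x(1)] z(2) dd_triangle[of x y z] by simp
    then show "y \<in> (\<Union>x\<in>F. K x)" using eK(3) x(1) by blast
  qed
  moreover have "compact (\<Union>x\<in>F. K x)" using F(2) eK(2) by blast
  ultimately have "compact {x. dd x p \<le> \<rho> + d / 2}"
    using closed_dd_ball compact_Int_closed by (metis inf.absorb_iff2)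
  then show ?thesis using d by (intro exI[of _ "\<rho> + d / 2"]) auto
qed

text \<open>The Hopf--Rinow theorem, in the form valid for complete locally compact length spaces.\<close>

lemma compact_dd_ball: "compact {x. dd x p \<le> \<rho>}"
proof (rule ccontr)
  assume n: "\<not> compact {x. dd x p \<le> \<rho>}"
  have mono: "compact {x. dd x p \<le> s}" if "compact {x. dd x p \<le> t}" "s \<le> t" for s t
  proof -
    have "{x. dd x p \<le> s} = {x. dd x p \<le> t} \<inter> {x. dd x p \<le> s}" using that(2) by auto
    then show ?thesis using compact_Int_closed[OF that(1) closed_dd_ball] by metis
  qed
  define S where "S = {s. 0 \<le> s \<and> compact {x. dd x p \<le> s}}"
  have "{x. dd x p \<le> 0} = {p}" using dd_nonneg dd_eq_0 dd_refl by (auto simp: order.antisym)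
  then have S0: "0 \<in> S" by (simp add: S_def)
  have bd: "s \<le> \<rho>" if "s \<in> S" for s using that n mono[of s \<rho>] unfolding S_def by force
  then have bdd: "bdd_above S" by (rule bdd_aboveI)
  define t where "t = Sup S"
  have t: "0 \<le> t" unfolding t_def using cSup_upper[OF S0 bdd] .
  have lt: "compact {x. dd x p \<le> s}" if s: "s < t" for s
  proof -
    obtain s' where "s' \<in> S" "s < s'" using s S0 less_cSup_iff[OF _ bdd] unfolding t_def by blast
    then show ?thesis using mono[of s' s] by (simp add: S_def)
  qed
  have ct: "compact {x. dd x p \<le> t}"
  proof (cases "t = 0")
    case True
    then show ?thesis using S0 by (simp add: S_def)
  next
    case False
    then show ?thesis using compact_dd_ball_limit[of t p] lt t by simp
  qed
  then obtain t' where "t' > t" "compact {x. dd x p \<le> t'}" using compact_dd_ball_extend[OF t ct] by blast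
  then have "t' \<in> S" using t by (simp add: S_def)
  then have "t' \<le> t" unfolding t_def using cSup_upper[OF _ bdd] by blast
  then show False using \<open>t' > t\<close> by simp
qed

end

section \<open>The Riemannian volume\<close>

subsection \<open>Change of variables for non-negative integrals\<close>

text \<open>
  The library states the change of variables formula only for well-ordered index types, so the
  index type is copied and the copy ordered by an enumeration.
\<close>

typedef 'm ordered_copy = "UNIV :: 'm set" morphisms oc_rep oc_abs by auto

lemma oc_bij: "bij oc_rep" "bij oc_abs"
  by (auto intro!: bij_betw_byWitness[where f' = oc_abs] bij_betw_byWitness[where f' = oc_rep]
      simp: oc_abs_inverse oc_rep_inverse)

instance ordered_copy :: (finite) finite
proof
  have "(UNIV :: 'a ordered_copy set) = oc_abs ` UNIV" using bij_is_surj[OF oc_bij(2)] by auto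
  then show "finite (UNIV :: 'a ordered_copy set)" by (metis finite finite_imageI)
qed

instantiation ordered_copy :: (finite) wellorder
begin

definition less_eq_ordered_copy :: "'a ordered_copy \<Rightarrow> 'a ordered_copy \<Rightarrow> bool" where
  "x \<le> y \<longleftrightarrow> to_nat_on (UNIV :: 'a set) (oc_rep x) \<le> to_nat_on UNIV (oc_rep y)"

definition less_ordered_copy :: "'a ordered_copy \<Rightarrow> 'a ordered_copy \<Rightarrow> bool" where
  "x < y \<longleftrightarrow> to_nat_on (UNIV :: 'a set) (oc_rep x) < to_nat_on UNIV (oc_rep y)"

instance
proof
  fix x y z :: "'a ordered_copy" and P :: "'a ordered_copy \<Rightarrow> bool"
  have inj: "to_nat_on (UNIV :: 'a set) a = to_nat_on UNIV b \<Longrightarrow> a = b" for a b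
    using inj_on_to_nat_on[of "UNIV :: 'a set"] by (simp add: countable_finite inj_on_def)
  show "x \<le> y \<Longrightarrow> y \<le> x \<Longrightarrow> x = y"
    unfolding less_eq_ordered_copy_def using inj oc_rep_inject by (metis order.antisym)
  show "x < y \<longleftrightarrow> x \<le> y \<and> \<not> y \<le> x" "x \<le> x" "x \<le> y \<Longrightarrow> y \<le> z \<Longrightarrow> x \<le> z" "x \<le> y \<or> y \<le> x"
    by (auto simp: less_eq_ordered_copy_def less_ordered_copy_def)
  assume "\<And>x. (\<And>y. y < x \<Longrightarrow> P y) \<Longrightarrow> P x"
  then show "P z"
    using measure_induct_rule[of "\<lambda>x. to_nat_on (UNIV :: 'a set) (oc_rep x)" P z]
    by (simp add: less_ordered_copy_def)
qed

end

definition oc_vec :: "'b ^ 'm \<Rightarrow> 'b ^ 'm ordered_copy" where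
  "oc_vec x = (\<chi> i. x $ oc_rep i)"

definition oc_unvec :: "'b ^ 'm ordered_copy \<Rightarrow> 'b ^ 'm" where
  "oc_unvec x = (\<chi> i. x $ oc_abs i)"

lemma oc_vec_inverse [simp]: "oc_unvec (oc_vec x) = x" "oc_vec (oc_unvec y) = y"
  by (simp_all add: oc_vec_def oc_unvec_def vec_eq_iff oc_abs_inverse oc_rep_inverse)

lemma oc_vec_linear:
  "bounded_linear (oc_vec :: real ^ 'm::finite \<Rightarrow> real ^ 'm ordered_copy)"
  "bounded_linear (oc_unvec :: real ^ 'm ordered_copy \<Rightarrow> real ^ 'm)"
  by (auto intro!: linear_conv_bounded_linear[THEN iffD1] linearI simp: oc_vec_def oc_unvec_def vec_eq_iff)

lemma prod_Basis_vec: "(\<Prod>b\<in>Basis. (x :: real ^ 'm::finite) \<bullet> b) = (\<Prod>i\<in>UNIV. x $ i)"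
proof -
  have "(Basis :: (real ^ 'm) set) = range (\<lambda>i. axis i 1)" by (auto simp: Basis_vec_def)
  moreover have "inj (\<lambda>i :: 'm. axis i (1::real))" by (auto simp: inj_def axis_eq_axis)
  ultimately have "(\<Prod>b\<in>Basis. x \<bullet> b) = (\<Prod>i\<in>UNIV. x \<bullet> axis i 1)"
    using prod.reindex[of "\<lambda>i :: 'm. axis i (1::real)" UNIV "\<lambda>b. x \<bullet> b"] by (simp add: o_def)
  then show ?thesis by (simp add: cart_eq_inner_axis)
qed

lemma distr_oc_vec: "distr lborel borel oc_vec = (lborel :: (real ^ 'm::finite ordered_copy) measure)"
proof (rule lborel_eqI[symmetric])
  have m: "oc_vec \<in> borel_measurable (borel :: (real ^ 'm) measure)"
    by (intro borel_measurable_continuous_onI linear_continuous_on oc_vec_linear)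
  fix l u :: "real ^ 'm ordered_copy" assume le: "\<And>b. b \<in> Basis \<Longrightarrow> l \<bullet> b \<le> u \<bullet> b"
  have le': "l $ i \<le> u $ i" for i using le[of "axis i 1"] by (auto simp: Basis_vec_def cart_eq_inner_axis)
  have "oc_vec -` box l u = box (oc_unvec l) (oc_unvec u)"
    by (auto simp: mem_box_cart oc_vec_def oc_unvec_def) (metis UNIV_I oc_abs_inverse oc_rep_inverse)+
  then have "emeasure (distr lborel borel oc_vec) (box l u) = emeasure lborel (box (oc_unvec l) (oc_unvec u))"
    using m by (simp add: emeasure_distr)
  also have "\<dots> = ennreal (\<Prod>b\<in>Basis. (oc_unvec u - oc_unvec l) \<bullet> b)"
  proof (rule emeasure_lborel_box)
    fix b :: "real ^ 'm" assume "b \<in> Basis"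
    then show "oc_unvec l \<bullet> b \<le> oc_unvec u \<bullet> b"
      using le' by (auto simp: Basis_vec_def oc_unvec_def cart_eq_inner_axis[symmetric])
  qed
  also have "(\<Prod>b\<in>Basis. (oc_unvec u - oc_unvec l) \<bullet> b) = (\<Prod>i\<in>UNIV. (u - l) $ oc_abs i)"
    by (simp add: prod_Basis_vec oc_unvec_def)
  also have "\<dots> = (\<Prod>i\<in>UNIV. (u - l) $ i)"
    by (rule prod.reindex_bij_betw[OF oc_bij(2)])
  also have "\<dots> = (\<Prod>b\<in>Basis. (u - l) \<bullet> b)" by (simp only: prod_Basis_vec)
  finally show "emeasure (distr lborel borel oc_vec) (box l u) = ennreal (\<Prod>b\<in>Basis. (u - l) \<bullet> b)" .
qed simp

text \<open>Conjugation with the bijection between the index types matches the permutations on both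
  sides and preserves their signs.\<close>

lemma det_ordered_copy:
  fixes M :: "real ^ 'm ^ 'm::finite"
  shows "det (\<chi> i j. M $ oc_rep i $ oc_rep j) = det M"
proof -
  let ?T = "\<lambda>q. oc_abs \<circ> q \<circ> oc_rep" and ?R = "\<lambda>p. oc_rep \<circ> p \<circ> oc_abs"
  have inv: "oc_rep (oc_abs x) = x" "oc_abs (oc_rep y) = y" for x and y
    by (simp_all add: oc_abs_inverse oc_rep_inverse)
  have mp: "map_permutation UNIV oc_abs q = ?T q" for q :: "'m \<Rightarrow> 'm"
    using bij_is_surj[OF oc_bij(2)] bij_is_inj[OF oc_bij(2)]
    by (auto simp: map_permutation_def restrict_id_def fun_eq_iff inv_f_eq[OF bij_is_inj[OF oc_bij(2)] inv(2)])
  have perm: "?T q permutes UNIV" "sign (?T q) = sign q" if "q permutes (UNIV :: 'm set)" for q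
    using map_permutation_permutes[of oc_abs UNIV UNIV q] sign_map_permutation[of oc_abs UNIV q]
      that oc_bij(2) bij_is_inj[OF oc_bij(2)] mp by auto
  have "det M = (\<Sum>q | q permutes (UNIV :: 'm set). of_int (sign q) * (\<Prod>i\<in>UNIV. M $ i $ q i))"
    by (simp add: det_def)
  also have "\<dots> = (\<Sum>p | p permutes (UNIV :: 'm ordered_copy set). of_int (sign p) * (\<Prod>i\<in>UNIV. M $ oc_rep i $ oc_rep (p i)))"
  proof (rule sum.reindex_bij_witness[of _ ?R ?T])
    fix p :: "'m ordered_copy \<Rightarrow> 'm ordered_copy" assume "p \<in> {p. p permutes UNIV}"
    then have "bij p" by (simp add: permutes_imp_bij)
    then have "bij (?R p)" using oc_bij by (intro bij_comp)
    then show "?R p \<in> {q. q permutes UNIV}" using bij_imp_permutes[of "?R p" UNIV] by auto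
  next
    fix q :: "'m \<Rightarrow> 'm" assume q: "q \<in> {q. q permutes UNIV}"
    have "(\<Prod>i\<in>UNIV. M $ oc_rep i $ oc_rep (?T q i)) = (\<Prod>i\<in>UNIV. M $ oc_rep i $ q (oc_rep i))"
      by (simp add: inv)
    also have "\<dots> = (\<Prod>i\<in>UNIV. M $ i $ q i)"
      by (rule prod.reindex_bij_betw[OF oc_bij(1)])
    finally show "of_int (sign (?T q)) * (\<Prod>i\<in>UNIV. M $ oc_rep i $ oc_rep (?T q i)) = of_int (sign q) * (\<Prod>i\<in>UNIV. M $ i $ q i)"
      using perm q by simp
  qed (use perm in \<open>auto simp: fun_eq_iff inv\<close>)
  finally show ?thesis by (simp add: det_def)
qed

text \<open>Substitution is available for absolutely integrable functions. For a non-negative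
  function this determines the extended integral as well, since failure of integrability means the
  value infinity.\<close>

lemma nn_integral_absolutely_integrable:
  fixes f :: "'a::euclidean_space \<Rightarrow> real"
  assumes "(\<lambda>x. f x * indicator S x) \<in> borel_measurable borel" "\<And>x. x \<in> S \<Longrightarrow> f x \<ge> 0"
  shows "(\<integral>\<^sup>+x\<in>S. ennreal (f x) \<partial>lborel) = (if f absolutely_integrable_on S then ennreal (integral S f) else \<infinity>)"
proof -
  let ?F = "\<lambda>x. f x * indicator S x"
  have m: "?F \<in> borel_measurable lborel" using assms(1) by simp
  have n: "?F x \<ge> 0" for x using assms(2) by (auto simp: indicator_def)
  have e: "(\<integral>\<^sup>+x\<in>S. ennreal (f x) \<partial>lborel) = (\<integral>\<^sup>+x. ennreal (?F x) \<partial>lborel)"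
    by (rule nn_integral_cong) (auto simp: indicator_def)
  have i: "f absolutely_integrable_on S \<longleftrightarrow> integrable lborel ?F"
    using integrable_completion[OF m] by (simp add: set_integrable_def mult.commute)
  show ?thesis
  proof (cases "f absolutely_integrable_on S")
    case True
    have "(\<integral>\<^sup>+x. ennreal (?F x) \<partial>lborel) = ennreal (LINT x|lborel. ?F x)"
      by (rule nn_integral_eq_integral) (use True i n in auto)
    also have "(LINT x|lborel. ?F x) = (LINT x:S|lebesgue. f x)"
      using integral_completion[OF m] by (simp add: set_lebesgue_integral_def mult.commute)
    also have "\<dots> = integral S f" by (rule set_lebesgue_integral_eq_integral(2)[OF True])
    finally show ?thesis using True e by simp
  next
    case False
    then have "\<not> integrable lborel ?F" using i by simp
    then have "(\<integral>\<^sup>+x. ennreal (norm (?F x)) \<partial>lborel) = \<infinity>"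
      using m unfolding integrable_iff_bounded by (simp add: less_top[symmetric])
    then show ?thesis using False e n by simp
  qed
qed

lemma nn_integral_change_of_variables_wellorder:
  fixes F :: "real ^ 'm::{finite,wellorder} \<Rightarrow> real ^ 'm::_" and h :: "real ^ 'm::_ \<Rightarrow> real"
  assumes S: "S \<in> sets borel" and der: "\<And>x. x \<in> S \<Longrightarrow> (F has_derivative F' x) (at x)" and inj: "inj_on F S"
    and m1: "(\<lambda>x. \<bar>det (matrix (F' x))\<bar> * h (F x) * indicator S x) \<in> borel_measurable borel"
    and m2: "(\<lambda>y. h y * indicator (F ` S) y) \<in> borel_measurable borel" and nn: "\<And>y. y \<in> F ` S \<Longrightarrow> h y \<ge> 0"
  shows "(\<integral>\<^sup>+y\<in>F ` S. ennreal (h y) \<partial>lborel) = (\<integral>\<^sup>+x\<in>S. ennreal (\<bar>det (matrix (F' x))\<bar> * h (F x)) \<partial>lborel)"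
proof -
  have "S \<in> sets lebesgue" using S by simp
  moreover have "(F has_derivative F' x) (at x within S)" if "x \<in> S" for x using der[OF that] has_derivative_at_withinI by blast
  \<comment> \<open>The substitution rule concerns vector-valued functions, so scalars are embedded
    into \<open>real ^ 1\<close>. The free value \<open>b\<close> lets one equivalence express both
    integrability and equality of the integrals.\<close>
  ultimately have cov: "(\<lambda>x. \<bar>det (matrix (F' x))\<bar> *\<^sub>R (vec (h (F x)) :: real ^ 1)) absolutely_integrable_on S \<and>
      integral S (\<lambda>x. \<bar>det (matrix (F' x))\<bar> *\<^sub>R (vec (h (F x)) :: real ^ 1)) = b
     \<longleftrightarrow> (\<lambda>y. vec (h y) :: real ^ 1) absolutely_integrable_on (F ` S) \<and> integral (F ` S) (\<lambda>y. vec (h y)) = b" for b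
    using has_absolute_integral_change_of_variables[OF _ _ inj, of F' "\<lambda>y. vec (h y) :: real ^ 1"] by blast
  have "(\<lambda>x. \<bar>det (matrix (F' x))\<bar> * h (F x)) absolutely_integrable_on S \<and>
      integral S (\<lambda>x. \<bar>det (matrix (F' x))\<bar> * h (F x)) = b
     \<longleftrightarrow> h absolutely_integrable_on (F ` S) \<and> integral (F ` S) h = b" for b
    using cov[of "vec b"] by (simp add: absolutely_integrable_on_1_iff integral_on_1_eq vec_eq_iff)
  then have "(\<lambda>x. \<bar>det (matrix (F' x))\<bar> * h (F x)) absolutely_integrable_on S \<longleftrightarrow> h absolutely_integrable_on (F ` S)"
    and "h absolutely_integrable_on (F ` S) \<Longrightarrow> integral S (\<lambda>x. \<bar>det (matrix (F' x))\<bar> * h (F x)) = integral (F ` S) h"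
    by blast+
  moreover have "(\<integral>\<^sup>+y\<in>F ` S. ennreal (h y) \<partial>lborel) = (if h absolutely_integrable_on F ` S then ennreal (integral (F ` S) h) else \<infinity>)"
    by (rule nn_integral_absolutely_integrable[OF m2 nn])
  moreover have "(\<integral>\<^sup>+x\<in>S. ennreal (\<bar>det (matrix (F' x))\<bar> * h (F x)) \<partial>lborel)
     = (if (\<lambda>x. \<bar>det (matrix (F' x))\<bar> * h (F x)) absolutely_integrable_on S
        then ennreal (integral S (\<lambda>x. \<bar>det (matrix (F' x))\<bar> * h (F x))) else \<infinity>)"
    by (rule nn_integral_absolutely_integrable[OF m1]) (use nn in auto)
  ultimately show ?thesis by simp
qed

lemma matrix_ordered_copy:
  fixes L :: "real ^ 'm::finite \<Rightarrow> real ^ 'm"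
  assumes "linear L"
  shows "det (matrix (oc_vec \<circ> L \<circ> oc_unvec)) = det (matrix L)"
proof -
  have ax: "oc_unvec (axis j 1) = (axis (oc_rep j) 1 :: real ^ 'm)" for j
    by (auto simp: oc_unvec_def axis_def vec_eq_iff oc_abs_inverse oc_rep_inverse)
  have "matrix (oc_vec \<circ> L \<circ> oc_unvec) = (\<chi> i j. matrix L $ oc_rep i $ oc_rep j)"
    by (simp add: matrix_def vec_eq_iff ax oc_vec_def)
  then show ?thesis by (simp add: det_ordered_copy)
qed

lemma nn_integral_oc_vec:
  assumes "(\<lambda>x. f x * indicator S x) \<in> borel_measurable (borel :: (real ^ 'm::finite) measure)"
  shows "(\<integral>\<^sup>+y\<in>oc_vec ` S. ennreal (f (oc_unvec y)) \<partial>lborel) = (\<integral>\<^sup>+x\<in>S. ennreal (f x) \<partial>lborel)"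
    "(\<lambda>y. f (oc_unvec y) * indicator (oc_vec ` S) y) \<in> borel_measurable borel"
proof -
  have m: "oc_vec \<in> borel_measurable (borel :: (real ^ 'm) measure)"
      "oc_unvec \<in> borel_measurable (borel :: (real ^ 'm ordered_copy) measure)"
    by (intro borel_measurable_continuous_onI linear_continuous_on oc_vec_linear)+
  have ind: "indicator (oc_vec ` S) y = indicator S (oc_unvec y)" for y
    by (auto simp: indicator_def image_iff) (metis oc_vec_inverse)+
  show m2: "(\<lambda>y. f (oc_unvec y) * indicator (oc_vec ` S) y) \<in> borel_measurable borel"
    unfolding ind using measurable_compose[OF m(2) assms] .
  have "(\<integral>\<^sup>+y\<in>oc_vec ` S. ennreal (f (oc_unvec y)) \<partial>lborel)
      = (\<integral>\<^sup>+y. ennreal (f (oc_unvec y) * indicator (oc_vec ` S) y) \<partial>distr lborel borel oc_vec)"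
    unfolding distr_oc_vec by (rule nn_integral_cong) (auto simp: indicator_def)
  also have "\<dots> = (\<integral>\<^sup>+x. ennreal (f (oc_unvec (oc_vec x)) * indicator (oc_vec ` S) (oc_vec x)) \<partial>lborel)"
    using m m2 by (subst nn_integral_distr) auto
  also have "\<dots> = (\<integral>\<^sup>+x\<in>S. ennreal (f x) \<partial>lborel)"
    by (rule nn_integral_cong) (simp add: ind split: split_indicator)
  finally show "(\<integral>\<^sup>+y\<in>oc_vec ` S. ennreal (f (oc_unvec y)) \<partial>lborel) = (\<integral>\<^sup>+x\<in>S. ennreal (f x) \<partial>lborel)" .
qed

lemma nn_integral_change_of_variables:
  fixes F :: "real ^ 'm::finite \<Rightarrow> real ^ 'm" and h :: "real ^ 'm \<Rightarrow> real"
  assumes S: "S \<in> sets borel" and der: "\<And>x. x \<in> S \<Longrightarrow> (F has_derivative F' x) (at x)" and inj: "inj_on F S"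
    and m1: "(\<lambda>x. \<bar>det (matrix (F' x))\<bar> * h (F x) * indicator S x) \<in> borel_measurable borel"
    and m2: "(\<lambda>y. h y * indicator (F ` S) y) \<in> borel_measurable borel" and nn: "\<And>y. y \<in> F ` S \<Longrightarrow> h y \<ge> 0"
  shows "(\<integral>\<^sup>+y\<in>F ` S. ennreal (h y) \<partial>lborel) = (\<integral>\<^sup>+x\<in>S. ennreal (\<bar>det (matrix (F' x))\<bar> * h (F x)) \<partial>lborel)"
proof -
  let ?F = "\<lambda>x. oc_vec (F (oc_unvec x))" and ?F' = "\<lambda>x. oc_vec \<circ> F' (oc_unvec x) \<circ> oc_unvec"
    and ?S = "oc_vec ` S" and ?h = "\<lambda>y. h (oc_unvec y)"
  have im: "?F ` ?S = oc_vec ` F ` S" by (auto simp: image_iff)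
  have det: "det (matrix (?F' x)) = det (matrix (F' (oc_unvec x)))" if "x \<in> ?S" for x
    using that by (intro matrix_ordered_copy has_derivative_linear[OF der]) auto
  have "(\<lambda>x. \<bar>det (matrix (?F' x))\<bar> * ?h (?F x) * indicator ?S x)
     = (\<lambda>x. \<bar>det (matrix (F' (oc_unvec x)))\<bar> * h (F (oc_unvec x)) * indicator ?S x)"
    using det by (auto simp: indicator_def fun_eq_iff)
  then have m1': "(\<lambda>x. \<bar>det (matrix (?F' x))\<bar> * ?h (?F x) * indicator ?S x) \<in> borel_measurable borel"
    using nn_integral_oc_vec(2)[OF m1] by simp
  have m2': "(\<lambda>y. ?h y * indicator (?F ` ?S) y) \<in> borel_measurable borel"
    unfolding im by (rule nn_integral_oc_vec(2)[OF m2])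
  have "?S = oc_unvec -` S" by (auto simp: image_iff) (metis oc_vec_inverse)
  moreover have "oc_unvec \<in> borel_measurable (borel :: (real ^ 'm ordered_copy) measure)"
    by (intro borel_measurable_continuous_onI linear_continuous_on oc_vec_linear)
  ultimately have S': "?S \<in> sets borel" using measurable_sets_borel[OF _ S] by metis
  have der': "(?F has_derivative ?F' x) (at x)" if "x \<in> ?S" for x
  proof -
    have "(F has_derivative F' (oc_unvec x)) (at (oc_unvec x))" using der that by auto
    from has_derivative_compose[OF bounded_linear.has_derivative[OF oc_vec_linear(2) has_derivative_ident] this]
    have "((\<lambda>x. F (oc_unvec x)) has_derivative (\<lambda>v. F' (oc_unvec x) (oc_unvec v))) (at x)" .
    from bounded_linear.has_derivative[OF oc_vec_linear(1) this] show ?thesis by (simp add: o_def)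
  qed
  have inj': "inj_on ?F ?S"
    using inj by (auto simp: inj_on_def) (metis oc_vec_inverse(1))
  have nn': "?h y \<ge> 0" if "y \<in> ?F ` ?S" for y using that nn by auto
  have "(\<integral>\<^sup>+y\<in>F ` S. ennreal (h y) \<partial>lborel) = (\<integral>\<^sup>+y\<in>?F ` ?S. ennreal (?h y) \<partial>lborel)"
    unfolding im by (rule nn_integral_oc_vec(1)[OF m2, symmetric])
  also have "\<dots> = (\<integral>\<^sup>+x\<in>?S. ennreal (\<bar>det (matrix (?F' x))\<bar> * ?h (?F x)) \<partial>lborel)"
    by (rule nn_integral_change_of_variables_wellorder[OF S' der' inj' m1' m2' nn'])
  also have "\<dots> = (\<integral>\<^sup>+x\<in>?S. ennreal (\<bar>det (matrix (F' (oc_unvec x)))\<bar> * h (F (oc_unvec x))) \<partial>lborel)"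
    by (rule nn_integral_cong) (auto simp: indicator_def det)
  also have "\<dots> = (\<integral>\<^sup>+x\<in>S. ennreal (\<bar>det (matrix (F' x))\<bar> * h (F x)) \<partial>lborel)"
    by (rule nn_integral_oc_vec(1)[OF m1])
  finally show ?thesis .
qed

lemma suminf_swap_ennreal:
  fixes f :: "nat \<Rightarrow> nat \<Rightarrow> ennreal"
  shows "(\<Sum>n. \<Sum>i. f n i) = (\<Sum>i. \<Sum>n. f n i)"
proof -
  have "(\<Sum>n. \<Sum>i. f n i) = (\<Sum>n. \<integral>\<^sup>+i. f n i \<partial>count_space UNIV)"
    by (simp add: nn_integral_count_space_nat)
  also have "\<dots> = (\<integral>\<^sup>+i. (\<Sum>n. f n i) \<partial>count_space UNIV)"
    by (rule nn_integral_suminf[symmetric]) simp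
  also have "\<dots> = (\<Sum>i. \<Sum>n. f n i)" by (simp add: nn_integral_count_space_nat)
  finally show ?thesis .
qed

context riem
begin

subsection \<open>Existence and uniqueness of the volume measure\<close>

definition dens :: "('a, 'm) chart \<Rightarrow> real ^ 'm \<Rightarrow> real" where
  "dens c y = sqrt (det (g c (coord_inv c y)))"

definition chart_vol :: "('a, 'm) chart \<Rightarrow> 'a set \<Rightarrow> ennreal" where
  "chart_vol c E = (\<integral>\<^sup>+y\<in>snd c ` E. ennreal (dens c y) \<partial>lborel)"

context
  fixes c assumes c: "c \<in> A"
begin

lemma borel_indicator_chart:
  fixes f :: "real ^ 'm \<Rightarrow> real"
  assumes "E \<in> sets borel" "E \<subseteq> fst c" and f: "continuous_on (snd c ` E) f"
  shows "snd c ` E \<in> sets borel" "(\<lambda>y. f y * indicator (snd c ` E) y) \<in> borel_measurable borel"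
proof -
  have U: "snd c ` fst c \<in> sets borel" using chart_homeo(2)[OF c] by simp
  have "coord_inv c \<in> borel_measurable (restrict_space borel (snd c ` fst c))"
    by (rule borel_measurable_continuous_on_restrict[OF chart_homeo(4)[OF c]])
  from measurable_sets[OF this assms(1)]
  have "coord_inv c -` E \<inter> snd c ` fst c \<in> sets (restrict_space borel (snd c ` fst c))"
    by (simp add: space_restrict_space)
  then have "coord_inv c -` E \<inter> snd c ` fst c \<in> sets borel"
    using U by (simp add: sets_restrict_space_iff)
  also have "coord_inv c -` E \<inter> snd c ` fst c = snd c ` E" using chart_image_eq[OF c assms(2)] by blast
  finally show S: "snd c ` E \<in> sets borel" .
  have "(\<lambda>y. indicator (snd c ` E) y *\<^sub>R f y) \<in> borel_measurable borel"
    by (rule borel_measurable_continuous_on_indicator[OF S f])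
  then show "(\<lambda>y. f y * indicator (snd c ` E) y) \<in> borel_measurable borel"
    by (simp add: mult.commute)
qed

lemma dens_continuous: "continuous_on (snd c ` fst c) (dens c)"
proof -
  have "continuous_on (snd c ` fst c) (\<lambda>y. g c (coord_inv c y))"
    by (rule continuous_on_compose2[OF metric_continuous[OF c] chart_homeo(4)[OF c]])
      (use chart_homeo(7)[OF c] in auto)
  then show ?thesis unfolding dens_def[abs_def] by (intro continuous_intros continuous_on_det)
qed

lemma dens_pos: "y \<in> snd c ` fst c \<Longrightarrow> dens c y > 0"
  unfolding dens_def using pos_def_det_pos[OF metric_pos_def[OF c chart_homeo(7)[OF c]]] by simp

lemma chart_vol_density:
  assumes "E \<in> sets borel" "E \<subseteq> fst c"
  shows "chart_vol c E = emeasure (density lborel (\<lambda>y. ennreal (dens c y * indicator (snd c ` fst c) y))) (snd c ` E)"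
proof -
  have "(\<lambda>y. dens c y * indicator (snd c ` fst c) y) \<in> borel_measurable borel"
    by (rule borel_indicator_chart(2)) (use chart_homeo(1)[OF c] dens_continuous in auto)
  then have "emeasure (density lborel (\<lambda>y. ennreal (dens c y * indicator (snd c ` fst c) y))) (snd c ` E)
     = (\<integral>\<^sup>+y. ennreal (dens c y * indicator (snd c ` fst c) y) * indicator (snd c ` E) y \<partial>lborel)"
    using borel_indicator_chart(1)[OF assms continuous_on_const[of _ 0]] by (subst emeasure_density) auto
  also have "\<dots> = chart_vol c E"
    unfolding chart_vol_def by (rule nn_integral_cong) (use assms(2) in \<open>auto simp: indicator_def\<close>)
  finally show ?thesis by simp
qed

lemma chart_vol_suminf:
  assumes "\<And>i :: nat. E i \<in> sets borel" "\<And>i. E i \<subseteq> fst c" "disjoint_family E"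
  shows "(\<Sum>i. chart_vol c (E i)) = chart_vol c (\<Union>i. E i)"
proof -
  let ?M = "density lborel (\<lambda>y. ennreal (dens c y * indicator (snd c ` fst c) y))"
  have "(\<Sum>i. emeasure ?M (snd c ` E i)) = emeasure ?M (\<Union>i. snd c ` E i)"
  proof (rule suminf_emeasure)
    show "range (\<lambda>i. snd c ` E i) \<subseteq> sets ?M"
      using borel_indicator_chart(1)[OF assms(1,2) continuous_on_const[of _ 0]] by auto
    have "snd c ` E i \<inter> snd c ` E j = {}" if "i \<noteq> j" for i j
    proof -
      have "inj_on (snd c) (fst c)" by (rule inj_on_inverseI[where g = "coord_inv c"]) (rule chart_homeo(5)[OF c])
      then have "snd c ` E i \<inter> snd c ` E j = snd c ` (E i \<inter> E j)"
        using assms(2) by (simp add: inj_on_image_Int)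
      then show ?thesis using assms(3) that by (simp add: disjoint_family_on_def)
    qed
    then show "disjoint_family (\<lambda>i. snd c ` E i)" by (simp add: disjoint_family_on_def)
  qed
  moreover have "(\<Union>i. E i) \<in> sets borel" "(\<Union>i. E i) \<subseteq> fst c" using assms by auto
  ultimately show ?thesis
    using assms by (simp add: chart_vol_density image_UN)
qed

end

text \<open>The determinant of the Gram matrix changes by the square of the Jacobian determinant.
  Its root thus absorbs exactly the factor that appears in the change of variables.\<close>

lemma chart_vol_change:
  assumes c: "c \<in> A" and d: "d \<in> A" and E: "E \<in> sets borel" "E \<subseteq> fst c" "E \<subseteq> fst d"
  shows "chart_vol c E = chart_vol d E"
proof -
  let ?F = "snd d \<circ> coord_inv c" and ?J = "\<lambda>y. trans_mat c d (coord_inv c y)"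
  have in_c: "coord_inv c y \<in> E" "coord_inv c y \<in> fst c" "coord_inv c y \<in> fst d" "y \<in> snd c ` fst c" if y: "y \<in> snd c ` E" for y
  proof -
    obtain p where p: "p \<in> E" "y = snd c p" using y by blast
    then have "coord_inv c y = p" using chart_homeo(5)[OF c] E(2) by auto
    then show "coord_inv c y \<in> E" "coord_inv c y \<in> fst c" "coord_inv c y \<in> fst d" "y \<in> snd c ` fst c"
      using p E by auto
  qed
  have im: "?F ` snd c ` E = snd d ` E"
    using chart_homeo(5)[OF c] E(2) by (force simp: image_iff)
  have dens: "dens c y = \<bar>det (?J y)\<bar> * dens d (?F y)" if "y \<in> snd c ` E" for y
  proof -
    note p = in_c(2,3)[OF that]
    have "det (g c (coord_inv c y)) = (det (?J y))\<^sup>2 * det (g d (coord_inv c y))"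
      unfolding metric_change[OF c d p] by (simp add: det_mul det_transpose power2_eq_square)
    then have "dens c y = \<bar>det (?J y)\<bar> * sqrt (det (g d (coord_inv c y)))"
      by (simp add: dens_def real_sqrt_mult)
    then show ?thesis by (simp add: dens_def chart_homeo(5)[OF d p(2)])
  qed
  have m: "matrix (\<lambda>v. ?J y *v v) = ?J y" for y by (rule matrix_of_matrix_vector_mul)
  have cJ: "continuous_on (snd c ` E) ?J"
    by (rule continuous_on_compose2[OF trans_mat_continuous[OF c d] continuous_on_subset[OF chart_homeo(4)[OF c]]])
      (use E in_c in auto)
  have "continuous_on (snd c ` E) ?F"
    using trans_smooth[OF c d, of 0] E by (auto intro: continuous_on_subset)
  then have cd: "continuous_on (snd c ` E) (\<lambda>y. dens d (?F y))"
    by (rule continuous_on_compose2[OF dens_continuous[OF d]]) (use im E in auto)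
  have "(\<integral>\<^sup>+y\<in>?F ` snd c ` E. ennreal (dens d y) \<partial>lborel)
    = (\<integral>\<^sup>+x\<in>snd c ` E. ennreal (\<bar>det (matrix (\<lambda>v. ?J x *v v))\<bar> * dens d (?F x)) \<partial>lborel)"
  proof (rule nn_integral_change_of_variables)
    show "snd c ` E \<in> sets borel" by (rule borel_indicator_chart(1)[OF c E(1,2) continuous_on_const[of _ 0]])
    show "(?F has_derivative (\<lambda>v. ?J y *v v)) (at y)" if "y \<in> snd c ` E" for y
      using trans_derivative[OF c d in_c(2,3)[OF that]] chart_homeo(6)[OF c in_c(4)[OF that]] by simp
    show "inj_on ?F (snd c ` E)"
    proof (rule inj_onI)
      fix x y assume xy: "x \<in> snd c ` E" "y \<in> snd c ` E" "?F x = ?F y"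
      have "coord_inv c x = coord_inv d (?F x)" by (simp add: chart_homeo(5)[OF d in_c(3)[OF xy(1)]])
      also have "\<dots> = coord_inv d (?F y)" by (simp only: xy(3))
      also have "\<dots> = coord_inv c y" by (simp add: chart_homeo(5)[OF d in_c(3)[OF xy(2)]])
      finally have "snd c (coord_inv c x) = snd c (coord_inv c y)" by simp
      then show "x = y" unfolding chart_homeo(6)[OF c in_c(4)[OF xy(1)]] chart_homeo(6)[OF c in_c(4)[OF xy(2)]] .
    qed
    show "(\<lambda>x. \<bar>det (matrix (\<lambda>v. ?J x *v v))\<bar> * dens d (?F x) * indicator (snd c ` E) x) \<in> borel_measurable borel"
      unfolding m by (rule borel_indicator_chart(2)[OF c E(1,2)]) (intro continuous_intros continuous_on_det cJ cd)
    show "(\<lambda>y. dens d y * indicator (?F ` snd c ` E) y) \<in> borel_measurable borel"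
      unfolding im by (rule borel_indicator_chart(2)[OF d E(1,3)])
        (use E in \<open>auto intro: continuous_on_subset[OF dens_continuous[OF d]]\<close>)
    show "dens d y \<ge> 0" if "y \<in> ?F ` snd c ` E" for y
      using that dens_pos[OF d, of y] E(3) unfolding im by force
  qed
  also have "\<dots> = chart_vol c E"
    unfolding chart_vol_def m by (rule nn_integral_cong) (auto simp: indicator_def dens)
  finally show ?thesis unfolding im chart_vol_def by simp
qed

definition is_vol :: "'a measure \<Rightarrow> bool" where
  "is_vol \<mu> \<longleftrightarrow> sets \<mu> = sets borel \<and> (\<forall>c\<in>A. \<forall>E\<in>sets borel. E \<subseteq> fst c \<longrightarrow> emeasure \<mu> E = chart_vol c E)"

lemma countable_charts:
  "\<exists>cn :: nat \<Rightarrow> ('a, 'm) chart. (\<forall>n. cn n \<in> A) \<and> (\<Union>n. fst (cn n)) = UNIV"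
proof -
  have "open S" if "S \<in> fst ` A" for S using that chart_homeo(1) by blast
  from Lindelof[OF this] obtain F where F: "F \<subseteq> fst ` A" "countable F" "\<Union>F = \<Union>(fst ` A)" by metis
  have "\<Union>(fst ` A) = UNIV" using ex_chart by blast
  then have U: "\<Union>F = UNIV" using F by simp
  then have ne: "F \<noteq> {}" by auto
  have "\<forall>n. \<exists>c\<in>A. fst c = from_nat_into F n" using F(1) from_nat_into[OF ne] by blast
  then obtain cn where cn: "\<And>n. cn n \<in> A \<and> fst (cn n) = from_nat_into F n" by metis
  have "(\<Union>n. fst (cn n)) = \<Union>(range (from_nat_into F))" using cn by simp
  then have "(\<Union>n. fst (cn n)) = UNIV" using range_from_nat_into[OF ne F(2)] U by simp
  then show ?thesis using cn by blast
qed

text \<open>Second countability gives countably many charts, whose domains are made disjoint.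
  Summing the chart volumes over these pieces defines a measure, and the invariance under change of
  chart shows that it has the right values in every chart. The pieces also determine any other such
  measure, which the definite description in \<open>rvol\<close> requires.\<close>

lemma ex1_vol: "\<exists>!\<mu>. is_vol \<mu>"
proof -
  obtain cn :: "nat \<Rightarrow> ('a, 'm) chart" where cn': "\<forall>n. cn n \<in> A" and U: "(\<Union>n. fst (cn n)) = UNIV"
    using countable_charts by blast
  have cn: "cn n \<in> A" "(\<Union>n. fst (cn n)) = UNIV" for n using cn' U by auto
  define D where "D = disjointed (\<lambda>n. fst (cn n))"
  have D: "D n \<in> sets borel" "D n \<subseteq> fst (cn n)" "disjoint_family D" "(\<Union>n. D n) = UNIV" for n
  proof -
    have "range (\<lambda>n. fst (cn n)) \<subseteq> sets borel" using chart_homeo(1)[OF cn(1)] by auto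
    then show "D n \<in> sets borel" unfolding D_def using sets.range_disjointed_sets[of "\<lambda>n. fst (cn n)" borel] by blast
    show "D n \<subseteq> fst (cn n)" unfolding D_def by (rule disjointed_subset)
    show "disjoint_family D" unfolding D_def by (rule disjoint_family_disjointed)
    show "(\<Union>n. D n) = UNIV" unfolding D_def UN_disjointed_eq by (rule cn(2))
  qed
  have split: "E \<inter> D n \<in> sets borel" "E \<inter> D n \<subseteq> fst (cn n)" "disjoint_family (\<lambda>n. E \<inter> D n)" "(\<Union>n. E \<inter> D n) = E"
    if Eb: "E \<in> sets borel" for E n
  proof -
    show "E \<inter> D n \<in> sets borel" using Eb D(1) by simp
    show "E \<inter> D n \<subseteq> fst (cn n)" using D(2)[of n] by blast
    show "disjoint_family (\<lambda>n. E \<inter> D n)"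
      by (rule disjoint_family_subset[OF D(3)]) simp
    have "(\<Union>n. E \<inter> D n) = E \<inter> (\<Union>n. D n)" by blast
    then show "(\<Union>n. E \<inter> D n) = E" using D(4) by simp
  qed
  define \<mu>0 where "\<mu>0 = (\<lambda>E. \<Sum>n. chart_vol (cn n) (E \<inter> D n))"
  define M where "M = measure_of UNIV (sets borel) \<mu>0"
  have sM: "sets M = sets borel" "space M = UNIV"
    unfolding M_def using sets.space_closed[of "borel :: 'a measure"] by (auto simp: sets.sigma_sets_eq space_borel[symmetric] simp del: space_borel)
  have ca: "countably_additive (sets M) \<mu>0"
    unfolding countably_additive_def
  proof (intro allI impI)
    fix E :: "nat \<Rightarrow> 'a set" assume E: "range E \<subseteq> sets M" "disjoint_family E"
    then have Eb: "E i \<in> sets borel" for i using sM by auto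
    have "(\<Sum>i. \<mu>0 (E i)) = (\<Sum>n. \<Sum>i. chart_vol (cn n) (E i \<inter> D n))"
      unfolding \<mu>0_def by (rule suminf_swap_ennreal)
    also have "\<dots> = (\<Sum>n. chart_vol (cn n) (\<Union>i. E i \<inter> D n))"
    proof -
      have "disjoint_family (\<lambda>i. E i \<inter> D n)" for n using E(2) unfolding disjoint_family_on_def by blast
      then have "(\<Sum>i. chart_vol (cn n) (E i \<inter> D n)) = chart_vol (cn n) (\<Union>i. E i \<inter> D n)" for n
        by (intro chart_vol_suminf[OF cn(1)] split Eb)
      then show ?thesis by simp
    qed
    also have "\<dots> = \<mu>0 (\<Union>(range E))" unfolding \<mu>0_def by simp
    finally show "(\<Sum>i. \<mu>0 (E i)) = \<mu>0 (\<Union>(range E))" .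
  qed
  have pos: "positive (sets M) \<mu>0"
    by (simp add: positive_def \<mu>0_def chart_vol_def)
  have em: "emeasure M E = \<mu>0 E" if "E \<in> sets borel" for E
  proof (rule emeasure_measure_of[OF M_def])
    show "sets borel \<subseteq> Pow (UNIV :: 'a set)" by simp
    show "E \<in> sets M" using that sM by simp
  qed (use ca pos in auto)
  have vol: "is_vol M"
    unfolding is_vol_def
  proof (intro conjI ballI impI sM(1))
    fix c E assume c: "c \<in> A" and E: "E \<in> sets borel" "E \<subseteq> fst c"
    have "emeasure M E = (\<Sum>n. chart_vol (cn n) (E \<inter> D n))" using em[OF E(1)] by (simp add: \<mu>0_def)
    also have "\<dots> = (\<Sum>n. chart_vol c (E \<inter> D n))"
      by (intro suminf_cong chart_vol_change[OF cn(1) c split(1,2)[OF E(1)]]) (use E(2) in auto)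
    also have "\<dots> = chart_vol c (\<Union>n. E \<inter> D n)"
      by (rule chart_vol_suminf[OF c]) (use split[OF E(1)] E(2) in auto)
    also have "\<dots> = chart_vol c E" using split(4)[OF E(1)] by simp
    finally show "emeasure M E = chart_vol c E" .
  qed
  show ?thesis
  proof (rule ex1I[of is_vol M, OF vol])
    fix \<mu> assume \<mu>: "is_vol \<mu>"
    show "\<mu> = M"
    proof (rule measure_eqI)
      show "sets \<mu> = sets M" using \<mu> sM by (simp add: is_vol_def)
      fix E assume "E \<in> sets \<mu>"
      then have E: "E \<in> sets borel" using \<mu> by (simp add: is_vol_def)
      have "emeasure \<mu> E = emeasure \<mu> (\<Union>n. E \<inter> D n)" using split(4)[OF E] by simp
      also have "\<dots> = (\<Sum>n. emeasure \<mu> (E \<inter> D n))"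
        by (rule suminf_emeasure[symmetric]) (use split[OF E] \<mu> in \<open>auto simp: is_vol_def\<close>)
      also have "\<dots> = (\<Sum>n. chart_vol (cn n) (E \<inter> D n))"
      proof (rule suminf_cong)
        fix n
        show "emeasure \<mu> (E \<inter> D n) = chart_vol (cn n) (E \<inter> D n)"
          using \<mu> cn(1)[of n] split(1,2)[OF E, of n] unfolding is_vol_def by blast
      qed
      also have "\<dots> = emeasure M E" using em[OF E] by (simp add: \<mu>0_def)
      finally show "emeasure \<mu> E = emeasure M E" .
    qed
  qed
qed

lemma is_vol_rvol: "is_vol (rvol A g)"
proof -
  have "rvol A g = (THE \<mu>. is_vol \<mu>)"
    unfolding rvol_def is_vol_def chart_vol_def dens_def ..
  then show ?thesis using theI'[OF ex1_vol] by simp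
qed

abbreviation "vol \<equiv> rvol A g"

lemma sets_vol [simp, measurable_cong]: "sets vol = sets borel"
  using is_vol_rvol by (simp add: is_vol_def)

lemma space_vol [simp]: "space vol = UNIV"
  using sets_eq_imp_space_eq[OF sets_vol] by simp

lemma emeasure_vol_chart: "c \<in> A \<Longrightarrow> E \<in> sets borel \<Longrightarrow> E \<subseteq> fst c \<Longrightarrow> emeasure vol E = chart_vol c E"
  using is_vol_rvol by (simp add: is_vol_def)

lemma emeasure_vol_compact: "compact K \<Longrightarrow> emeasure vol K < \<infinity>"
proof -
  assume K: "compact K"
  have "\<exists>V. open V \<and> p \<in> V \<and> emeasure vol V < \<infinity>" for p
  proof -
    obtain c where c: "c \<in> A" "p \<in> fst c" using ex_chart by blast
    obtain r where r: "r > 0" "cball (snd c p) r \<subseteq> snd c ` fst c"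
      using chart_homeo(2)[OF c(1)] c(2) open_contains_cball by blast
    define V where "V = fst c \<inter> snd c -` ball (snd c p) r"
    have V: "open V" "p \<in> V" "V \<subseteq> fst c"
      using chart_preimage_open[OF c(1) open_ball] c r by (auto simp: V_def)
    have "compact (dens c ` cball (snd c p) r)"
      by (intro compact_continuous_image continuous_on_subset[OF dens_continuous[OF c(1)] r(2)] compact_cball)
    from compact_imp_bounded[OF this] obtain B where B0: "\<forall>x\<in>dens c ` cball (snd c p) r. norm x \<le> B"
      unfolding bounded_iff by blast
    have B: "dens c y \<le> B" if "y \<in> cball (snd c p) r" for y
      using bspec[OF B0 imageI[OF that]] by simp
    have im: "snd c ` V \<subseteq> cball (snd c p) r" by (auto simp: V_def)
    have "emeasure vol V = chart_vol c V" by (rule emeasure_vol_chart[OF c(1) _ V(3)]) (use V in simp)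
    also have "\<dots> \<le> (\<integral>\<^sup>+y. ennreal B * indicator (cball (snd c p) r) y \<partial>lborel)"
      unfolding chart_vol_def
      by (rule nn_integral_mono) (use im B in \<open>auto simp: indicator_def intro!: ennreal_leI\<close>)
    also have "\<dots> = ennreal B * emeasure lborel (cball (snd c p) r)" by (rule nn_integral_cmult_indicator) simp
    also have "\<dots> < \<infinity>" using emeasure_lborel_cball_finite[of "snd c p" r] by (simp add: ennreal_mult_less_top)
    finally show ?thesis using V by blast
  qed
  then obtain V where V: "\<And>p. open (V p) \<and> p \<in> V p \<and> emeasure vol (V p) < \<infinity>" by metis
  obtain F where F: "F \<subseteq> K" "finite F" "K \<subseteq> (\<Union>p\<in>F. V p)"
    using compactE_image[OF K, of K V] V by blast
  have "emeasure vol K \<le> emeasure vol (\<Union>p\<in>F. V p)" by (rule emeasure_mono[OF F(3)]) (use V open_UN[of F V] in simp)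
  also have "\<dots> \<le> (\<Sum>p\<in>F. emeasure vol (V p))"
    by (rule emeasure_subadditive_finite[OF F(2)]) (use V in auto)
  also have "\<dots> < \<infinity>" using V F(2) by simp
  finally show ?thesis .
qed

text \<open>This ensures that the set where the truncation is large carries a positive volume, which
  keeps the main term of the energy estimate away from 0.\<close>

lemma emeasure_vol_open_pos: "open W \<Longrightarrow> W \<noteq> {} \<Longrightarrow> emeasure vol W > 0"
proof -
  assume W: "open W" "W \<noteq> {}"
  then obtain p where p: "p \<in> W" by blast
  obtain c where c: "c \<in> A" "p \<in> fst c" using ex_chart by blast
  let ?E = "W \<inter> fst c"
  have E: "open ?E" "?E \<subseteq> fst c" using W chart_homeo(1)[OF c(1)] by auto
  have oim: "open (snd c ` ?E)" by (rule chart_image_open[OF c(1) E])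
  have md: "(\<lambda>y. dens c y * indicator (snd c ` ?E) y) \<in> borel_measurable borel"
    by (rule borel_indicator_chart(2)[OF c(1) _ E(2)])
      (use E in \<open>auto intro: continuous_on_subset[OF dens_continuous[OF c(1)]]\<close>)
  have "chart_vol c ?E \<noteq> 0"
  proof
    assume "chart_vol c ?E = 0"
    then have "(\<integral>\<^sup>+y. ennreal (dens c y * indicator (snd c ` ?E) y) \<partial>lborel) = 0"
      unfolding chart_vol_def by (subst (asm) nn_integral_cong[of _ _ "\<lambda>y. ennreal (dens c y * indicator (snd c ` ?E) y)"])
        (auto simp: indicator_def)
    then have "AE y in lborel. ennreal (dens c y * indicator (snd c ` ?E) y) = 0"
      using md by (subst (asm) nn_integral_0_iff_AE) auto
    then have "AE y in lborel. y \<notin> snd c ` ?E"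
    proof (rule AE_mp, intro AE_I2 impI notI)
      fix y assume "ennreal (dens c y * indicator (snd c ` ?E) y) = 0" "y \<in> snd c ` ?E"
      then show False using dens_pos[OF c(1), of y] by (auto simp: ennreal_eq_0_iff)
    qed
    then have "snd c ` ?E \<in> null_sets lborel" using oim by (simp add: AE_iff_null_sets)
    then have "negligible (snd c ` ?E)" by (simp add: negligible_iff_null_sets null_sets_completionI)
    then show False using open_not_negligible[OF oim] p c by auto
  qed
  then have "emeasure vol ?E > 0" using emeasure_vol_chart[OF c(1) _ E(2)] E(1) by (simp add: zero_less_iff_neq_zero)
  also have "emeasure vol ?E \<le> emeasure vol W" by (rule emeasure_mono) (use W in auto)
  finally show ?thesis .
qed

end

section \<open>Cutoff functions and test functions of class \<open>C\<^sup>1\<close>\<close>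

text \<open>A power of the positive part, of class C^1 for \<alpha> > 1 even at 0. Real exponents
  are required because \<open>\<alpha>\<close> will be \<open>r powr (1 + \<delta>) / Q r\<close>;
  the exponent 2 provides elementary C^1 cutoffs.\<close>

definition ppow :: "real \<Rightarrow> real \<Rightarrow> real" where
  "ppow \<alpha> t = max 0 t powr \<alpha>"

lemma ppow_nonneg: "ppow \<alpha> t \<ge> 0" and ppow_nonpos: "t \<le> 0 \<Longrightarrow> ppow \<alpha> t = 0"
  and ppow_pos: "t > 0 \<Longrightarrow> ppow \<alpha> t = t powr \<alpha>"
  by (auto simp: ppow_def max_def)

lemma ppow_continuous: "\<alpha> > 0 \<Longrightarrow> continuous_on S (ppow \<alpha>)"
  unfolding ppow_def[abs_def] by (intro continuous_on_powr' continuous_intros) auto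

lemma ppow_deriv:
  assumes "\<alpha> > 1"
  shows "(ppow \<alpha> has_real_derivative \<alpha> * ppow (\<alpha> - 1) t) (at t)"
proof -
  consider "t > 0" | "t < 0" | "t = 0" by linarith
  then show ?thesis
  proof cases
    case 1
    have "((\<lambda>t. t powr \<alpha>) has_real_derivative \<alpha> * ppow (\<alpha> - 1) t) (at t)"
      using 1 by (auto intro!: derivative_eq_intros simp: ppow_pos)
    then show ?thesis
      by (rule has_field_derivative_transform_within_open[of _ _ _ "{0<..}"]) (use 1 in \<open>auto simp: ppow_pos\<close>)
  next
    case 2
    have "((\<lambda>t. 0) has_real_derivative \<alpha> * ppow (\<alpha> - 1) t) (at t)"
      using 2 by (simp add: ppow_nonpos)
    then show ?thesis
      by (rule has_field_derivative_transform_within_open[of _ _ _ "{..<0}"]) (use 2 in \<open>auto simp: ppow_nonpos\<close>)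
  next
    case 3
    have "continuous_on UNIV (ppow (\<alpha> - 1))" by (rule ppow_continuous) (use assms in simp)
    then have "(ppow (\<alpha> - 1) \<longlongrightarrow> ppow (\<alpha> - 1) 0) (at 0)" by (simp add: continuous_on_def)
    then have lim: "(ppow (\<alpha> - 1) \<longlongrightarrow> 0) (at 0)" by (simp add: ppow_nonpos)
    have "(ppow \<alpha> h - ppow \<alpha> 0) / (h - 0) = ppow (\<alpha> - 1) h" if "h \<noteq> 0" for h
      using that assms by (cases "h > 0") (auto simp: ppow_pos ppow_nonpos powr_diff)
    then have "((\<lambda>h. (ppow \<alpha> h - ppow \<alpha> 0) / (h - 0)) \<longlongrightarrow> 0) (at 0)"
      by (intro Lim_transform_eventually[OF lim]) (auto simp: eventually_at_filter)
    then show ?thesis using 3 by (simp add: has_field_derivative_iff ppow_nonpos)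
  qed
qed

context riem
begin

subsection \<open>Integration of continuous functions with compact support\<close>

lemma continuous_on_compact_bound:
  fixes f :: "'a \<Rightarrow> real"
  assumes "continuous_on UNIV f" "compact K"
  shows "\<exists>B>0. \<forall>x\<in>K. \<bar>f x\<bar> \<le> B"
proof -
  have "bounded (f ` K)"
    by (intro compact_imp_bounded compact_continuous_image assms(2) continuous_on_subset[OF assms(1)]) simp
  then obtain B where "B > 0" "\<forall>y\<in>f ` K. norm y \<le> B" unfolding bounded_pos by blast
  then show ?thesis by auto
qed

lemma compact_sets_borel: "compact (K :: 'a set) \<Longrightarrow> K \<in> sets borel"
  by (simp add: compact_imp_closed)

lemma integrable_indicator_vol: "compact K \<Longrightarrow> integrable vol (\<lambda>x. k * indicator K x :: real)"
  using emeasure_vol_compact[of K] compact_sets_borel[of K] by simp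

lemma integrable_vol:
  fixes f :: "'a \<Rightarrow> real"
  assumes "continuous_on UNIV f" "compact K" "\<And>x. x \<notin> K \<Longrightarrow> f x = 0"
  shows "integrable vol f"
proof -
  obtain B where B: "B > 0" "\<forall>x\<in>K. \<bar>f x\<bar> \<le> B" using continuous_on_compact_bound[OF assms(1,2)] by blast
  have m: "f \<in> borel_measurable vol"
    using borel_measurable_continuous_onI[OF assms(1)] by (simp cong: measurable_cong_sets)
  show ?thesis
    by (rule Bochner_Integration.integrable_bound[OF integrable_indicator_vol[OF assms(2), of B] m])
      (use B assms(3) in \<open>auto simp: indicator_def\<close>)
qed

lemma integral_vol_le:
  fixes f :: "'a \<Rightarrow> real"
  assumes "integrable vol f" "compact K" "\<And>x. x \<notin> K \<Longrightarrow> f x \<le> 0" "\<And>x. x \<in> K \<Longrightarrow> f x \<le> k"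
  shows "(LINT x|vol. f x) \<le> k * measure vol K"
proof -
  have "(LINT x|vol. f x) \<le> (LINT x|vol. k * indicator K x)"
    by (rule integral_mono[OF assms(1) integrable_indicator_vol[OF assms(2)]])
      (use assms(3,4) in \<open>auto simp: indicator_def\<close>)
  also have "\<dots> = k * measure vol K" by simp
  finally show ?thesis .
qed

subsection \<open>Extension by zero from a chart\<close>

text \<open>Two open sets cover the manifold: the chart domain, where the function is a composite
  with transition maps, and the complement of K, where it vanishes. K is closed because it is
  compact.\<close>

lemma Ck_fun_extend:
  assumes c: "c \<in> A" and K: "compact K" "K \<subseteq> fst c" and F: "Ck_on k (snd c ` fst c) F"
    and zero: "\<And>q. q \<in> fst c \<Longrightarrow> q \<notin> K \<Longrightarrow> F (snd c q) = 0"
  shows "Ck_fun A k (\<lambda>q. if q \<in> fst c then F (snd c q) else 0)"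
  unfolding Ck_fun_def
proof
  fix d assume d: "d \<in> A"
  let ?f = "\<lambda>q. if q \<in> fst c then F (snd c q) else 0"
  show "Ck_on k (snd d ` fst d) (?f \<circ> coord_inv d)"
  proof (rule Ck_on_local)
    fix y assume y: "y \<in> snd d ` fst d"
    let ?q = "coord_inv d y"
    note q = chart_homeo(7)[OF d y]
    have oc: "open (fst c)" "open (fst d)" using chart_homeo(1) c d by auto
    show "\<exists>T. open T \<and> y \<in> T \<and> Ck_on k T (?f \<circ> coord_inv d)"
    proof (cases "?q \<in> fst c")
      case True
      let ?T = "snd d ` (fst d \<inter> fst c)"
      have T: "open ?T" by (rule chart_image_open[OF d]) (use oc in auto)
      have "y \<in> ?T" using True q chart_homeo(6)[OF d y] by (intro image_eqI[of _ _ ?q]) auto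
      moreover have "Ck_on k ?T (F \<circ> (snd c \<circ> coord_inv d))"
        by (rule Ck_on_compose[OF T trans_smooth[OF d c] F]) (use chart_homeo(5)[OF d] in auto)
      then have "Ck_on k ?T (?f \<circ> coord_inv d)"
        by (rule Ck_on_cong[OF T, rotated]) (use chart_homeo(5)[OF d] in auto)
      ultimately show ?thesis using T by blast
    next
      case False
      let ?T = "snd d ` (fst d - K)"
      have T: "open ?T" by (rule chart_image_open[OF d]) (use oc compact_imp_closed[OF K(1)] in auto)
      have "y \<in> ?T" using False K q chart_homeo(6)[OF d y] by (intro image_eqI[of _ _ ?q]) auto
      moreover have "Ck_on k ?T (?f \<circ> coord_inv d)"
        by (rule Ck_on_cong[OF T _ Ck_on_const[of _ _ 0]]) (use chart_homeo(5)[OF d] zero in auto)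
      ultimately show ?thesis using T by blast
    qed
  qed
qed

definition chart_bump :: "('a, 'm) chart \<Rightarrow> real ^ 'm \<Rightarrow> real \<Rightarrow> 'a \<Rightarrow> real" where
  "chart_bump c y0 r q = (if q \<in> fst c then bump r (snd c q - y0) else 0)"

lemma chart_cball_compact:
  "c \<in> A \<Longrightarrow> cball y0 r \<subseteq> snd c ` fst c \<Longrightarrow> compact (coord_inv c ` cball y0 r)"
  by (rule compact_continuous_image[OF continuous_on_subset[OF chart_homeo(4)]]) auto

lemma chart_bump:
  assumes "c \<in> A" "r > 0" "cball y0 r \<subseteq> snd c ` fst c"
  shows "C1at (chart_bump c y0 r) q" "chart_bump c y0 r q \<ge> 0"
    "chart_bump c y0 r q \<noteq> 0 \<longleftrightarrow> q \<in> fst c \<and> snd c q \<in> ball y0 r"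
proof -
  let ?K = "coord_inv c ` cball y0 r"
  have "Ck_on 1 (snd c ` fst c) (\<lambda>y. y + (- y0))"
    by (intro Ck_on_add Ck_on_id Ck_on_const chart_homeo(2)[OF assms(1)])
  from Ck_on_compose[OF chart_homeo(2)[OF assms(1)] this Ck_on_bump[of 1 r]]
  have Fk: "Ck_on 1 (snd c ` fst c) (\<lambda>y. bump r (y - y0))" by (simp add: o_def)
  have "Ck_fun A 1 (\<lambda>q. if q \<in> fst c then bump r (snd c q - y0) else 0)"
  proof (rule Ck_fun_extend[OF assms(1) chart_cball_compact[OF assms(1,3)] _ Fk])
    show "?K \<subseteq> fst c" using chart_inv_image[OF assms(1,3)] by blast
    fix q assume "q \<in> fst c" "q \<notin> ?K"
    then have "snd c q \<notin> cball y0 r" using chart_inv_image[OF assms(1,3)] by blast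
    then have "r \<le> norm (snd c q - y0)" by (simp add: dist_norm norm_minus_commute[of y0])
    then show "bump r (snd c q - y0) = 0" by (rule bump_props(3)[OF assms(2)])
  qed
  then show "C1at (chart_bump c y0 r) q" unfolding Ck_fun_1_iff chart_bump_def[abs_def] by blast
  show "chart_bump c y0 r q \<ge> 0" by (simp add: chart_bump_def bump_props(1))
  show "chart_bump c y0 r q \<noteq> 0 \<longleftrightarrow> q \<in> fst c \<and> snd c q \<in> ball y0 r"
    using bump_props(1,2)[of r "snd c q - y0"] assms(2) unfolding chart_bump_def
    by (auto simp: dist_norm norm_minus_commute less_le)
qed

subsection \<open>Partitions of unity\<close>

lemma C1at_divide:
  assumes "C1at f p" "C1at h p" "h p \<noteq> 0" shows "C1at (\<lambda>x. f x / h x) p"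
proof -
  have "C1at (\<lambda>x. inverse (h x)) p"
    by (rule C1at_compose[OF assms(2), of "- {0}" _ "\<lambda>t. - (inverse t ^ Suc (Suc 0))"])
      (use assms(3) in \<open>auto intro!: DERIV_inverse continuous_intros simp del: power_Suc\<close>)
  from C1at_mult[OF assms(1) this] show ?thesis by (simp add: divide_inverse)
qed

lemma C1at_cmult: "C1at f p \<Longrightarrow> C1at (\<lambda>x. k * f x) p"
  by (rule C1at_mult[OF C1at_const])

text \<open>
  Dividing by \<open>B + (m - B)\<^sub>+\<^sup>2\<close>, where \<open>B\<close> is the sum of the bumps, avoids the zeros of \<open>B\<close>
  without changing the quotient where \<open>B \<ge> m\<close>.
\<close>

lemma partition_of_unity:
  fixes cb :: "'a \<Rightarrow> ('a, 'm) chart" and rb :: "'a \<Rightarrow> real"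
  assumes K: "compact K" and cb: "\<And>p. p \<in> K \<Longrightarrow> cb p \<in> A \<and> p \<in> fst (cb p) \<and> rb p > 0 \<and> cball (snd (cb p) p) (rb p) \<subseteq> snd (cb p) ` fst (cb p)"
  shows "\<exists>I \<eta>. finite I \<and> I \<subseteq> K \<and> (\<forall>i\<in>I. \<forall>q. C1at (\<eta> i) q \<and> 0 \<le> \<eta> i q \<and>
      (\<eta> i q \<noteq> 0 \<longrightarrow> q \<in> fst (cb i) \<and> snd (cb i) q \<in> ball (snd (cb i) i) (rb i))) \<and>
      (\<forall>q. (\<Sum>i\<in>I. \<eta> i q) \<le> (1::real)) \<and> (\<exists>W. open W \<and> K \<subseteq> W \<and> (\<forall>q\<in>W. (\<Sum>i\<in>I. \<eta> i q) = 1))"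
proof -
  define \<beta> where "\<beta> p = chart_bump (cb p) (snd (cb p) p) (rb p)" for p
  define V where "V p = fst (cb p) \<inter> snd (cb p) -` ball (snd (cb p) p) (rb p)" for p
  have \<beta>: "C1at (\<beta> p) q" "\<beta> p q \<ge> 0" "\<beta> p q \<noteq> 0 \<longleftrightarrow> q \<in> V p" if "p \<in> K" for p q
    unfolding \<beta>_def V_def using chart_bump[of "cb p" "rb p" "snd (cb p) p" q] cb[OF that] by auto
  have V: "open (V p)" "p \<in> V p" if "p \<in> K" for p
    using chart_preimage_open[OF _ open_ball, of "cb p"] cb[OF that] by (auto simp: V_def)
  obtain I where I: "I \<subseteq> K" "finite I" "K \<subseteq> (\<Union>p\<in>I. V p)"
    using compactE_image[OF K, of K V] V by blast
  define B where "B q = (\<Sum>i\<in>I. \<beta> i q)" for q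
  have BC: "C1at B q" for q unfolding B_def[abs_def] by (rule C1at_sum) (use \<beta> I in blast)
  have Bc: "continuous_on UNIV B" using C1at_isCont[OF BC] by (simp add: continuous_at_imp_continuous_on)
  have B0: "B q \<ge> 0" for q unfolding B_def by (rule sum_nonneg) (use \<beta> I in blast)
  have Bpos: "B q > 0" if q: "q \<in> K" for q
  proof -
    obtain i where "i \<in> I" "q \<in> V i" using I(3) q by blast
    then show ?thesis unfolding B_def
      by (intro sum_pos2[of I i]) (use \<beta> I in \<open>auto simp: less_le subset_iff\<close>)
  qed
  have "\<exists>m>0. \<forall>q\<in>K. B q > m"
  proof (cases "K = {}")
    case False
    then obtain x where x: "x \<in> K" "\<And>y. y \<in> K \<Longrightarrow> B x \<le> B y"
      using continuous_attains_inf[OF K _ continuous_on_subset[OF Bc subset_UNIV]] by blast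
    then show ?thesis using Bpos[OF x(1)] by (intro exI[of _ "B x / 2"]) force
  qed (auto intro: exI[of _ 1])
  then obtain m where m: "m > 0" "\<And>q. q \<in> K \<Longrightarrow> B q > m" by blast
  define D where "D q = B q + ppow 2 (m + (-1) * B q)" for q
  have Dpos: "D q > 0" for q
    using B0[of q] m(1) ppow_nonneg[of 2 "m + (-1) * B q"] by (cases "B q = 0") (auto simp: D_def ppow_pos)
  have C1p: "C1at (\<lambda>q. ppow 2 (m + (-1) * B q)) q" for q
    by (rule C1at_compose[OF C1at_add[OF C1at_const C1at_cmult[OF BC]], where T = UNIV and \<theta>' = "\<lambda>t. 2 * ppow (2 - 1) t"])
      (use ppow_deriv[of 2] in \<open>auto intro!: continuous_intros ppow_continuous\<close>)
  have C1D: "C1at D q" for q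
    unfolding D_def[abs_def] by (rule C1at_add[OF BC C1p])
  define \<eta> where "\<eta> i q = \<beta> i q / D q" for i q
  have s: "(\<Sum>i\<in>I. \<eta> i q) = B q / D q" for q
    unfolding \<eta>_def B_def by (simp add: sum_divide_distrib)
  show ?thesis
  proof (rule exI[of _ I], rule exI[of _ \<eta>], intro conjI allI ballI impI I(1,2))
    fix i q assume i: "i \<in> I"
    then have iK: "i \<in> K" using I by blast
    show "C1at (\<eta> i) q"
      unfolding \<eta>_def[abs_def] by (rule C1at_divide[OF \<beta>(1)[OF iK] C1D]) (use Dpos[of q] in simp)
    show "0 \<le> \<eta> i q" using \<beta>(2)[OF iK] Dpos[of q] by (simp add: \<eta>_def)
    assume "\<eta> i q \<noteq> 0"
    then have "q \<in> V i" using \<beta>(3)[OF iK] by (simp add: \<eta>_def)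
    then show "q \<in> fst (cb i)" "snd (cb i) q \<in> ball (snd (cb i) i) (rb i)" by (auto simp: V_def)
  next
    fix q
    show "(\<Sum>i\<in>I. \<eta> i q) \<le> 1"
      unfolding s using Dpos[of q] ppow_nonneg[of 2 "m + (-1) * B q"] by (simp add: D_def)
  next
    \<comment> \<open>A neighbourhood of K, and not only K itself, allows the constant sum to be
      differentiated at points of K.\<close>
    show "\<exists>W. open W \<and> K \<subseteq> W \<and> (\<forall>q\<in>W. (\<Sum>i\<in>I. \<eta> i q) = 1)"
    proof (intro exI[of _ "B -` {m<..}"] conjI ballI)
      show "open (B -` {m<..})" using continuous_on_open_vimage[of UNIV B] Bc by simp
      show "K \<subseteq> B -` {m<..}" using m(2) by auto
      fix q assume "q \<in> B -` {m<..}"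
      then have "D q = B q" "B q > 0" using m(1) by (auto simp: D_def ppow_nonpos)
      then show "(\<Sum>i\<in>I. \<eta> i q) = 1" unfolding s by simp
    qed
  qed
qed

end

lemma mollify_nonneg: "(\<And>x. f x \<ge> 0) \<Longrightarrow> mollify e f y \<ge> 0"
  unfolding mollify_def
  by (intro divide_nonneg_nonneg Bochner_Integration.integral_nonneg mult_nonneg_nonneg) (auto simp: bump_props)

lemma uniformly_continuous_compact_support:
  fixes f :: "'a::euclidean_space \<Rightarrow> 'b::real_normed_vector"
  assumes "continuous_on UNIV f" "\<And>x. x \<notin> cball y0 r \<Longrightarrow> f x = 0" "e > 0"
  shows "\<exists>d>0. \<forall>x y. dist x y < d \<longrightarrow> norm (f x - f y) < e"
proof -
  have "uniformly_continuous_on (cball y0 (r + 2)) f"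
    by (rule compact_uniformly_continuous[OF continuous_on_subset[OF assms(1)]]) auto
  then obtain d where d: "d > 0" "\<And>x y. x \<in> cball y0 (r + 2) \<Longrightarrow> y \<in> cball y0 (r + 2) \<Longrightarrow> dist y x < d \<Longrightarrow> dist (f y) (f x) < e"
    unfolding uniformly_continuous_on_def using assms(3) by metis
  show ?thesis
  proof (intro exI[of _ "min d 1"] conjI allI impI)
    fix x y :: 'a assume xy: "dist x y < min d 1"
    show "norm (f x - f y) < e"
    proof (cases "x \<in> cball y0 (r + 1)")
      case True
      then have "x \<in> cball y0 (r + 2)" "y \<in> cball y0 (r + 2)"
        using xy dist_triangle[of y0 y x] by auto
      then show ?thesis using d(2)[of y x] xy by (simp add: dist_norm)
    next
      case False
      then have "x \<notin> cball y0 r" "y \<notin> cball y0 r"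
        using xy dist_triangle[of y0 x y] by (auto simp: dist_commute)
      then show ?thesis using assms(2,3) by simp
    qed
  qed (use d in auto)
qed

context riem
begin

lemma has_dif_cmult: "has_dif f c p \<omega> \<Longrightarrow> c \<in> A \<Longrightarrow> p \<in> fst c \<Longrightarrow> has_dif (\<lambda>x. k * f x) c p (k *\<^sub>R \<omega>)"
  using has_dif_mult[of c p "\<lambda>_. k" 0 f \<omega>] has_dif_const[of k c p] by simp

lemma rinner_grad_diff:
  assumes "C1at h1 p" "C1at h2 p"
  shows "rinner A g X (grad g (\<lambda>x. h1 x + (-1) * h2 x)) p = rinner A g X (grad g h1) p - rinner A g X (grad g h2) p"
proof -
  let ?c = "chart_at A p"
  note d = C1at_has_dif[OF assms(1) chart_at] C1at_has_dif[OF assms(2) chart_at]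
  have "coord_partials (\<lambda>x. h1 x + (-1) * h2 x) ?c p = coord_partials h1 ?c p + (-1) *\<^sub>R coord_partials h2 ?c p"
    by (rule has_dif_coord_partials[OF has_dif_add[OF d(1) has_dif_cmult[OF d(2) chart_at]]])
  then show ?thesis by (simp add: rinner_grad inner_diff_right)
qed

lemma has_dif_0:
  assumes "closed K" "p \<notin> K" "\<And>x. x \<notin> K \<Longrightarrow> h x = 0" "c \<in> A" "p \<in> fst c"
  shows "has_dif h c p 0"
  by (rule has_dif_cong[OF assms(4), of _ "- K" "\<lambda>_. 0"]) (use assms in \<open>auto intro: has_dif_const\<close>)

lemma rinner_grad_0:
  assumes "closed K" "p \<notin> K" "\<And>x. x \<notin> K \<Longrightarrow> h x = 0"
  shows "rinner A g X (grad g h) p = 0"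
  using has_dif_coord_partials[OF has_dif_0[OF assms chart_at]] by (simp add: rinner_grad)

lemma gnorm_le_partials:
  assumes nb: "nice_ball c y0 r \<Lambda>" and p: "p \<in> fst c" "snd c p \<in> cball y0 r" and d: "has_dif f c p \<omega>"
  shows "gnorm f p \<le> \<Lambda> * norm \<omega>"
proof (rule gnorm_le[OF _ p(1) d])
  show "c \<in> A" using nb by (simp add: nice_ball_def)
  show "\<Lambda> * norm \<omega> \<ge> 0" using nb by (simp add: nice_ball_def)
  fix v
  have "\<omega> \<bullet> v \<le> norm \<omega> * norm v" by (rule norm_cauchy_schwarz)
  also have "norm v \<le> \<Lambda> * sqrt (v \<bullet> (g c (coord_inv c (snd c p)) *v v))"
    using nb p(2) unfolding nice_ball_def by blast
  then have "norm \<omega> * norm v \<le> norm \<omega> * (\<Lambda> * sqrt (v \<bullet> (g c (coord_inv c (snd c p)) *v v)))"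
    by (rule mult_left_mono) simp
  also have "\<dots> = \<Lambda> * norm \<omega> * sqrt (v \<bullet> (g c p *v v))"
    using chart_homeo(5)[OF \<open>c \<in> A\<close> p(1)] by simp
  finally show "\<omega> \<bullet> v \<le> \<Lambda> * norm \<omega> * sqrt (v \<bullet> (g c p *v v))" .
qed

subsection \<open>Mollification of a \<open>C\<^sup>1\<close> function supported in a chart\<close>

text \<open>A C^1 function supported in a smaller coordinate ball is mollified in coordinates and
  extended by 0. Values and differentials converge uniformly, and the gap between r' and r keeps all
  approximants inside one compact set. The factor \<open>CARD('m)\<close> stems from bounding a norm
  by the sum of the components.\<close>

lemma mollify_in_chart:
  fixes \<epsilon> \<Lambda> :: real
  assumes nb: "nice_ball c y0 r \<Lambda>" and r': "r' < r"
    and C1: "\<And>q. C1at \<zeta> q" and nn: "\<And>q. \<zeta> q \<ge> 0"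
    and supp: "\<And>q. \<zeta> q \<noteq> 0 \<Longrightarrow> q \<in> fst c \<and> snd c q \<in> cball y0 r'" and "\<epsilon> > 0"
  shows "\<exists>\<eta>. smooth_fun A \<eta> \<and> (\<forall>q. \<eta> q \<ge> 0) \<and> (\<forall>q. q \<notin> coord_inv c ` cball y0 r \<longrightarrow> \<eta> q = 0) \<and>
    (\<forall>q. \<bar>\<eta> q - \<zeta> q\<bar> \<le> \<epsilon>) \<and> (\<forall>q\<in>coord_inv c ` cball y0 r. gnorm (\<lambda>x. \<eta> x + (-1) * \<zeta> x) q \<le> \<Lambda> * (CARD('m) * \<epsilon>))"
proof -
  have c: "c \<in> A" and r: "r > 0" and sub: "cball y0 r \<subseteq> snd c ` fst c" and \<Lambda>: "\<Lambda> > 0"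
    using nb by (auto simp: nice_ball_def)
  let ?K = "coord_inv c ` cball y0 r"
  have K: "compact ?K" "?K = fst c \<inter> snd c -` cball y0 r"
    using chart_cball_compact[OF c sub] chart_inv_image[OF c sub] by auto
  define f where "f y = (if y \<in> cball y0 r then \<zeta> (coord_inv c y) else 0)" for y
  define D where "D y = (if y \<in> cball y0 r then coord_partials \<zeta> c (coord_inv c y) else 0)" for y
  have inv: "coord_inv c y \<in> fst c" "snd c (coord_inv c y) = y" if "y \<in> cball y0 r" for y
    using chart_homeo(6,7)[OF c] sub that by auto
  have f0: "f y = 0" if "y \<notin> cball y0 r'" for y
  proof (cases "y \<in> cball y0 r")
    case True
    then have "\<zeta> (coord_inv c y) = 0" using supp[of "coord_inv c y"] inv[OF True] that by auto
    then show ?thesis by (simp add: f_def)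
  qed (auto simp: f_def)
  have D0: "D y = 0" if y: "y \<notin> cball y0 r'" for y
  proof (cases "y \<in> cball y0 r")
    case True
    have cs: "cball y0 r' \<subseteq> snd c ` fst c" using sub r' by auto
    have "has_dif \<zeta> c (coord_inv c y) 0"
    proof (rule has_dif_0[OF _ _ _ c])
      show "closed (coord_inv c ` cball y0 r')" by (rule compact_imp_closed[OF chart_cball_compact[OF c cs]])
      show "coord_inv c y \<notin> coord_inv c ` cball y0 r'"
        using y inv[OF True] unfolding chart_inv_image[OF c cs] by simp
      show "\<zeta> x = 0" if "x \<notin> coord_inv c ` cball y0 r'" for x
        using supp[of x] that unfolding chart_inv_image[OF c cs] by blast
    qed (rule inv(1)[OF True])
    from has_dif_coord_partials[OF this] show ?thesis by (simp add: D_def)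
  qed (auto simp: D_def)
  have cover: "ball y0 r \<union> - cball y0 r' = UNIV" using r' by auto
  have fd: "(f has_derivative (\<lambda>v. D y \<bullet> v)) (at y)" for y
  proof (cases "y \<in> ball y0 r")
    case True
    then have y: "y \<in> cball y0 r" by auto
    have "has_dif \<zeta> c (coord_inv c y) (D y)"
      using C1at_has_dif[OF C1 c inv(1)[OF y]] y by (simp add: D_def)
    then have "(\<zeta> \<circ> coord_inv c has_derivative (\<lambda>v. D y \<bullet> v)) (at y)"
      unfolding has_dif_def inv(2)[OF y] .
    then show ?thesis
      by (rule has_derivative_transform_within_open[OF _ open_ball True]) (auto simp: f_def)
  next
    case False
    then have y: "y \<in> - cball y0 r'" using cover by blast
    have "((\<lambda>y. 0) has_derivative (\<lambda>v. D y \<bullet> v)) (at y)" using D0[of y] y by simp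
    then show ?thesis
      by (rule has_derivative_transform_within_open[OF _ _ y]) (use f0 in auto)
  qed
  have fc: "continuous_on UNIV f"
    using has_derivative_continuous[OF fd] by (simp add: continuous_at_imp_continuous_on)
  have "continuous_on (ball y0 r \<union> - cball y0 r') D"
  proof (rule continuous_on_open_Un)
    have "continuous_on (fst c) (coord_partials \<zeta> c)"
      by (rule C1at_partials_continuous[OF c chart_homeo(1)[OF c] order_refl C1])
    then have "continuous_on (ball y0 r) (\<lambda>y. coord_partials \<zeta> c (coord_inv c y))"
    proof (rule continuous_on_compose2[OF _ continuous_on_subset[OF chart_homeo(4)[OF c]]])
      show "ball y0 r \<subseteq> snd c ` fst c" using sub ball_subset_cball by blast
      show "coord_inv c ` ball y0 r \<subseteq> fst c" using inv(1) by auto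
    qed
    then show "continuous_on (ball y0 r) D"
      by (rule continuous_on_eq) (auto simp: D_def)
    show "continuous_on (- cball y0 r') D"
      by (rule continuous_on_eq[OF continuous_on_const[of _ 0]]) (use D0 in auto)
  qed auto
  then have Dc: "continuous_on UNIV D" unfolding cover .
  have f0': "f y = 0" and D0': "D y = 0" if "y \<notin> cball y0 r" for y using that by (auto simp: f_def D_def)
  obtain d1 where d1: "d1 > 0" "\<And>x y. dist x y < d1 \<Longrightarrow> norm (f x - f y) < \<epsilon>"
    using uniformly_continuous_compact_support[OF fc f0' \<open>\<epsilon> > 0\<close>] by blast
  obtain d2 where d2: "d2 > 0" "\<And>x y. dist x y < d2 \<Longrightarrow> norm (D x - D y) < \<epsilon>"
    using uniformly_continuous_compact_support[OF Dc D0' \<open>\<epsilon> > 0\<close>] by blast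
  \<comment> \<open>The bound d1 controls the values. Half of d2 is reserved for the increment along
    an axis, so the base point may move by the other half. The gap r - r' keeps the support in the
    larger ball.\<close>
  define e where "e = min (min d1 (d2 / 2)) (r - r')"
  have e: "e > 0" "e \<le> d1" "e \<le> d2 / 2" "e \<le> r - r'" using d1(1) d2(1) r' unfolding e_def by linarith+
  have "bounded (cball y0 r)" by simp
  then obtain a where a: "cball y0 r \<subseteq> cbox (- a) a" using bounded_subset_cbox_symmetric by blast
  have fbox: "f z = 0" if "z \<notin> cbox (- a) a" for z using f0'[of z] a that by blast
  define F where "F = mollify e f"
  have Fk: "Ck_on k UNIV F" for k unfolding F_def by (rule Ck_on_mollify[OF e(1) fc fbox])
  have Fclose: "\<bar>F y - f y\<bar> \<le> \<epsilon>" for y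
    unfolding F_def
  proof (rule mollify_close[OF e(1) fc])
    fix w :: "real ^ 'm" assume "norm w < e"
    then show "\<bar>f (y - w) - f y\<bar> \<le> \<epsilon>" using d1(2)[of "y - w" y] e(2) by (simp add: dist_norm)
  qed
  have F0: "F y = 0" if y: "y \<notin> cball y0 r" for y
  proof -
    have "\<bar>mollify e f y - 0\<bar> \<le> 0"
    proof (rule mollify_close[OF e(1) fc])
      fix w :: "real ^ 'm" assume w: "norm w < e"
      have "dist y0 y \<le> dist y0 (y - w) + norm w" using dist_triangle[of y0 y "y - w"] by (simp add: dist_norm)
      then have "y - w \<notin> cball y0 r'" using y w e(4) by auto
      then show "\<bar>f (y - w) - 0\<bar> \<le> 0" using f0 by simp
    qed
    then show ?thesis by (simp add: F_def)
  qed
  have Fnn: "F y \<ge> 0" for y unfolding F_def by (rule mollify_nonneg) (simp add: f_def nn)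
  have Fd: "\<bar>frechet_derivative F (at y) (axis i 1) - D y $ i\<bar> \<le> \<epsilon>" for y i
    unfolding F_def
  proof (rule mollify_derivative[OF e(1) fc fbox, where ?h0.0 = "d2 / 2"])
    show "0 < d2 / 2" using d2 by simp
    fix w :: "real ^ 'm" and h :: real assume w: "norm w < e" and h: "0 < h" "h < d2 / 2"
    let ?v = "axis i 1 :: real ^ 'm"
    have der: "((\<lambda>t. f (y - w + t *\<^sub>R ?v)) has_derivative (\<lambda>s. D (y - w + t *\<^sub>R ?v) \<bullet> (s *\<^sub>R ?v))) (at t within {0..h})" for t
    proof -
      have "((\<lambda>t. y - w + t *\<^sub>R ?v) has_derivative (\<lambda>s. s *\<^sub>R ?v)) (at t within {0..h})"
        by (auto intro!: derivative_eq_intros)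
      from has_derivative_compose[OF this fd] show ?thesis .
    qed
    obtain t where t: "t \<in> {0<..<h}" "f (y - w + h *\<^sub>R ?v) - f (y - w + 0 *\<^sub>R ?v) = D (y - w + t *\<^sub>R ?v) \<bullet> ((h - 0) *\<^sub>R ?v)"
      using mvt_simple[OF h(1) der] by blast
    then have eq: "f (y - w + h *\<^sub>R ?v) - f (y - w) = h * (D (y - w + t *\<^sub>R ?v) $ i)"
      by (simp add: inner_axis)
    have "norm (- w + t *\<^sub>R ?v) \<le> norm w + t" using norm_triangle_ineq[of "- w" "t *\<^sub>R ?v"] t(1) by simp
    also have "\<dots> < d2" using w e(3) t(1) h by simp
    finally have "norm (D (y - w + t *\<^sub>R ?v) - D y) < \<epsilon>"
      by (intro d2(2)) (simp add: dist_norm algebra_simps)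
    then have "\<bar>D (y - w + t *\<^sub>R ?v) $ i - D y $ i\<bar> \<le> \<epsilon>"
      using component_le_norm_cart[of "D (y - w + t *\<^sub>R ?v) - D y" i] by simp
    then have "h * \<bar>D (y - w + t *\<^sub>R ?v) $ i - D y $ i\<bar> \<le> h * \<epsilon>" using h by (intro mult_left_mono) auto
    moreover have "f (y - w + h *\<^sub>R ?v) - f (y - w) - h * (D y $ i) = h * (D (y - w + t *\<^sub>R ?v) $ i - D y $ i)"
      unfolding eq by (simp add: algebra_simps)
    ultimately show "\<bar>f (y - w + h *\<^sub>R ?v) - f (y - w) - h * (D y $ i)\<bar> \<le> h * \<epsilon>"
      using h by (simp add: abs_mult)
  qed
  define \<eta> where "\<eta> q = (if q \<in> fst c then F (snd c q) else 0)" for q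
  have sm: "smooth_fun A \<eta>"
    unfolding smooth_fun_def \<eta>_def[abs_def]
  proof (intro allI Ck_fun_extend[OF c K(1)])
    show "?K \<subseteq> fst c" using K(2) by blast
    show "Ck_on k (snd c ` fst c) F" for k by (rule Ck_on_subset[OF Fk]) simp
    show "F (snd c q) = 0" if "q \<in> fst c" "q \<notin> ?K" for q using F0[of "snd c q"] that K(2) by blast
  qed
  then have C1\<eta>: "C1at \<eta> q" for q using Ck_fun_1_iff unfolding smooth_fun_def by blast
  have close: "\<bar>\<eta> q - \<zeta> q\<bar> \<le> \<epsilon>" for q
  proof (cases "q \<in> ?K")
    case True
    then have q: "q \<in> fst c" "snd c q \<in> cball y0 r" using K(2) by auto
    then have "f (snd c q) = \<zeta> q" using chart_homeo(5)[OF c q(1)] by (simp add: f_def)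
    then show ?thesis using Fclose[of "snd c q"] q by (simp add: \<eta>_def)
  next
    case False
    then have "\<eta> q = 0" using F0[of "snd c q"] K(2) by (auto simp: \<eta>_def)
    moreover have "\<zeta> q = 0" using supp[of q] False K(2) r' by force
    ultimately show ?thesis using \<open>\<epsilon> > 0\<close> by simp
  qed
  have gn: "gnorm (\<lambda>x. \<eta> x + (-1) * \<zeta> x) q \<le> \<Lambda> * (CARD('m) * \<epsilon>)" if q0: "q \<in> ?K" for q
  proof -
    have q: "q \<in> fst c" "snd c q \<in> cball y0 r" using q0 K(2) by auto
    let ?DF = "frechet_derivative F (at (snd c q))"
    define \<omega> where "\<omega> = (\<chi> i. ?DF (axis i 1))"
    have DF: "(F has_derivative ?DF) (at (snd c q))" using Ck_on_SucD(1)[OF Fk[of "Suc 0"]] by simp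
    have "?DF = (\<lambda>v. \<omega> \<bullet> v)"
      unfolding \<omega>_def using linear_inner_rep[OF has_derivative_linear[OF DF]] by blast
    then have "(F has_derivative (\<lambda>v. \<omega> \<bullet> v)) (at (snd c q))" using DF by simp
    then have d1: "has_dif \<eta> c q \<omega>"
      unfolding has_dif_def
      by (rule has_derivative_transform_within_open[OF _ chart_homeo(2)[OF c]])
        (use q chart_homeo(6,7)[OF c] in \<open>auto simp: \<eta>_def\<close>)
    have d2: "has_dif \<zeta> c q (D (snd c q))"
      using C1at_has_dif[OF C1 c q(1)] q chart_homeo(5)[OF c q(1)] by (simp add: D_def)
    have "norm (\<omega> + (-1) *\<^sub>R D (snd c q)) \<le> (\<Sum>i\<in>UNIV. \<bar>(\<omega> + (-1) *\<^sub>R D (snd c q)) $ i\<bar>)"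
      by (rule norm_le_l1_cart)
    also have "\<dots> \<le> (\<Sum>i\<in>(UNIV :: 'm set). \<epsilon>)"
      by (rule sum_mono) (use Fd[of "snd c q"] in \<open>simp add: \<omega>_def\<close>)
    also have "\<dots> = CARD('m) * \<epsilon>" by simp
    finally have n: "norm (\<omega> + (-1) *\<^sub>R D (snd c q)) \<le> CARD('m) * \<epsilon>" .
    have "gnorm (\<lambda>x. \<eta> x + (-1) * \<zeta> x) q \<le> \<Lambda> * norm (\<omega> + (-1) *\<^sub>R D (snd c q))"
      by (rule gnorm_le_partials[OF nb q has_dif_add[OF d1 has_dif_cmult[OF d2 c q(1)]]])
    also have "\<dots> \<le> \<Lambda> * (CARD('m) * \<epsilon>)" using n \<Lambda> by (intro mult_left_mono) auto
    finally show ?thesis .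
  qed
  have "\<eta> q = 0" if "q \<notin> ?K" for q using F0[of "snd c q"] that K(2) by (auto simp: \<eta>_def)
  moreover have "\<eta> q \<ge> 0" for q by (simp add: \<eta>_def Fnn)
  ultimately show ?thesis using sm close gn by blast
qed

section \<open>The weak inequality for test functions of class C^1\<close>

context
  fixes \<phi> :: "real \<Rightarrow> real" and u f :: "'a \<Rightarrow> real"
  assumes uC1: "\<And>q. C1at u q" and \<phi>: "continuous_on {0..} \<phi>" "\<phi> 0 = 0" "\<And>t. t \<ge> 0 \<Longrightarrow> \<phi> t \<ge> 0"
    and fcont: "continuous_on UNIV f" and dg: "div_ge A g (phi_field A g \<phi> u) f"
begin

abbreviation pairing :: "('a \<Rightarrow> real) \<Rightarrow> 'a \<Rightarrow> real" where
  "pairing h \<equiv> rinner A g (phi_field A g \<phi> u) (grad g h)"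

lemma pairing_integrable:
  assumes "\<And>q. C1at h q" "compact K" "\<And>x. x \<notin> K \<Longrightarrow> h x = 0"
  shows "integrable vol (pairing h)" "integrable vol (\<lambda>x. f x * h x)"
proof -
  show "integrable vol (pairing h)"
    by (rule integrable_vol[OF phi_pairing_continuous[OF uC1 assms(1) \<phi>] assms(2)])
      (use rinner_grad_0[OF compact_imp_closed[OF assms(2)] _ assms(3)] in auto)
  have "continuous_on UNIV h" using C1at_isCont[OF assms(1)] by (simp add: continuous_at_imp_continuous_on)
  then have "continuous_on UNIV (\<lambda>x. f x * h x)" by (intro continuous_intros fcont)
  then show "integrable vol (\<lambda>x. f x * h x)"
  proof (rule integrable_vol[OF _ assms(2)])
    show "f x * h x = 0" if "x \<notin> K" for x using assms(3)[OF that] by simp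
  qed
qed

text \<open>Smooth approximants of the test function satisfy the inequality. They are supported in
  one compact set of finite volume and the pairing is linear in the test function, so the error is
  at most a fixed multiple of \<epsilon>.\<close>

lemma div_ge_C1_chart:
  assumes nb: "nice_ball c y0 r \<Lambda>" and r': "r' < r"
    and C1: "\<And>q. C1at \<zeta> q" and nn: "\<And>q. \<zeta> q \<ge> 0"
    and supp: "\<And>q. \<zeta> q \<noteq> 0 \<Longrightarrow> q \<in> fst c \<and> snd c q \<in> cball y0 r'"
  shows "(LINT x|vol. f x * \<zeta> x) + (LINT x|vol. pairing \<zeta> x) \<le> 0"
proof -
  have c: "c \<in> A" and r: "r > 0" and sub: "cball y0 r \<subseteq> snd c ` fst c" and \<Lambda>: "\<Lambda> > 0"
    using nb by (auto simp: nice_ball_def)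
  let ?K = "coord_inv c ` cball y0 r"
  have K: "compact ?K" "?K = fst c \<inter> snd c -` cball y0 r"
    using chart_cball_compact[OF c sub] chart_inv_image[OF c sub] by auto
  have \<zeta>0: "\<zeta> x = 0" if "x \<notin> ?K" for x using supp[of x] that K(2) r' by force
  obtain Bf where Bf: "Bf > 0" "\<forall>x\<in>?K. \<bar>f x\<bar> \<le> Bf" using continuous_on_compact_bound[OF fcont K(1)] by blast
  have "continuous_on UNIV (\<lambda>p. \<phi> (gnorm u p))"
    by (rule continuous_on_compose2[OF \<phi>(1) gnorm_continuous]) (use uC1 gnorm_nonneg in auto)
  then obtain B\<phi> where B\<phi>: "B\<phi> > 0" "\<forall>x\<in>?K. \<bar>\<phi> (gnorm u x)\<bar> \<le> B\<phi>" using continuous_on_compact_bound[OF _ K(1)] by blast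
  define C where "C = (Bf + B\<phi> * (\<Lambda> * CARD('m))) * measure vol ?K"
  have C: "C \<ge> 0" using Bf(1) B\<phi>(1) \<Lambda> by (simp add: C_def)
  have main: "(LINT x|vol. f x * \<zeta> x) + (LINT x|vol. pairing \<zeta> x) \<le> C * \<epsilon>" if \<epsilon>: "\<epsilon> > 0" for \<epsilon>
  proof -
    obtain \<eta> where \<eta>: "smooth_fun A \<eta>" "\<forall>q. \<eta> q \<ge> 0" "\<forall>q. q \<notin> ?K \<longrightarrow> \<eta> q = 0" "\<forall>q. \<bar>\<eta> q - \<zeta> q\<bar> \<le> \<epsilon>"
      "\<forall>q\<in>?K. gnorm (\<lambda>x. \<eta> x + (-1) * \<zeta> x) q \<le> \<Lambda> * (CARD('m) * \<epsilon>)"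
      using mollify_in_chart[OF nb r' C1 nn supp \<epsilon>] by blast
    have C1\<eta>: "C1at \<eta> q" for q using Ck_fun_1_iff \<eta>(1) unfolding smooth_fun_def by blast
    have C1d: "C1at (\<lambda>x. \<eta> x + (-1) * \<zeta> x) q" for q by (rule C1at_add[OF C1\<eta> C1at_cmult[OF C1]])
    have "closure {x. \<eta> x \<noteq> 0} \<subseteq> ?K"
      by (rule closure_minimal) (use \<eta>(3) compact_imp_closed[OF K(1)] in auto)
    then have "compact (closure {x. \<eta> x \<noteq> 0})"
      using compact_Int_closed[OF K(1) closed_closure] by (metis inf.absorb_iff2)
    then have t: "(LINT x|vol. f x * \<eta> x) + (LINT x|vol. pairing \<eta> x) \<le> 0"
      using dg \<eta>(1,2) unfolding div_ge_def by fastforce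
    note i\<zeta> = pairing_integrable[OF C1 K(1) \<zeta>0]
    have \<eta>0: "\<eta> x = 0" if "x \<notin> ?K" for x using \<eta>(3) that by blast
    note i\<eta> = pairing_integrable[OF C1\<eta> K(1) \<eta>0]
    have "(LINT x|vol. f x * \<zeta> x) - (LINT x|vol. f x * \<eta> x) = (LINT x|vol. f x * \<zeta> x - f x * \<eta> x)"
      using i\<zeta> i\<eta> by simp
    also have "\<dots> \<le> Bf * \<epsilon> * measure vol ?K"
    proof (rule integral_vol_le[OF _ K(1)])
      show "integrable vol (\<lambda>x. f x * \<zeta> x - f x * \<eta> x)" using i\<zeta> i\<eta> by simp
      show "f x * \<zeta> x - f x * \<eta> x \<le> 0" if "x \<notin> ?K" for x using \<eta>0[OF that] \<zeta>0[OF that] by simp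
      show "f x * \<zeta> x - f x * \<eta> x \<le> Bf * \<epsilon>" if "x \<in> ?K" for x
      proof -
        have "f x * \<zeta> x - f x * \<eta> x \<le> \<bar>f x\<bar> * \<bar>\<eta> x - \<zeta> x\<bar>"
          by (metis abs_ge_self abs_minus_commute abs_mult right_diff_distrib)
        also have "\<dots> \<le> Bf * \<epsilon>" using Bf that \<eta>(4) by (intro mult_mono) auto
        finally show ?thesis .
      qed
    qed
    finally have 1: "(LINT x|vol. f x * \<zeta> x) - (LINT x|vol. f x * \<eta> x) \<le> Bf * \<epsilon> * measure vol ?K" .
    have "(LINT x|vol. pairing \<zeta> x) - (LINT x|vol. pairing \<eta> x) = (LINT x|vol. pairing \<zeta> x - pairing \<eta> x)"
      using i\<zeta> i\<eta> by simp
    also have "\<dots> \<le> B\<phi> * (\<Lambda> * (CARD('m) * \<epsilon>)) * measure vol ?K"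
    proof (rule integral_vol_le[OF _ K(1)])
      show "integrable vol (\<lambda>x. pairing \<zeta> x - pairing \<eta> x)" using i\<zeta> i\<eta> by simp
      show "pairing \<zeta> x - pairing \<eta> x \<le> 0" if "x \<notin> ?K" for x
        using rinner_grad_0[OF compact_imp_closed[OF K(1)] that] \<zeta>0 \<eta>0 by simp
      show "pairing \<zeta> x - pairing \<eta> x \<le> B\<phi> * (\<Lambda> * (CARD('m) * \<epsilon>))" if x: "x \<in> ?K" for x
      proof -
        have "pairing \<zeta> x - pairing \<eta> x = - pairing (\<lambda>x. \<eta> x + (-1) * \<zeta> x) x"
          using rinner_grad_diff[OF C1\<eta> C1] by simp
        also have "\<dots> \<le> \<bar>pairing (\<lambda>x. \<eta> x + (-1) * \<zeta> x) x\<bar>" by simp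
        also have "\<dots> \<le> \<phi> (gnorm u x) * gnorm (\<lambda>x. \<eta> x + (-1) * \<zeta> x) x"
          by (rule phi_pairing_bound[OF uC1 C1d \<phi>(3)])
        also have "\<dots> \<le> B\<phi> * (\<Lambda> * (CARD('m) * \<epsilon>))"
          using B\<phi> \<eta>(5) x gnorm_nonneg[OF C1d] by (intro mult_mono) (auto dest!: bspec[OF _ x])
        finally show ?thesis .
      qed
    qed
    finally have "(LINT x|vol. pairing \<zeta> x) - (LINT x|vol. pairing \<eta> x) \<le> B\<phi> * (\<Lambda> * (CARD('m) * \<epsilon>)) * measure vol ?K" .
    moreover have "Bf * \<epsilon> * measure vol ?K + B\<phi> * (\<Lambda> * (CARD('m) * \<epsilon>)) * measure vol ?K = C * \<epsilon>"
      by (simp add: C_def algebra_simps)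
    ultimately show ?thesis using 1 t by linarith
  qed
  show ?thesis
  proof (rule field_le_epsilon)
    fix e :: real assume e: "e > 0"
    have "C * (e / (C + 1)) \<le> e" using C e by (simp add: field_simps)
    then show "(LINT x|vol. f x * \<zeta> x) + (LINT x|vol. pairing \<zeta> x) \<le> 0 + e"
      using main[of "e / (C + 1)"] C e by simp
  qed
qed

lemma rinner_grad_sum:
  assumes "finite I" "\<And>i. i \<in> I \<Longrightarrow> C1at (h i) p"
  shows "rinner A g X (grad g (\<lambda>x. \<Sum>i\<in>I. h i x)) p = (\<Sum>i\<in>I. rinner A g X (grad g (h i)) p)"
proof -
  have "has_dif (\<lambda>x. \<Sum>i\<in>I. h i x) (chart_at A p) p (\<Sum>i\<in>I. coord_partials (h i) (chart_at A p) p)"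
    using assms
  proof (induction I rule: finite_induct)
    case (insert i I)
    then have "has_dif (\<lambda>x. h i x + (\<Sum>i\<in>I. h i x)) (chart_at A p) p
       (coord_partials (h i) (chart_at A p) p + (\<Sum>i\<in>I. coord_partials (h i) (chart_at A p) p))"
      by (intro has_dif_add C1at_has_dif chart_at) auto
    then show ?case using insert by simp
  qed (simp add: has_dif_const)
  then show ?thesis by (simp add: rinner_grad has_dif_coord_partials inner_sum_right)
qed

text \<open>Both integrals are linear in the test function, so a partition of unity on its support
  reduces the claim to test functions supported in single charts. The weights are non-negative,
  which keeps the pieces admissible.\<close>

lemma div_ge_C1:
  assumes C1: "\<And>q. C1at \<zeta> q" and nn: "\<And>q. \<zeta> q \<ge> 0" and K: "compact K" and supp: "\<And>x. x \<notin> K \<Longrightarrow> \<zeta> x = 0"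
  shows "(LINT x|vol. f x * \<zeta> x) + (LINT x|vol. pairing \<zeta> x) \<le> 0"
proof -
  have "\<forall>p. \<exists>c r \<Lambda>. c \<in> A \<and> p \<in> fst c \<and> nice_ball c (snd c p) r \<Lambda>" using ex_chart ex_nice_ball by metis
  then obtain cb R L where nb: "\<And>p. cb p \<in> A \<and> p \<in> fst (cb p) \<and> nice_ball (cb p) (snd (cb p) p) (R p) (L p)" by metis
  have rb: "cb p \<in> A \<and> p \<in> fst (cb p) \<and> R p / 2 > 0 \<and> cball (snd (cb p) p) (R p / 2) \<subseteq> snd (cb p) ` fst (cb p)" for p
    using nb[of p] subset_cball[of "R p / 2" "R p" "snd (cb p) p"] by (auto simp: nice_ball_def)
  from partition_of_unity[OF K, of cb "\<lambda>p. R p / 2", OF rb]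
  obtain I \<eta> where I: "finite I" "I \<subseteq> K"
    and \<eta>: "\<forall>i\<in>I. \<forall>q. C1at (\<eta> i) q \<and> 0 \<le> \<eta> i q \<and> (\<eta> i q \<noteq> 0 \<longrightarrow> q \<in> fst (cb i) \<and> snd (cb i) q \<in> ball (snd (cb i) i) (R i / 2))"
    and one: "\<exists>W. open W \<and> K \<subseteq> W \<and> (\<forall>q\<in>W. (\<Sum>i\<in>I. \<eta> i q) = (1::real))"
    by (elim exE conjE) (rule that, assumption, assumption, assumption, blast)
  define z where "z i x = \<eta> i x * \<zeta> x" for i x
  have zC1: "C1at (z i) q" if "i \<in> I" for i q
    unfolding z_def[abs_def] using \<eta> that C1 by (intro C1at_mult) auto
  have each: "(LINT x|vol. f x * z i x) + (LINT x|vol. pairing (z i) x) \<le> 0" if i: "i \<in> I" for i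
  proof (rule div_ge_C1_chart[of "cb i" "snd (cb i) i" "R i" "L i" "R i / 2"])
    show "nice_ball (cb i) (snd (cb i) i) (R i) (L i)" using nb by blast
    show "R i / 2 < R i" using rb[of i] by simp
    show "z i q \<ge> 0" for q using \<eta> i nn by (simp add: z_def)
    show "q \<in> fst (cb i) \<and> snd (cb i) q \<in> cball (snd (cb i) i) (R i / 2)" if "z i q \<noteq> 0" for q
    proof -
      have "\<eta> i q \<noteq> 0" using that by (simp add: z_def)
      then have "q \<in> fst (cb i)" "snd (cb i) q \<in> ball (snd (cb i) i) (R i / 2)" using \<eta> i by blast+
      then show ?thesis by auto
    qed
  qed (rule zC1[OF i])
  have sum: "\<zeta> = (\<lambda>x. \<Sum>i\<in>I. z i x)"
  proof
    fix x
    show "\<zeta> x = (\<Sum>i\<in>I. z i x)"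
      using one supp[of x] by (cases "x \<in> K") (auto simp: z_def sum_distrib_right[symmetric])
  qed
  have z0: "z i x = 0" if "x \<notin> K" for i x using supp[OF that] by (simp add: z_def)
  have int: "integrable vol (pairing (z i))" "integrable vol (\<lambda>x. f x * z i x)" if "i \<in> I" for i
    using pairing_integrable[OF zC1[OF that] K z0] by auto
  have "pairing \<zeta> = (\<lambda>x. \<Sum>i\<in>I. pairing (z i) x)"
    by (subst sum, rule ext, rule rinner_grad_sum[OF I(1) zC1])
  then have "(LINT x|vol. pairing \<zeta> x) = (LINT x|vol. (\<Sum>i\<in>I. pairing (z i) x))" by simp
  also have "\<dots> = (\<Sum>i\<in>I. LINT x|vol. pairing (z i) x)"
    by (rule Bochner_Integration.integral_sum) (rule int)
  finally have 1: "(LINT x|vol. pairing \<zeta> x) = (\<Sum>i\<in>I. LINT x|vol. pairing (z i) x)" .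
  have "(LINT x|vol. f x * \<zeta> x) = (LINT x|vol. (\<Sum>i\<in>I. f x * z i x))"
    by (subst sum) (simp add: sum_distrib_left)
  also have "\<dots> = (\<Sum>i\<in>I. LINT x|vol. f x * z i x)"
    by (rule Bochner_Integration.integral_sum) (rule int)
  finally have "(LINT x|vol. f x * \<zeta> x) + (LINT x|vol. pairing \<zeta> x)
     = (\<Sum>i\<in>I. (LINT x|vol. f x * z i x) + (LINT x|vol. pairing (z i) x))"
    using 1 by (simp add: sum.distrib)
  also have "\<dots> \<le> 0" by (rule sum_nonpos) (rule each)
  finally show ?thesis .
qed

end

end

text \<open>A C^1 transition from 0 to 1, polynomial between the two values; its slope is at most
  4.\<close>

definition smooth_step :: "real \<Rightarrow> real" where
  "smooth_step x = 1 - ppow 2 (1 - ppow 2 x)"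

lemma ppow_1: "ppow 1 t = max 0 t"
  by (simp add: ppow_def)

lemma smooth_step:
  shows "0 \<le> smooth_step x" "smooth_step x \<le> 1" "x \<le> 0 \<Longrightarrow> smooth_step x = 0" "x \<ge> 1 \<Longrightarrow> smooth_step x = 1"
proof -
  have "ppow 2 (1 - ppow 2 x) \<le> 1" using ppow_nonneg[of 2 x]
    by (auto simp: ppow_def[of _ "1 - _"] max_def intro: power_le_one)
  then show "0 \<le> smooth_step x" by (simp add: smooth_step_def)
  show "smooth_step x \<le> 1" using ppow_nonneg[of 2 "1 - ppow 2 x"] by (simp add: smooth_step_def)
  show "x \<le> 0 \<Longrightarrow> smooth_step x = 0" by (simp add: smooth_step_def ppow_nonpos ppow_pos)
  assume "x \<ge> 1"
  then have "ppow 2 x \<ge> 1" by (simp add: ppow_pos one_le_power)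
  then show "smooth_step x = 1" by (simp add: smooth_step_def ppow_nonpos)
qed

definition smooth_step' :: "real \<Rightarrow> real" where
  "smooth_step' x = 4 * ppow 1 (1 - ppow 2 x) * ppow 1 x"

lemma smooth_step_deriv: "(smooth_step has_real_derivative smooth_step' x) (at x)"
proof -
  have p: "(ppow 2 has_real_derivative 2 * ppow 1 t) (at t)" for t using ppow_deriv[of 2 t] by simp
  have "((\<lambda>x. 1 - ppow 2 x) has_real_derivative - (2 * ppow 1 x)) (at x)"
    using DERIV_diff[OF DERIV_const[of 1] p[of x]] by simp
  from DERIV_chain2[OF p this] DERIV_diff[OF DERIV_const[of 1]]
  have "((\<lambda>x. 1 - ppow 2 (1 - ppow 2 x)) has_real_derivative 0 - 2 * ppow 1 (1 - ppow 2 x) * - (2 * ppow 1 x)) (at x)"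
    by blast
  then show ?thesis by (simp add: smooth_step_def[abs_def] smooth_step'_def algebra_simps)
qed

lemma smooth_step'_bound: "\<bar>smooth_step' x\<bar> \<le> 4"
proof -
  consider "x \<le> 0" | "x \<ge> 1" | "0 < x" "x < 1" by linarith
  then show ?thesis
  proof cases
    case 2
    then have "ppow 2 x \<ge> 1" by (simp add: ppow_pos one_le_power)
    then show ?thesis by (simp add: smooth_step'_def ppow_1)
  next
    case 3
    have "ppow 1 (1 - ppow 2 x) \<le> 1" using ppow_nonneg[of 2 x] by (simp add: ppow_1)
    moreover have "ppow 1 x \<le> 1" using 3 by (simp add: ppow_1)
    ultimately have "ppow 1 (1 - ppow 2 x) * ppow 1 x \<le> 1 * 1"
      by (intro mult_mono) (auto simp: ppow_nonneg)
    then show ?thesis using ppow_nonneg by (simp add: smooth_step'_def abs_mult)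
  qed (simp add: smooth_step'_def ppow_1)
qed

context riem
begin

subsection \<open>Calculus of the gradient norm\<close>

lemma gnorm_dual:
  assumes "c \<in> A" "p \<in> fst c" "has_dif f c p \<omega>"
  shows "\<omega> \<bullet> v \<le> gnorm f p * sqrt (v \<bullet> (g c p *v v))"
proof -
  note G = metric_pos_def[OF assms(1,2)]
  let ?w = "matrix_inv (g c p) *v \<omega>"
  have f: "cip f f p = ?w \<bullet> (g c p *v ?w)"
    using cip_chart[OF assms assms(3)] by (simp add: pos_def_inverse[OF G] inner_commute)
  have "\<omega> \<bullet> v = ?w \<bullet> (g c p *v v)"
    using pos_def_sym[OF G, of ?w v] by (simp add: pos_def_inverse[OF G] inner_commute)
  also have "\<dots> \<le> sqrt ((?w \<bullet> (g c p *v v))\<^sup>2)" by simp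
  also have "\<dots> \<le> sqrt ((?w \<bullet> (g c p *v ?w)) * (v \<bullet> (g c p *v v)))"
    by (rule real_sqrt_le_mono[OF pos_def_Cauchy_Schwarz[OF G]])
  also have "\<dots> = gnorm f p * sqrt (v \<bullet> (g c p *v v))" by (simp add: gnorm_def f real_sqrt_mult)
  finally show ?thesis .
qed

lemma gnorm_abs_dual:
  assumes "c \<in> A" "p \<in> fst c" "has_dif f c p \<omega>"
  shows "k * (\<omega> \<bullet> v) \<le> \<bar>k\<bar> * gnorm f p * sqrt (v \<bullet> (g c p *v v))"
proof -
  have "g c p *v (- v) = - (g c p *v v)" using matrix_vector_mult_diff_distrib[of "g c p" 0 v] by simp
  then have "\<bar>\<omega> \<bullet> v\<bar> \<le> gnorm f p * sqrt (v \<bullet> (g c p *v v))"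
    using gnorm_dual[OF assms, of v] gnorm_dual[OF assms, of "- v"] by (simp add: abs_le_iff)
  then have "\<bar>k\<bar> * \<bar>\<omega> \<bullet> v\<bar> \<le> \<bar>k\<bar> * (gnorm f p * sqrt (v \<bullet> (g c p *v v)))" by (intro mult_left_mono) auto
  moreover have "k * (\<omega> \<bullet> v) \<le> \<bar>k\<bar> * \<bar>\<omega> \<bullet> v\<bar>" by (metis abs_ge_self abs_mult)
  ultimately show ?thesis by simp
qed

lemma gnorm_add_le:
  assumes "C1at f p" "C1at h p" shows "gnorm (\<lambda>x. f x + h x) p \<le> gnorm f p + gnorm h p"
proof -
  note d = C1at_has_dif[OF assms(1) chart_at] C1at_has_dif[OF assms(2) chart_at]
  show ?thesis
    by (rule gnorm_le[OF chart_at has_dif_add[OF d]])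
      (use gnorm_dual[OF chart_at d(1)] gnorm_dual[OF chart_at d(2)] gnorm_nonneg[OF assms(1)] gnorm_nonneg[OF assms(2)]
        in \<open>auto simp: inner_add_left distrib_right intro: add_mono\<close>)
qed

lemma gnorm_const: "gnorm (\<lambda>x. k) p = 0"
  using cip_chart[OF chart_at has_dif_const has_dif_const] by (simp add: gnorm_def)

lemma gnorm_sum_le:
  assumes "finite I" "\<And>i. i \<in> I \<Longrightarrow> C1at (h i) p"
  shows "gnorm (\<lambda>x. \<Sum>i\<in>I. h i x) p \<le> (\<Sum>i\<in>I. gnorm (h i) p)"
  using assms
proof (induction I rule: finite_induct)
  case (insert i I)
  have "gnorm (\<lambda>x. h i x + (\<Sum>i\<in>I. h i x)) p \<le> gnorm (h i) p + gnorm (\<lambda>x. \<Sum>i\<in>I. h i x) p"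
    by (rule gnorm_add_le) (use insert in \<open>auto intro: C1at_sum\<close>)
  then show ?case using insert by simp
qed (simp add: gnorm_const)

lemma gnorm_mult_le:
  assumes "C1at f p" "C1at h p" shows "gnorm (\<lambda>x. f x * h x) p \<le> \<bar>f p\<bar> * gnorm h p + \<bar>h p\<bar> * gnorm f p"
proof -
  note d = C1at_has_dif[OF assms(1) chart_at] C1at_has_dif[OF assms(2) chart_at]
  show ?thesis
  proof (rule gnorm_le[OF chart_at has_dif_mult[OF chart_at d]])
    fix v
    show "(f p *\<^sub>R coord_partials h (chart_at A p) p + h p *\<^sub>R coord_partials f (chart_at A p) p) \<bullet> v
      \<le> (\<bar>f p\<bar> * gnorm h p + \<bar>h p\<bar> * gnorm f p) * sqrt (v \<bullet> (g (chart_at A p) p *v v))"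
      using gnorm_abs_dual[OF chart_at d(1), of "h p" v] gnorm_abs_dual[OF chart_at d(2), of "f p" v]
      by (simp add: inner_add_left distrib_right)
  qed (use gnorm_nonneg[OF assms(1)] gnorm_nonneg[OF assms(2)] in simp)
qed

lemma gnorm_compose_le:
  assumes "C1at f p" "(\<theta> has_real_derivative k) (at (f p))"
  shows "gnorm (\<lambda>x. \<theta> (f x)) p \<le> \<bar>k\<bar> * gnorm f p"
proof -
  note d = C1at_has_dif[OF assms(1) chart_at]
  show ?thesis
    by (rule gnorm_le[OF chart_at has_dif_compose[OF chart_at d assms(2)]])
      (use gnorm_abs_dual[OF chart_at d] gnorm_nonneg[OF assms(1)] in auto)
qed

lemma gnorm_cong:
  assumes "C1at f p" "open V" "p \<in> V" "\<And>x. x \<in> V \<Longrightarrow> f x = h x"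
  shows "gnorm h p = gnorm f p"
proof -
  note d = C1at_has_dif[OF assms(1) chart_at]
  have "has_dif h (chart_at A p) p (coord_partials f (chart_at A p) p)"
    by (rule has_dif_cong[OF chart_at(1) assms(3,2,4) d chart_at(2)])
  from has_dif_coord_partials[OF this] show ?thesis by (simp add: gnorm_def cip_def)
qed

end

section \<open>Cutoff functions with gradient of order 1/r\<close>

context conn_riem
begin

text \<open>Coordinate translates of f differ by at most k times the distance, which is at most
  twice the length of the displacement measured at the fixed point y. The mollification inherits
  this bound, and the constant is 2k without any \<Lambda>.\<close>

lemma mollify_lipschitz_in_chart:
  fixes f :: "'a \<Rightarrow> real"
  assumes nb: "nice_ball c y0 R \<Lambda>" and fc: "continuous_on UNIV f" and k: "k \<ge> 0" and lip: "\<And>p q. \<bar>f p - f q\<bar> \<le> k * dd p q" and "\<epsilon> > 0"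
  shows "\<exists>F. (\<forall>n. Ck_on n UNIV F) \<and> (\<forall>y\<in>cball y0 (R / 2). \<bar>F y - f (coord_inv c y)\<bar> \<le> \<epsilon> \<and>
     (\<forall>v. \<bar>frechet_derivative F (at y) v\<bar> \<le> 2 * k * sqrt (v \<bullet> (g c (coord_inv c y) *v v))))"
proof -
  have c: "c \<in> A" and R: "R > 0" and sub: "cball y0 R \<subseteq> snd c ` fst c" using nb by (auto simp: nice_ball_def)
  \<comment> \<open>A cutoff equal to 1 up to radius 3R/4, which gives f compact support in
    coordinates. It is not felt on the half ball: the smoothing and the increment move a point by at
    most R/8 each.\<close>
  define cl where "cl y = max 0 (min 1 ((R - norm (y - y0)) * (4 / R)))" for y :: "real ^ 'b"
  define F0 where "F0 y = (if y \<in> cball y0 R then f (coord_inv c y) * cl y else 0)" for y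
  have clc: "continuous_on S cl" for S unfolding cl_def[abs_def] by (intro continuous_intros)
  have cl1: "cl y = 1" if "y \<in> cball y0 (3 * R / 4)" for y
  proof -
    have "R / 4 \<le> R - norm (y - y0)" using that by (simp add: dist_norm norm_minus_commute)
    then have "R / 4 * (4 / R) \<le> (R - norm (y - y0)) * (4 / R)" using R by (intro mult_right_mono) auto
    then show ?thesis using R by (simp add: cl_def)
  qed
  have "continuous_on (cball y0 R) (\<lambda>y. f (coord_inv c y))"
    by (rule continuous_on_compose2[OF fc continuous_on_subset[OF chart_homeo(4)[OF c] sub]]) simp
  then have "continuous_on (cball y0 R \<union> - ball y0 R) F0"
    unfolding F0_def[abs_def]
  proof (intro continuous_on_cases continuous_on_mult clc continuous_on_const)
    show "\<forall>y. y \<in> cball y0 R \<and> y \<notin> cball y0 R \<or> y \<in> - ball y0 R \<and> y \<in> cball y0 R \<longrightarrow> f (coord_inv c y) * cl y = 0"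
      by (auto simp: cl_def dist_norm norm_minus_commute)
  qed auto
  moreover have "cball y0 R \<union> - ball y0 R = UNIV" by auto
  ultimately have F0c: "continuous_on UNIV F0" by simp
  have F0z: "F0 y = 0" if "y \<notin> cball y0 R" for y using that by (auto simp: F0_def)
  have F0in: "F0 y = f (coord_inv c y)" if "y \<in> cball y0 (3 * R / 4)" for y
    using that cl1[OF that] R by (auto simp: F0_def)
  obtain d1 where d1: "d1 > 0" "\<And>x y. dist x y < d1 \<Longrightarrow> norm (F0 x - F0 y) < \<epsilon>"
    using uniformly_continuous_compact_support[OF F0c F0z \<open>\<epsilon> > 0\<close>] by blast
  define e where "e = min d1 (R / 8)"
  have e: "e > 0" "e \<le> d1" "e \<le> R / 8" using d1 R by (auto simp: e_def)
  have "bounded (cball y0 R)" by simp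
  then obtain a where a: "cball y0 R \<subseteq> cbox (- a) a" using bounded_subset_cbox_symmetric by blast
  have fbox: "F0 z = 0" if "z \<notin> cbox (- a) a" for z using F0z[of z] a that by blast
  show ?thesis
  proof (intro exI[of _ "mollify e F0"] conjI allI ballI)
    show "Ck_on n UNIV (mollify e F0)" for n by (rule Ck_on_mollify[OF e(1) F0c fbox])
    fix y assume y: "y \<in> cball y0 (R / 2)"
    then have y': "y \<in> cball y0 (3 * R / 4)" "y \<in> cball y0 R" using R by auto
    have "\<bar>mollify e F0 y - F0 y\<bar> \<le> \<epsilon>"
    proof (rule mollify_close[OF e(1) F0c])
      fix w :: "real ^ 'b" assume "norm w < e"
      then show "\<bar>F0 (y - w) - F0 y\<bar> \<le> \<epsilon>" using d1(2)[of "y - w" y] e(2) by (simp add: dist_norm)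
    qed
    then show "\<bar>mollify e F0 y - f (coord_inv c y)\<bar> \<le> \<epsilon>" using F0in[OF y'(1)] by simp
    fix v :: "real ^ 'b"
    let ?n = "sqrt (v \<bullet> (g c (coord_inv c y) *v v))"
    have "\<bar>frechet_derivative (mollify e F0) (at y) v - 0\<bar> \<le> 2 * k * ?n"
    proof (rule mollify_derivative[OF e(1) F0c fbox, where ?h0.0 = "R / 8 / (norm v + 1)"])
      show "0 < R / 8 / (norm v + 1)" using R by (simp add: add_nonneg_pos)
      fix w :: "real ^ 'b" and h :: real
      assume w: "norm w < e" and h: "0 < h" "h < R / 8 / (norm v + 1)"
      have "h * norm v \<le> h * (norm v + 1)" using h by simp
      also have "\<dots> < R / 8"
        using h(2) pos_less_divide_eq[of "norm v + 1" h "R / 8"] by (simp add: add_nonneg_pos)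
      finally have hv: "norm (h *\<^sub>R v) < R / 8" using h by simp
      have z1: "y - w \<in> cball y0 (3 * R / 4)"
        using y w e(3) R norm_triangle_ineq4[of "y - y0" w] by (simp add: dist_norm norm_minus_commute algebra_simps)
      have z2: "y - w + h *\<^sub>R v \<in> cball y0 (3 * R / 4)"
      proof -
        have "norm (y - w + h *\<^sub>R v - y0) \<le> norm (y - y0) + norm w + norm (h *\<^sub>R v)"
          using norm_triangle_ineq[of "y - w - y0" "h *\<^sub>R v"] norm_triangle_ineq4[of "y - y0" w] by (simp add: algebra_simps)
        then have "norm (y - w + h *\<^sub>R v - y0) \<le> 3 * R / 4"
          using y w e(3) hv by (simp add: dist_norm norm_minus_commute)
        then show ?thesis by (simp add: dist_norm norm_minus_commute[of y0])
      qed
      have zz: "y - w \<in> cball y0 R" "y - w + h *\<^sub>R v \<in> cball y0 R" using z1 z2 R by auto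
      have "\<bar>F0 (y - w + h *\<^sub>R v) - F0 (y - w)\<bar> \<le> k * dd (coord_inv c (y - w + h *\<^sub>R v)) (coord_inv c (y - w))"
        unfolding F0in[OF z1] F0in[OF z2] by (rule lip)
      also have "\<dots> = k * dd (coord_inv c (y - w)) (coord_inv c (y - w + h *\<^sub>R v))" by (simp add: dd_sym)
      also have "\<dots> \<le> k * (2 * sqrt ((h *\<^sub>R v) \<bullet> (g c (coord_inv c y) *v (h *\<^sub>R v))))"
        using nice_ball_curve(2)[OF nb zz y'(2)] k by (intro mult_left_mono) auto
      also have "\<dots> = h * (2 * k * ?n)"
        using h by (simp add: matrix_vector_mult_scaleR real_sqrt_mult mult.assoc[symmetric])
      finally show "\<bar>F0 (y - w + h *\<^sub>R v) - F0 (y - w) - h * 0\<bar> \<le> h * (2 * k * ?n)" by simp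
    qed
    then show "\<bar>frechet_derivative (mollify e F0) (at y) v\<bar> \<le> 2 * k * ?n" by simp
  qed
qed

end

context complete_riem
begin

text \<open>A truncated affine function of the distance has Lipschitz constant 2/r. It is mollified
  in charts and glued by a partition of unity, with gradient at most 5/r, and is then composed with
  a step function to restore the exact values 0 and 1. The constant is 40 = 4 * 2 * 5: the slope of
  the step, the inner scaling, and the gradient of the glued function.\<close>

lemma ex_cutoff:
  assumes r: "r > 0"
  shows "\<exists>\<psi>. (\<forall>q. C1at \<psi> q \<and> 0 \<le> \<psi> q \<and> \<psi> q \<le> 1 \<and> (dd q pole < r / 2 \<longrightarrow> \<psi> q = 1) \<and>
     (\<psi> q \<noteq> 0 \<longrightarrow> dd q pole < r) \<and> gnorm \<psi> q \<le> 40 / r)"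
proof -
  define f where "f q = max 0 (min 1 (2 - 2 / r * dd q pole))" for q
  define K where "K = {x. dd x pole \<le> r}"
  have K: "compact K" "closed K" unfolding K_def by (rule compact_dd_ball, rule closed_dd_ball)
  have fc: "continuous_on UNIV f"
    unfolding f_def[abs_def] by (intro continuous_intros dd_continuous)
  have f01: "0 \<le> f q" "f q \<le> 1" for q by (auto simp: f_def)
  have f1: "f q = 1" if "dd q pole < r / 2" for q
    using that r by (simp add: f_def field_simps)
  have f0: "dd q pole < r" if "f q > 0" for q
    using that r by (auto simp: f_def field_simps split: if_splits simp: max_def min_def)
  have lip: "\<bar>f p - f q\<bar> \<le> 2 / r * dd p q" for p q
  proof -
    have "\<bar>dd p pole - dd q pole\<bar> \<le> dd p q"
      using dd_triangle[of p pole q] dd_triangle[of q pole p] dd_sym[of p q] by linarith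
    then have "2 / r * \<bar>dd p pole - dd q pole\<bar> \<le> 2 / r * dd p q" using r by (intro mult_left_mono) auto
    moreover have "\<bar>2 / r * dd p pole - 2 / r * dd q pole\<bar> = 2 / r * \<bar>dd p pole - dd q pole\<bar>"
      using r by (simp add: abs_mult right_diff_distrib[symmetric] del: times_divide_eq_left)
    moreover have "\<bar>f p - f q\<bar> \<le> \<bar>2 / r * dd p pole - 2 / r * dd q pole\<bar>"
      unfolding f_def by linarith
    ultimately show ?thesis by linarith
  qed
  have "\<forall>p. \<exists>c R \<Lambda>. c \<in> A \<and> p \<in> fst c \<and> nice_ball c (snd c p) R \<Lambda>" using ex_chart ex_nice_ball by metis
  then obtain cb R L where nb: "\<And>p. cb p \<in> A \<and> p \<in> fst (cb p) \<and> nice_ball (cb p) (snd (cb p) p) (R p) (L p)" by metis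
  have rb: "cb p \<in> A \<and> p \<in> fst (cb p) \<and> R p / 2 > 0 \<and> cball (snd (cb p) p) (R p / 2) \<subseteq> snd (cb p) ` fst (cb p)" for p
    using nb[of p] subset_cball[of "R p / 2" "R p" "snd (cb p) p"] by (auto simp: nice_ball_def)
  from partition_of_unity[OF K(1), of cb "\<lambda>p. R p / 2", OF rb]
  obtain I \<eta> where I: "finite I" "I \<subseteq> K"
    and \<eta>: "\<forall>i\<in>I. \<forall>q. C1at (\<eta> i) q \<and> 0 \<le> \<eta> i q \<and> (\<eta> i q \<noteq> 0 \<longrightarrow> q \<in> fst (cb i) \<and> snd (cb i) q \<in> ball (snd (cb i) i) (R i / 2))"
    and le1: "\<forall>q. (\<Sum>i\<in>I. \<eta> i q) \<le> (1::real)"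
    and one: "\<exists>W. open W \<and> K \<subseteq> W \<and> (\<forall>q\<in>W. (\<Sum>i\<in>I. \<eta> i q) = (1::real))"
    by (elim exE conjE) (rule that, assumption, assumption, assumption, assumption, blast)
  from one obtain W where W: "open W" "K \<subseteq> W" "\<And>q. q \<in> W \<Longrightarrow> (\<Sum>i\<in>I. \<eta> i q) = 1" by blast
  have \<eta>C: "C1at (\<eta> i) q" "0 \<le> \<eta> i q" if "i \<in> I" for i q using \<eta> that by auto
  have "continuous_on UNIV (\<lambda>q. \<Sum>i\<in>I. gnorm (\<eta> i) q)"
    by (intro continuous_on_sum gnorm_continuous \<eta>C(1))
  then obtain B where B: "B > 0" "\<forall>q\<in>K. \<bar>\<Sum>i\<in>I. gnorm (\<eta> i) q\<bar> \<le> B" using continuous_on_compact_bound[OF _ K(1)] by blast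
  \<comment> \<open>The partition, and with it the bound B for its gradients, is fixed before the
    accuracy of the mollification. Hence the terms containing derivatives of the partition
    contribute at most 1/r.\<close>
  define \<epsilon> where "\<epsilon> = min (1 / 8) (1 / r / B)"
  have \<epsilon>: "\<epsilon> > 0" "\<epsilon> \<le> 1 / 8" "\<epsilon> * B \<le> 1 / r"
  proof -
    show "\<epsilon> > 0" "\<epsilon> \<le> 1 / 8" using r B by (auto simp: \<epsilon>_def)
    have "\<epsilon> * B \<le> 1 / r / B * B" using B by (intro mult_right_mono) (auto simp: \<epsilon>_def)
    then show "\<epsilon> * B \<le> 1 / r" using B by simp
  qed
  have "\<forall>i. \<exists>F. (\<forall>n. Ck_on n UNIV F) \<and> (\<forall>y\<in>cball (snd (cb i) i) (R i / 2). \<bar>F y - f (coord_inv (cb i) y)\<bar> \<le> \<epsilon> \<and>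
     (\<forall>v. \<bar>frechet_derivative F (at y) v\<bar> \<le> 2 * (2 / r) * sqrt (v \<bullet> (g (cb i) (coord_inv (cb i) y) *v v))))"
    by (intro allI, rule mollify_lipschitz_in_chart[OF _ fc _ lip \<epsilon>(1)]) (use nb r in auto)
  then obtain F where F: "\<And>i n. Ck_on n UNIV (F i)"
    and Fc: "\<And>i y. y \<in> cball (snd (cb i) i) (R i / 2) \<Longrightarrow> \<bar>F i y - f (coord_inv (cb i) y)\<bar> \<le> \<epsilon>"
    and Fd: "\<And>i y v. y \<in> cball (snd (cb i) i) (R i / 2) \<Longrightarrow>
       \<bar>frechet_derivative (F i) (at y) v\<bar> \<le> 2 * (2 / r) * sqrt (v \<bullet> (g (cb i) (coord_inv (cb i) y) *v v))"
    by metis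
  define V where "V i = coord_inv (cb i) ` cball (snd (cb i) i) (R i / 2)" for i
  have V: "closed (V i)" "V i = fst (cb i) \<inter> snd (cb i) -` cball (snd (cb i) i) (R i / 2)" for i
    using compact_imp_closed[OF chart_cball_compact] chart_inv_image rb[of i] by (auto simp: V_def)
  have \<eta>V: "\<eta> i q = 0" if "i \<in> I" "q \<notin> V i" for i q
  proof (rule ccontr)
    assume "\<eta> i q \<noteq> 0"
    then have "q \<in> fst (cb i)" "snd (cb i) q \<in> ball (snd (cb i) i) (R i / 2)" using \<eta> that(1) by blast+
    then show False using that(2) unfolding V(2) by auto
  qed
  define G where "G i q = F i (snd (cb i) q)" for i q
  have DF: "(F i has_derivative frechet_derivative (F i) (at y)) (at y)" for i y
    using Ck_on_SucD(1)[OF F[of "Suc 0" i]] by simp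
  have GC: "C1at (G i) q" if "q \<in> fst (cb i)" for i q
  proof (rule C1at_chart[of "cb i" q "snd (cb i) ` fst (cb i)" "F i" "\<lambda>y. frechet_derivative (F i) (at y)"])
    have "continuous_on UNIV (\<lambda>y. frechet_derivative (F i) (at y) (axis j 1))" for j
      using Ck_on_SucD(2)[OF F[of "Suc 0" i], of "axis j 1"] by (auto simp: Basis_vec_def)
    then show "continuous_on (snd (cb i) ` fst (cb i)) (\<lambda>y. frechet_derivative (F i) (at y) (axis j 1))" for j
      by (rule continuous_on_subset) simp
  qed (use rb[of i] that chart_homeo(2) DF in \<open>auto simp: G_def\<close>)
  have Gf: "\<bar>G i q - f q\<bar> \<le> \<epsilon>" if "q \<in> V i" for i q
  proof -
    have q: "q \<in> fst (cb i)" "snd (cb i) q \<in> cball (snd (cb i) i) (R i / 2)" using that unfolding V(2) by auto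
    then show ?thesis using Fc[OF q(2)] chart_homeo(5)[of "cb i" q] rb[of i] by (simp add: G_def)
  qed
  have Gn: "gnorm (G i) q \<le> 4 / r" if "q \<in> V i" for i q
  proof -
    have c: "cb i \<in> A" using rb by blast
    have q: "q \<in> fst (cb i)" "snd (cb i) q \<in> cball (snd (cb i) i) (R i / 2)" using that unfolding V(2) by auto
    let ?D = "frechet_derivative (F i) (at (snd (cb i) q))"
    define \<omega> where "\<omega> = (\<chi> j. ?D (axis j 1))"
    have D': "?D = (\<lambda>v. \<omega> \<bullet> v)"
      unfolding \<omega>_def using linear_inner_rep[OF has_derivative_linear[OF DF]] by blast
    have "(F i has_derivative (\<lambda>v. \<omega> \<bullet> v)) (at (snd (cb i) q))" using DF[of i "snd (cb i) q"] unfolding D' .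
    then have hd: "has_dif (G i) (cb i) q \<omega>"
      unfolding has_dif_def
      by (rule has_derivative_transform_within_open[OF _ chart_homeo(2)[OF c]])
        (use q chart_homeo(6)[OF c] in \<open>auto simp: G_def\<close>)
    show ?thesis
    proof (rule gnorm_le[OF c q(1) hd])
      fix v
      have "\<omega> \<bullet> v = ?D v" by (simp add: D')
      also have "\<dots> \<le> 2 * (2 / r) * sqrt (v \<bullet> (g (cb i) (coord_inv (cb i) (snd (cb i) q)) *v v))"
        using Fd[OF q(2), of v] by simp
      finally show "\<omega> \<bullet> v \<le> 4 / r * sqrt (v \<bullet> (g (cb i) q *v v))" by (simp add: chart_homeo(5)[OF c q(1)])
    qed (use r in simp)
  qed
  have zC: "C1at (\<lambda>x. \<eta> i x * (G i x + k)) q" if "i \<in> I" for i k q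
  proof (cases "q \<in> fst (cb i)")
    case True
    then show ?thesis by (intro C1at_mult C1at_add GC C1at_const \<eta>C(1)[OF that])
  next
    case False
    then have "q \<in> - V i" unfolding V(2) by simp
    then show ?thesis
      by (rule C1at_cong[OF C1at_const[of 0] open_Compl[OF V(1)]]) (simp add: \<eta>V[OF that])
  qed
  define f' where "f' q = (\<Sum>i\<in>I. \<eta> i q * (G i q + 0))" for q
  have f'C: "C1at f' q" for q unfolding f'_def[abs_def] by (rule C1at_sum) (rule zC)
  have close: "\<bar>f' q - (\<Sum>i\<in>I. \<eta> i q) * f q\<bar> \<le> 1 / 8" for q
  proof -
    have "f' q - (\<Sum>i\<in>I. \<eta> i q) * f q = (\<Sum>i\<in>I. \<eta> i q * (G i q - f q))"
      by (simp add: f'_def sum_distrib_right sum_subtractf[symmetric] right_diff_distrib)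
    also have "\<bar>\<dots>\<bar> \<le> (\<Sum>i\<in>I. \<bar>\<eta> i q * (G i q - f q)\<bar>)" by (rule sum_abs)
    also have "\<dots> \<le> (\<Sum>i\<in>I. \<eta> i q * \<epsilon>)"
    proof (rule sum_mono)
      fix i assume i: "i \<in> I"
      show "\<bar>\<eta> i q * (G i q - f q)\<bar> \<le> \<eta> i q * \<epsilon>"
      proof (cases "q \<in> V i")
        case True
        then show ?thesis using Gf[OF True] \<eta>C(2)[OF i] by (simp add: abs_mult mult_left_mono)
      qed (simp add: \<eta>V[OF i])
    qed
    also have "\<dots> = (\<Sum>i\<in>I. \<eta> i q) * \<epsilon>" by (simp add: sum_distrib_right)
    also have "\<dots> \<le> 1 * \<epsilon>" using le1 \<epsilon> by (intro mult_right_mono) auto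
    finally show ?thesis using \<epsilon>(2) by linarith
  qed
  have gn: "gnorm f' q \<le> 5 / r" if q: "q \<in> K" for q
  proof -
    \<comment> \<open>Near K the weights sum to 1, so subtracting the constant f(q) from every local
      function does not change the sum. The derivatives of the weights are then multiplied by errors
      of size \<epsilon> only.\<close>
    define h where "h x = f q + (\<Sum>i\<in>I. \<eta> i x * (G i x + (- f q)))" for x
    have hC: "C1at (\<lambda>x. \<Sum>i\<in>I. \<eta> i x * (G i x + (- f q))) p" for p by (rule C1at_sum) (rule zC)
    have hC': "C1at h p" for p unfolding h_def[abs_def] by (rule C1at_add[OF C1at_const hC])
    have eq: "h x = f' x" if "x \<in> W" for x
    proof -
      have "(\<Sum>i\<in>I. \<eta> i x * (G i x + (- f q))) = (\<Sum>i\<in>I. \<eta> i x * G i x) - (\<Sum>i\<in>I. \<eta> i x) * f q"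
        by (simp add: sum_distrib_right sum_subtractf[symmetric] right_diff_distrib)
      then show ?thesis using W(3)[OF that] by (simp add: h_def f'_def)
    qed
    have "gnorm f' q = gnorm h q" by (rule gnorm_cong[OF hC' W(1) _ eq]) (use q W(2) in auto)
    also have "\<dots> \<le> gnorm (\<lambda>x. f q) q + gnorm (\<lambda>x. \<Sum>i\<in>I. \<eta> i x * (G i x + (- f q))) q"
      unfolding h_def[abs_def] by (rule gnorm_add_le[OF C1at_const hC])
    also have "\<dots> \<le> (\<Sum>i\<in>I. gnorm (\<lambda>x. \<eta> i x * (G i x + (- f q))) q)"
    proof -
      have "gnorm (\<lambda>x. \<Sum>i\<in>I. \<eta> i x * (G i x + (- f q))) q \<le> (\<Sum>i\<in>I. gnorm (\<lambda>x. \<eta> i x * (G i x + (- f q))) q)"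
        by (rule gnorm_sum_le[OF I(1)]) (rule zC)
      then show ?thesis by (simp add: gnorm_const)
    qed
    also have "\<dots> \<le> (\<Sum>i\<in>I. \<eta> i q * (4 / r) + \<epsilon> * gnorm (\<eta> i) q)"
    proof (rule sum_mono)
      fix i assume i: "i \<in> I"
      show "gnorm (\<lambda>x. \<eta> i x * (G i x + (- f q))) q \<le> \<eta> i q * (4 / r) + \<epsilon> * gnorm (\<eta> i) q"
      proof (cases "q \<in> V i")
        case True
        then have qc: "q \<in> fst (cb i)" unfolding V(2) by simp
        have "gnorm (\<lambda>x. \<eta> i x * (G i x + (- f q))) q
          \<le> \<bar>\<eta> i q\<bar> * gnorm (\<lambda>x. G i x + (- f q)) q + \<bar>G i q + (- f q)\<bar> * gnorm (\<eta> i) q"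
          by (rule gnorm_mult_le[OF \<eta>C(1)[OF i] C1at_add[OF GC[OF qc] C1at_const]])
        also have "\<dots> \<le> \<eta> i q * (4 / r) + \<epsilon> * gnorm (\<eta> i) q"
        proof (intro add_mono mult_mono)
          show "gnorm (\<lambda>x. G i x + (- f q)) q \<le> 4 / r"
            using gnorm_add_le[OF GC[OF qc] C1at_const[of "- f q"]] Gn[OF True] by (simp add: gnorm_const)
          show "0 \<le> gnorm (\<lambda>x. G i x + (- f q)) q" by (rule gnorm_nonneg[OF C1at_add[OF GC[OF qc] C1at_const]])
        qed (use \<eta>C[OF i] Gf[OF True] gnorm_nonneg[OF \<eta>C(1)[OF i]] \<epsilon> in auto)
        finally show ?thesis .
      next
        case False
        have "gnorm (\<lambda>x. \<eta> i x * (G i x + (- f q))) q = gnorm (\<lambda>x. 0) q"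
          by (rule gnorm_cong[OF C1at_const open_Compl[OF V(1)[of i]]]) (use False \<eta>V[OF i] in auto)
        then show ?thesis using \<eta>C[OF i] gnorm_nonneg[OF \<eta>C(1)[OF i]] \<epsilon> r by (simp add: gnorm_const)
      qed
    qed
    also have "\<dots> = (\<Sum>i\<in>I. \<eta> i q) * (4 / r) + \<epsilon> * (\<Sum>i\<in>I. gnorm (\<eta> i) q)"
      by (simp only: sum.distrib sum_distrib_right sum_distrib_left)
    also have "\<dots> \<le> 4 / r + \<epsilon> * B"
    proof -
      have "\<epsilon> * (\<Sum>i\<in>I. gnorm (\<eta> i) q) \<le> \<epsilon> * B"
        using bspec[OF B(2) q] \<epsilon>(1) by (intro mult_left_mono) auto
      then show ?thesis using W(3)[of q] W(2) q by auto
    qed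
    also have "\<dots> \<le> 5 / r" using \<epsilon>(3) by (simp add: field_simps add_divide_distrib[symmetric])
    finally show ?thesis .
  qed
  \<comment> \<open>Values of f' up to 1/8 become arguments at most -1/4, and values from 7/8 on
    become arguments at least 5/4. An error of 1/8 is thus removed where f is 0, and likewise where
    f is 1 inside K.\<close>
  define \<psi> where "\<psi> q = smooth_step (2 * f' q + (- 1 / 2))" for q
  have lin: "C1at (\<lambda>x. 2 * f' x + (- 1 / 2)) q" for q by (intro C1at_add C1at_cmult f'C C1at_const)
  have \<psi>0: "f q > 0" if "\<psi> q \<noteq> 0" for q
  proof (rule ccontr)
    assume "\<not> f q > 0"
    then have "f q = 0" using f01[of q] by simp
    then have "f' q \<le> 1 / 8" using close[of q] by simp
    then show False using that smooth_step(3)[of "2 * f' q + (- 1 / 2)"] by (simp add: \<psi>_def)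
  qed
  have "gnorm \<psi> q \<le> 40 / r" for q
  proof (cases "q \<in> K")
    case True
    have "gnorm \<psi> q \<le> \<bar>smooth_step' (2 * f' q + (- 1 / 2))\<bar> * gnorm (\<lambda>x. 2 * f' x + (- 1 / 2)) q"
      unfolding \<psi>_def[abs_def] by (rule gnorm_compose_le[OF lin smooth_step_deriv])
    also have "\<dots> \<le> 4 * (10 / r)"
    proof (intro mult_mono smooth_step'_bound gnorm_nonneg lin)
      have "gnorm (\<lambda>x. 2 * f' x + (- 1 / 2)) q \<le> gnorm (\<lambda>x. 2 * f' x) q + gnorm (\<lambda>x. - 1 / 2) q"
        by (rule gnorm_add_le[OF C1at_cmult[OF f'C] C1at_const])
      also have "gnorm (\<lambda>x. 2 * f' x) q \<le> 2 * gnorm f' q"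
        using gnorm_mult_le[OF C1at_const[of 2] f'C, of q] by (simp add: gnorm_const)
      finally show "gnorm (\<lambda>x. 2 * f' x + (- 1 / 2)) q \<le> 10 / r" using gn[OF True] by (simp add: gnorm_const)
    qed simp
    finally show ?thesis by simp
  next
    case False
    have "\<psi> x = 0" if "x \<in> - K" for x
    proof (rule ccontr)
      assume "\<psi> x \<noteq> 0"
      from f0[OF \<psi>0[OF this]] show False using that by (simp add: K_def)
    qed
    then have "gnorm \<psi> q = gnorm (\<lambda>x. 0) q"
      by (intro gnorm_cong[OF C1at_const open_Compl[OF K(2)]]) (use False in auto)
    then show ?thesis using r by (simp add: gnorm_const)
  qed
  moreover have "C1at \<psi> q" for q
  proof -
    have "continuous_on UNIV smooth_step'"
      unfolding smooth_step'_def[abs_def]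
      by (intro continuous_intros ppow_continuous continuous_on_compose2[OF ppow_continuous[of 1 UNIV]]) auto
    then show ?thesis unfolding \<psi>_def[abs_def]
      by (intro C1at_compose[OF lin open_UNIV, where \<theta>' = smooth_step'] smooth_step_deriv) auto
  qed
  moreover have "0 \<le> \<psi> q" "\<psi> q \<le> 1" for q by (simp_all add: \<psi>_def smooth_step)
  moreover have "\<psi> q = 1" if q: "dd q pole < r / 2" for q
  proof -
    have "q \<in> K" using q r by (simp add: K_def)
    then have "(\<Sum>i\<in>I. \<eta> i q) = 1" using W by blast
    then have "\<bar>f' q - 1\<bar> \<le> 1 / 8" using close[of q] f1[OF q] by simp
    then have "f' q \<ge> 7 / 8" by linarith
    then show ?thesis unfolding \<psi>_def by (intro smooth_step(4)) simp
  qed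
  moreover have "dd q pole < r" if "\<psi> q \<noteq> 0" for q using f0[OF \<psi>0[OF that]] .
  ultimately show ?thesis by (intro exI[of _ \<psi>]) blast
qed

end

section \<open>The energy estimate\<close>

text \<open>
  If \<open>q\<close> exceeds the value at which the two terms balance, the left-hand side is non-positive;
  otherwise \<open>q\<close> can be replaced by that value.
\<close>

lemma absorb_gradient:
  fixes \<psi> lam lam' D p q \<Phi> K \<delta> :: real
  assumes "\<psi> > 0" "lam > 0" "lam' > 0" "D \<ge> 0" "p > 0" "\<delta> > 0" "q \<ge> 0" "K > 0" "0 \<le> \<Phi>" "\<Phi> \<le> K * q powr \<delta>"
  shows "p * \<psi> powr (p - 1) * lam * (\<Phi> * D) - \<psi> powr p * lam' * (\<Phi> * q)
     \<le> K * p * \<psi> powr (p - 1) * lam * D * (p * D / \<psi> * (lam / lam')) powr \<delta>"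
proof -
  define R where "R = p * D / \<psi> * (lam / lam')"
  define B where "B = p * \<psi> powr (p - 1) * lam * D"
  have R: "R \<ge> 0" and B: "B \<ge> 0" using assms by (auto simp: R_def B_def)
  have "\<psi> powr p = \<psi> powr (p - 1) * \<psi>" using assms by (simp add: powr_diff)
  then have BR: "B = \<psi> powr p * lam' * R" using assms by (simp add: R_def B_def)
  have l: "p * \<psi> powr (p - 1) * lam * (\<Phi> * D) - \<psi> powr p * lam' * (\<Phi> * q) = B * \<Phi> - \<psi> powr p * lam' * (\<Phi> * q)"
    by (simp add: B_def)
  have r: "K * p * \<psi> powr (p - 1) * lam * D * (p * D / \<psi> * (lam / lam')) powr \<delta> = B * (K * R powr \<delta>)"
    by (simp add: B_def R_def)
  show ?thesis
  proof (cases "R \<le> q")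
    case True
    then have "B \<le> \<psi> powr p * lam' * q" unfolding BR using assms by (intro mult_left_mono) auto
    then have "B * \<Phi> \<le> \<psi> powr p * lam' * q * \<Phi>" using assms by (intro mult_right_mono) auto
    moreover have "B * (K * R powr \<delta>) \<ge> 0" using B assms by simp
    ultimately show ?thesis unfolding l r by (simp add: mult.assoc mult.commute[of q])
  next
    case False
    then have "q powr \<delta> \<le> R powr \<delta>" using assms by (intro powr_mono2) auto
    then have "K * q powr \<delta> \<le> K * R powr \<delta>" using assms by (intro mult_left_mono) auto
    then have "\<Phi> \<le> K * R powr \<delta>" using assms(10) by linarith
    then have "B * \<Phi> \<le> B * (K * R powr \<delta>)" using B by (rule mult_left_mono)
    moreover have "\<psi> powr p * lam' * (\<Phi> * q) \<ge> 0" using assms by simp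
    ultimately show ?thesis unfolding l r by linarith
  qed
qed

text \<open>
  The lower order term is absorbed where \<open>2K \<le> \<psi>\<^sup>1\<^sup>+\<^sup>\<delta> v\<^sup>\<sigma>\<^sup>-\<^sup>\<sigma>\<^sup>'\<close>; elsewhere
  both \<open>v\<close> and \<open>\<psi>\<close> are controlled by \<open>K\<close>.
\<close>

lemma absorb_lower_order:
  fixes \<psi> v K \<sigma> \<sigma>' \<delta> \<alpha> N p \<gamma> :: real
  assumes "0 < \<psi>" "0 < \<gamma>" "\<gamma> \<le> v" "0 < K" "\<sigma>' < \<sigma>" "0 < \<sigma>'" "0 < \<alpha>" "0 < \<delta>"
    and N: "N = \<sigma>' / (\<sigma> - \<sigma>')" and p: "p = (1 + \<delta>) * (1 + N + \<alpha>)"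
  shows "K * \<psi> powr (p - 1 - \<delta>) * v powr \<sigma>' \<le> v powr \<sigma> * \<psi> powr p / 2 + K * (2 * K) powr N * (2 * K * \<gamma> powr (\<sigma>' - \<sigma>)) powr \<alpha>"
proof -
  define X where "X = \<psi> powr (1 + \<delta>) * v powr (\<sigma> - \<sigma>')"
  have v: "v > 0" using assms by linarith
  have X: "X > 0" using assms v by (simp add: X_def)
  have N0: "N > 0" using assms by simp
  show ?thesis
  proof (cases "2 * K \<le> X")
    case True
    have "v powr \<sigma> * \<psi> powr p = X * (\<psi> powr (p - 1 - \<delta>) * v powr \<sigma>')"
    proof -
      have "\<psi> powr p = \<psi> powr (1 + \<delta>) * \<psi> powr (p - 1 - \<delta>)" by (simp add: powr_add[symmetric])
      moreover have "v powr \<sigma> = v powr (\<sigma> - \<sigma>') * v powr \<sigma>'" by (simp add: powr_add[symmetric])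
      ultimately show ?thesis by (simp add: X_def)
    qed
    moreover have "2 * K * (\<psi> powr (p - 1 - \<delta>) * v powr \<sigma>') \<le> X * (\<psi> powr (p - 1 - \<delta>) * v powr \<sigma>')"
      using True by (intro mult_right_mono) auto
    moreover have "K * (2 * K) powr N * (2 * K * \<gamma> powr (\<sigma>' - \<sigma>)) powr \<alpha> \<ge> 0" using assms by simp
    ultimately show ?thesis by simp
  next
    case False
    \<comment> \<open>This identity is the origin of \<open>N\<close>, and the next one that of
      \<open>p\<close>: together they express the lower order term through X^N and a power \<alpha>
      of \<psi>^(1+\<delta>).\<close>
    have "v powr \<sigma>' = (v powr (\<sigma> - \<sigma>')) powr N" using assms by (simp add: powr_powr N)
    moreover have "\<psi> powr (p - 1 - \<delta>) = (\<psi> powr (1 + \<delta>)) powr N * (\<psi> powr (1 + \<delta>)) powr \<alpha>"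
      by (simp add: powr_powr powr_add[symmetric] p algebra_simps)
    ultimately have eq: "\<psi> powr (p - 1 - \<delta>) * v powr \<sigma>' = X powr N * (\<psi> powr (1 + \<delta>)) powr \<alpha>"
      by (simp add: X_def powr_mult)
    have "X powr N \<le> (2 * K) powr N" using False X N0 by (intro powr_mono2) auto
    moreover have "\<psi> powr (1 + \<delta>) \<le> 2 * K * \<gamma> powr (\<sigma>' - \<sigma>)"
    proof -
      have "\<psi> powr (1 + \<delta>) = X * v powr (\<sigma>' - \<sigma>)" using v by (simp add: X_def powr_add[symmetric] mult.assoc)
      also have "\<dots> \<le> 2 * K * \<gamma> powr (\<sigma>' - \<sigma>)"
        using False X assms by (intro mult_mono powr_mono2') auto
      finally show ?thesis .
    qed
    then have "(\<psi> powr (1 + \<delta>)) powr \<alpha> \<le> (2 * K * \<gamma> powr (\<sigma>' - \<sigma>)) powr \<alpha>"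
      using assms by (intro powr_mono2) auto
    ultimately have "X powr N * (\<psi> powr (1 + \<delta>)) powr \<alpha> \<le> (2 * K) powr N * (2 * K * \<gamma> powr (\<sigma>' - \<sigma>)) powr \<alpha>"
      by (intro mult_mono) auto
    then have "K * (\<psi> powr (p - 1 - \<delta>) * v powr \<sigma>') \<le> K * ((2 * K) powr N * (2 * K * \<gamma> powr (\<sigma>' - \<sigma>)) powr \<alpha>)"
      unfolding eq using assms by (intro mult_left_mono) auto
    moreover have "v powr \<sigma> * \<psi> powr p / 2 \<ge> 0" by simp
    ultimately show ?thesis unfolding mult.assoc by linarith
  qed
qed

context riem
begin

lemma cip_lincomb:
  assumes "c \<in> A" "p \<in> fst c" "has_dif u c p \<omega>" "has_dif f c p \<xi>1" "has_dif h c p \<xi>2"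
    "has_dif z c p (k1 *\<^sub>R \<xi>1 + k2 *\<^sub>R \<xi>2)"
  shows "cip u z p = k1 * cip u f p + k2 * cip u h p"
  unfolding cip_chart[OF assms(1-3,4)] cip_chart[OF assms(1-3,5)] cip_chart[OF assms(1-3,6)]
  by (simp add: matrix_vector_right_distrib matrix_vector_mult_scaleR inner_add_right)

end

section \<open>The differential inequality and its test function\<close>

locale quasilinear_inequality = complete_riem A g
  for A :: "('a::{t2_space,second_countable_topology}, 'm::finite) chart set" and g :: "('a, 'm) metric_tensor" +
  fixes pole :: 'a and \<phi> Q :: "real \<Rightarrow> real" and a b u :: "'a \<Rightarrow> real" and A\<phi> \<delta> H \<sigma> :: real
  assumes \<phi>_cont: "continuous_on {0..} \<phi>" and \<phi>_0: "\<phi> 0 = 0" and \<phi>_pos: "\<And>t. t > 0 \<Longrightarrow> \<phi> t > 0"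
    and A\<phi>: "A\<phi> > 0" and \<delta>: "\<delta> > 0" and \<phi>_le: "\<And>t. t \<ge> 0 \<Longrightarrow> \<phi> t \<le> A\<phi> * t powr \<delta>"
    and a_cont: "continuous_on UNIV a" and b_cont: "continuous_on UNIV b"
    and Q_pos: "\<And>t. t \<ge> 0 \<Longrightarrow> Q t > 0" and Q_mono: "mono_on {0..} Q"
    and b_ge: "\<And>x. b x \<ge> 1 / Q (dd x pole)" and H: "H > 0" and a_b: "\<And>x. neg_part a x / b x \<le> H"
    and u_C1: "\<And>x. C1at u x" and u_nonneg: "\<And>x. u x \<ge> 0" and \<sigma>: "\<sigma> > 1" "\<sigma> > \<delta>"
    and div_u: "div_ge A g (phi_field A g \<phi> u) (\<lambda>x. b x * u x powr \<sigma> + a x * u x)"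
begin

abbreviation rhs :: "'a \<Rightarrow> real" where "rhs x \<equiv> b x * u x powr \<sigma> + a x * u x"

lemma \<phi>_nonneg: "t \<ge> 0 \<Longrightarrow> \<phi> t \<ge> 0"
  using \<phi>_pos[of t] \<phi>_0 by (cases "t = 0") auto

lemma u_cont: "continuous_on UNIV u"
  using C1at_isCont[OF u_C1] by (simp add: continuous_at_imp_continuous_on)

lemma rhs_cont: "continuous_on UNIV rhs"
  using \<sigma> u_nonneg by (intro continuous_intros continuous_on_powr' a_cont b_cont u_cont) auto

lemma b_pos: "b x > 0"
  using b_ge[of x] Q_pos[OF dd_nonneg, of x pole] by (smt (verit) divide_pos_pos)

text \<open>Where u > \<gamma>, the linear term is at most H b u, hence at most H
  \<gamma>^(1-\<sigma>) times b u^\<sigma>. A positive fraction of the power term survives exactly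
  when \<gamma> exceeds the asserted bound for u.\<close>

lemma rhs_ge:
  assumes "\<gamma> > 0" "u x > \<gamma>" "1 - H * \<gamma> powr (1 - \<sigma>) > 0" "dd x pole < r" "r > 0"
  shows "rhs x \<ge> (1 - H * \<gamma> powr (1 - \<sigma>)) / Q r * u x powr \<sigma>"
proof -
  have u: "u x > 0" using assms by linarith
  have "neg_part a x \<le> H * b x" using a_b[of x] b_pos[of x] by (simp add: pos_divide_le_eq)
  moreover have "- a x \<le> neg_part a x" by (simp add: neg_part_def)
  ultimately have "- a x * u x \<le> H * b x * u x" using u by (intro mult_right_mono) auto
  moreover have "u x = u x powr \<sigma> * u x powr (1 - \<sigma>)" using u by (simp add: powr_add[symmetric])
  moreover have "u x powr (1 - \<sigma>) \<le> \<gamma> powr (1 - \<sigma>)" using assms \<sigma> by (intro powr_mono2') auto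
  then have "H * b x * (u x powr \<sigma> * u x powr (1 - \<sigma>)) \<le> H * b x * (u x powr \<sigma> * \<gamma> powr (1 - \<sigma>))"
    using H b_pos[of x] by (intro mult_left_mono) auto
  ultimately have "rhs x \<ge> b x * (u x powr \<sigma> * (1 - H * \<gamma> powr (1 - \<sigma>)))" by (simp add: algebra_simps)
  moreover have "1 / Q r \<le> b x"
  proof -
    have "Q (dd x pole) \<le> Q r" using Q_mono assms dd_nonneg[of x pole] by (auto simp: mono_on_def)
    then have "1 / Q r \<le> 1 / Q (dd x pole)" using Q_pos[OF dd_nonneg, of x pole] by (intro divide_left_mono) auto
    then show ?thesis using b_ge[of x] by simp
  qed
  then have "1 / Q r * (u x powr \<sigma> * (1 - H * \<gamma> powr (1 - \<sigma>))) \<le> b x * (u x powr \<sigma> * (1 - H * \<gamma> powr (1 - \<sigma>)))"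
    using assms by (intro mult_right_mono) auto
  ultimately show ?thesis by (simp add: mult.commute)
qed

text \<open>
  With \<open>w = - u\<^sup>-\<^sup>s\<close>, the gradient of \<open>u\<close> is \<open>u\<^sup>s\<^sup>+\<^sup>1\<close> times that of \<open>w\<close> up to a constant; the choice of \<open>s\<close> makes
  the resulting error term grow like \<open>u\<^sup>\<sigma>\<^sup>'\<close> for the mean \<open>\<sigma>'\<close> of \<open>\<delta>\<close> and \<open>\<sigma>\<close>.
\<close>

definition s where "s = (\<sigma> - \<delta>) / (2 * \<delta>)"
definition \<sigma>' where "\<sigma>' = (\<sigma> + \<delta>) / 2"
definition N where "N = \<sigma>' / (\<sigma> - \<sigma>')"

lemma exponents: "s > 0" "\<sigma>' > 0" "\<sigma>' < \<sigma>" "N > 0" "(s + 1) * \<delta> = \<sigma>'"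
  using \<sigma> \<delta> by (auto simp: s_def \<sigma>'_def N_def field_simps)

context
  fixes \<gamma> w0 \<eta> :: real
  assumes \<gamma>: "\<gamma> > 0" "1 - H * \<gamma> powr (1 - \<sigma>) > 0" and w0: "- w0 \<le> \<gamma> powr (- s)"
    and \<eta>: "\<eta> > 0" "\<And>x. u x > \<gamma> \<Longrightarrow> - w0 - u x powr (- s) \<le> \<eta>"
begin

text \<open>The level \<open>w0\<close> will be the supremum of -u^(-s) on {u > \<gamma>} minus
  \<eta>. The condition on \<open>w0\<close> makes the maximum vanish already at u = \<gamma>, so
  the case distinction produces no jump. It is needed because a negative power of 0 has the default
  value 0.\<close>

definition trunc :: "'a \<Rightarrow> real" where
  "trunc x = (if u x > \<gamma> then max 0 (- w0 - u x powr (- s)) else 0)"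

lemma trunc: "0 \<le> trunc x" "trunc x \<le> \<eta>" "trunc x > 0 \<Longrightarrow> u x > \<gamma>"
  using \<eta> by (auto simp: trunc_def split: if_splits)

lemma trunc_powr:
  assumes "\<alpha> > 1"
  shows "C1at (\<lambda>x. trunc x powr \<alpha>) p"
    and "c \<in> A \<Longrightarrow> p \<in> fst c \<Longrightarrow> has_dif (\<lambda>x. trunc x powr \<alpha>) c p
      ((\<alpha> * trunc p powr (\<alpha> - 1) * (s * u p powr (- s - 1))) *\<^sub>R coord_partials u c p)"
proof -
  let ?\<theta> = "\<lambda>t. ppow \<alpha> (- w0 - t powr (- s))"
  let ?\<theta>' = "\<lambda>t. \<alpha> * ppow (\<alpha> - 1) (- w0 - t powr (- s)) * (s * t powr (- s - 1))"
  let ?f = "\<lambda>x. trunc x powr \<alpha>"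
  have d: "(?\<theta> has_real_derivative ?\<theta>' t) (at t)" if "t > 0" for t
  proof -
    have "((\<lambda>t. - w0 - t powr (- s)) has_real_derivative s * t powr (- s - 1)) (at t)"
      using that by (auto intro!: derivative_eq_intros)
    from DERIV_chain2[OF ppow_deriv[OF assms] this] show ?thesis .
  qed
  have eq: "trunc x powr \<beta> = ppow \<beta> (- w0 - u x powr (- s))" if "u x > \<gamma> / 2" for x \<beta>
  proof (cases "u x > \<gamma>")
    case False
    then have "\<gamma> powr (- s) \<le> u x powr (- s)" using that \<gamma>(1) exponents(1) by (intro powr_mono2') auto
    then have "- w0 - u x powr (- s) \<le> 0" using w0 by linarith
    then show ?thesis using False by (simp add: trunc_def ppow_nonpos)
  qed (simp add: trunc_def ppow_def)
  have "C1at ?f p \<and> (c \<in> A \<longrightarrow> p \<in> fst c \<longrightarrow> has_dif ?f c p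
      ((\<alpha> * trunc p powr (\<alpha> - 1) * (s * u p powr (- s - 1))) *\<^sub>R coord_partials u c p))" for c
  \<comment> \<open>The cases lead to two overlapping open sets, {u > \<gamma>/2} and {u <
    \<gamma>}: the first keeps u away from 0, where its negative power is singular, and on the
    second the truncation vanishes.\<close>
  proof (cases "u p > \<gamma> / 2")
    case True
    let ?V = "u -` {\<gamma> / 2<..}"
    have V: "open ?V" "p \<in> ?V" using continuous_on_open_vimage[of UNIV u] u_cont True by auto
    have C: "C1at (\<lambda>x. ?\<theta> (u x)) p"
    proof (rule C1at_compose[OF u_C1 open_greaterThan[of 0]])
      show "u p \<in> {0<..}" using True \<gamma> by simp
      show "\<And>t. t \<in> {0<..} \<Longrightarrow> (?\<theta> has_real_derivative ?\<theta>' t) (at t)" using d by simp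
      show "continuous_on {0<..} ?\<theta>'"
        using assms by (intro continuous_intros continuous_on_compose2[OF ppow_continuous[of "\<alpha> - 1" UNIV]]) auto
    qed
    have "has_dif ?f c p ((\<alpha> * trunc p powr (\<alpha> - 1) * (s * u p powr (- s - 1))) *\<^sub>R coord_partials u c p)"
      if c: "c \<in> A" "p \<in> fst c"
    proof (rule has_dif_cong[OF c(1) V(2,1) _ _ c(2)])
      show "has_dif (\<lambda>x. ?\<theta> (u x)) c p ((\<alpha> * trunc p powr (\<alpha> - 1) * (s * u p powr (- s - 1))) *\<^sub>R coord_partials u c p)"
        unfolding eq[OF True] by (rule has_dif_compose[OF c C1at_has_dif[OF u_C1 c] d]) (use True \<gamma> in simp)
    qed (use eq in auto)
    moreover have "C1at ?f p" by (rule C1at_cong[OF C V]) (use eq in auto)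
    ultimately show ?thesis by blast
  next
    case False
    let ?V = "u -` {..<\<gamma>}"
    have V: "open ?V" "p \<in> ?V" using continuous_on_open_vimage[of UNIV u] u_cont False \<gamma> by auto
    have z: "0 = ?f x" if "x \<in> ?V" for x using that by (simp add: trunc_def)
    have "trunc p = 0" using False \<gamma> by (simp add: trunc_def)
    then have "has_dif ?f c p ((\<alpha> * trunc p powr (\<alpha> - 1) * (s * u p powr (- s - 1))) *\<^sub>R coord_partials u c p)"
      if c: "c \<in> A" "p \<in> fst c"
      using has_dif_cong[OF c(1) V(2,1) z has_dif_const c(2)] by simp
    moreover have "C1at ?f p" by (rule C1at_cong[OF C1at_const V z])
    ultimately show ?thesis by blast
  qed
  then show "C1at ?f p" and "c \<in> A \<Longrightarrow> p \<in> fst c \<Longrightarrow> has_dif ?f c p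
      ((\<alpha> * trunc p powr (\<alpha> - 1) * (s * u p powr (- s - 1))) *\<^sub>R coord_partials u c p)" by blast+
qed

text \<open>The gradient of the test function has a part along the gradient of u, which contributes
  a favourable term, and a part from the cutoff, which has no sign. \<open>absorb_gradient\<close>
  trades the latter for a term of order u^\<sigma>' with \<sigma>' < \<sigma>, and
  \<open>absorb_lower_order\<close> hides this in half of the power term of the right-hand side. All
  constants of the first exchange are collected in K, relative to the factor of u^\<sigma>.\<close>

lemma energy_pointwise:
  fixes \<psi> :: "'a \<Rightarrow> real"
  assumes "r > 0" "\<alpha> > 1" and p: "p = (1 + \<delta>) * (1 + N + \<alpha>)"
    and K: "K = A\<phi> * p powr (1 + \<delta>) * (40 / r) powr (1 + \<delta>) * (\<eta> / (\<alpha> * s)) powr \<delta> * Q r / (1 - H * \<gamma> powr (1 - \<sigma>))"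
    and \<psi>: "\<And>q. C1at \<psi> q" "0 \<le> \<psi> x" "\<psi> x \<le> 1" "\<psi> x \<noteq> 0 \<Longrightarrow> dd x pole < r" "gnorm \<psi> x \<le> 40 / r"
  defines "\<zeta> \<equiv> \<lambda>x. ppow p (\<psi> x) * trunc x powr \<alpha>"
  shows "C1at \<zeta> q"
    and "\<psi> x = 0 \<Longrightarrow> rhs x * \<zeta> x + rinner A g (phi_field A g \<phi> u) (grad g \<zeta>) x = 0"
    and "rhs x * \<zeta> x + rinner A g (phi_field A g \<phi> u) (grad g \<zeta>) x \<ge> (1 - H * \<gamma> powr (1 - \<sigma>)) / Q r *
      (u x powr \<sigma> * ppow p (\<psi> x) * trunc x powr \<alpha> / 2 - K * (2 * K) powr N * (2 * K * \<gamma> powr (\<sigma>' - \<sigma>)) powr \<alpha> * \<eta> powr \<alpha>)"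
proof -
  let ?P = "\<lambda>h. rinner A g (phi_field A g \<phi> u) (grad g h) x"
  let ?c1 = "1 - H * \<gamma> powr (1 - \<sigma>)" and ?Z = "K * (2 * K) powr N * (2 * K * \<gamma> powr (\<sigma>' - \<sigma>)) powr \<alpha>"
  let ?q = "gnorm u x" and ?D = "40 / r" and ?T = "trunc x" and ?lam' = "\<alpha> * trunc x powr (\<alpha> - 1) * (s * u x powr (- s - 1))"
  have "1 + N + \<alpha> > 1" using exponents assms(2) by simp
  then have "1 * 1 < (1 + \<delta>) * (1 + N + \<alpha>)" using \<delta> by (intro mult_strict_mono) auto
  then have p1: "p > 1" by (simp add: p)
  have Qr: "Q r > 0" using Q_pos assms(1) by simp
  have Kpos: "K > 0"
    unfolding K using A\<phi> p1 assms(1,2) \<eta>(1) exponents(1) Qr \<gamma>(2)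
    by (intro divide_pos_pos mult_pos_pos) auto
  have Z: "?Z \<ge> 0" using Kpos by simp
  have pC: "C1at (\<lambda>x. ppow p (\<psi> x)) q" for q
    by (rule C1at_compose[OF \<psi>(1) open_UNIV UNIV_I, where \<theta>' = "\<lambda>t. p * ppow (p - 1) t"])
      (use p1 in \<open>auto intro!: ppow_deriv continuous_intros ppow_continuous\<close>)
  show "C1at \<zeta> q" for q unfolding \<zeta>_def by (rule C1at_mult[OF pC trunc_powr(1)[OF assms(2)]])
  define c where "c = chart_at A x"
  have c: "c \<in> A" "x \<in> fst c" using chart_at c_def by auto
  note du = C1at_has_dif[OF u_C1 c]
  note d\<psi> = C1at_has_dif[OF \<psi>(1) c]
  have "has_dif \<zeta> c x (ppow p (\<psi> x) *\<^sub>R (?lam' *\<^sub>R coord_partials u c x) + ?T powr \<alpha> *\<^sub>R ((p * ppow (p - 1) (\<psi> x)) *\<^sub>R coord_partials \<psi> c x))"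
    unfolding \<zeta>_def
    by (rule has_dif_mult[OF c has_dif_compose[OF c d\<psi> ppow_deriv[OF p1]] trunc_powr(2)[OF assms(2) c]])
  then have d\<zeta>: "has_dif \<zeta> c x ((ppow p (\<psi> x) * ?lam') *\<^sub>R coord_partials u c x + (?T powr \<alpha> * (p * ppow (p - 1) (\<psi> x))) *\<^sub>R coord_partials \<psi> c x)"
    by simp
  have cip: "cip u \<zeta> x = (ppow p (\<psi> x) * ?lam') * cip u u x + (?T powr \<alpha> * (p * ppow (p - 1) (\<psi> x))) * cip u \<psi> x"
    by (rule cip_lincomb[OF c du du d\<psi> d\<zeta>])
  have P: "?P \<zeta> = (ppow p (\<psi> x) * ?lam') * (\<phi> ?q * ?q) + (?T powr \<alpha> * (p * ppow (p - 1) (\<psi> x))) * ?P \<psi>"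
  proof -
    have "\<phi> ?q / ?q * cip u u x = \<phi> ?q * ?q" using gnorm_sq[OF u_C1, of x] by (cases "?q = 0") (auto simp: field_simps)
    moreover have "?P \<zeta> = (ppow p (\<psi> x) * ?lam') * (\<phi> ?q / ?q * cip u u x) + (?T powr \<alpha> * (p * ppow (p - 1) (\<psi> x))) * ?P \<psi>"
      by (simp only: rinner_phi_field cip) (simp add: algebra_simps)
    ultimately show ?thesis by simp
  qed
  show "\<psi> x = 0 \<Longrightarrow> rhs x * \<zeta> x + ?P \<zeta> = 0"
    unfolding P by (simp add: \<zeta>_def ppow_nonpos)
  show "rhs x * \<zeta> x + ?P \<zeta> \<ge> ?c1 / Q r * (u x powr \<sigma> * ppow p (\<psi> x) * ?T powr \<alpha> / 2 - ?Z * \<eta> powr \<alpha>)"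
  proof (cases "\<psi> x = 0 \<or> ?T = 0")
    case True
    then have e: "rhs x * \<zeta> x + ?P \<zeta> = 0" "u x powr \<sigma> * ppow p (\<psi> x) * ?T powr \<alpha> / 2 = 0"
      unfolding P by (auto simp: \<zeta>_def ppow_nonpos)
    have "?c1 / Q r \<ge> 0" "0 - ?Z * \<eta> powr \<alpha> \<le> 0" using \<gamma>(2) Qr mult_nonneg_nonneg[OF Z powr_ge_zero[of \<eta> \<alpha>]] by auto
    then show ?thesis unfolding e by (rule mult_nonneg_nonpos)
  next
    case False
    then have \<psi>p: "\<psi> x > 0" and T: "?T > 0" using \<psi>(2) trunc(1)[of x] by auto
    have ux: "u x > \<gamma>" "u x > 0" using trunc(3)[OF T] \<gamma>(1) by auto
    have q0: "?q \<ge> 0" by (rule gnorm_nonneg[OF u_C1])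
    have lam': "?lam' > 0" using T assms(2) exponents(1) ux by simp
    \<comment> \<open>The quotient of the two coefficients retains one factor of the truncation,
      which is at most \<eta>. After the power \<delta> it supplies the factor \<eta>^\<delta> of K,
      while u^(s+1) becomes u^\<sigma>'.\<close>
    have ratio: "?T powr \<alpha> / ?lam' = ?T / (\<alpha> * s) * u x powr (s + 1)"
    proof -
      have "?T powr \<alpha> = ?T powr (\<alpha> - 1) * ?T" using T by (simp add: powr_diff)
      moreover have "u x powr (- s - 1) * u x powr (s + 1) = 1" using ux by (simp add: powr_add[symmetric])
      ultimately show ?thesis using T assms(2) exponents(1) ux by (simp add: field_simps)
    qed
    have "\<bar>?P \<psi>\<bar> \<le> \<phi> ?q * gnorm \<psi> x" by (rule phi_pairing_bound[OF u_C1 \<psi>(1) \<phi>_nonneg])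
    also have "\<dots> \<le> \<phi> ?q * ?D" using \<psi>(5) \<phi>_nonneg[OF q0] by (intro mult_left_mono) auto
    finally have "?P \<psi> \<ge> - (\<phi> ?q * ?D)" by linarith
    then have "(?T powr \<alpha> * (p * ppow (p - 1) (\<psi> x))) * ?P \<psi> \<ge> (?T powr \<alpha> * (p * ppow (p - 1) (\<psi> x))) * - (\<phi> ?q * ?D)"
      using p1 by (intro mult_left_mono) (auto simp: ppow_nonneg)
    then have "- ?P \<zeta> \<le> p * \<psi> x powr (p - 1) * ?T powr \<alpha> * (\<phi> ?q * ?D) - \<psi> x powr p * ?lam' * (\<phi> ?q * ?q)"
      unfolding P ppow_pos[OF \<psi>p] by (simp add: algebra_simps)
    also have "\<dots> \<le> A\<phi> * p * \<psi> x powr (p - 1) * ?T powr \<alpha> * ?D * (p * ?D / \<psi> x * (?T powr \<alpha> / ?lam')) powr \<delta>"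
      by (rule absorb_gradient) (use \<psi>p T lam' assms(1) p1 \<delta> q0 A\<phi> \<phi>_nonneg[OF q0] \<phi>_le[OF q0] in auto)
    also have "\<dots> \<le> A\<phi> * p * \<psi> x powr (p - 1) * ?T powr \<alpha> * ?D * (p * ?D / \<psi> x * (\<eta> / (\<alpha> * s) * u x powr (s + 1))) powr \<delta>"
    proof -
      have "?T / (\<alpha> * s) * u x powr (s + 1) \<le> \<eta> / (\<alpha> * s) * u x powr (s + 1)"
        using trunc(2)[of x] assms(2) exponents(1) by (intro mult_right_mono divide_right_mono) auto
      then have "p * ?D / \<psi> x * (?T powr \<alpha> / ?lam') \<le> p * ?D / \<psi> x * (\<eta> / (\<alpha> * s) * u x powr (s + 1))"
        unfolding ratio using p1 assms(1) \<psi>p by (intro mult_left_mono) auto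
      moreover have "0 \<le> p * ?D / \<psi> x * (?T powr \<alpha> / ?lam')" using p1 assms(1) \<psi>p lam' by (intro mult_nonneg_nonneg) auto
      ultimately have "(p * ?D / \<psi> x * (?T powr \<alpha> / ?lam')) powr \<delta> \<le> (p * ?D / \<psi> x * (\<eta> / (\<alpha> * s) * u x powr (s + 1))) powr \<delta>"
        using \<delta> by (intro powr_mono2) auto
      then show ?thesis using A\<phi> p1 assms(1) by (intro mult_left_mono) auto
    qed
    also have "\<dots> = ?c1 / Q r * (K * \<psi> x powr (p - 1 - \<delta>) * u x powr \<sigma>') * ?T powr \<alpha>"
    proof -
      have "(p * ?D / \<psi> x * (\<eta> / (\<alpha> * s) * u x powr (s + 1))) powr \<delta>
        = p powr \<delta> * ?D powr \<delta> / \<psi> x powr \<delta> * ((\<eta> / (\<alpha> * s)) powr \<delta> * u x powr \<sigma>')"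
        by (simp only: powr_mult powr_divide powr_powr exponents(5))
      moreover have "p powr (1 + \<delta>) = p * p powr \<delta>" "?D powr (1 + \<delta>) = ?D * ?D powr \<delta>"
        using p1 assms(1) by (simp_all add: powr_add)
      moreover have "\<psi> x powr (p - 1 - \<delta>) = \<psi> x powr (p - 1) / \<psi> x powr \<delta>" by (simp add: powr_diff)
      ultimately show ?thesis using \<gamma>(2) Qr unfolding K by simp
    qed
    finally have Pge: "?P \<zeta> \<ge> - (?c1 / Q r * (K * \<psi> x powr (p - 1 - \<delta>) * u x powr \<sigma>') * ?T powr \<alpha>)" by linarith
    have "rhs x \<ge> ?c1 / Q r * u x powr \<sigma>" by (rule rhs_ge[OF \<gamma>(1) ux(1) \<gamma>(2) \<psi>(4) assms(1)]) (use \<psi>p in simp)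
    then have "rhs x * \<zeta> x \<ge> ?c1 / Q r * u x powr \<sigma> * \<zeta> x"
      by (rule mult_right_mono) (simp add: \<zeta>_def ppow_nonneg)
    then have "rhs x * \<zeta> x + ?P \<zeta> \<ge> ?c1 / Q r * ((u x powr \<sigma> * \<psi> x powr p - K * \<psi> x powr (p - 1 - \<delta>) * u x powr \<sigma>') * ?T powr \<alpha>)"
      using Pge by (simp add: \<zeta>_def ppow_pos[OF \<psi>p] right_diff_distrib left_diff_distrib mult.assoc)
    moreover have "?c1 / Q r * ((u x powr \<sigma> * \<psi> x powr p - K * \<psi> x powr (p - 1 - \<delta>) * u x powr \<sigma>') * ?T powr \<alpha>)
       \<ge> ?c1 / Q r * (u x powr \<sigma> * ppow p (\<psi> x) * ?T powr \<alpha> / 2 - ?Z * \<eta> powr \<alpha>)"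
    proof (rule mult_left_mono)
      have "K * \<psi> x powr (p - 1 - \<delta>) * u x powr \<sigma>' \<le> u x powr \<sigma> * \<psi> x powr p / 2 + ?Z"
        by (rule absorb_lower_order[OF \<psi>p \<gamma>(1) _ Kpos exponents(3,2) _ \<delta> N_def p]) (use ux assms(2) in auto)
      then have "(u x powr \<sigma> * \<psi> x powr p / 2 - ?Z) * ?T powr \<alpha> \<le> (u x powr \<sigma> * \<psi> x powr p - K * \<psi> x powr (p - 1 - \<delta>) * u x powr \<sigma>') * ?T powr \<alpha>"
        by (intro mult_right_mono) auto
      moreover have "?Z * ?T powr \<alpha> \<le> ?Z * \<eta> powr \<alpha>"
        using Z T trunc(2)[of x] assms(2) by (intro mult_left_mono powr_mono2) auto
      ultimately show "u x powr \<sigma> * ppow p (\<psi> x) * ?T powr \<alpha> / 2 - ?Z * \<eta> powr \<alpha>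
         \<le> (u x powr \<sigma> * \<psi> x powr p - K * \<psi> x powr (p - 1 - \<delta>) * u x powr \<sigma>') * ?T powr \<alpha>"
        by (simp add: ppow_pos[OF \<psi>p] left_diff_distrib)
    qed (use \<gamma>(2) Qr in simp)
    ultimately show ?thesis by linarith
  qed
qed

lemma open_trunc: "open {x. trunc x > k}" if "k \<ge> 0"
proof -
  \<comment> \<open>Regularity of the truncation is known for powers greater than 1, so openness is
    read off from the square.\<close>
  have "continuous_on UNIV (\<lambda>x. trunc x powr 2)"
    using C1at_isCont[OF trunc_powr(1)[of 2]] by (simp add: continuous_at_imp_continuous_on)
  then have "open ((\<lambda>x. trunc x powr 2) -` {k powr 2<..})"
    using continuous_on_open_vimage[of UNIV "\<lambda>x. trunc x powr 2"] by auto
  moreover have "(\<lambda>x. trunc x powr 2) -` {k powr 2<..} = {x. trunc x > k}"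
  proof -
    have "k powr 2 < trunc x powr 2 \<longleftrightarrow> k < trunc x" for x
    proof (cases "k < trunc x")
      case True
      then show ?thesis using powr_less_mono2[OF _ that True, of 2] by simp
    next
      case False
      then have "trunc x powr 2 \<le> k powr 2" using trunc(1)[of x] by (intro powr_mono2) auto
      then show ?thesis using False by (meson not_less)
    qed
    then show ?thesis by auto
  qed
  ultimately show ?thesis by simp
qed

text \<open>The integral of the pointwise expression is at most 0. Its lower bound keeps the main
  term only where the cutoff is 1 and the truncation exceeds \<eta>/2, charges the error on the
  whole ball, and is 0 outside.\<close>

lemma energy_estimate:
  assumes r: "r > 0" and \<alpha>: "\<alpha> > 1" and p: "p = (1 + \<delta>) * (1 + N + \<alpha>)"
    and K: "K = A\<phi> * p powr (1 + \<delta>) * (40 / r) powr (1 + \<delta>) * (\<eta> / (\<alpha> * s)) powr \<delta> * Q r / (1 - H * \<gamma> powr (1 - \<sigma>))"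
  shows "\<gamma> powr \<sigma> * (\<eta> / 2) powr \<alpha> / 2 * measure vol ({x. trunc x > \<eta> / 2} \<inter> {x. dd x pole < r / 2})
    \<le> K * (2 * K) powr N * (2 * K * \<gamma> powr (\<sigma>' - \<sigma>)) powr \<alpha> * \<eta> powr \<alpha> * measure vol {x. dd x pole < r}"
proof -
  let ?c = "(1 - H * \<gamma> powr (1 - \<sigma>)) / Q r" and ?M1 = "\<gamma> powr \<sigma> * (\<eta> / 2) powr \<alpha> / 2"
    and ?M2 = "K * (2 * K) powr N * (2 * K * \<gamma> powr (\<sigma>' - \<sigma>)) powr \<alpha> * \<eta> powr \<alpha>"
    and ?B = "{x. dd x pole < r}" and ?U = "{x. trunc x > \<eta> / 2} \<inter> {x. dd x pole < r / 2}" and ?C = "{x. dd x pole \<le> r}"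
  obtain \<psi> where \<psi>: "\<And>q. C1at \<psi> q" "\<And>q. 0 \<le> \<psi> q" "\<And>q. \<psi> q \<le> 1" "\<And>q. dd q pole < r / 2 \<Longrightarrow> \<psi> q = 1"
    "\<And>q. \<psi> q \<noteq> 0 \<Longrightarrow> dd q pole < r" "\<And>q. gnorm \<psi> q \<le> 40 / r"
    using ex_cutoff[OF r, of pole] by blast
  define \<zeta> where "\<zeta> x = ppow p (\<psi> x) * trunc x powr \<alpha>" for x
  define E where "E x = rhs x * \<zeta> x + rinner A g (phi_field A g \<phi> u) (grad g \<zeta>) x" for x
  note ep = energy_pointwise[OF r \<alpha> p K \<psi>(1) \<psi>(2) \<psi>(3) \<psi>(5) \<psi>(6), folded \<zeta>_def[abs_def], folded \<zeta>_def, folded E_def]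
  have C: "compact ?C" by (rule compact_dd_ball)
  have \<zeta>0: "\<zeta> x = 0" if "x \<notin> ?C" for x
  proof -
    have "\<psi> x = 0" using that \<psi>(5)[of x] by auto
    then show ?thesis by (simp add: \<zeta>_def ppow_nonpos)
  qed
  have \<zeta>nn: "\<zeta> x \<ge> 0" for x by (simp add: \<zeta>_def ppow_nonneg)
  note int = pairing_integrable[OF u_C1 \<phi>_cont \<phi>_0 \<phi>_nonneg rhs_cont div_u ep(1) C \<zeta>0]
  have le0: "(LINT x|vol. E x) \<le> 0"
    using div_ge_C1[OF u_C1 \<phi>_cont \<phi>_0 \<phi>_nonneg rhs_cont div_u ep(1) \<zeta>nn C \<zeta>0] int
    unfolding E_def by simp
  have intE: "integrable vol E" unfolding E_def[abs_def] using int by (intro Bochner_Integration.integrable_add)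
  have oB: "open {x. dd x pole < k}" for k
    using open_vimage[OF open_lessThan[of k] dd_continuous[of pole]] by (simp add: vimage_def)
  have oU: "open ?U" using \<eta>(1) by (intro open_Int open_trunc oB) simp
  have UB: "?U \<subseteq> ?B" "?B \<subseteq> ?C" using r by auto
  have fin: "W \<in> sets vol \<and> emeasure vol W < \<infinity>" if "open W" "W \<subseteq> ?C" for W
  proof
    show "W \<in> sets vol" using that(1) by (simp add: sets_vol)
    have "?C \<in> sets vol" using compact_imp_closed[OF C] by (simp add: sets_vol)
    then have "emeasure vol W \<le> emeasure vol ?C" by (rule emeasure_mono[OF that(2)])
    then show "emeasure vol W < \<infinity>" using emeasure_vol_compact[OF C] by (rule le_less_trans)
  qed
  have ind: "integrable vol (indicat_real ?U)" "integrable vol (indicat_real ?B)"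
    using fin[OF oU] fin[OF oB UB(2)] UB by auto
  have cpos: "?c > 0" using \<gamma>(2) Q_pos[of r] r by simp
  have ge: "?c * (?M1 * indicat_real ?U x - ?M2 * indicat_real ?B x) \<le> E x" for x
  proof -
    consider "x \<in> ?U" | "x \<notin> ?U" "x \<in> ?B" | "x \<notin> ?U" "x \<notin> ?B" by blast
    then show ?thesis
    proof cases
      case 1
      then have xB: "x \<in> ?B" and T: "\<eta> / 2 < trunc x" and \<psi>1: "\<psi> x = 1" using UB \<psi>(4) by auto
      have "u x > \<gamma>" using trunc(3)[of x] T \<eta>(1) by simp
      then have "\<gamma> powr \<sigma> * (\<eta> / 2) powr \<alpha> \<le> u x powr \<sigma> * trunc x powr \<alpha>"
        using T \<gamma>(1) \<eta>(1) \<sigma> \<alpha> by (intro mult_mono powr_mono2) auto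
      then have "?M1 - ?M2 \<le> u x powr \<sigma> * ppow p (\<psi> x) * trunc x powr \<alpha> / 2 - ?M2"
        unfolding \<psi>1 by (simp add: ppow_def)
      then have "?c * (?M1 - ?M2) \<le> ?c * (u x powr \<sigma> * ppow p (\<psi> x) * trunc x powr \<alpha> / 2 - ?M2)"
        using cpos by (intro mult_left_mono) auto
      also have "\<dots> \<le> E x" by (rule ep(3))
      finally show ?thesis using 1 xB by simp
    next
      case 2
      have "?c * (0 - ?M2) \<le> ?c * (u x powr \<sigma> * ppow p (\<psi> x) * trunc x powr \<alpha> / 2 - ?M2)"
        using cpos by (intro mult_left_mono) (auto simp: ppow_nonneg)
      also have "\<dots> \<le> E x" by (rule ep(3))
      finally show ?thesis using 2 by simp
    next
      case 3
      then have "\<psi> x = 0" using \<psi>(5)[of x] by auto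
      then show ?thesis using 3 ep(2)[of x] by simp
    qed
  qed
  have "?c * (?M1 * measure vol ?U - ?M2 * measure vol ?B) = (LINT x|vol. ?c * (?M1 * indicat_real ?U x - ?M2 * indicat_real ?B x))"
    using ind by (simp add: space_vol)
  also have "\<dots> \<le> (LINT x|vol. E x)"
    by (rule integral_mono[OF _ intE ge]) (use ind in simp)
  finally have "?c * (?M1 * measure vol ?U - ?M2 * measure vol ?B) \<le> 0" using le0 by simp
  then show ?thesis using cpos by (simp only: mult_le_0_iff) linarith
qed

end

end

section \<open>Volume growth and the contradiction\<close>

context quasilinear_inequality
begin

text \<open>For \<alpha> \<ge> 1 the exponent p is at most a multiple of \<alpha>, and
  p^(1+\<delta>) / \<alpha>^\<delta> leaves a multiple of \<alpha>. Since \<alpha> Q(r) =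
  r^(1+\<delta>) cancels the scale of the cutoff, the bound is uniform in r; this dictates the
  choice of \<alpha>.\<close>

lemma K_bound:
  assumes "r > 0" "\<alpha> \<ge> 1" "Q r > 0" and \<alpha>: "\<alpha> = r powr (1 + \<delta>) / Q r" and p: "p = (1 + \<delta>) * (1 + N + \<alpha>)" and "\<eta> > 0" "c > 0"
    and K: "K = A\<phi> * p powr (1 + \<delta>) * (40 / r) powr (1 + \<delta>) * (\<eta> / (\<alpha> * s)) powr \<delta> * Q r / c"
  shows "0 < K" "K \<le> A\<phi> * ((1 + \<delta>) * (2 + N) * 40) powr (1 + \<delta>) / s powr \<delta> / c * \<eta> powr \<delta>"
proof -
  have s: "s > 0" and N: "N > 0" by (rule exponents)+
  have p0: "p > 0" unfolding p using \<delta> N assms(2) by (intro mult_pos_pos) auto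
  show "0 < K" unfolding K using A\<phi> p0 assms(1,2,3,6,7) s by (intro divide_pos_pos mult_pos_pos) auto
  have "1 + N + \<alpha> \<le> (2 + N) * \<alpha>"
  proof -
    have "(1 + N) * 1 \<le> (1 + N) * \<alpha>" using N assms(2) by (intro mult_left_mono) auto
    then show ?thesis by (simp add: algebra_simps)
  qed
  then have "p \<le> (1 + \<delta>) * ((2 + N) * \<alpha>)" unfolding p using \<delta> by (intro mult_left_mono) auto
  then have "p powr (1 + \<delta>) \<le> ((1 + \<delta>) * (2 + N) * \<alpha>) powr (1 + \<delta>)"
    using p0 \<delta> by (intro powr_mono2) (auto simp: mult.assoc)
  then have "K \<le> A\<phi> * ((1 + \<delta>) * (2 + N) * \<alpha>) powr (1 + \<delta>) * (40 / r) powr (1 + \<delta>) * (\<eta> / (\<alpha> * s)) powr \<delta> * Q r / c"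
    unfolding K using A\<phi> assms(3,7) by (intro divide_right_mono mult_right_mono mult_left_mono) auto
  also have "\<dots> = A\<phi> * ((1 + \<delta>) * (2 + N) * 40) powr (1 + \<delta>) / s powr \<delta> / c * \<eta> powr \<delta>"
  proof -
    have "Q r = r powr (1 + \<delta>) / \<alpha>" using \<alpha> assms(1,2,3) by (simp add: field_simps)
    moreover have "\<alpha> powr (1 + \<delta>) = \<alpha> * \<alpha> powr \<delta>" using assms(2) by (simp add: powr_add)
    moreover have "r powr (1 + \<delta>) > 0" "\<alpha> powr \<delta> > 0" "s powr \<delta> > 0" using assms(1,2) s by auto
    ultimately show ?thesis using assms(1,2,7) by (simp add: powr_mult powr_divide)
  qed
  finally show "K \<le> A\<phi> * ((1 + \<delta>) * (2 + N) * 40) powr (1 + \<delta>) / s powr \<delta> / c * \<eta> powr \<delta>" .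
qed

text \<open>A liminf below infinity bounds the quotient frequently, whereas the condition on Q makes
  r^(1+\<delta>)/Q(r) large eventually, so both can be had at one large radius. Positivity of the
  volume is a premise because the logarithm of 0 carries no information.\<close>

lemma frequent_volume_bound:
  assumes Q_o: "Q \<in> o[at_top](\<lambda>t. t powr (1 + \<delta>))"
    and L: "Liminf at_top (\<lambda>r. ereal (Q r * ln (measure vol (rball A g pole r)) / r powr (1 + \<delta>))) < \<infinity>"
  shows "\<exists>L. \<forall>k. \<exists>r\<ge>k. r > 0 \<and> r powr (1 + \<delta>) / Q r \<ge> k \<and>
     (measure vol {x. dd x pole < r} > 0 \<longrightarrow> measure vol {x. dd x pole < r} \<le> exp (L * (r powr (1 + \<delta>) / Q r)))"
proof -
  let ?X = "\<lambda>r. ereal (Q r * ln (measure vol (rball A g pole r)) / r powr (1 + \<delta>))"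
  have "\<not> (\<infinity> \<le> Liminf at_top ?X)" using L by simp
  then obtain y where y: "y < \<infinity>" "\<not> eventually (\<lambda>r. y < ?X r) at_top" unfolding le_Liminf_iff by blast
  obtain L where L: "y \<le> ereal L" using y(1) by (cases y) auto
  have fr: "frequently (\<lambda>r. ?X r \<le> ereal L) at_top"
    using y(2) unfolding frequently_def
  proof (rule contrapos_nn)
    assume "eventually (\<lambda>r. \<not> ?X r \<le> ereal L) at_top"
    then show "eventually (\<lambda>r. y < ?X r) at_top"
    proof (rule eventually_mono)
      fix r
      assume "\<not> ?X r \<le> ereal L"
      then show "y < ?X r" using L le_less_trans not_le by blast
    qed
  qed
  have "\<exists>r\<ge>k. r > 0 \<and> r powr (1 + \<delta>) / Q r \<ge> k \<and>
     (measure vol {x. dd x pole < r} > 0 \<longrightarrow> measure vol {x. dd x pole < r} \<le> exp (L * (r powr (1 + \<delta>) / Q r)))" for k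
  proof -
    let ?k = "max 1 k"
    have "eventually (\<lambda>r. norm (Q r) \<le> 1 / ?k * norm (r powr (1 + \<delta>))) at_top"
      by (rule landau_o.smallD[OF Q_o]) simp
    then have "eventually (\<lambda>r. norm (Q r) \<le> 1 / ?k * norm (r powr (1 + \<delta>)) \<and> r \<ge> ?k) at_top"
      by (intro eventually_conj eventually_ge_at_top)
    from frequently_ex[OF frequently_eventually_frequently[OF fr this]]
    obtain r where r: "?X r \<le> ereal L" "norm (Q r) \<le> 1 / ?k * norm (r powr (1 + \<delta>))" "r \<ge> ?k" by blast
    have r0: "r > 0" "r \<ge> k" using r(3) by auto
    have Qr: "Q r > 0" using Q_pos r0 by simp
    have "Q r * ?k \<le> r powr (1 + \<delta>)" using r(2) Qr by (simp add: field_simps)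
    then have "?k \<le> r powr (1 + \<delta>) / Q r" using Qr by (simp only: pos_le_divide_eq mult.commute)
    moreover have "measure vol {x. dd x pole < r} \<le> exp (L * (r powr (1 + \<delta>) / Q r))" if m: "measure vol {x. dd x pole < r} > 0"
    proof -
      have "Q r * ln (measure vol {x. dd x pole < r}) / r powr (1 + \<delta>) \<le> L" using r(1) by (simp add: rball_def)
      then have "ln (measure vol {x. dd x pole < r}) \<le> L * (r powr (1 + \<delta>) / Q r)"
        using r0 Qr by (simp add: field_simps)
      then show ?thesis using m by (metis exp_ln exp_le_cancel_iff)
    qed
    ultimately show ?thesis using r0 by (intro exI[of _ r]) auto
  qed
  then show ?thesis by blast
qed

lemma u_le:
  assumes Q_o: "Q \<in> o[at_top](\<lambda>t. t powr (1 + \<delta>))"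
    and L: "Liminf at_top (\<lambda>r. ereal (Q r * ln (measure vol (rball A g pole r)) / r powr (1 + \<delta>))) < \<infinity>"
  shows "u x0 \<le> H powr (1 / (\<sigma> - 1))"
proof (rule ccontr)
  let ?h = "H powr (1 / (\<sigma> - 1))"
  assume "\<not> u x0 \<le> ?h"
  \<comment> \<open>Lying strictly above the asserted bound makes \<open>c1\<close> positive; lying
    strictly below u(x0) makes the superlevel set non-empty and the supremum of -u^(-s) on it larger
    than -\<gamma>^(-s).\<close>
  define \<gamma> where "\<gamma> = (?h + u x0) / 2"
  have h0: "?h > 0" using H by simp
  have \<gamma>1: "?h < \<gamma>" "\<gamma> < u x0" using \<open>\<not> u x0 \<le> ?h\<close> by (auto simp: \<gamma>_def)
  then have \<gamma>: "?h < \<gamma>" "\<gamma> < u x0" "\<gamma> > 0" using h0 by linarith+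
  define c1 where "c1 = 1 - H * \<gamma> powr (1 - \<sigma>)"
  have c1: "c1 > 0"
  proof -
    have "\<gamma> powr (1 - \<sigma>) < ?h powr (1 - \<sigma>)" using \<gamma> h0 \<sigma> by (intro powr_less_mono2_neg) auto
    also have "\<dots> = H powr (- 1)"
    proof -
      have "1 / (\<sigma> - 1) * (1 - \<sigma>) = - 1" using \<sigma> by (simp add: field_simps)
      then show ?thesis by (simp only: powr_powr)
    qed
    also have "\<dots> = 1 / H" using H by (simp add: powr_minus_divide)
    finally show ?thesis using H by (simp add: c1_def field_simps)
  qed
  define S where "S = {- (u x powr (- s)) | x. u x > \<gamma>}"
  have bdd: "bdd_above S" by (rule bdd_aboveI[of _ 0]) (auto simp: S_def)
  define wst where "wst = Sup S"
  have up: "- (u x powr (- s)) \<le> wst" if "u x > \<gamma>" for x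
    unfolding wst_def using bdd that by (intro cSup_upper) (auto simp: S_def)
  have \<eta>0: "wst + \<gamma> powr (- s) > 0"
  proof -
    have "u x0 powr (- s) < \<gamma> powr (- s)" using \<gamma> exponents(1) by (intro powr_less_mono2_neg) auto
    then show ?thesis using up[OF \<gamma>(2)] by linarith
  qed
  obtain L where L: "\<And>k. \<exists>r\<ge>k. r > 0 \<and> r powr (1 + \<delta>) / Q r \<ge> k \<and>
     (measure vol {x. dd x pole < r} > 0 \<longrightarrow> measure vol {x. dd x pole < r} \<le> exp (L * (r powr (1 + \<delta>) / Q r)))"
    using frequent_volume_bound[OF Q_o L] by blast
  define C where "C = A\<phi> * ((1 + \<delta>) * (2 + N) * 40) powr (1 + \<delta>) / s powr \<delta> / c1"
  have C: "C > 0" unfolding C_def using A\<phi> c1 exponents \<delta> by (intro divide_pos_pos mult_pos_pos) auto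
  define \<Gamma> where "\<Gamma> = \<gamma> powr (\<sigma>' - \<sigma>)"
  have \<Gamma>: "\<Gamma> > 0" using \<gamma> by (simp add: \<Gamma>_def)
  \<comment> \<open>The first bound makes the truncation vanish at u = \<gamma>. The second gives
    \<open>4 * K1 * \<Gamma> * exp L \<le> 1 / 2\<close>, where one factor 2 stems from 2K in the
    energy estimate, the other from comparing \<eta> with \<eta>/2, and exp L from the
    volume.\<close>
  define \<eta> where "\<eta> = min (wst + \<gamma> powr (- s)) ((1 / (8 * C * \<Gamma> * exp L)) powr (1 / \<delta>))"
  have \<eta>: "\<eta> > 0" "\<eta> \<le> wst + \<gamma> powr (- s)" using \<eta>0 C \<Gamma> by (auto simp: \<eta>_def)
  define K1 where "K1 = C * \<eta> powr \<delta>"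
  have K1: "K1 > 0" using C \<eta> by (simp add: K1_def)
  have small: "4 * K1 * \<Gamma> * exp L \<le> 1 / 2"
  proof -
    have "\<eta> powr \<delta> \<le> ((1 / (8 * C * \<Gamma> * exp L)) powr (1 / \<delta>)) powr \<delta>"
      using \<eta> \<delta> by (intro powr_mono2) (auto simp: \<eta>_def)
    also have "\<dots> = 1 / (8 * C * \<Gamma> * exp L)" using \<delta> C \<Gamma> by (simp add: powr_powr)
    finally have "\<eta> powr \<delta> * (8 * C * \<Gamma> * exp L) \<le> 1" using C \<Gamma> by (simp add: pos_le_divide_eq)
    then show ?thesis by (simp add: K1_def algebra_simps)
  qed
  define w0 where "w0 = wst - \<eta>"
  have w0: "- w0 \<le> \<gamma> powr (- s)" using \<eta>(2) by (simp add: w0_def)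
  have w\<eta>: "- w0 - u x powr (- s) \<le> \<eta>" if "u x > \<gamma>" for x using up[OF that] by (simp add: w0_def)
  note ctx = \<gamma>(3) c1[unfolded c1_def] w0 \<eta>(1) w\<eta>
  obtain x1 where x1: "trunc \<gamma> w0 x1 > \<eta> / 2"
  proof -
    have "wst - \<eta> / 2 < Sup S" using \<eta>(1) by (simp add: wst_def)
    moreover have "S \<noteq> {}" using \<gamma>(2) by (auto simp: S_def)
    ultimately obtain y where "y \<in> S" "wst - \<eta> / 2 < y" using less_cSupE by metis
    then obtain x where "u x > \<gamma>" "wst - \<eta> / 2 < - (u x powr (- s))" by (auto simp: S_def)
    moreover from this have "- w0 - u x powr (- s) > \<eta> / 2" unfolding w0_def by linarith
    ultimately have "trunc \<gamma> w0 x > \<eta> / 2" by (simp only: trunc_def[OF ctx] if_True less_max_iff_disj) simp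
    then show ?thesis by (rule that)
  qed
  define U where "U r = {x. trunc \<gamma> w0 x > \<eta> / 2} \<inter> {x. dd x pole < r / 2}" for r
  \<comment> \<open>The half ball of this radius contains x1. The sets U(r) grow with r, so the
    volume of U(r1) is a positive lower bound for all larger radii.\<close>
  define r1 where "r1 = 2 * (dd x1 pole + 1)"
  have oB: "open {x. dd x pole < k}" for k
    using open_vimage[OF open_lessThan[of k] dd_continuous[of pole]] by (simp add: vimage_def)
  have oU: "open (U r)" for r
    unfolding U_def using \<eta>(1) by (intro open_Int open_trunc[OF ctx] oB) simp_all
  have fin: "W \<in> sets vol \<and> emeasure vol W < \<infinity>" if "open W" "W \<subseteq> {x. dd x pole < r}" for W r
  proof
    let ?C = "{x. dd x pole \<le> r}"
    show "W \<in> sets vol" using that(1) by (simp add: sets_vol)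
    have "?C \<in> sets vol" using compact_imp_closed[OF compact_dd_ball] by (simp add: sets_vol)
    then have "emeasure vol W \<le> emeasure vol ?C" using that(2) by (intro emeasure_mono) auto
    then show "emeasure vol W < \<infinity>" using emeasure_vol_compact[OF compact_dd_ball] by (rule le_less_trans)
  qed
  have mono: "measure vol V \<le> measure vol W" if "open V" "open W" "V \<subseteq> W" "W \<subseteq> {x. dd x pole < r}" for V W r
    using fin[OF that(2,4)] fin[of V r] that by (intro measure_mono_fmeasurable) (auto simp: fmeasurable_def)
  have Usub: "U r \<subseteq> {x. dd x pole < r}" if "r > 0" for r using that by (auto simp: U_def)
  have r1: "r1 > 0" using dd_nonneg[of x1 pole] by (simp add: r1_def)
  define m where "m = measure vol (U r1)"
  have m: "m > 0"
  proof -
    have "x1 \<in> U r1" using x1 by (simp add: U_def r1_def)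
    then have "emeasure vol (U r1) > 0" using emeasure_vol_open_pos[OF oU] by blast
    moreover have "emeasure vol (U r1) < \<infinity>" using fin[OF oU Usub[OF r1]] by blast
    ultimately show ?thesis unfolding m_def measure_def by (simp add: enn2real_positive_iff)
  qed
  define M where "M = K1 * (2 * K1) powr N"
  have M: "M > 0" using K1 by (simp add: M_def)
  have "\<gamma> powr \<sigma> / 2 * m / M > 0" using \<gamma> m M by simp
  \<comment> \<open>The estimate below bounds the right-hand side by (1/2)^\<alpha>, which is
    impossible once \<alpha> \<ge> n. Asking for at least n + 2 in the next step also ensures
    \<alpha> > 1.\<close>
  then obtain n where n: "(1 / 2) ^ n < \<gamma> powr \<sigma> / 2 * m / M" using real_arch_pow_inv[of _ "1 / 2"] by auto
  obtain r where r: "r \<ge> max r1 (real n + 2)" "r > 0" "r powr (1 + \<delta>) / Q r \<ge> max r1 (real n + 2)"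
    and vol: "measure vol {x. dd x pole < r} > 0 \<Longrightarrow> measure vol {x. dd x pole < r} \<le> exp (L * (r powr (1 + \<delta>) / Q r))"
    using L[of "max r1 (real n + 2)"] by blast
  define \<alpha> where "\<alpha> = r powr (1 + \<delta>) / Q r"
  have \<alpha>: "\<alpha> > 1" "\<alpha> \<ge> 1" "\<alpha> \<ge> n" using r(3) by (auto simp: \<alpha>_def)
  define p where "p = (1 + \<delta>) * (1 + N + \<alpha>)"
  define K where "K = A\<phi> * p powr (1 + \<delta>) * (40 / r) powr (1 + \<delta>) * (\<eta> / (\<alpha> * s)) powr \<delta> * Q r / c1"
  have Qr: "Q r > 0" using Q_pos r(2) by simp
  have K: "0 < K" "K \<le> K1"
    using K_bound[OF r(2) \<alpha>(2) Qr \<alpha>_def p_def \<eta>(1) c1 K_def] by (auto simp: K1_def C_def)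
  have Ur: "m \<le> measure vol (U r)"
    unfolding m_def by (rule mono[OF oU oU _ Usub[OF r(2)]]) (use r(1) in \<open>auto simp: U_def\<close>)
  moreover have "measure vol (U r) \<le> measure vol {x. dd x pole < r}" by (rule mono[OF oU oB Usub[OF r(2)] order_refl])
  ultimately have vr: "measure vol {x. dd x pole < r} \<le> exp L powr \<alpha>"
    using vol m by (simp add: \<alpha>_def powr_def mult.commute)
  have "(\<eta> / 2) powr \<alpha> * (\<gamma> powr \<sigma> / 2 * m) \<le> \<gamma> powr \<sigma> * (\<eta> / 2) powr \<alpha> / 2 * measure vol (U r)"
    using mult_left_mono[OF Ur, of "\<gamma> powr \<sigma> * (\<eta> / 2) powr \<alpha> / 2"] by (simp add: mult.commute mult.left_commute)
  also have "\<dots> \<le> K * (2 * K) powr N * (2 * K * \<Gamma>) powr \<alpha> * \<eta> powr \<alpha> * measure vol {x. dd x pole < r}"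
    unfolding U_def \<Gamma>_def by (rule energy_estimate[OF ctx r(2) \<alpha>(1) p_def K_def[unfolded c1_def]])
  also have "\<dots> \<le> K1 * (2 * K1) powr N * (2 * K1 * \<Gamma>) powr \<alpha> * \<eta> powr \<alpha> * exp L powr \<alpha>"
    using K K1 \<Gamma> \<eta>(1) \<alpha>(1) vr exponents(4) by (intro mult_mono powr_mono2 mult_nonneg_nonneg) auto
  \<comment> \<open>Splitting \<eta>^\<alpha> as (\<eta>/2)^\<alpha> * 2^\<alpha> lets the left-hand
    factor cancel; everything else that is exponential in \<alpha> is gathered under one power with
    base at most 1/2.\<close>
  also have "\<dots> = (\<eta> / 2) powr \<alpha> * (M * (4 * K1 * \<Gamma> * exp L) powr \<alpha>)"
  proof -
    have "4 * K1 * \<Gamma> * exp L = 2 * (2 * K1 * \<Gamma>) * exp L" by simp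
    then have "(4 * K1 * \<Gamma> * exp L) powr \<alpha> = 2 powr \<alpha> * (2 * K1 * \<Gamma>) powr \<alpha> * exp L powr \<alpha>"
      by (simp only: powr_mult)
    moreover have "\<eta> powr \<alpha> = (\<eta> / 2) powr \<alpha> * 2 powr \<alpha>" by (simp add: powr_divide)
    ultimately show ?thesis by (simp only: M_def) (simp only: mult_ac)
  qed
  finally have "\<gamma> powr \<sigma> / 2 * m \<le> M * (4 * K1 * \<Gamma> * exp L) powr \<alpha>"
    using \<eta>(1) by (simp only: mult_le_cancel_left) auto
  also have "\<dots> \<le> M * (1 / 2) powr \<alpha>"
    using M small K1 \<Gamma> \<alpha>(1) by (intro mult_left_mono powr_mono2) auto
  also have "\<dots> \<le> M * (1 / 2) powr (real n)"
    using M \<alpha>(3) by (intro mult_left_mono powr_mono') auto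
  also have "\<dots> = M * (1 / 2) ^ n" by (simp add: powr_realpow)
  also have "\<dots> < \<gamma> powr \<sigma> / 2 * m" using n M by (simp only: pos_less_divide_eq[OF M]) (simp only: mult.commute)
  finally show False by simp
qed

end

theorem theoremB:
  fixes \<A> :: "('a::{t2_space,second_countable_topology}, 'm::finite) chart set"
    and g :: "('a, 'm) metric_tensor"
    and pole :: 'a
    and \<phi> Q :: "real \<Rightarrow> real"
    and a b u :: "'a \<Rightarrow> real"
    and A \<delta> H \<sigma> :: real
  assumes "smooth_atlas \<A>" and "riemannian_metric \<A> g"
    and "CARD('m) \<ge> 2"
    and "connected (UNIV :: 'a set)" and "\<not> compact (UNIV :: 'a set)"
    and "riemannian_complete \<A> g"
    and "\<phi> C1_differentiable_on {0<..}" and "continuous_on {0..} \<phi>"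
    and "\<phi> 0 = 0" and "\<forall>t>0. \<phi> t > 0"
    and "A > 0" and "\<delta> > 0" and "\<forall>t\<ge>0. \<phi> t \<le> A * t powr \<delta>"
    and "continuous_on UNIV a" and "continuous_on UNIV b"
    and "bdd_above (range (neg_part a))"
    and "\<forall>t\<ge>0. Q t > 0" and "mono_on {0..} Q"
    and "Q \<in> o[at_top](\<lambda>t. t powr (1 + \<delta>))"
    and "\<forall>x. b x \<ge> 1 / Q (rdist \<A> g x pole)"
    and "H > 0" and "\<forall>x. neg_part a x / b x \<le> H"
    and "Ck_fun \<A> 1 u" and "\<forall>x. u x \<ge> 0"
    and "\<sigma> > max 1 \<delta>"
    and "div_ge \<A> g (phi_field \<A> g \<phi> u) (\<lambda>x. b x * u x powr \<sigma> + a x * u x)"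
    and "Liminf at_top
           (\<lambda>r. ereal (Q r * ln (measure (rvol \<A> g) (rball \<A> g pole r)) / r powr (1 + \<delta>))) < \<infinity>"
  shows "\<forall>x. u x \<le> H powr (1 / (\<sigma> - 1))"
proof
  fix x
  interpret complete_riem \<A> g
    by unfold_locales (use assms(1,2,4,6) in auto)
  have u: "\<And>x. C1at u x" using assms(23) Ck_fun_1_iff by blast
  interpret quasilinear_inequality \<A> g pole \<phi> Q a b u A \<delta> H \<sigma>
    by unfold_locales (use assms u in auto)
  show "u x \<le> H powr (1 / (\<sigma> - 1))" by (rule u_le[OF assms(19,27)])
qed

end
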